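(* Let $n\ge 1$ be an integer, let $q=p^r$ be a prime power with $p\geq 3$ prime, and let $a\in\mathbb{F}_q\setminus\{0,1\}$. Let $$N_{n,2}(a;q) := \left|\{(A,B)\in C_{n,2}(\mathbb{F}_q) : B^2 = A(A-I_n)(A-a I_n)\}\right|.$$ Then $$ N_{n,2}(a; q)=P(n,0)_q-\sum_{k=1}^{n}\phi_{q^k}(-1)\cdot P(n,k)_q\cdot {}_2F^{\mathrm{ff}}_1(a)_{q^k}, $$ where, for $0\le k\le n$, $$ P(n,k)_q := (-1)^kq^{n(n-k)+\frac{k(k+1)}{2}}\sum_{s=0}^{\lfloor\frac{n-k}{2}\rfloor} q^{2s(s-n+k)}\binom{n}{s,\,n-k-2s,\,k+s}_q. $$ Moreover, for $0\le k\le n$, $P(n,k)_q$ is a polynomial in $q$ (viewed as a variable) with leading term $(-1)^k q^{n^2-\frac{k(k-1)}{2}}$, and $$ \lim_{q\to 1} P(n,k)_q = (-1)^k \binom{n}{k}\cdot {}_2F^{\mathrm{cl}}_1\left(\begin{matrix} \frac{k-n}{2} & \frac{k+1-n}{2}\\ \ & k+1 \end{matrix}\ \middle|\ 4\right). $$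
   Context: Notation. For a field $K$ and positive integers $n,m$, $C_{n,m}(K)$ is the set of $m$-tuples of pairwise commuting $n\times n$ matrices over $K$; $I_n$ is the identity matrix. $q$-Pochhammer symbol: $(z;q)_0=1$ and $(z;q)_n=(1-z)(1-zq)\cdots(1-zq^{n-1})$ for $n\ge 1$. For nonnegative integers $m_1+\dots+m_k=n$, the $q$-multinomial is $$\binom{n}{m_1,\ldots,m_k}_q:=\frac{(q;q)_n}{(q;q)_{m_1}\cdots(q;q)_{m_k}},$$ which is a polynomial in $q$. Classical hypergeometric function: with $(\gamma)_0=1$ and $(\gamma)_n=\gamma(\gamma+1)\cdots(\gamma+n-1)$, $${}_2F^{\mathrm{cl}}_1\left(\begin{matrix}\alpha_1 & \alpha_2\\ \ & \beta_1\end{matrix}\ \middle|\ x\right):=\sum_{n\ge 0}\frac{(\alpha_1)_n(\alpha_2)_n}{(\beta_1)_n}\cdot\frac{x^n}{n!}$$ (a finite sum when one of the upper parameters is a nonpositive integer). Finite field hypergeometric function (Greene): let $Q$ be an odd prime power. Multiplicative characters $\chi:\mathbb{F}_Q^\times\to\mathbb{C}^\times$ (including the trivial one $\epsilon_Q$) are extended to $\mathbb{F}_Q$ by $\chi(0)=0$, and $\phi_Q$ is the character of order $2$. For characters $A,B$ of $\mathbb{F}_Q$ set $$\binom{A}{B}:=\frac{B(-1)}{Q}\sum_{x\in\mathbb{F}_Q}A(x)\overline{B}(1-x).$$ Then, for $x\in\mathbb{F}_Q$, $${}_2F^{\mathrm{ff}}_1(x)_Q:=\frac{Q}{Q-1}\sum_{\chi}\binom{\phi_Q\chi}{\chi}\binom{\phi_Q\chi}{\epsilon_Q\chi}\chi(x),$$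 where $\chi$ runs over all multiplicative characters of $\mathbb{F}_Q$. In the theorem this is applied with $Q=q^k$ and $a\in\mathbb{F}_q\subseteq\mathbb{F}_{q^k}$. *)

theory Defs
  imports
    Complex_Main
    "HOL-Library.Cardinality"
    "HOL-Computational_Algebra.Polynomial_Factorial"
    "HOL-Algebra.Algebraic_Closure_Type"
    "Jordan_Normal_Form.Matrix"
begin

definition commuting_tuples :: "nat \<Rightarrow> nat \<Rightarrow> 'a::field mat list set" where
  "commuting_tuples n m =
     {As. length As = m \<and> set As \<subseteq> carrier_mat n n \<and>
          (\<forall>A\<in>set As. \<forall>B\<in>set As. A * B = B * A)}"

definition num_legendre_pairs :: "nat \<Rightarrow> 'a::field \<Rightarrow> nat" where
  "num_legendre_pairs n a =
     card {(A, B). [A, B] \<in> commuting_tuples n 2 \<and>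
       B ^\<^sub>m 2 = A * (A - 1\<^sub>m n) * (A - a \<cdot>\<^sub>m 1\<^sub>m n)}"


text \<open>
  The \<open>q\<close>-analogues are defined over an arbitrary field, so that \<open>q\<close> can be specialised to
  a number as well as to the indeterminate of a field of rational functions.  As division is
  total, \<open>q_multinomial\<close> has its intended value only if \<open>q\<close> is not a root of unity of
  order at most \<open>n\<close>; in particular the value at \<open>q = 1\<close> is junk.
\<close>

definition q_pochhammer :: "'b::field \<Rightarrow> 'b \<Rightarrow> nat \<Rightarrow> 'b" where
  "q_pochhammer z q n = (\<Prod>i<n. 1 - z * q ^ i)"

definition q_multinomial :: "nat \<Rightarrow> nat list \<Rightarrow> 'b::field \<Rightarrow> 'b" where
  "q_multinomial n ms q = q_pochhammer q q n / (\<Prod>m\<leftarrow>ms. q_pochhammer q q m)"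

definition P_coeff :: "nat \<Rightarrow> nat \<Rightarrow> 'b::field \<Rightarrow> 'b" where
  "P_coeff n k q =
     (-1) ^ k * q ^ (n * (n - k) + k * (k + 1) div 2) *
     (\<Sum>s = 0..(n - k) div 2.
        q powi (2 * int s * (int s - int n + int k)) *
        q_multinomial n [s, n - k - 2 * s, k + s] q)"


definition hypergeom_2F1_cl :: "real \<Rightarrow> real \<Rightarrow> real \<Rightarrow> real \<Rightarrow> real" where
  "hypergeom_2F1_cl \<alpha>1 \<alpha>2 \<beta>1 x =
     (\<Sum>n. pochhammer \<alpha>1 n * pochhammer \<alpha>2 n / pochhammer \<beta>1 n * (x ^ n / fact n))"


text \<open>
  Finite fields are represented as finite subfields \<open>K\<close> of a field type.  A multiplicative
  character of \<open>K\<close>, extended by \<open>0\<close> at \<open>0\<close>, is also set to \<open>0\<close> outside \<open>K\<close>; hence distinct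
  elements of \<open>mult_chars K\<close> are distinct characters, and \<open>mult_chars K\<close> is finite.
\<close>

definition mult_chars :: "'b::field set \<Rightarrow> ('b \<Rightarrow> complex) set" where
  "mult_chars K =
     {\<chi>. (\<forall>x. x \<notin> K - {0} \<longrightarrow> \<chi> x = 0) \<and>
         (\<forall>x\<in>K - {0}. \<chi> x \<noteq> 0) \<and>
         (\<forall>x\<in>K - {0}. \<forall>y\<in>K - {0}. \<chi> (x * y) = \<chi> x * \<chi> y)}"

definition trivial_char :: "'b::field set \<Rightarrow> 'b \<Rightarrow> complex" where
  "trivial_char K x = (if x \<in> K - {0} then 1 else 0)"

definition quadratic_char :: "'b::field set \<Rightarrow> 'b \<Rightarrow> complex" where
  "quadratic_char K =
     (THE \<chi>. \<chi> \<in> mult_chars K \<and> \<chi> \<noteq> trivial_char K \<and> (\<lambda>x. \<chi> x * \<chi> x) = trivial_char K)"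

definition char_binomial ::
    "'b::field set \<Rightarrow> ('b \<Rightarrow> complex) \<Rightarrow> ('b \<Rightarrow> complex) \<Rightarrow> complex" where
  "char_binomial K A B = B (-1) / of_nat (card K) * (\<Sum>x\<in>K. A x * cnj (B (1 - x)))"

definition hypergeom_2F1_ff :: "'b::field set \<Rightarrow> 'b \<Rightarrow> complex" where
  "hypergeom_2F1_ff K x =
     of_nat (card K) / (of_nat (card K) - 1) *
     (\<Sum>\<chi>\<in>mult_chars K.
        char_binomial K (\<lambda>y. quadratic_char K y * \<chi> y) \<chi> *
        char_binomial K (\<lambda>y. quadratic_char K y * \<chi> y) (\<lambda>y. trivial_char K y * \<chi> y) *
        \<chi> x)"

text \<open>
  If \<open>'a\<close> is the field with \<open>q\<close> elements, then \<open>ext_field k\<close> is its extension with \<open>q ^ k\<close>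
  elements, taken inside the algebraic closure: the set of roots of \<open>X ^ (q ^ k) - X\<close>.
\<close>

definition ext_field :: "nat \<Rightarrow> 'a::{field, finite} alg_closure set" where
  "ext_field k = {x. x ^ (CARD('a) ^ k) = x}"

end

theory Submission
  imports Defs
    "Jordan_Normal_Form.Determinant"
    "HOL-Computational_Algebra.Formal_Power_Series"
    "HOL-Algebra.Multiplicative_Group"
    "HOL-Library.Function_Algebras"
    "HOL-Library.Product_Plus"
begin

text \<open>
  A commuting pair \<open>(A, B)\<close> on the curve \<open>y\<^sup>2 = h(x)\<close>, \<open>h = x (x - 1) (x - a)\<close>, is a module structure on
  \<open>k\<^sup>n\<close> over the coordinate ring \<open>R = k[x, y] / (y\<^sup>2 - h)\<close>.  Triples of a pair and a vector are sorted by
  the annihilator of the vector.  As the curve is smooth, the commuting block triangular pairs with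
  given diagonal blocks of sizes \<open>i\<close> and \<open>j\<close> number exactly \<open>q ^ (i * j)\<close>; hence
  \<open>f n = N n / card (GL n)\<close> satisfies \<open>q ^ n * f n = (\<Sum>j\<le>n. S j * f (n - j))\<close>, where \<open>S j\<close> is the number
  of ideals of \<open>R\<close> of codimension \<open>j\<close>.  Every ideal is principal or becomes principal
  after multiplication by the ideal of a rational point, so \<open>S j\<close> is proportional to \<open>q ^ (j - 1)\<close> for
  \<open>j \<ge> 2\<close> and the recurrence collapses to three terms.
  It is solved by the coefficients of a product of two \<open>q\<close>-exponential series in the Frobenius
  eigenvalues \<open>\<alpha>\<close>, \<open>\<beta>\<close> and one Euler series.  Collecting the terms with \<open>(\<alpha> * \<beta>) ^ s = q ^ s\<close> leaves
  \<open>P(n,k)\<close> times \<open>\<alpha> ^ k + \<beta> ^ k\<close>.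

  By orthogonality of characters Greene's function over the extension of degree \<open>k\<close> is, up to a factor,
  the quadratic character sum of \<open>h\<close>.  That this sum is \<open>- (\<alpha> ^ k + \<beta> ^ k)\<close> follows from Newton's
  identities for the character sums over monic polynomials of degree \<open>d\<close>, which vanish for \<open>d \<ge> 3\<close>.
\<close>

no_notation fps_nth (infixl "$" 75)

section \<open>Kernels of commuting nilpotent operators\<close>

text \<open>The exponent i * j is an Euler characteristic: over a smooth curve dim Hom(M, N) = dim
  Ext^1(M, N) for modules M, N of finite length, and the off-diagonal blocks are the cocycles, of
  dimension dim Ext^1 + i * j - dim Hom. The proof treats the cocycle equations as a linear system
  whose matrix is a 2 x 2 matrix of commuting operators on i x j matrices with determinant 0.
  Smoothness says that its entries have no common kernel. Hence, after Fitting decompositions, one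
  entry is invertible on each piece, and there the solutions form the graph of a function. The two
  kinds of ideals are told apart by pole orders at the point at infinity, where x and y have orders
  2 and 3 and only order 1 is missing. If m is the least pole order of an ideal, then m + 2, m + 3,
  ... occur as well, and only m + 1 is in question: without it the ideal is principal, with it a
  rational point enters. The numbers \<alpha>, \<beta> are introduced as complex roots of X^2 - c X
  + q with c = q - (number of affine points); their powers are tied to the extension fields through
  factorisations of monic polynomials over the base field.\<close>

definition add_subgroup :: "'b::ab_group_add set \<Rightarrow> bool" where
  "add_subgroup H \<longleftrightarrow> 0 \<in> H \<and> (\<forall>x\<in>H. \<forall>y\<in>H. x - y \<in> H)"

definition endo_on :: "'b::ab_group_add set \<Rightarrow> ('b \<Rightarrow> 'b) \<Rightarrow> bool" where
  "endo_on H f \<longleftrightarrow> (\<forall>x\<in>H. f x \<in> H) \<and> (\<forall>x\<in>H. \<forall>y\<in>H. f (x + y) = f x + f y)"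

lemma add_subgroup_zero: "add_subgroup H \<Longrightarrow> 0 \<in> H"
  and add_subgroup_diff: "add_subgroup H \<Longrightarrow> x \<in> H \<Longrightarrow> y \<in> H \<Longrightarrow> x - y \<in> H"
  by (auto simp: add_subgroup_def)

lemma add_subgroup_uminus: "add_subgroup H \<Longrightarrow> x \<in> H \<Longrightarrow> - x \<in> H"
  using add_subgroup_diff[of H 0 x] add_subgroup_zero by auto

lemma add_subgroup_add: "add_subgroup H \<Longrightarrow> x \<in> H \<Longrightarrow> y \<in> H \<Longrightarrow> x + y \<in> H"
  using add_subgroup_diff[of H x "- y"] add_subgroup_uminus by auto

lemma endo_on_closed: "endo_on H f \<Longrightarrow> x \<in> H \<Longrightarrow> f x \<in> H"
  and endo_on_add: "endo_on H f \<Longrightarrow> x \<in> H \<Longrightarrow> y \<in> H \<Longrightarrow> f (x + y) = f x + f y"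
  by (auto simp: endo_on_def)

lemma endo_on_zero: "endo_on H f \<Longrightarrow> add_subgroup H \<Longrightarrow> f 0 = 0"
  using endo_on_add[of H f 0 0] add_subgroup_zero[of H] by auto

lemma endo_on_diff:
  assumes "endo_on H f" "add_subgroup H" "x \<in> H" "y \<in> H"
  shows "f (x - y) = f x - f y"
proof -
  have "f ((x - y) + y) = f (x - y) + f y"
    using assms add_subgroup_diff by (intro endo_on_add) auto
  thus ?thesis by (simp add: algebra_simps)
qed

lemma endo_on_funpow: "endo_on H f \<Longrightarrow> endo_on H (f ^^ n)"
proof (induction n)
  case (Suc n)
  hence IH: "endo_on H (f ^^ n)" by simp
  show ?case unfolding endo_on_def
    using endo_on_closed[OF IH] endo_on_add[OF IH] endo_on_closed[OF Suc.prems] endo_on_add[OF Suc.prems]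
    by simp
qed (auto simp: endo_on_def)

lemma endo_on_subset: "endo_on H f \<Longrightarrow> H' \<subseteq> H \<Longrightarrow> (\<And>x. x \<in> H' \<Longrightarrow> f x \<in> H') \<Longrightarrow> endo_on H' f"
  unfolding endo_on_def by blast

lemma endo_on_inj_iff:
  assumes "endo_on H f" "add_subgroup H"
  shows "inj_on f H \<longleftrightarrow> (\<forall>x\<in>H. f x = 0 \<longrightarrow> x = 0)"
proof
  assume "inj_on f H"
  thus "\<forall>x\<in>H. f x = 0 \<longrightarrow> x = 0"
    using endo_on_zero[OF assms] add_subgroup_zero[OF assms(2)] by (metis inj_onD)
next
  assume *: "\<forall>x\<in>H. f x = 0 \<longrightarrow> x = 0"
  show "inj_on f H"
  proof (rule inj_onI)
    fix x y assume "x \<in> H" "y \<in> H" "f x = f y"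
    hence "f (x - y) = 0" "x - y \<in> H"
      using endo_on_diff[OF assms] add_subgroup_diff[OF assms(2)] by auto
    with * show "x = y" by auto
  qed
qed

text \<open>The powers of f are self-maps of a finite set, so they repeat from some exponent on. A
  suitable power is then idempotent: the projection onto the part on which f is bijective.\<close>

lemma funpow_idempotent:
  assumes "finite H" and cl: "\<And>x. x \<in> H \<Longrightarrow> f x \<in> H"
  shows "\<exists>N. N > 0 \<and> (\<forall>x\<in>H. (f ^^ N) ((f ^^ N) x) = (f ^^ N) x)"
proof -
  have clN: "(f ^^ n) x \<in> H" if "x \<in> H" for n x
    using that cl by (induction n) auto
  have "finite (H \<rightarrow>\<^sub>E H)" using assms by (simp add: finite_PiE)
  moreover have "(\<lambda>n. restrict (f ^^ n) H) ` UNIV \<subseteq> (H \<rightarrow>\<^sub>E H)"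
    using clN by auto
  ultimately have "\<not> inj (\<lambda>n. restrict (f ^^ n) H)"
    using finite_subset finite_imageD by blast
  then obtain i j where ij: "i < j" "restrict (f ^^ i) H = restrict (f ^^ j) H"
    unfolding inj_def by (metis linorder_neqE_nat)
  define p where "p = j - i"
  have p: "p > 0" "j = i + p" using ij(1) by (auto simp: p_def)
  have eq: "(f ^^ (i + p)) x = (f ^^ i) x" if "x \<in> H" for x
    using fun_cong[OF ij(2), of x] that p(2) by simp
  have per: "(f ^^ (i + d + p)) x = (f ^^ (i + d)) x" if "x \<in> H" for x d
  proof -
    have "(f ^^ (i + d + p)) x = (f ^^ d) ((f ^^ (i + p)) x)"
      by (metis add.assoc add.commute comp_apply funpow_add)
    also have "\<dots> = (f ^^ d) ((f ^^ i) x)" using eq that by simp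
    also have "\<dots> = (f ^^ (i + d)) x" by (metis add.commute comp_apply funpow_add)
    finally show ?thesis .
  qed
  have per2: "(f ^^ (i + d + t * p)) x = (f ^^ (i + d)) x" if "x \<in> H" for x d t
  proof (induction t)
    case (Suc t)
    have "i + d + Suc t * p = i + (d + t * p) + p" by simp
    hence "(f ^^ (i + d + Suc t * p)) x = (f ^^ (i + (d + t * p) + p)) x" by metis
    also have "\<dots> = (f ^^ (i + (d + t * p))) x" by (rule per[OF that])
    also have "\<dots> = (f ^^ (i + d + t * p)) x" by (simp add: add.assoc)
    finally show ?case using Suc by simp
  qed auto
  \<comment> \<open>A multiple of the period \<open>p\<close> that is at least the preperiod
    \<open>i\<close>; the summand 1 also makes it positive.\<close>
  define N where "N = (i + 1) * p"
  have "N \<ge> i" unfolding N_def using p(1) by (cases p) auto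
  then obtain d where d: "N = i + d" using le_Suc_ex by blast
  have "(f ^^ N) ((f ^^ N) x) = (f ^^ N) x" if "x \<in> H" for x
  proof -
    have "(f ^^ N) ((f ^^ N) x) = (f ^^ (N + N)) x" by (simp add: funpow_add)
    also have "N + N = i + d + (i + 1) * p" using d N_def by simp
    finally show ?thesis using per2[OF that] d by metis
  qed
  moreover have "N > 0" using p by (simp add: N_def)
  ultimately show ?thesis by blast
qed

section \<open>Kernels of 2 x 2 matrices of commuting operators\<close>

definition ker2 :: "'b::ab_group_add set \<Rightarrow> ('b \<Rightarrow> 'b) \<Rightarrow> ('b \<Rightarrow> 'b) \<Rightarrow> ('b \<Rightarrow> 'b) \<Rightarrow> ('b \<Rightarrow> 'b) \<Rightarrow> ('b \<times> 'b) set" where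
  "ker2 H a b c d = {(x, y). x \<in> H \<and> y \<in> H \<and> a x + b y = 0 \<and> c x + d y = 0}"

text \<open>The second equation determines y from x, because \<open>d\<close> is bijective on the
  finite group \<open>H\<close>. The first one then follows: applying \<open>d\<close> turns its
  left side into b (c x + d y) = 0. The kernel is thus the graph of a function on
  \<open>H\<close>.\<close>

lemma card_ker2_inj:
  assumes H: "finite H" "add_subgroup H"
    and e: "endo_on H a" "endo_on H b" "endo_on H c" "endo_on H d"
    and com: "\<And>x. x \<in> H \<Longrightarrow> d (a x) = b (c x)" "\<And>x. x \<in> H \<Longrightarrow> d (b x) = b (d x)"
    and inj: "inj_on d H"
  shows "card (ker2 H a b c d) = card H"
proof -
  have "d ` H = H"
    using inj H(1) e(4) by (intro endo_inj_surj) (auto simp: endo_on_def)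
  hence "\<exists>y\<in>H. d y = - c x" if "x \<in> H" for x
    using that endo_on_closed[OF e(3) that] add_subgroup_uminus[OF H(2)] by (metis imageE)
  then obtain y where y: "\<And>x. x \<in> H \<Longrightarrow> y x \<in> H \<and> d (y x) = - c x" by metis
  have "a x + b (y x) = 0" if x: "x \<in> H" for x
  proof -
    have "d (a x + b (y x)) = d (a x) + d (b (y x))"
      using x y e by (simp add: endo_on_add endo_on_closed)
    also have "\<dots> = b (c x) + b (- c x)" using x y com by simp
    also have "\<dots> = b (c x + - c x)"
      using x e add_subgroup_uminus[OF H(2)] by (simp only: endo_on_add endo_on_closed)
    also have "\<dots> = 0" using endo_on_zero[OF e(2) H(2)] by simp
    finally show ?thesis using inj endo_on_inj_iff[OF e(4) H(2)] x y e H
      by (simp add: endo_on_closed add_subgroup_add)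
  qed
  moreover have "y' = y x" if "x \<in> H" "y' \<in> H" "c x + d y' = 0" for x y'
    using that y inj by (metis add_eq_0_iff inj_onD)
  ultimately have "ker2 H a b c d = (\<lambda>x. (x, y x)) ` H"
    using y by (auto simp: ker2_def)
  thus ?thesis by (simp add: card_image inj_on_def)
qed

lemma card_ker2_swap: "card (ker2 H a b c d) = card (ker2 H b a d c)"
proof -
  have "ker2 H b a d c = prod.swap ` ker2 H a b c d"
    by (force simp: ker2_def add.commute)
  thus ?thesis by (simp add: card_image)
qed

lemma ker2_swap_rows: "ker2 H a b c d = ker2 H c d a b"
  by (auto simp: ker2_def)

(* Fitting decomposition: along an operator that is neither nilpotent nor injective, H splits into
   two smaller stable subgroups. Once no operator allows a splitting, one of them is invertible. *)
lemma card_ker2: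
  assumes "finite H" "add_subgroup H"
    and F: "{a, b, c, d} \<subseteq> F"
    and "\<And>f. f \<in> F \<Longrightarrow> endo_on H f"
    and "\<And>f g x. f \<in> F \<Longrightarrow> g \<in> F \<Longrightarrow> x \<in> H \<Longrightarrow> f (g x) = g (f x)"
    and "\<And>x. x \<in> H \<Longrightarrow> a (d x) = b (c x)"
    and "\<And>H'. add_subgroup H' \<Longrightarrow> H' \<subseteq> H \<Longrightarrow> (\<And>f. f \<in> F \<Longrightarrow> endo_on H' f) \<Longrightarrow>
           (\<And>f. f \<in> {a, b, c, d} \<Longrightarrow> \<exists>N. \<forall>x\<in>H'. (f ^^ N) x = 0) \<Longrightarrow> H' \<subseteq> {0}"
  shows "card (ker2 H a b c d) = card H"
  using assms(1,2,4-)
proof (induction "card H" arbitrary: H rule: less_induct)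
  case (less H)
  note fin = less.prems(1) and sg = less.prems(2) and en = less.prems(3)
    and cm = less.prems(4) and dt = less.prems(5) and nil = less.prems(6)
  have ea: "endo_on H a" and eb: "endo_on H b" and ec: "endo_on H c" and ed: "endo_on H d"
    using en F by auto
  have cm2: "a (b x) = b (a x)" "a (c x) = c (a x)" "a (d x) = d (a x)" "b (c x) = c (b x)"
    "b (d x) = d (b x)" "c (d x) = d (c x)" if "x \<in> H" for x
    using cm[OF _ _ that] F by auto
  show ?case
  proof (cases "\<exists>f\<in>{a, b, c, d}. inj_on f H")
    case True
    then consider "inj_on a H" | "inj_on b H" | "inj_on c H" | "inj_on d H" by auto
    thus ?thesis
    proof cases
      case 1
      have "card (ker2 H d c b a) = card H"
        using 1 dt cm2 by (intro card_ker2_inj fin sg ea eb ec ed) auto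
      thus ?thesis using card_ker2_swap ker2_swap_rows by metis
    next
      case 2
      have "card (ker2 H c d a b) = card H"
        using 2 dt cm2 by (intro card_ker2_inj fin sg ea eb ec ed) auto
      thus ?thesis using ker2_swap_rows by metis
    next
      case 3
      have "card (ker2 H b a d c) = card H"
        using 3 dt cm2 by (intro card_ker2_inj fin sg ea eb ec ed) auto
      thus ?thesis using card_ker2_swap by metis
    next
      case 4
      show ?thesis
        using 4 dt cm2 by (intro card_ker2_inj fin sg ea eb ec ed) auto
    qed
  next
    case False
    \<comment> \<open>If all four operators were nilpotent, the last assumption would make
      \<open>H\<close> trivial, and on a trivial group every operator is injective.\<close>
    have "\<exists>f\<in>{a, b, c, d}. \<forall>N. \<exists>x\<in>H. (f ^^ N) x \<noteq> 0"
    proof (rule ccontr)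
      assume "\<not> ?thesis"
      hence "H \<subseteq> {0}" by (intro nil sg en) auto
      hence "inj_on a H" by (auto simp: inj_on_def)
      thus False using False by auto
    qed
    then obtain f where f0: "f \<in> {a, b, c, d}" and nn: "\<And>N. \<exists>x\<in>H. (f ^^ N) x \<noteq> 0" by blast
    hence f: "f \<in> F" using F by blast
    have ef: "endo_on H f" using en f by auto
    obtain N where N: "N > 0" and idem: "\<And>x. x \<in> H \<Longrightarrow> (f ^^ N) ((f ^^ N) x) = (f ^^ N) x"
      using funpow_idempotent[OF fin, of f] endo_on_closed[OF ef] by blast
    define \<pi> where "\<pi> = f ^^ N"
    have e\<pi>: "endo_on H \<pi>" unfolding \<pi>_def by (rule endo_on_funpow[OF ef])
    have idem: "\<pi> (\<pi> x) = \<pi> x" if "x \<in> H" for x using idem that \<pi>_def by auto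
    have com\<pi>: "g (\<pi> x) = \<pi> (g x)" if "g \<in> F" "x \<in> H" for g x
    proof -
      have "g ((f ^^ n) x) = (f ^^ n) (g x)" for n
      proof (induction n)
        case (Suc n)
        have "(f ^^ n) x \<in> H" using endo_on_closed[OF endo_on_funpow[OF ef] that(2)] .
        thus ?case using Suc cm[OF that(1) f] by simp
      qed auto
      thus ?thesis by (simp add: \<pi>_def)
    qed
    \<comment> \<open>The two Fitting components of \<open>f\<close>: image and kernel of its
      idempotent power.\<close>
    define H1 where "H1 = \<pi> ` H"
    define H0 where "H0 = {x \<in> H. \<pi> x = 0}"
    have H1eq: "H1 = {x \<in> H. \<pi> x = x}"
      unfolding H1_def using idem endo_on_closed[OF e\<pi>] by (force simp: image_iff)
    have H1sub: "H1 \<subseteq> H" and H0sub: "H0 \<subseteq> H" by (auto simp: H1eq H0_def)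
    have sg1: "add_subgroup H1" unfolding H1eq add_subgroup_def
      using endo_on_zero[OF e\<pi> sg] endo_on_diff[OF e\<pi> sg] add_subgroup_diff[OF sg] add_subgroup_zero[OF sg]
      by auto
    have sg0: "add_subgroup H0" unfolding H0_def add_subgroup_def
      using endo_on_zero[OF e\<pi> sg] endo_on_diff[OF e\<pi> sg] add_subgroup_diff[OF sg] add_subgroup_zero[OF sg]
      by auto
    have en1: "endo_on H1 g" if "g \<in> F" for g
      using com\<pi>[OF that] endo_on_closed[OF en[OF that]]
      by (intro endo_on_subset[OF en[OF that] H1sub]) (auto simp: H1eq, metis)
    have en0: "endo_on H0 g" if "g \<in> F" for g
      using com\<pi>[OF that] endo_on_closed[OF en[OF that]] endo_on_zero[OF en[OF that] sg]
      by (intro endo_on_subset[OF en[OF that] H0sub]) (auto simp: H0_def, metis)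
    have "H0 \<noteq> H" using nn[of N] by (auto simp: H0_def \<pi>_def)
    hence c0: "card H0 < card H" using H0sub fin by (simp add: psubset_card_mono psubsetI)
    have "H1 \<noteq> H"
    proof
      assume "H1 = H"
      hence "inj_on \<pi> H" using fin by (simp add: H1_def eq_card_imp_inj_on)
      moreover have "\<pi> = (f ^^ (N - 1)) \<circ> f" using N
        by (metis Suc_pred' \<pi>_def funpow_Suc_right)
      ultimately have "inj_on f H" using inj_on_imageI2 by blast
      thus False using False f0 by auto
    qed
    hence c1: "card H1 < card H" using H1sub fin by (simp add: psubset_card_mono psubsetI)
    have IH1: "card (ker2 H1 a b c d) = card H1"
      using c1 finite_subset[OF H1sub fin] sg1 en1
    proof (rule less.hyps)
      show "\<And>f g x. f \<in> F \<Longrightarrow> g \<in> F \<Longrightarrow> x \<in> H1 \<Longrightarrow> f (g x) = g (f x)"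
        using cm H1sub by blast
      show "\<And>x. x \<in> H1 \<Longrightarrow> a (d x) = b (c x)" using dt H1sub by blast
      show "H' \<subseteq> {0}" if "add_subgroup H'" "H' \<subseteq> H1" "\<And>f. f \<in> F \<Longrightarrow> endo_on H' f"
        "\<And>f. f \<in> {a, b, c, d} \<Longrightarrow> \<exists>N. \<forall>x\<in>H'. (f ^^ N) x = 0" for H'
        using that H1sub by (intro nil) auto
    qed
    have IH0: "card (ker2 H0 a b c d) = card H0"
      using c0 finite_subset[OF H0sub fin] sg0 en0
    proof (rule less.hyps)
      show "\<And>f g x. f \<in> F \<Longrightarrow> g \<in> F \<Longrightarrow> x \<in> H0 \<Longrightarrow> f (g x) = g (f x)"
        using cm H0sub by blast
      show "\<And>x. x \<in> H0 \<Longrightarrow> a (d x) = b (c x)" using dt H0sub by blast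
      show "H' \<subseteq> {0}" if "add_subgroup H'" "H' \<subseteq> H0" "\<And>f. f \<in> F \<Longrightarrow> endo_on H' f"
        "\<And>f. f \<in> {a, b, c, d} \<Longrightarrow> \<exists>N. \<forall>x\<in>H'. (f ^^ N) x = 0" for H'
        using that H0sub by (intro nil) auto
    qed
    have split1: "\<pi> (u + v) = u" if "u \<in> H1" "v \<in> H0" for u v
      using that endo_on_add[OF e\<pi>, of u v] by (auto simp: H1eq H0_def)
    have dec: "\<pi> x \<in> H1" "x - \<pi> x \<in> H0" if "x \<in> H" for x
      using that idem endo_on_diff[OF e\<pi> sg] endo_on_closed[OF e\<pi>] add_subgroup_diff[OF sg]
      by (auto simp: H1eq H0_def)
    have "bij_betw (\<lambda>(u, v). u + v) (H1 \<times> H0) H"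
      by (rule bij_betwI[where g = "\<lambda>x. (\<pi> x, x - \<pi> x)"])
        (use dec split1 add_subgroup_add[OF sg subsetD[OF H1sub] subsetD[OF H0sub]] in auto)
    hence cH: "card H = card H1 * card H0"
      using bij_betw_same_card by (fastforce simp: card_cartesian_product)
    have eqpart: "\<pi> (g x + h y) = g (\<pi> x) + h (\<pi> y)" if "g \<in> F" "h \<in> F" "x \<in> H" "y \<in> H" for g h x y
      using that com\<pi> endo_on_add[OF e\<pi>] endo_on_closed[OF en] by simp
    \<comment> \<open>All operators commute with \<open>\<pi>\<close>, so the equations hold for (x,
      y) if and only if they hold for both of its components.\<close>
    have "bij_betw (\<lambda>((u1, u2), (v1, v2)). (u1 + v1, u2 + v2))
        (ker2 H1 a b c d \<times> ker2 H0 a b c d) (ker2 H a b c d)"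
    proof (rule bij_betwI[where g = "\<lambda>(x, y). ((\<pi> x, \<pi> y), (x - \<pi> x, y - \<pi> y))"])
      show "(\<lambda>((u1, u2), (v1, v2)). (u1 + v1, u2 + v2)) \<in>
        (ker2 H1 a b c d \<times> ker2 H0 a b c d) \<rightarrow> (ker2 H a b c d)"
      proof
        fix z assume z: "z \<in> ker2 H1 a b c d \<times> ker2 H0 a b c d"
        obtain u1 u2 v1 v2 where zz: "z = ((u1, u2), (v1, v2))" by (metis prod.exhaust)
        have uv: "u1 \<in> H" "u2 \<in> H" "v1 \<in> H" "v2 \<in> H" "a u1 + b u2 = 0" "c u1 + d u2 = 0"
          "a v1 + b v2 = 0" "c v1 + d v2 = 0"
          using z H1sub H0sub by (auto simp: zz ker2_def)
        have "a (u1 + v1) + b (u2 + v2) = (a u1 + b u2) + (a v1 + b v2)"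
          using uv(1-4) by (simp only: endo_on_add[OF ea] endo_on_add[OF eb] add_ac)
        moreover have "c (u1 + v1) + d (u2 + v2) = (c u1 + d u2) + (c v1 + d v2)"
          using uv(1-4) by (simp only: endo_on_add[OF ec] endo_on_add[OF ed] add_ac)
        ultimately show "(\<lambda>((u1, u2), (v1, v2)). (u1 + v1, u2 + v2)) z \<in> ker2 H a b c d"
          using uv add_subgroup_add[OF sg] by (simp add: zz ker2_def)
      qed
      show "(\<lambda>(x, y). ((\<pi> x, \<pi> y), (x - \<pi> x, y - \<pi> y))) \<in>
        ker2 H a b c d \<rightarrow> ker2 H1 a b c d \<times> ker2 H0 a b c d"
      proof
        fix z assume "z \<in> ker2 H a b c d"
        then obtain x y where z: "z = (x, y)" "x \<in> H" "y \<in> H" "a x + b y = 0" "c x + d y = 0"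
          by (auto simp: ker2_def)
        have p: "\<pi> x \<in> H" "\<pi> y \<in> H" using z endo_on_closed[OF e\<pi>] by auto
        have "\<pi> (a x + b y) = a (\<pi> x) + b (\<pi> y)" "\<pi> (c x + d y) = c (\<pi> x) + d (\<pi> y)"
          using z F by (intro eqpart; blast)+
        hence k1: "a (\<pi> x) + b (\<pi> y) = 0" "c (\<pi> x) + d (\<pi> y) = 0"
          using z endo_on_zero[OF e\<pi> sg] by auto
        have "a (x - \<pi> x) + b (y - \<pi> y) = (a x + b y) - (a (\<pi> x) + b (\<pi> y))"
          "c (x - \<pi> x) + d (y - \<pi> y) = (c x + d y) - (c (\<pi> x) + d (\<pi> y))"
          using z p by (simp_all add: endo_on_diff[OF ea sg] endo_on_diff[OF eb sg] endo_on_diff[OF ec sg] endo_on_diff[OF ed sg])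
        hence k0: "a (x - \<pi> x) + b (y - \<pi> y) = 0" "c (x - \<pi> x) + d (y - \<pi> y) = 0"
          using z k1 by auto
        show "(case z of (x, y) \<Rightarrow> ((\<pi> x, \<pi> y), (x - \<pi> x, y - \<pi> y))) \<in> ker2 H1 a b c d \<times> ker2 H0 a b c d"
          using k0 k1 z dec by (simp add: ker2_def)
      qed
    qed (use split1 in \<open>auto simp: ker2_def\<close>)
    hence "card (ker2 H a b c d) = card (ker2 H1 a b c d) * card (ker2 H0 a b c d)"
      using bij_betw_same_card by (fastforce simp: card_cartesian_product)
    thus ?thesis using IH0 IH1 cH by simp
  qed
qed

text \<open>The ring of operators generated by \<open>B\<close>, as a set of functions: stability of
  subgroups and commutation then have to be checked for the generators alone.\<close>

inductive_set op_closure :: "('b::ab_group_add \<Rightarrow> 'b) set \<Rightarrow> ('b \<Rightarrow> 'b) set" for B where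
  op_id: "(\<lambda>x. x) \<in> op_closure B"
| op_comp: "g \<in> B \<Longrightarrow> f \<in> op_closure B \<Longrightarrow> (\<lambda>x. g (f x)) \<in> op_closure B"
| op_add: "f \<in> op_closure B \<Longrightarrow> g \<in> op_closure B \<Longrightarrow> (\<lambda>x. f x + g x) \<in> op_closure B"
| op_diff: "f \<in> op_closure B \<Longrightarrow> g \<in> op_closure B \<Longrightarrow> (\<lambda>x. f x - g x) \<in> op_closure B"

lemma endo_on_op_closure:
  assumes "f \<in> op_closure B" and sg: "add_subgroup H" and B: "\<And>g. g \<in> B \<Longrightarrow> endo_on H g"
  shows "endo_on H f"
  using assms(1)
proof induction
  case (op_comp g f)
  thus ?case using B[OF op_comp(1)] by (simp add: endo_on_def)
next
  case (op_add f g)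
  thus ?case using add_subgroup_add[OF sg] by (simp add: endo_on_def)
next
  case (op_diff f g)
  thus ?case using add_subgroup_diff[OF sg] by (simp add: endo_on_def)
qed (auto simp: endo_on_def)

text \<open>Two inductions, the first for commutation of an arbitrary operator with a generator. The
  point x is kept arbitrary because the operators move it within \<open>H\<close>.\<close>

lemma op_closure_commute:
  assumes "f \<in> op_closure B" "g \<in> op_closure B" "x \<in> H"
    and sg: "add_subgroup H" and B: "\<And>g. g \<in> B \<Longrightarrow> endo_on H g"
    and com: "\<And>f g x. f \<in> B \<Longrightarrow> g \<in> B \<Longrightarrow> x \<in> H \<Longrightarrow> f (g x) = g (f x)"
  shows "f (g x) = g (f x)"
proof -
  note en = endo_on_op_closure[OF _ sg B]
  have base: "f (g x) = g (f x)" if "f \<in> op_closure B" "g \<in> B" "x \<in> H" for f g x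
    using that
  proof (induction arbitrary: x)
    case (op_comp k f)
    have "k (f (g x)) = k (g (f x))" using op_comp by simp
    also have "\<dots> = g (k (f x))" using op_comp com endo_on_closed[OF en[OF op_comp(2)]] by blast
    finally show ?case .
  next
    case (op_add f k)
    have "f x \<in> H" "k x \<in> H" using op_add endo_on_closed[OF en] by auto
    thus ?case using op_add endo_on_add[OF B[OF op_add(5)]] by simp
  next
    case (op_diff f k)
    have "f x \<in> H" "k x \<in> H" using op_diff endo_on_closed[OF en] by auto
    thus ?case using op_diff endo_on_diff[OF B[OF op_diff(5)] sg] by simp
  qed auto
  show ?thesis using assms(2,3)
  proof (induction arbitrary: x)
    case (op_comp k g)
    have "f (k (g x)) = k (f (g x))"
      using base[OF assms(1) op_comp(1)] op_comp endo_on_closed[OF en[OF op_comp(2)]] by blast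
    thus ?case using op_comp by simp
  next
    case (op_add k g)
    have "k x \<in> H" "g x \<in> H" using op_add endo_on_closed[OF en] by auto
    thus ?case using op_add endo_on_add[OF en[OF assms(1)]] by simp
  next
    case (op_diff k g)
    have "k x \<in> H" "g x \<in> H" using op_diff endo_on_closed[OF en] by auto
    thus ?case using op_diff endo_on_diff[OF en[OF assms(1)] sg] by simp
  qed auto
qed

text \<open>One operator is added at a time. A nonzero common zero of the others is replaced by its
  last nonzero iterate under the new operator; commutation keeps it a zero of the others.\<close>

lemma nilpotent_common_kernel:
  assumes "add_subgroup H" "x0 \<in> H" "x0 \<noteq> 0" "finite F"
    and "\<And>f. f \<in> F \<Longrightarrow> endo_on H f"
    and "\<And>f g x. f \<in> F \<Longrightarrow> g \<in> F \<Longrightarrow> x \<in> H \<Longrightarrow> f (g x) = g (f x)"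
    and "\<And>f. f \<in> F \<Longrightarrow> \<exists>N. \<forall>x\<in>H. (f ^^ N) x = 0"
  shows "\<exists>x\<in>H. x \<noteq> 0 \<and> (\<forall>f\<in>F. f x = 0)"
  using assms(4-)
proof (induction F rule: finite_induct)
  case empty
  thus ?case using assms by auto
next
  case (insert f F)
  have "\<exists>x\<in>H. x \<noteq> 0 \<and> (\<forall>f\<in>F. f x = 0)"
    by (rule insert.IH) (use insert.prems in blast)+
  then obtain x where x: "x \<in> H" "x \<noteq> 0" "\<And>g. g \<in> F \<Longrightarrow> g x = 0" by blast
  have ef: "endo_on H f" using insert by auto
  note fH = endo_on_closed[OF endo_on_funpow[OF ef] x(1)]
  obtain N where N: "(f ^^ N) x = 0" using insert.prems(3)[of f] x(1) by blast
  define k where "k = (LEAST k. (f ^^ k) x = 0)"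
  have k: "(f ^^ k) x = 0" unfolding k_def using N by (rule LeastI)
  have "k \<noteq> 0" using k x by (cases k) auto
  then obtain m where m: "k = Suc m" by (cases k) auto
  have "(f ^^ m) x \<noteq> 0" using not_less_Least[of m "\<lambda>k. (f ^^ k) x = 0"] m k_def by auto
  moreover have "f ((f ^^ m) x) = 0" using k m by simp
  moreover have "g ((f ^^ m) x) = 0" if g: "g \<in> F" for g
  proof -
    have "g ((f ^^ n) x) = 0" for n
    proof (induction n)
      case (Suc n)
      thus ?case using insert.prems(2)[of g f "(f ^^ n) x"] g fH endo_on_zero[OF ef assms(1)] by simp
    qed (use x g in auto)
    thus ?thesis .
  qed
  ultimately show ?case using fH by blast
qed

section \<open>Extending commuting pairs by block triangular matrices\<close>

definition legendre_mat :: "'a::field \<Rightarrow> nat \<Rightarrow> 'a mat \<Rightarrow> 'a mat" where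
  "legendre_mat a n A = A * (A - 1\<^sub>m n) * (A - a \<cdot>\<^sub>m 1\<^sub>m n)"

definition legendre_pairs :: "'a::field \<Rightarrow> nat \<Rightarrow> ('a mat \<times> 'a mat) set" where
  "legendre_pairs a n = {(A, B). A \<in> carrier_mat n n \<and> B \<in> carrier_mat n n \<and> A * B = B * A \<and>
     B * B = legendre_mat a n A}"

lemma legendre_mat_carrier [simp]: "A \<in> carrier_mat n n \<Longrightarrow> legendre_mat a n A \<in> carrier_mat n n"
  unfolding legendre_mat_def by (intro mult_carrier_mat[where n = n] minus_carrier_mat) auto

definition upper_block :: "nat \<Rightarrow> nat \<Rightarrow> 'a::field mat \<Rightarrow> 'a mat \<Rightarrow> 'a mat \<Rightarrow> 'a mat" where
  "upper_block i j A V D = four_block_mat A V (0\<^sub>m j i) D"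

lemma upper_block_carrier [simp]:
  "A \<in> carrier_mat i i \<Longrightarrow> D \<in> carrier_mat j j \<Longrightarrow> upper_block i j A V D \<in> carrier_mat (i + j) (i + j)"
  by (simp add: upper_block_def)

lemma upper_block_mult:
  assumes "A \<in> carrier_mat i i" "V \<in> carrier_mat i j" "D \<in> carrier_mat j j"
    "A' \<in> carrier_mat i i" "V' \<in> carrier_mat i j" "D' \<in> carrier_mat j j"
  shows "upper_block i j A V D * upper_block i j A' V' D' =
    upper_block i j (A * A') (A * V' + V * D') (D * D')"
  unfolding upper_block_def using assms
  by (subst mult_four_block_mat[of _ i i _ j _ j _ _ i _ j]) (auto intro!: cong_four_block_mat)

lemma upper_block_minus_scalar:
  assumes "A \<in> carrier_mat i i" "V \<in> carrier_mat i j" "D \<in> carrier_mat j j"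
  shows "upper_block i j A V D - c \<cdot>\<^sub>m 1\<^sub>m (i + j) =
    upper_block i j (A - c \<cdot>\<^sub>m 1\<^sub>m i) V (D - c \<cdot>\<^sub>m 1\<^sub>m j)"
  using assms by (intro eq_matI) (auto simp: upper_block_def)

lemma upper_block_eq_iff:
  assumes "A \<in> carrier_mat i i" "V \<in> carrier_mat i j" "D \<in> carrier_mat j j"
    "A' \<in> carrier_mat i i" "V' \<in> carrier_mat i j" "D' \<in> carrier_mat j j"
  shows "upper_block i j A V D = upper_block i j A' V' D' \<longleftrightarrow> A = A' \<and> V = V' \<and> D = D'"
proof
  assume eq: "upper_block i j A V D = upper_block i j A' V' D'"
  have ix: "upper_block i j A V D $$ (p, r) = upper_block i j A' V' D' $$ (p, r)" for p r
    using eq by simp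
  have "A = A'"
  proof (rule eq_matI)
    fix p r assume "p < dim_row A'" "r < dim_col A'"
    thus "A $$ (p, r) = A' $$ (p, r)" using assms ix[of p r] by (auto simp: upper_block_def)
  qed (use assms in auto)
  moreover have "V = V'"
  proof (rule eq_matI)
    fix p r assume "p < dim_row V'" "r < dim_col V'"
    thus "V $$ (p, r) = V' $$ (p, r)" using assms ix[of p "i + r"] by (auto simp: upper_block_def)
  qed (use assms in auto)
  moreover have "D = D'"
  proof (rule eq_matI)
    fix p r assume "p < dim_row D'" "r < dim_col D'"
    thus "D $$ (p, r) = D' $$ (p, r)" using assms ix[of "i + p" "i + r"] by (auto simp: upper_block_def)
  qed (use assms in auto)
  ultimately show "A = A' \<and> V = V' \<and> D = D'" by simp
qed auto

text \<open>The divided difference of h at left multiplication s by \<open>A\<close> and right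
  multiplication t by \<open>D\<close>: (h(s) - h(t)) / (s - t) = s (s - 1) + (s + t - 1) (t - a).
  For s = t it becomes h'(s).\<close>

definition legendre_tangent :: "'a::field \<Rightarrow> nat \<Rightarrow> nat \<Rightarrow> 'a mat \<Rightarrow> 'a mat \<Rightarrow> 'a mat \<Rightarrow> 'a mat" where
  "legendre_tangent a i j A D V = (A * (A - 1\<^sub>m i)) * V + (A * V + V * (D - 1\<^sub>m j)) * (D - a \<cdot>\<^sub>m 1\<^sub>m j)"

lemma legendre_mat_upper_block:
  assumes "A \<in> carrier_mat i i" "V \<in> carrier_mat i j" "D \<in> carrier_mat j j"
  shows "legendre_mat a (i + j) (upper_block i j A V D) =
    upper_block i j (legendre_mat a i A) (legendre_tangent a i j A D V) (legendre_mat a j D)"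
proof -
  have 1: "1\<^sub>m k = (1::'a) \<cdot>\<^sub>m 1\<^sub>m k" for k by (intro eq_matI) auto
  have "upper_block i j A V D - 1\<^sub>m (i + j) = upper_block i j (A - 1\<^sub>m i) V (D - 1\<^sub>m j)"
    using upper_block_minus_scalar[OF assms, of 1] by (simp flip: 1)
  moreover have c: "A - 1\<^sub>m i \<in> carrier_mat i i" "A * (A - 1\<^sub>m i) \<in> carrier_mat i i"
    "A - a \<cdot>\<^sub>m 1\<^sub>m i \<in> carrier_mat i i" "D - 1\<^sub>m j \<in> carrier_mat j j" "D * (D - 1\<^sub>m j) \<in> carrier_mat j j"
    "D - a \<cdot>\<^sub>m 1\<^sub>m j \<in> carrier_mat j j" "A * V + V * (D - 1\<^sub>m j) \<in> carrier_mat i j"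
    using assms by (auto intro!: mult_carrier_mat[of _ i i] mult_carrier_mat[of _ j j] minus_carrier_mat)
  ultimately show ?thesis
    unfolding legendre_mat_def legendre_tangent_def upper_block_minus_scalar[OF assms]
    by (simp only: upper_block_mult[OF assms c(1) assms(2) c(4)] upper_block_mult[OF c(2,7,5,3) assms(2) c(6)])
qed

text \<open>Once the diagonal blocks are fixed, the conditions on the off-diagonal blocks are
  linear: one equation comes from commutation, one from the curve equation.\<close>

lemma upper_block_legendre_pairs_iff:
  assumes "A \<in> carrier_mat i i" "V \<in> carrier_mat i j" "D \<in> carrier_mat j j"
    "B \<in> carrier_mat i i" "Y \<in> carrier_mat i j" "E \<in> carrier_mat j j"
  shows "(upper_block i j A V D, upper_block i j B Y E) \<in> legendre_pairs a (i + j) \<longleftrightarrow>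
    (A, B) \<in> legendre_pairs a i \<and> (D, E) \<in> legendre_pairs a j \<and>
    A * Y + V * E = B * V + Y * D \<and> B * Y + Y * E = legendre_tangent a i j A D V"
proof -
  have T: "legendre_tangent a i j A D V \<in> carrier_mat i j"
    unfolding legendre_tangent_def using assms by auto
  have c1: "M * Y' + V' * M' \<in> carrier_mat i j" if "M \<in> carrier_mat i i" "Y' \<in> carrier_mat i j"
    "V' \<in> carrier_mat i j" "M' \<in> carrier_mat j j" for M Y' V' M'
    using that by auto
  show ?thesis
    unfolding legendre_pairs_def
    using assms T c1
    by (auto simp: upper_block_mult[of _ i _ j] legendre_mat_upper_block upper_block_eq_iff)
qed

text \<open>Matrices of a fixed size become elements of a function type, which is an additive group;
  the value 0 out of range makes the map additive and injective on each
  \<open>carrier_mat i j\<close>.\<close>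

definition mat_fun :: "'a::field mat \<Rightarrow> nat \<Rightarrow> nat \<Rightarrow> 'a" where
  "mat_fun M = (\<lambda>p r. if p < dim_row M \<and> r < dim_col M then M $$ (p, r) else 0)"

definition fun_mat :: "nat \<Rightarrow> nat \<Rightarrow> (nat \<Rightarrow> nat \<Rightarrow> 'a::field) \<Rightarrow> 'a mat" where
  "fun_mat i j F = mat i j (\<lambda>(p, r). F p r)"

lemma fun_mat_mat_fun [simp]: "M \<in> carrier_mat i j \<Longrightarrow> fun_mat i j (mat_fun M) = M"
  by (intro eq_matI) (auto simp: fun_mat_def mat_fun_def)

lemma fun_mat_add: "fun_mat i j (F + G) = fun_mat i j F + fun_mat i j G"
  by (intro eq_matI) (auto simp: fun_mat_def)

lemma mat_fun_add: "M \<in> carrier_mat i j \<Longrightarrow> N \<in> carrier_mat i j \<Longrightarrow> mat_fun (M + N) = mat_fun M + mat_fun N"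
  by (intro ext) (auto simp: mat_fun_def)

lemma mat_fun_minus: "M \<in> carrier_mat i j \<Longrightarrow> N \<in> carrier_mat i j \<Longrightarrow> mat_fun (M - N) = mat_fun M - mat_fun N"
  by (intro ext) (auto simp: mat_fun_def)

lemma mat_fun_inj: "M \<in> carrier_mat i j \<Longrightarrow> N \<in> carrier_mat i j \<Longrightarrow> mat_fun M = mat_fun N \<longleftrightarrow> M = N"
  by (metis fun_mat_mat_fun)

lemma card_carrier_vec: "card (carrier_vec n :: 'a::{finite,field} vec set) = CARD('a) ^ n"
proof -
  have "bij_betw (\<lambda>v. restrict (vec_index v) {..<n}) (carrier_vec n :: 'a vec set) ({..<n} \<rightarrow>\<^sub>E UNIV)"
    by (rule bij_betwI[where g = "\<lambda>f. vec n f"]) (auto simp: fun_eq_iff PiE_def extensional_def)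
  thus ?thesis using bij_betw_same_card by (fastforce simp: card_PiE)
qed

lemma card_carrier_mat: "card (carrier_mat i j :: 'a::{finite,field} mat set) = CARD('a) ^ (i * j)"
proof -
  have "bij_betw (\<lambda>M. restrict (\<lambda>p. M $$ p) ({..<i} \<times> {..<j})) (carrier_mat i j :: 'a mat set)
     ({..<i} \<times> {..<j} \<rightarrow>\<^sub>E UNIV)"
    by (rule bij_betwI[where g = "\<lambda>f. mat i j f"]) (auto simp: fun_eq_iff PiE_def extensional_def)
  thus ?thesis using bij_betw_same_card by (fastforce simp: card_PiE card_cartesian_product)
qed

lemma finite_carrier_vec [simp]: "finite (carrier_vec n :: 'a::{finite,field} vec set)"
  by (rule card_ge_0_finite) (simp add: card_carrier_vec)

lemma finite_carrier_mat [simp]: "finite (carrier_mat i j :: 'a::{finite,field} mat set)"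
  by (rule card_ge_0_finite) (simp add: card_carrier_mat)

(* A common zero x of the operators of the matrix factorisation satisfies 2 B x = 0, h(A) x = 0 and
   h'(A) x = 0, where x0, ..., x4 are the entries of x, A x, ..., A^4 x; h is squarefree. *)
lemma legendre_bezout:
  fixes a :: "'a::field"
  assumes "a \<noteq> 0" "a \<noteq> 1"
    and "x3 - (1 + a) * x2 + a * x1 = 0" "x4 - (1 + a) * x3 + a * x2 = 0"
    and "3 * x2 - 2 * (1 + a) * x1 + a * x0 = 0" "3 * x3 - 2 * (1 + a) * x2 + a * x1 = 0"
      "3 * x4 - 2 * (1 + a) * x3 + a * x2 = 0"
  shows "x0 = 0"
proof -
  \<comment> \<open>The discriminant a^2 (a - 1)^2 of h is written as u h + v h' with v = a (a -
    1)^2 + \<open>v1\<close> X + \<open>v2\<close> X^2 and u = 2 (1 + a) (a - 1)^2 -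
    \<open>v1\<close> - 3 \<open>v2\<close> X; then X^i is replaced by the i-th entry.\<close>
  define v1 where "v1 = - 2 * a ^ 3 + a ^ 2 + a - 2"
  define v2 where "v2 = 2 * a ^ 2 - 2 * a + 2"
  have "a ^ 2 * (a - 1) ^ 2 * x0 =
    (2 * (1 + a) * (a - 1) ^ 2 - v1) * (x3 - (1 + a) * x2 + a * x1) - 3 * v2 * (x4 - (1 + a) * x3 + a * x2)
    + a * (a - 1) ^ 2 * (3 * x2 - 2 * (1 + a) * x1 + a * x0) + v1 * (3 * x3 - 2 * (1 + a) * x2 + a * x1)
    + v2 * (3 * x4 - 2 * (1 + a) * x3 + a * x2)"
    unfolding v1_def v2_def by (simp add: power2_eq_square power3_eq_cube ring_distribs mult_ac)
  also have "\<dots> = 0" using assms(3-) by simp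
  finally have "a ^ 2 * (a - 1) ^ 2 * x0 = 0" .
  thus ?thesis using assms(1,2) by auto
qed

section \<open>The linear system for the off-diagonal blocks\<close>

context
  fixes a :: "'a::{finite,field}" and i j :: nat and A B D E :: "'a mat"
  assumes a: "a \<noteq> 0" "a \<noteq> 1" and two: "(2::'a) \<noteq> 0"
    and AB: "(A, B) \<in> legendre_pairs a i" and DE: "(D, E) \<in> legendre_pairs a j"
begin

lemma carr: "A \<in> carrier_mat i i" "B \<in> carrier_mat i i" "D \<in> carrier_mat j j" "E \<in> carrier_mat j j"
  and comm: "A * B = B * A" "D * E = E * D"
  and sq: "B * B = legendre_mat a i A" "E * E = legendre_mat a j D"
  using AB DE by (auto simp: legendre_pairs_def)

definition "funs = (mat_fun ` carrier_mat i j :: (nat \<Rightarrow> nat \<Rightarrow> 'a) set)"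

text \<open>Multiplication by the four diagonal blocks, as operators on the i x j matrices. Scaling
  by \<open>a\<close> joins them because \<open>op_closure\<close> provides integer coefficients
  only.\<close>

definition "lA F = mat_fun (A * fun_mat i j F)"
definition "lB F = mat_fun (B * fun_mat i j F)"
definition "rD F = mat_fun (fun_mat i j F * D)"
definition "rE F = mat_fun (fun_mat i j F * E)"
definition "sc F = mat_fun (a \<cdot>\<^sub>m fun_mat i j F)"

lemmas ops_def = lA_def lB_def rD_def rE_def sc_def

lemma mcarr [simp]: "U \<in> carrier_mat i j \<Longrightarrow> A * U \<in> carrier_mat i j"
  "U \<in> carrier_mat i j \<Longrightarrow> B * U \<in> carrier_mat i j"
  "U \<in> carrier_mat i j \<Longrightarrow> U * D \<in> carrier_mat i j"
  "U \<in> carrier_mat i j \<Longrightarrow> U * E \<in> carrier_mat i j"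
  using carr by auto

lemma funs_cases: "F \<in> funs \<Longrightarrow> (\<And>U. F = mat_fun U \<Longrightarrow> U \<in> carrier_mat i j \<Longrightarrow> P) \<Longrightarrow> P"
  by (auto simp: funs_def)

lemma ops_mat_fun [simp]:
  assumes "U \<in> carrier_mat i j"
  shows "lA (mat_fun U) = mat_fun (A * U)" "lB (mat_fun U) = mat_fun (B * U)"
    "rD (mat_fun U) = mat_fun (U * D)" "rE (mat_fun U) = mat_fun (U * E)" "sc (mat_fun U) = mat_fun (a \<cdot>\<^sub>m U)"
  using assms by (simp_all add: ops_def)

lemma funs_subgroup: "add_subgroup funs"
  unfolding add_subgroup_def
proof (intro conjI ballI)
  have "mat_fun (0\<^sub>m i j) = (0 :: nat \<Rightarrow> nat \<Rightarrow> 'a)" by (intro ext) (auto simp: mat_fun_def)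
  thus "0 \<in> funs" unfolding funs_def by (metis image_eqI zero_carrier_mat)
  fix F G assume "F \<in> funs" "G \<in> funs"
  thus "F - G \<in> funs" unfolding funs_def
    by (auto simp flip: mat_fun_minus intro!: imageI minus_carrier_mat)
qed

lemma ops_endo: "g \<in> {lA, lB, rD, rE, sc} \<Longrightarrow> endo_on funs g"
  using carr by (auto simp: endo_on_def funs_def ops_def fun_mat_add mat_fun_add[of _ i j]
      mult_add_distrib_mat[of _ i i _ j] add_mult_distrib_mat[of _ i j _ _ j] add_smult_distrib_left_mat[of _ i j])

lemma ops_comm: "f \<in> {lA, lB, rD, rE, sc} \<Longrightarrow> g \<in> {lA, lB, rD, rE, sc} \<Longrightarrow> F \<in> funs \<Longrightarrow> f (g F) = g (f F)"
proof -
  assume *: "f \<in> {lA, lB, rD, rE, sc}" "g \<in> {lA, lB, rD, rE, sc}" "F \<in> funs"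
  then obtain U where U: "F = mat_fun U" "U \<in> carrier_mat i j" by (elim funs_cases)
  have 1: "A * (B * U) = B * (A * U)" "U * D * E = U * E * D"
    using assoc_mult_mat[OF carr(1,2) U(2)] assoc_mult_mat[OF carr(2,1) U(2)]
      assoc_mult_mat[OF U(2) carr(3,4)] assoc_mult_mat[OF U(2) carr(4,3)] comm by simp_all
  have 2: "A * (U * D) = A * U * D" "A * (U * E) = A * U * E" "B * (U * D) = B * U * D" "B * (U * E) = B * U * E"
    using U carr by simp_all
  have 3: "A * (a \<cdot>\<^sub>m U) = a \<cdot>\<^sub>m (A * U)" "B * (a \<cdot>\<^sub>m U) = a \<cdot>\<^sub>m (B * U)"
    "(a \<cdot>\<^sub>m U) * D = a \<cdot>\<^sub>m (U * D)" "(a \<cdot>\<^sub>m U) * E = a \<cdot>\<^sub>m (U * E)"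
    using U carr by (auto simp: mult_smult_distrib mult_smult_assoc_mat)
  show ?thesis using * by (elim insertE emptyE; simp only: U ops_mat_fun mcarr smult_carrier_mat 1 2 3)
qed

abbreviation "W \<equiv> op_closure {lA, lB, rD, rE, sc}"

lemma base_in_W: "f \<in> {lA, lB, rD, rE, sc} \<Longrightarrow> f \<in> W"
  using op_comp[OF _ op_id, of f "{lA, lB, rD, rE, sc}"] by simp

text \<open>The matrix of the linear system: the first column acts on the block U of the first
  matrix, the second on the block V of the second; the rows are commutation and the curve equation.
  \<open>m21\<close> is written as a difference because \<open>op_closure\<close> has no
  negation.\<close>

definition "m11 F = rE F - lB F"
definition "m12 F = lA F - rD F"
definition "tang F = lA (lA F - F) + (rD (lA F + (rD F - F)) - sc (lA F + (rD F - F)))"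
definition "m21 F = 0 - tang F" for F :: "nat \<Rightarrow> nat \<Rightarrow> 'a"
definition "m22 F = lB F + rE F"

lemma m_in_W: "{m11, m12, m21, m22} \<subseteq> W"
proof -
  have b: "lA \<in> W" "lB \<in> W" "rD \<in> W" "rE \<in> W" "sc \<in> W" using base_in_W by auto
  have 1: "(\<lambda>F. lA F + (rD F - F)) \<in> W" "(\<lambda>F. lA F - F) \<in> W"
    using b by (auto intro!: op_add op_diff op_id)
  have "tang \<in> W" unfolding tang_def[abs_def]
    using op_add[OF op_comp[OF _ 1(2), of lA] op_diff[OF op_comp[OF _ 1(1), of rD] op_comp[OF _ 1(1), of sc]]]
    by simp
  moreover have "(\<lambda>F. 0) \<in> W" using op_diff[OF op_id op_id, of "{lA, lB, rD, rE, sc}"] by simp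
  ultimately have "m21 \<in> W" unfolding m21_def[abs_def] by (intro op_diff)
  thus ?thesis using b unfolding m11_def[abs_def] m12_def[abs_def] m22_def[abs_def]
    by (auto intro!: op_add op_diff)
qed

lemmas endos = ops_endo[of lA, simplified] ops_endo[of lB, simplified] ops_endo[of rD, simplified]
  ops_endo[of rE, simplified] ops_endo[of sc, simplified]

lemma funs_closed:
  "x \<in> funs \<Longrightarrow> y \<in> funs \<Longrightarrow> x + y \<in> funs" "x \<in> funs \<Longrightarrow> y \<in> funs \<Longrightarrow> x - y \<in> funs"
  "x \<in> funs \<Longrightarrow> lA x \<in> funs" "x \<in> funs \<Longrightarrow> lB x \<in> funs" "x \<in> funs \<Longrightarrow> rD x \<in> funs"
  "x \<in> funs \<Longrightarrow> rE x \<in> funs" "x \<in> funs \<Longrightarrow> sc x \<in> funs" "0 \<in> funs"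
  by (fact add_subgroup_add[OF funs_subgroup] add_subgroup_diff[OF funs_subgroup]
    add_subgroup_zero[OF funs_subgroup] endo_on_closed[OF endos(1)] endo_on_closed[OF endos(2)]
    endo_on_closed[OF endos(3)] endo_on_closed[OF endos(4)] endo_on_closed[OF endos(5)])+

lemmas funs_linear = endo_on_add[OF endos(1)] endo_on_add[OF endos(2)] endo_on_add[OF endos(3)]
  endo_on_add[OF endos(4)] endo_on_add[OF endos(5)]
  endo_on_diff[OF endos(1) funs_subgroup] endo_on_diff[OF endos(2) funs_subgroup]
  endo_on_diff[OF endos(3) funs_subgroup] endo_on_diff[OF endos(4) funs_subgroup]
  endo_on_diff[OF endos(5) funs_subgroup]
  endo_on_zero[OF endos(1) funs_subgroup] endo_on_zero[OF endos(2) funs_subgroup]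
  endo_on_zero[OF endos(3) funs_subgroup] endo_on_zero[OF endos(4) funs_subgroup]
  endo_on_zero[OF endos(5) funs_subgroup]

lemma swap_ops:
  assumes "x \<in> funs"
  shows "rD (lA x) = lA (rD x)" "sc (lA x) = lA (sc x)" "sc (rD x) = rD (sc x)" "rE (lB x) = lB (rE x)"
  by (rule ops_comm; use assms in simp)+

lemma sc_apply: "x \<in> funs \<Longrightarrow> sc x p r = a * x p r"
  by (elim funs_cases) (simp, auto simp: mat_fun_def)

text \<open>The curve equation B^2 = h(A), multiplied out so that \<open>m_det\<close> becomes a
  comparison of sums of monomials in the operators.\<close>

lemma lB_sq:
  assumes "x \<in> funs"
  shows "lB (lB x) = lA (lA (lA x)) - lA (lA x) - lA (lA (sc x)) + lA (sc x)"
proof -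
  obtain U where U: "x = mat_fun U" "U \<in> carrier_mat i j" using assms by (rule funs_cases)
  have c: "A - a \<cdot>\<^sub>m 1\<^sub>m i \<in> carrier_mat i i" "A - 1\<^sub>m i \<in> carrier_mat i i"
    "A * (A - 1\<^sub>m i) \<in> carrier_mat i i"
    using carr by (auto intro!: mult_carrier_mat[of _ i i] minus_carrier_mat)
  define V where "V = A * U - a \<cdot>\<^sub>m U"
  have V: "V \<in> carrier_mat i j" using U unfolding V_def by (intro minus_carrier_mat) auto
  have "B * (B * U) = legendre_mat a i A * U" using assoc_mult_mat[OF carr(2,2) U(2)] sq by simp
  also have "\<dots> = A * (A - 1\<^sub>m i) * ((A - a \<cdot>\<^sub>m 1\<^sub>m i) * U)"
    unfolding legendre_mat_def using c U by (intro assoc_mult_mat) auto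
  also have "(A - a \<cdot>\<^sub>m 1\<^sub>m i) * U = V"
    unfolding V_def using carr U by (simp add: minus_mult_distrib_mat[of _ i i _ _ j] mult_smult_assoc_mat[of _ i i _ j])
  also have "A * (A - 1\<^sub>m i) * V = A * ((A - 1\<^sub>m i) * V)" using c carr V by (intro assoc_mult_mat) auto
  also have "(A - 1\<^sub>m i) * V = A * V - V" using carr V by (simp add: minus_mult_distrib_mat[of _ i i _ _ j])
  finally have "B * (B * U) = A * (A * V - V)" .
  hence "lB (lB x) = lA (lA (mat_fun V) - mat_fun V)"
    using U V by (simp add: minus_carrier_mat flip: mat_fun_minus[of _ i j])
  moreover have "mat_fun V = lA x - sc x" using U unfolding V_def by (simp flip: mat_fun_minus[of _ i j])
  ultimately have "lB (lB x) = lA (lA (lA x - sc x) - (lA x - sc x))" by (simp only:)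
  also have "\<dots> = (lA (lA (lA x)) - lA (lA (sc x))) - (lA (lA x) - lA (sc x))"
    using assms by (simp only: funs_linear funs_closed)
  also have "\<dots> = lA (lA (lA x)) - lA (lA x) - lA (lA (sc x)) + lA (sc x)" by (rule ext)+ simp
  finally show ?thesis .
qed

lemma rE_sq:
  assumes "x \<in> funs"
  shows "rE (rE x) = rD (rD (rD x)) - rD (rD x) - rD (rD (sc x)) + rD (sc x)"
proof -
  obtain U where U: "x = mat_fun U" "U \<in> carrier_mat i j" using assms by (rule funs_cases)
  have c: "D - a \<cdot>\<^sub>m 1\<^sub>m j \<in> carrier_mat j j" "D - 1\<^sub>m j \<in> carrier_mat j j"
    "D * (D - 1\<^sub>m j) \<in> carrier_mat j j"
    using carr by (auto intro!: mult_carrier_mat[of _ j j] minus_carrier_mat)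
  define V where "V = U * D * D - U * D"
  have V: "V \<in> carrier_mat i j" using U unfolding V_def by (intro minus_carrier_mat) auto
  have "U * E * E = U * legendre_mat a j D" using assoc_mult_mat[OF U(2) carr(4,4)] sq by simp
  also have "\<dots> = U * (D * (D - 1\<^sub>m j)) * (D - a \<cdot>\<^sub>m 1\<^sub>m j)"
    unfolding legendre_mat_def using c U by (intro assoc_mult_mat[symmetric]) auto
  also have "U * (D * (D - 1\<^sub>m j)) = U * D * (D - 1\<^sub>m j)"
    using c carr U by (intro assoc_mult_mat[symmetric]) auto
  also have "\<dots> = V"
    unfolding V_def using carr U by (subst mult_minus_distrib_mat[of _ i j _ j]) auto
  also have "V * (D - a \<cdot>\<^sub>m 1\<^sub>m j) = V * D - a \<cdot>\<^sub>m V"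
    using carr V by (simp add: mult_minus_distrib_mat[of _ i j _ j] mult_smult_distrib[of _ i j _ j])
  finally have "U * E * E = V * D - a \<cdot>\<^sub>m V" .
  hence "rE (rE x) = rD (mat_fun V) - sc (mat_fun V)"
    using U V by (simp add: minus_carrier_mat del: assoc_mult_mat flip: mat_fun_minus[of _ i j])
  moreover have "mat_fun V = rD (rD x) - rD x"
    using U unfolding V_def by (simp add: del: assoc_mult_mat flip: mat_fun_minus[of _ i j])
  ultimately have "rE (rE x) = rD (rD (rD x) - rD x) - sc (rD (rD x) - rD x)" by (simp only:)
  also have "\<dots> = (rD (rD (rD x)) - rD (rD x)) - (rD (rD (sc x)) - rD (sc x))"
    using assms by (simp only: funs_linear funs_closed swap_ops)
  also have "\<dots> = rD (rD (rD x)) - rD (rD x) - rD (rD (sc x)) + rD (sc x)" by (rule ext)+ simp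
  finally show ?thesis .
qed

lemma tang_mat:
  assumes U: "U \<in> carrier_mat i j"
  shows "tang (mat_fun U) = mat_fun (legendre_tangent a i j A D U)" "legendre_tangent a i j A D U \<in> carrier_mat i j"
proof -
  have c: "A - 1\<^sub>m i \<in> carrier_mat i i" "D - a \<cdot>\<^sub>m 1\<^sub>m j \<in> carrier_mat j j" "D - 1\<^sub>m j \<in> carrier_mat j j"
    using carr by (auto intro!: minus_carrier_mat)
  define V where "V = A * U + (U * D - U)"
  have V: "V \<in> carrier_mat i j" using U unfolding V_def by (intro add_carrier_mat minus_carrier_mat) auto
  have "A * (A - 1\<^sub>m i) * U = A * ((A - 1\<^sub>m i) * U)" using c carr U by (intro assoc_mult_mat) auto
  also have "(A - 1\<^sub>m i) * U = A * U - U" using carr U by (simp add: minus_mult_distrib_mat[of _ i i _ _ j])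
  finally have 1: "A * (A - 1\<^sub>m i) * U = A * (A * U - U)" .
  have 2: "U * (D - 1\<^sub>m j) = U * D - U" using carr U by (subst mult_minus_distrib_mat[of _ i j _ j]) auto
  have 3: "V * (D - a \<cdot>\<^sub>m 1\<^sub>m j) = V * D - a \<cdot>\<^sub>m V"
    using carr V by (simp add: mult_minus_distrib_mat[of _ i j _ j] mult_smult_distrib[of _ i j _ j])
  have T: "legendre_tangent a i j A D U = A * (A * U - U) + (V * D - a \<cdot>\<^sub>m V)"
    unfolding legendre_tangent_def 1 2 using 3 V_def by simp
  show "legendre_tangent a i j A D U \<in> carrier_mat i j"
    unfolding T using U V by (intro add_carrier_mat minus_carrier_mat) auto
  have "mat_fun V = lA (mat_fun U) + (rD (mat_fun U) - mat_fun U)"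
    unfolding V_def using U by (simp add: mat_fun_add[of _ i j] mat_fun_minus[of _ i j] minus_carrier_mat)
  moreover have W: "mat_fun (A * U - U) = lA (mat_fun U) - mat_fun U" "A * U - U \<in> carrier_mat i j"
    using U by (simp_all add: mat_fun_minus[of _ i j] minus_carrier_mat)
  moreover have "mat_fun (A * (A * U - U) + (V * D - a \<cdot>\<^sub>m V)) =
      lA (mat_fun (A * U - U)) + (rD (mat_fun V) - sc (mat_fun V))"
    using W(2) V by (simp only: mat_fun_add[of _ i j] mat_fun_minus[of _ i j] minus_carrier_mat ops_mat_fun
        mcarr smult_carrier_mat)
  ultimately show "tang (mat_fun U) = mat_fun (legendre_tangent a i j A D U)"
    unfolding T tang_def by simp
qed

text \<open>Both sides are h at right multiplication by D minus h at left multiplication by A: the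
  left side through E^2 - B^2, the right side through the divided difference
  \<open>tang\<close>.\<close>

lemma m_det: "x \<in> funs \<Longrightarrow> m11 (m22 x) = m12 (m21 x)"
proof -
  assume x: "x \<in> funs"
  have "m11 (m22 x) = (lB (rE x) + rE (rE x)) - (lB (lB x) + lB (rE x))"
    unfolding m11_def m22_def using x by (simp only: funs_linear funs_closed swap_ops)
  also have "\<dots> = m12 (m21 x)"
    unfolding m12_def m21_def tang_def lB_sq[OF x] rE_sq[OF x]
    using x by (simp only: funs_linear funs_closed swap_ops) ((rule ext)+, simp)
  finally show ?thesis .
qed

text \<open>The Jacobian criterion: the first row vanishes where the left and right actions agree,
  and there the second row becomes - h'(A) and 2 B.\<close>

lemma m_kernel_trivial:
  assumes x: "x \<in> funs" and k: "m11 x = 0" "m12 x = 0" "m21 x = 0" "m22 x = 0"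
  shows "x = 0"
proof -
  have "lB x p r = 0" for p r
  proof -
    have "rE x = lB x" "lB x + rE x = 0" using k by (simp_all add: m11_def m22_def)
    hence "lB x p r + lB x p r = 0" by (metis plus_fun_apply zero_fun_apply)
    hence "2 * lB x p r = 0" by simp
    thus ?thesis using two by simp
  qed
  hence B0: "lB x = 0" by (intro ext) auto
  have AD: "rD x = lA x" using k by (simp add: m12_def)
  define h where "h y = lA (lA (lA y)) - lA (lA y) - lA (lA (sc y)) + lA (sc y)" for y
  have h0: "h x = 0" using lB_sq[OF x] B0 funs_linear by (simp add: h_def)
  have "tang x = 0" using k by (simp add: m21_def)
  hence t0: "lA (lA x) - lA x + (lA (lA x) + (lA (lA x) - lA x) - (lA (sc x) + (lA (sc x) - sc x))) = 0"
    unfolding tang_def using x by (simp only: funs_linear funs_closed AD swap_ops)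
  \<comment> \<open>This is \<open>tang\<close> with right multiplication replaced by left
    multiplication, that is, h'(A). As it commutes with A, the equations pass on to A x and A^2 x,
    as \<open>legendre_bezout\<close> requires.\<close>
  define t where "t y = lA (lA y) - lA y + (lA (lA y) + (lA (lA y) - lA y) - (lA (sc y) + (lA (sc y) - sc y)))" for y
  have lAt: "lA (t y) = t (lA y)" "lA (h y) = h (lA y)" if "y \<in> funs" for y
    unfolding t_def h_def using that by (simp_all only: funs_linear funs_closed swap_ops)
  have t1: "t x = 0" using t0 by (simp only: t_def)
  have t2: "t (lA x) = 0" using lAt(1)[OF x] funs_linear(11) t1 by simp
  have t3: "t (lA (lA x)) = 0" using lAt(1)[of "lA x"] x funs_closed funs_linear(11) t2 by simp
  have h1: "h (lA x) = 0" using lAt(2)[OF x] funs_linear(11) h0 by simp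
  have apply_t: "t y p r = 3 * lA (lA y) p r - 2 * (1 + a) * lA y p r + a * y p r" if "y \<in> funs" for y p r
    using that sc_apply[of "lA y" p r] by (simp add: t_def sc_apply funs_closed swap_ops algebra_simps)
  have apply_h: "h y p r = lA (lA (lA y)) p r - (1 + a) * lA (lA y) p r + a * lA y p r" if "y \<in> funs" for y p r
    using that sc_apply[of "lA (lA y)" p r] sc_apply[of "lA y" p r]
    by (simp add: h_def funs_closed swap_ops algebra_simps)
  have "x p r = 0" for p r
    using legendre_bezout[OF a, of "lA (lA (lA x)) p r" "lA (lA x) p r" "lA x p r" "lA (lA (lA (lA x))) p r" "x p r"]
      apply_t[of x p r] apply_t[of "lA x" p r] apply_t[of "lA (lA x)" p r] apply_h[of x p r] apply_h[of "lA x" p r]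
      t1 t2 t3 h0 h1 x by (simp add: funs_closed)
  thus ?thesis by (intro ext) auto
qed

lemma card_ker2_legendre: "card (ker2 funs m11 m12 m21 m22) = card funs"
proof (rule card_ker2[where F = W])
  show "finite funs" by (simp add: funs_def)
  show "add_subgroup funs" by (rule funs_subgroup)
  show "{m11, m12, m21, m22} \<subseteq> W" by (rule m_in_W)
  show "endo_on funs f" if "f \<in> W" for f
    using that funs_subgroup ops_endo by (rule endo_on_op_closure)
  show "f (g x) = g (f x)" if "f \<in> W" "g \<in> W" "x \<in> funs" for f g x
    using that funs_subgroup ops_endo ops_comm by (rule op_closure_commute)
  show "m11 (m22 x) = m12 (m21 x)" if "x \<in> funs" for x using that by (rule m_det)
  fix H' assume H': "add_subgroup H'" "H' \<subseteq> funs" "\<And>f. f \<in> W \<Longrightarrow> endo_on H' f"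
    "\<And>f. f \<in> {m11, m12, m21, m22} \<Longrightarrow> \<exists>N. \<forall>x\<in>H'. (f ^^ N) x = 0"
  show "H' \<subseteq> {0}"
  proof (rule ccontr)
    assume "\<not> H' \<subseteq> {0}"
    then obtain x0 where "x0 \<in> H'" "x0 \<noteq> 0" by auto
    hence "\<exists>x\<in>H'. x \<noteq> 0 \<and> (\<forall>f\<in>{m11, m12, m21, m22}. f x = 0)"
    proof (rule nilpotent_common_kernel[OF H'(1)])
      show "f (g x) = g (f x)" if "f \<in> {m11, m12, m21, m22}" "g \<in> {m11, m12, m21, m22}" "x \<in> H'" for f g x
        using that m_in_W H'(2) funs_subgroup ops_endo ops_comm
        by (intro op_closure_commute[of f "{lA, lB, rD, rE, sc}" g x funs]) auto
    qed (use H' m_in_W in auto)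
    thus False using m_kernel_trivial H'(2) by blast
  qed
qed

lemma card_extensions:
  "card {(U, V). U \<in> carrier_mat i j \<and> V \<in> carrier_mat i j \<and>
     (upper_block i j A U D, upper_block i j B V E) \<in> legendre_pairs a (i + j)} = CARD('a) ^ (i * j)"
    (is "card ?S = _")
proof -
  have iff: "(upper_block i j A U D, upper_block i j B V E) \<in> legendre_pairs a (i + j) \<longleftrightarrow>
     m11 (mat_fun U) + m12 (mat_fun V) = 0 \<and> m21 (mat_fun U) + m22 (mat_fun V) = 0"
    if U: "U \<in> carrier_mat i j" and V: "V \<in> carrier_mat i j" for U V
  proof -
    have "A * V + U * E = B * U + V * D \<longleftrightarrow> mat_fun (A * V + U * E) = mat_fun (B * U + V * D)"
      using U V by (intro mat_fun_inj[symmetric, of _ i j]) auto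
    also have "\<dots> \<longleftrightarrow> lA (mat_fun V) + rE (mat_fun U) = lB (mat_fun U) + rD (mat_fun V)"
      using U V by (simp add: mat_fun_add[of _ i j])
    also have "\<dots> \<longleftrightarrow> m11 (mat_fun U) + m12 (mat_fun V) = 0"
      by (auto simp: m11_def m12_def algebra_simps)
    finally have 1: "A * V + U * E = B * U + V * D \<longleftrightarrow> m11 (mat_fun U) + m12 (mat_fun V) = 0" .
    have "B * V + V * E = legendre_tangent a i j A D U \<longleftrightarrow>
        mat_fun (B * V + V * E) = mat_fun (legendre_tangent a i j A D U)"
      using U V tang_mat by (intro mat_fun_inj[symmetric, of _ i j]) auto
    also have "\<dots> \<longleftrightarrow> lB (mat_fun V) + rE (mat_fun V) = tang (mat_fun U)"
      using U V by (simp add: mat_fun_add[of _ i j] tang_mat)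
    also have "\<dots> \<longleftrightarrow> m21 (mat_fun U) + m22 (mat_fun V) = 0"
      by (auto simp: m21_def m22_def algebra_simps)
    finally show ?thesis
      using upper_block_legendre_pairs_iff[OF carr(1) U carr(3) carr(2) V carr(4), of a] AB DE 1 by simp
  qed
  have "bij_betw (map_prod mat_fun mat_fun) ?S (ker2 funs m11 m12 m21 m22)"
    unfolding bij_betw_def
  proof
    show "inj_on (map_prod mat_fun mat_fun) ?S" using mat_fun_inj by (auto simp: inj_on_def)
    show "map_prod mat_fun mat_fun ` ?S = ker2 funs m11 m12 m21 m22"
      using iff by (auto simp: ker2_def image_iff elim!: funs_cases) (auto simp: funs_def)
  qed
  hence "card ?S = card funs" using card_ker2_legendre by (simp only: bij_betw_same_card)
  also have "\<dots> = CARD('a) ^ (i * j)"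
    unfolding funs_def using mat_fun_inj
    by (subst card_image) (auto simp: inj_on_def card_carrier_mat)
  finally show ?thesis .
qed

end

section \<open>A three-term q-recurrence\<close>

lemma q_pochhammer_Suc: "q_pochhammer q q (Suc n) = q_pochhammer q q n * (1 - q ^ Suc n)"
  by (simp add: q_pochhammer_def)

lemma q_pochhammer_0 [simp]: "q_pochhammer z q 0 = 1"
  by (simp add: q_pochhammer_def)

lemma q_pochhammer_nonzero:
  assumes "\<And>i. 0 < i \<Longrightarrow> i \<le> n \<Longrightarrow> q ^ i \<noteq> (1::'b::field)"
  shows "q_pochhammer q q n \<noteq> 0"
  using assms
proof (induction n)
  case (Suc n)
  moreover have "1 - q ^ Suc n \<noteq> 0" using Suc.prems[of "Suc n"] by auto
  ultimately show ?case by (simp add: q_pochhammer_Suc del: power_Suc)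
qed auto

text \<open>Euler's series: for |q| < 1 it is the product of the 1 / (1 - z q^i t) over i \<ge> 0,
  and \<open>q_euler\<close> is the product of the 1 - q^i t over i \<ge> 1. The functional
  equations that these products suggest are proved for the formal series.\<close>

definition q_exp :: "'b::field \<Rightarrow> 'b \<Rightarrow> 'b fps" where
  "q_exp q z = Abs_fps (\<lambda>m. z ^ m / q_pochhammer q q m)"

definition q_euler :: "'b::field \<Rightarrow> 'b fps" where
  "q_euler q = Abs_fps (\<lambda>m. (-1) ^ m * q ^ (m * (m + 1) div 2) / q_pochhammer q q m)"

text \<open>The substitution of q t for t.\<close>

definition fps_dil :: "'b::field \<Rightarrow> 'b fps \<Rightarrow> 'b fps" where
  "fps_dil q f = Abs_fps (\<lambda>n. q ^ n * fps_nth f n)"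

lemma fps_dil_mult: "fps_dil q (f * g) = fps_dil q f * fps_dil q g"
proof -
  have "q ^ n * (\<Sum>i=0..n. fps_nth f i * fps_nth g (n - i)) =
     (\<Sum>i=0..n. (q ^ i * fps_nth f i) * (q ^ (n - i) * fps_nth g (n - i)))" for n
    unfolding sum_distrib_left
  proof (rule sum.cong, simp)
    fix i assume "i \<in> {0..n}"
    hence "q ^ n = q ^ i * q ^ (n - i)" by (simp flip: power_add)
    thus "q ^ n * (fps_nth f i * fps_nth g (n - i)) =
      q ^ i * fps_nth f i * (q ^ (n - i) * fps_nth g (n - i))" by simp
  qed
  thus ?thesis by (intro fps_ext) (simp add: fps_dil_def fps_mult_nth)
qed

lemma fps_dil_q_exp:
  assumes "\<And>i. 0 < i \<Longrightarrow> q ^ i \<noteq> (1::'b::field)"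
  shows "fps_dil q (q_exp q z) = (1 - fps_const z * fps_X) * q_exp q z"
proof (intro fps_ext)
  fix n
  note nz = q_pochhammer_nonzero[OF assms]
  show "fps_nth (fps_dil q (q_exp q z)) n = fps_nth ((1 - fps_const z * fps_X) * q_exp q z) n"
  proof (cases n)
    case (Suc m)
    have "1 - q ^ Suc m \<noteq> 0" using assms[of "Suc m"] by auto
    hence "q ^ Suc m * (z ^ Suc m / q_pochhammer q q (Suc m)) =
      z ^ Suc m / q_pochhammer q q (Suc m) - z * (z ^ m / q_pochhammer q q m)"
      using nz[of m] by (simp add: q_pochhammer_Suc divide_simps del: power_Suc) (simp add: algebra_simps)
    thus ?thesis
      by (simp add: Suc fps_dil_def q_exp_def left_diff_distrib mult.assoc fps_X_mult_nth del: power_Suc)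
  qed (simp add: fps_dil_def q_exp_def)
qed

lemma fps_dil_q_euler:
  assumes "\<And>i. 0 < i \<Longrightarrow> q ^ i \<noteq> (1::'b::field)"
  shows "(1 - fps_const q * fps_X) * fps_dil q (q_euler q) = q_euler q"
proof (intro fps_ext)
  fix n
  note nz = q_pochhammer_nonzero[OF assms]
  show "fps_nth ((1 - fps_const q * fps_X) * fps_dil q (q_euler q)) n = fps_nth (q_euler q) n"
  proof (cases n)
    case (Suc m)
    have "1 - q ^ Suc m \<noteq> 0" using assms[of "Suc m"] by auto
    moreover have e: "Suc m * (Suc m + 1) div 2 = m * (m + 1) div 2 + Suc m"
    proof -
      have "Suc m * (Suc m + 1) = m * (m + 1) + Suc m * 2" by (simp add: algebra_simps)
      thus ?thesis by simp
    qed
    ultimately have "q ^ Suc m * ((-1) ^ Suc m * q ^ (Suc m * (Suc m + 1) div 2) / q_pochhammer q q (Suc m))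
       - q * (q ^ m * ((-1) ^ m * q ^ (m * (m + 1) div 2) / q_pochhammer q q m)) =
      (-1) ^ Suc m * q ^ (Suc m * (Suc m + 1) div 2) / q_pochhammer q q (Suc m)"
      unfolding e power_add q_pochhammer_Suc using nz[of m]
      by (simp add: divide_simps del: power_Suc mult_Suc mult_Suc_right) (simp add: algebra_simps)
    thus ?thesis
      by (simp add: Suc fps_dil_def q_euler_def left_diff_distrib mult.assoc fps_X_mult_nth del: power_Suc)
  qed (simp add: fps_dil_def q_euler_def)
qed

(* The three-term recurrence is F(qt)(1 - qt) = (1 - \<alpha>t)(1 - \<beta>t)F(t) for the generating function F. *)
lemma recurrence_solution:
  fixes c :: "nat \<Rightarrow> 'b::field"
  assumes q: "\<And>i. 0 < i \<Longrightarrow> q ^ i \<noteq> 1"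
    and c0: "c 0 = 1"
    and c1: "(q - 1) * c 1 = q - (\<alpha> + \<beta>)"
    and cs: "\<And>n. (q ^ (n + 2) - 1) * c (n + 2) = (q ^ (n + 2) - (\<alpha> + \<beta>)) * c (n + 1) + \<alpha> * \<beta> * c n"
  shows "c n = fps_nth (q_exp q \<alpha> * q_exp q \<beta> * q_euler q) n"
proof -
  define D where "D = q_exp q \<alpha> * q_exp q \<beta> * q_euler q"
  define d where "d = fps_nth D"
  have "(1 - fps_const q * fps_X) * fps_dil q D =
      ((1 - fps_const \<alpha> * fps_X) * q_exp q \<alpha>) * ((1 - fps_const \<beta> * fps_X) * q_exp q \<beta>) *
      ((1 - fps_const q * fps_X) * fps_dil q (q_euler q))"
    unfolding D_def by (simp add: fps_dil_mult fps_dil_q_exp[OF q] mult_ac)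
  also have "\<dots> = (1 - fps_const \<alpha> * fps_X) * (1 - fps_const \<beta> * fps_X) * D"
    unfolding D_def fps_dil_q_euler[OF q, simplified] by (simp only: mult_ac)
  also have "\<dots> = (1 - fps_const (\<alpha> + \<beta>) * fps_X + fps_const (\<alpha> * \<beta>) * fps_X ^ 2) * D"
    by (simp add: algebra_simps power2_eq_square flip: fps_const_add fps_const_mult)
  finally have eq: "(1 - fps_const q * fps_X) * fps_dil q D =
     (1 - fps_const (\<alpha> + \<beta>) * fps_X + fps_const (\<alpha> * \<beta>) * fps_X ^ 2) * D" .
  have d0: "d 0 = 1" by (simp add: d_def D_def q_exp_def q_euler_def)
  have "fps_nth ((1 - fps_const q * fps_X) * fps_dil q D) 1 =
    fps_nth ((1 - fps_const (\<alpha> + \<beta>) * fps_X + fps_const (\<alpha> * \<beta>) * fps_X ^ 2) * D) 1" using eq by simp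
  hence d1: "(q - 1) * d 1 = q - (\<alpha> + \<beta>)" using d0
    by (simp add: left_diff_distrib distrib_right mult.assoc fps_X_mult_nth fps_X_power_mult_nth fps_dil_def
        algebra_simps flip: d_def)
  have ds: "(q ^ (n + 2) - 1) * d (n + 2) = (q ^ (n + 2) - (\<alpha> + \<beta>)) * d (n + 1) + \<alpha> * \<beta> * d n" for n
  proof -
    have "fps_nth ((1 - fps_const q * fps_X) * fps_dil q D) (n + 2) =
      fps_nth ((1 - fps_const (\<alpha> + \<beta>) * fps_X + fps_const (\<alpha> * \<beta>) * fps_X ^ 2) * D) (n + 2)"
      using eq by simp
    thus ?thesis
      by (simp add: left_diff_distrib distrib_right mult.assoc fps_X_mult_nth fps_X_power_mult_nth fps_dil_def
          flip: d_def) (simp add: algebra_simps)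
  qed
  \<comment> \<open>Two consecutive coefficients are carried along, as the recurrence has three
    terms; it can be solved for the highest one because no positive power of q is 1.\<close>
  have "c n = d n \<and> c (Suc n) = d (Suc n)"
  proof (induction n)
    case 0
    have "q - 1 \<noteq> 0" using q[of 1] by auto
    thus ?case using c0 d0 c1 d1 by (metis One_nat_def mult_cancel_left)
  next
    case (Suc n)
    have "q ^ (n + 2) - 1 \<noteq> 0" using q[of "n + 2"] by auto
    moreover have "(q ^ (n + 2) - 1) * c (n + 2) = (q ^ (n + 2) - 1) * d (n + 2)"
      using cs[of n] ds[of n] Suc by simp
    ultimately show ?case using Suc by simp
  qed
  thus ?thesis by (simp add: d_def D_def)
qed

section \<open>The coordinate ring of the curve\<close>

type_synonym 'a curve_ring = "'a poly \<times> 'a poly"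

text \<open>A pair \<open>(f, g)\<close> stands for f + g y with y^2 = h, so the unit element is
  \<open>(1, 0)\<close>; addition is the componentwise one.\<close>

definition cmult :: "'a::field poly \<Rightarrow> 'a curve_ring \<Rightarrow> 'a curve_ring \<Rightarrow> 'a curve_ring" where
  "cmult h r s = (fst r * fst s + h * (snd r * snd s), fst r * snd s + snd r * fst s)"

definition cscale :: "'a::field \<Rightarrow> 'a curve_ring \<Rightarrow> 'a curve_ring" where
  "cscale c r = (Polynomial.smult c (fst r), Polynomial.smult c (snd r))"

(* Poles at infinity: x has order 2 and y has order 3, so that pole_coeff n r is the coefficient
   of the unique monomial x^i or x^i y with pole order n; there is none of order 1. *)
definition pole_coeff :: "nat \<Rightarrow> 'a::field curve_ring \<Rightarrow> 'a" where
  "pole_coeff n r = (if even n then poly.coeff (fst r) (n div 2)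
     else if n = 1 then 0 else poly.coeff (snd r) ((n - 3) div 2))"

definition pole_basis :: "nat \<Rightarrow> 'a::field curve_ring" where
  "pole_basis n = (if even n then (Polynomial.monom 1 (n div 2), 0)
     else if n = 1 then 0 else (0, Polynomial.monom 1 ((n - 3) div 2)))"

definition pole_le :: "nat \<Rightarrow> 'a::field curve_ring \<Rightarrow> bool" where
  "pole_le m r \<longleftrightarrow> (\<forall>n>m. pole_coeff n r = 0)"

lemma cmult_commute: "cmult h r s = cmult h s r"
  by (simp add: cmult_def algebra_simps)

lemma cmult_assoc: "cmult h (cmult h r s) t = cmult h r (cmult h s t)"
  by (simp add: cmult_def algebra_simps)

lemma cmult_add_right: "cmult h r (s + t) = cmult h r s + cmult h r t"
  by (simp add: cmult_def algebra_simps)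

lemma cmult_add_left: "cmult h (s + t) r = cmult h s r + cmult h t r"
  by (simp add: cmult_def algebra_simps)

lemma cmult_diff_right: "cmult h r (s - t) = cmult h r s - cmult h r t"
  by (simp add: cmult_def algebra_simps)

lemma cmult_diff_left: "cmult h (s - t) r = cmult h s r - cmult h t r"
  by (simp add: cmult_def algebra_simps)

lemma cmult_zero [simp]: "cmult h 0 r = 0" "cmult h r 0 = 0"
  by (simp_all add: cmult_def zero_prod_def)

lemma cmult_one [simp]: "cmult h (1, 0) r = r" "cmult h r (1, 0) = r"
  by (simp_all add: cmult_def)

lemma cscale_cmult: "cscale c (cmult h r s) = cmult h (cscale c r) s"
  by (simp add: cmult_def cscale_def smult_add_right)

lemma cscale_eq_cmult: "cscale c r = cmult h ([:c:], 0) r"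
  by (simp add: cmult_def cscale_def)

lemma pole_coeff_add: "pole_coeff n (r + s) = pole_coeff n r + pole_coeff n s"
  and pole_coeff_diff: "pole_coeff n (r - s) = pole_coeff n r - pole_coeff n s"
  and pole_coeff_cscale: "pole_coeff n (cscale c r) = c * pole_coeff n r"
  and pole_coeff_zero [simp]: "pole_coeff n 0 = 0"
  and pole_coeff_one [simp]: "pole_coeff 1 r = 0" "pole_coeff (Suc 0) r = 0"
  by (auto simp: pole_coeff_def cscale_def)

lemma pole_coeff_sum: "pole_coeff n (sum f A) = (\<Sum>a\<in>A. pole_coeff n (f a))"
  by (induction A rule: infinite_finite_induct) (auto simp: pole_coeff_add)

lemma odd_cases: "odd (n::nat) \<Longrightarrow> n \<noteq> 1 \<Longrightarrow> (\<And>i. n = 2 * i + 3 \<Longrightarrow> P) \<Longrightarrow> P"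
proof -
  assume n: "odd n" "n \<noteq> 1" "\<And>i. n = 2 * i + 3 \<Longrightarrow> P"
  from n(1) obtain k where "n = 2 * k + 1" by (elim oddE)
  thus P using n(2) n(3)[of "k - 1"] by (cases k) auto
qed

lemma pole_coeff_even: "pole_coeff (2 * i) r = poly.coeff (fst r) i"
  and pole_coeff_odd: "pole_coeff (2 * i + 3) r = poly.coeff (snd r) i"
  by (auto simp: pole_coeff_def)

lemma pole_basis_even: "pole_basis (2 * i) = (Polynomial.monom 1 i, 0)"
  and pole_basis_odd: "pole_basis (2 * i + 3) = (0, Polynomial.monom 1 i)"
  by (auto simp: pole_basis_def)

lemma pole_index_cases:
  obtains (one) "n = (1::nat)" | (even) i where "n = 2 * i" | (odd) i where "n = 2 * i + 3"
  using odd_cases by (metis evenE)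

lemma pole_coeff_eqI:
  assumes "\<And>n. pole_coeff n r = pole_coeff n s"
  shows "r = s"
proof (rule prod_eqI)
  show "fst r = fst s" using assms[of "2 * _"] by (intro poly_eqI) (simp add: pole_coeff_even)
  show "snd r = snd s" using assms[of "2 * _ + 3"] by (intro poly_eqI) (simp only: pole_coeff_odd)
qed

lemma pole_coeff_basis:
  assumes "n \<noteq> 1"
  shows "pole_coeff m (pole_basis n) = (if m = n then 1 else 0)"
proof -
  have "2 * k + 3 \<noteq> 2 * l" "2 * l \<noteq> 2 * k + 3" for k l :: nat by presburger+
  thus ?thesis
    by (cases rule: pole_index_cases[of n]; cases rule: pole_index_cases[of m])
      (use assms in \<open>simp_all only: pole_coeff_even pole_coeff_odd pole_basis_even pole_basis_odd pole_coeff_one\<close>, auto)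
qed

lemma pole_le_mono: "pole_le m r \<Longrightarrow> m \<le> n \<Longrightarrow> pole_le n r"
  by (auto simp: pole_le_def)

lemma pole_le_add: "pole_le m r \<Longrightarrow> pole_le m s \<Longrightarrow> pole_le m (r + s)"
  and pole_le_diff: "pole_le m r \<Longrightarrow> pole_le m s \<Longrightarrow> pole_le m (r - s)"
  and pole_le_cscale: "pole_le m r \<Longrightarrow> pole_le m (cscale c r)"
  and pole_le_zero [simp]: "pole_le m 0"
  by (auto simp: pole_le_def pole_coeff_add pole_coeff_diff pole_coeff_cscale)

lemma pole_le_basis: "pole_le n (pole_basis n)"
  by (cases "n = 1") (auto simp: pole_le_def pole_coeff_basis, simp add: pole_basis_def)

lemma pole_le_exists: "\<exists>m. pole_le m r"
proof
  let ?m = "2 * Polynomial.degree (fst r) + 2 * Polynomial.degree (snd r) + 3"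
  have "pole_coeff n r = 0" if n: "n > ?m" for n
  proof (cases "even n")
    case True
    thus ?thesis using n by (elim evenE) (auto simp: pole_coeff_even coeff_eq_0)
  next
    case False
    from n have "n \<noteq> 1" by simp
    with False obtain i where "n = 2 * i + 3" by (rule odd_cases)
    thus ?thesis using n by (simp only: pole_coeff_odd) (simp add: coeff_eq_0)
  qed
  thus "pole_le ?m r" by (auto simp: pole_le_def)
qed

lemma pole_le_Suc: "pole_le (Suc m) r \<Longrightarrow> pole_coeff (Suc m) r = 0 \<Longrightarrow> pole_le m r"
  unfolding pole_le_def by (metis Suc_lessI)

lemma pole_order_exists:
  assumes "r \<noteq> 0"
  shows "\<exists>m. pole_le m r \<and> pole_coeff m r \<noteq> 0"
proof -
  have "\<exists>n. pole_coeff n r \<noteq> 0" using assms pole_coeff_eqI[of r 0] by auto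
  then obtain n where n: "pole_coeff n r \<noteq> 0" ..
  define m where "m = (LEAST m. pole_le m r)"
  have m: "pole_le m r" unfolding m_def using pole_le_exists by (rule LeastI_ex)
  have "pole_coeff m r \<noteq> 0"
  proof
    assume 0: "pole_coeff m r = 0"
    show False
    proof (cases m)
      case 0
      thus ?thesis using m n \<open>pole_coeff m r = 0\<close> by (metis gr0I pole_le_def)
    next
      case (Suc k)
      hence "pole_le k r" using m 0 pole_le_Suc by metis
      thus ?thesis using not_less_Least[of k "\<lambda>m. pole_le m r"] Suc m_def by auto
    qed
  qed
  thus ?thesis using m by blast
qed

lemma pole_order_unique:
  "pole_le m r \<Longrightarrow> pole_coeff m r \<noteq> 0 \<Longrightarrow> pole_le n r \<Longrightarrow> pole_coeff n r \<noteq> 0 \<Longrightarrow> m = n"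
  unfolding pole_le_def by (metis linorder_neqE_nat)

lemma pole_le_0: "pole_le 0 r \<longleftrightarrow> (\<exists>c. r = ([:c:], 0))"
proof
  assume "pole_le 0 r"
  hence *: "pole_coeff n r = 0" if "n > 0" for n using that by (auto simp: pole_le_def)
  have "r = ([:pole_coeff 0 r:], 0)"
  proof (rule pole_coeff_eqI)
    fix n show "pole_coeff n r = pole_coeff n ([:pole_coeff 0 r:], 0)"
      using *[of n] by (cases "n = 0") (auto simp: pole_coeff_def coeff_pCons split: nat.splits)
  qed
  thus "\<exists>c. r = ([:c:], 0)" by blast
qed (auto simp: pole_le_def pole_coeff_def coeff_pCons split: nat.splits)

lemma pole_le_1: "pole_le 1 r \<longleftrightarrow> pole_le 0 r"
  using pole_le_Suc[of 0 r] pole_le_mono[of 0 r 1] by auto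

text \<open>The span of the monomials with pole order in G. For the gaps of an ideal it is a
  complement of the ideal.\<close>

definition pole_support :: "nat set \<Rightarrow> 'a::field curve_ring set" where
  "pole_support G = {r. \<forall>n. pole_coeff n r \<noteq> 0 \<longrightarrow> n \<in> G}"

lemma pole_support_expand:
  assumes "finite G" "1 \<notin> G" "r \<in> pole_support G"
  shows "r = (\<Sum>n\<in>G. cscale (pole_coeff n r) (pole_basis n))"
proof (rule pole_coeff_eqI)
  fix m
  have "pole_coeff m (\<Sum>n\<in>G. cscale (pole_coeff n r) (pole_basis n)) =
     (\<Sum>n\<in>G. pole_coeff n r * (if m = n then 1 else 0))"
    unfolding pole_coeff_sum pole_coeff_cscale using assms(2)
    by (intro sum.cong refl) (metis pole_coeff_basis)
  also have "\<dots> = pole_coeff m r" using assms(1,3) by (simp add: if_distrib pole_support_def cong: if_cong) blast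
  finally show "pole_coeff m r = pole_coeff m (\<Sum>n\<in>G. cscale (pole_coeff n r) (pole_basis n))" by simp
qed

lemma pole_coeff_combination:
  assumes "finite G" "1 \<notin> G"
  shows "pole_coeff m (\<Sum>n\<in>G. cscale (f n) (pole_basis n)) = (if m \<in> G then f m else 0)"
proof -
  have "pole_coeff m (\<Sum>n\<in>G. cscale (f n) (pole_basis n)) = (\<Sum>n\<in>G. f n * (if m = n then 1 else 0))"
    unfolding pole_coeff_sum pole_coeff_cscale using assms(2)
    by (intro sum.cong refl) (metis pole_coeff_basis)
  also have "\<dots> = (if m \<in> G then f m else 0)" using assms(1) by (simp add: if_distrib cong: if_cong)
  finally show ?thesis .
qed

lemma card_pole_support:
  assumes "finite G" "1 \<notin> G"
  shows "card (pole_support G :: 'a::{finite,field} curve_ring set) = CARD('a) ^ card G"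
proof -
  have "bij_betw (\<lambda>r. restrict (\<lambda>n. pole_coeff n r) G) (pole_support G :: 'a curve_ring set) (G \<rightarrow>\<^sub>E UNIV)"
  proof (rule bij_betwI[where g = "\<lambda>f. \<Sum>n\<in>G. cscale (f n) (pole_basis n)"])
    show "(\<lambda>f. \<Sum>n\<in>G. cscale (f n) (pole_basis n)) \<in> (G \<rightarrow>\<^sub>E UNIV) \<rightarrow> (pole_support G :: 'a curve_ring set)"
      using assms by (auto simp: pole_support_def pole_coeff_combination split: if_splits)
    show "(\<Sum>n\<in>G. cscale (restrict (\<lambda>n. pole_coeff n r) G n) (pole_basis n)) = r"
      if "r \<in> pole_support G" for r :: "'a curve_ring"
      using pole_support_expand[OF assms that] by simp
  qed (use assms in \<open>auto simp: pole_coeff_combination fun_eq_iff PiE_def extensional_def\<close>)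
  thus ?thesis using assms bij_betw_same_card by (fastforce simp: card_PiE)
qed

section \<open>Monic elements, ideals and their gaps\<close>

definition pole_monic :: "nat \<Rightarrow> 'a::field curve_ring \<Rightarrow> bool" where
  "pole_monic m r \<longleftrightarrow> pole_le m r \<and> pole_coeff m r = 1"

lemma pole_monic_basis: "m \<noteq> 1 \<Longrightarrow> pole_monic m (pole_basis m)"
  by (simp add: pole_monic_def pole_le_basis pole_coeff_basis)

lemma pole_monic_normalize:
  "pole_le m r \<Longrightarrow> pole_coeff m r \<noteq> 0 \<Longrightarrow> pole_monic m (cscale (inverse (pole_coeff m r)) r)"
  by (simp add: pole_monic_def pole_le_cscale pole_coeff_cscale)

text \<open>The free coefficients sit at the orders below m except 1, which are m - 1 in
  number.\<close>

lemma card_pole_monic: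
  assumes "m \<ge> 2"
  shows "card {r :: 'a::{finite,field} curve_ring. pole_monic m r} = CARD('a) ^ (m - 1)"
proof -
  define G where "G = {..<m} - {1}"
  have "bij_betw (\<lambda>r. pole_basis m + r) (pole_support G :: 'a curve_ring set) {r. pole_monic m r}"
  proof (rule bij_betwI[where g = "\<lambda>r. r - pole_basis m"])
    show "(\<lambda>r. pole_basis m + r) \<in> pole_support G \<rightarrow> {r :: 'a curve_ring. pole_monic m r}"
      using assms by (auto simp: G_def pole_support_def pole_monic_def pole_le_def pole_coeff_add pole_coeff_basis)
    show "(\<lambda>r. r - pole_basis m) \<in> {r :: 'a curve_ring. pole_monic m r} \<rightarrow> pole_support G"
      using assms by (auto simp: G_def pole_support_def pole_monic_def pole_le_def pole_coeff_diff pole_coeff_basis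
          split: if_splits) (metis linorder_neqE_nat)+
  qed auto
  from bij_betw_same_card[OF this] have "card {r :: 'a curve_ring. pole_monic m r} = CARD('a) ^ card G"
    using card_pole_support[of G, where 'a = 'a] by (simp add: G_def)
  also have "card G = m - 1" using assms by (simp add: G_def)
  finally show ?thesis .
qed

definition curve_ideal :: "'a::field poly \<Rightarrow> 'a curve_ring set \<Rightarrow> bool" where
  "curve_ideal h J \<longleftrightarrow> 0 \<in> J \<and> (\<forall>r\<in>J. \<forall>s\<in>J. r + s \<in> J) \<and> (\<forall>r\<in>J. \<forall>s. cmult h s r \<in> J)"

definition pole_orders :: "'a::field curve_ring set \<Rightarrow> nat set" where
  "pole_orders J = {m. \<exists>r\<in>J. pole_monic m r}"

text \<open>Order 1 is left out because it occurs in no ideal; the whole ring has no gaps.\<close>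

definition gaps :: "'a::field curve_ring set \<Rightarrow> nat set" where
  "gaps J = - {1} - pole_orders J"

text \<open>The number of gaps is the codimension, because the monomials at the gaps represent a
  basis of the quotient: they span it by \<open>pole_reduce\<close> and are independent by
  \<open>pole_support_gaps_Int\<close>.\<close>

definition ideals :: "'a::field poly \<Rightarrow> nat \<Rightarrow> 'a curve_ring set set" where
  "ideals h j = {J. curve_ideal h J \<and> finite (gaps J) \<and> card (gaps J) = j}"

lemma curve_ideal_add: "curve_ideal h J \<Longrightarrow> r \<in> J \<Longrightarrow> s \<in> J \<Longrightarrow> r + s \<in> J"
  and curve_ideal_mult: "curve_ideal h J \<Longrightarrow> r \<in> J \<Longrightarrow> cmult h s r \<in> J"
  and curve_ideal_zero: "curve_ideal h J \<Longrightarrow> 0 \<in> J"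
  unfolding curve_ideal_def by blast+

lemma curve_ideal_cscale: "curve_ideal h J \<Longrightarrow> r \<in> J \<Longrightarrow> cscale c r \<in> J"
  using curve_ideal_mult[of h J r "([:c:], 0)"] cscale_eq_cmult by metis

lemma curve_ideal_diff: "curve_ideal h J \<Longrightarrow> r \<in> J \<Longrightarrow> s \<in> J \<Longrightarrow> r - s \<in> J"
proof -
  assume J: "curve_ideal h J" "r \<in> J" "s \<in> J"
  have "r - s = r + cscale (- 1) s" by (intro prod_eqI) (simp_all add: cscale_def)
  thus ?thesis using J curve_ideal_add curve_ideal_cscale by metis
qed

lemma pole_orders_eq:
  assumes J: "curve_ideal h J"
  shows "m \<in> pole_orders J \<longleftrightarrow> (\<exists>r\<in>J. pole_le m r \<and> pole_coeff m r \<noteq> 0)"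
proof
  assume "m \<in> pole_orders J"
  thus "\<exists>r\<in>J. pole_le m r \<and> pole_coeff m r \<noteq> 0"
    unfolding pole_orders_def pole_monic_def by force
next
  assume "\<exists>r\<in>J. pole_le m r \<and> pole_coeff m r \<noteq> 0"
  then obtain r where r: "r \<in> J" "pole_le m r" "pole_coeff m r \<noteq> 0" by blast
  from pole_monic_normalize[OF r(2,3)] curve_ideal_cscale[OF J r(1)]
  show "m \<in> pole_orders J" unfolding pole_orders_def by blast
qed

lemma one_not_pole_order: "1 \<notin> pole_orders J"
  by (auto simp: pole_orders_def pole_monic_def)

text \<open>Division with remainder by leading terms, from the highest order downwards: at a pole
  order of J the top term is cancelled by an element of J, at a gap it is moved into the
  remainder.\<close>

lemma pole_reduce:
  assumes J: "curve_ideal h J"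
  shows "\<exists>s. s \<in> pole_support (gaps J) \<and> r - s \<in> J"
proof -
  have "\<exists>s. s \<in> pole_support (gaps J) \<and> r - s \<in> J" if "pole_le m r" for m
    using that
  proof (induction m arbitrary: r rule: less_induct)
    case (less m)
    have low: "\<exists>s. s \<in> pole_support (gaps J) \<and> r' - s \<in> J"
      if r': "pole_le m r'" "pole_coeff m r' = 0" for r'
    proof (cases m)
      case 0
      hence "r' = 0" using r' by (intro pole_coeff_eqI) (metis gr0I pole_coeff_zero pole_le_def)
      thus ?thesis using curve_ideal_zero[OF J] by (intro exI[of _ 0]) (auto simp: pole_support_def)
    next
      case (Suc k)
      thus ?thesis using r' pole_le_Suc less.IH[of k r'] by blast
    qed
    consider "m \<in> pole_orders J" | "m = 1" | "m \<in> gaps J" by (auto simp: gaps_def)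
    thus ?case
    proof cases
      case 1
      then obtain u where u: "u \<in> J" "pole_monic m u" by (auto simp: pole_orders_def)
      define r' where "r' = r - cscale (pole_coeff m r) u"
      have "pole_le m r'" "pole_coeff m r' = 0"
        using u less.prems by (auto simp: r'_def pole_monic_def pole_le_diff pole_le_cscale pole_coeff_diff pole_coeff_cscale)
      then obtain s where s: "s \<in> pole_support (gaps J)" "r' - s \<in> J" using low by blast
      have "r - s = (r' - s) + cscale (pole_coeff m r) u" by (simp add: r'_def)
      hence "r - s \<in> J" using s u J curve_ideal_add curve_ideal_cscale by metis
      thus ?thesis using s by blast
    next
      \<comment> \<open>At order 1 every coefficient is 0, so there is nothing to cancel.\<close>
      case 2
      thus ?thesis using low less.prems by simp
    next
      case 3
      hence m1: "m \<noteq> 1" by (auto simp: gaps_def)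
      define r' where "r' = r - cscale (pole_coeff m r) (pole_basis m)"
      have "pole_le m r'" "pole_coeff m r' = 0"
        using m1 less.prems by (auto simp: r'_def pole_le_basis pole_le_diff pole_le_cscale pole_coeff_diff
            pole_coeff_cscale pole_coeff_basis)
      then obtain s where s: "s \<in> pole_support (gaps J)" "r' - s \<in> J" using low by blast
      have "s + cscale (pole_coeff m r) (pole_basis m) \<in> pole_support (gaps J)"
        using s(1) 3 m1 by (auto simp: pole_support_def pole_coeff_add pole_coeff_cscale pole_coeff_basis)
      moreover have "r - (s + cscale (pole_coeff m r) (pole_basis m)) = r' - s" by (simp add: r'_def algebra_simps)
      ultimately show ?thesis using s by metis
    qed
  qed
  thus ?thesis using pole_le_exists by blast
qed

lemma pole_support_gaps_Int:
  assumes J: "curve_ideal h J" and r: "r \<in> pole_support (gaps J)" "r \<in> J"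
  shows "r = 0"
proof (rule ccontr)
  assume "r \<noteq> 0"
  then obtain m where m: "pole_le m r" "pole_coeff m r \<noteq> 0" using pole_order_exists by blast
  hence "m \<in> pole_orders J" using pole_orders_eq[OF J] r by blast
  thus False using m r by (auto simp: pole_support_def gaps_def)
qed

text \<open>Equal pole orders mean equal codimension: the remainder modulo J of an element of K lies
  in K and is supported on the gaps of K, hence it is 0.\<close>

lemma curve_ideal_eqI:
  assumes J: "curve_ideal h J" and K: "curve_ideal h K" and sub: "J \<subseteq> K" and eq: "pole_orders K = pole_orders J"
  shows "J = K"
proof
  show "K \<subseteq> J"
  proof
    fix r assume r: "r \<in> K"
    obtain s where s: "s \<in> pole_support (gaps J)" "r - s \<in> J" using pole_reduce[OF J] by blast
    have "r - (r - s) \<in> K" using r s sub curve_ideal_diff[OF K] by blast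
    hence "s \<in> K" by simp
    moreover have "gaps K = gaps J" using eq by (simp add: gaps_def)
    ultimately have "s = 0" using pole_support_gaps_Int[OF K] s by simp
    thus "r \<in> J" using s by simp
  qed
qed (rule sub)

section \<open>The pole order as a valuation\<close>

locale cubic =
  fixes h :: "'a::field poly"
  assumes deg_h: "Polynomial.degree h = 3" and lead_h: "poly.coeff h 3 = 1"
begin

text \<open>Since y * (x^i y) = x^i h with h monic of degree 3, order 2 i + 3 moves to 2 i + 6. The
  lower terms of h spill into lower orders, so coefficients are shifted unchanged only from the
  bound m upwards.\<close>

lemma pole_mult_y:
  assumes "pole_le m r"
  shows "pole_le (m + 3) (cmult h (0, 1) r)" "pole_coeff (m + 3) (cmult h (0, 1) r) = pole_coeff m r"
proof -
  have c: "cmult h (0, 1) r = (h * snd r, fst r)" by (simp add: cmult_def)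
  have main: "pole_coeff (n + 3) (cmult h (0, 1) r) = pole_coeff n r" if n: "n \<ge> m" for n
  proof (cases rule: pole_index_cases[of n])
    case one
    have "poly.coeff (snd r) i = 0" for i
      using assms n one pole_coeff_odd[of i r] by (auto simp: pole_le_def)
    hence "snd r = 0" by (intro poly_eqI) simp
    thus ?thesis using one pole_coeff_even[of 2 "cmult h (0,1) r"] by (simp add: c)
  next
    case (even i)
    thus ?thesis by (simp only: pole_coeff_even pole_coeff_odd c fst_conv snd_conv)
  next
    case (odd i)
    have "poly.coeff (snd r) k = 0" if "k > i" for k
      using assms n that odd pole_coeff_odd[of k r] by (auto simp: pole_le_def)
    hence d: "Polynomial.degree (snd r) \<le> i" by (simp add: degree_le)
    have "poly.coeff (h * snd r) (i + 3) = (\<Sum>k\<le>i + 3. poly.coeff h k * poly.coeff (snd r) (i + 3 - k))"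
      by (simp add: coeff_mult)
    also have "\<dots> = (\<Sum>k\<in>{3}. poly.coeff h k * poly.coeff (snd r) (i + 3 - k))"
    proof (rule sum.mono_neutral_right)
      show "\<forall>k\<in>{..i + 3} - {3}. poly.coeff h k * poly.coeff (snd r) (i + 3 - k) = 0"
      proof
        fix k assume "k \<in> {..i + 3} - {3}"
        hence "k < 3 \<or> k > 3" by auto
        thus "poly.coeff h k * poly.coeff (snd r) (i + 3 - k) = 0"
          using d deg_h by (auto simp: coeff_eq_0)
      qed
    qed auto
    also have "\<dots> = pole_coeff n r" using odd lead_h pole_coeff_odd[of i r] by simp
    finally have "poly.coeff (h * snd r) (i + 3) = pole_coeff n r" .
    moreover have "n + 3 = 2 * (i + 3)" using odd by simp
    ultimately show ?thesis by (simp only: pole_coeff_even c fst_conv)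
  qed
  show "pole_coeff (m + 3) (cmult h (0, 1) r) = pole_coeff m r" using main by simp
  show "pole_le (m + 3) (cmult h (0, 1) r)" unfolding pole_le_def
  proof (intro allI impI)
    fix n assume n: "n > m + 3"
    have "pole_coeff (n - 3) r = 0" using assms n by (simp add: pole_le_def)
    thus "pole_coeff n (cmult h (0, 1) r) = 0" using main[of "n - 3"] n by simp
  qed
qed

lemma pole_mult_x:
  shows "pole_coeff (m + 2) (cmult h ([:0, 1:], 0) r) = pole_coeff m r"
    and "pole_le m r \<Longrightarrow> pole_le (m + 2) (cmult h ([:0, 1:], 0) r)"
proof -
  have c: "cmult h ([:0, 1:], 0) r = (pCons 0 (fst r), pCons 0 (snd r))" by (simp add: cmult_def)
  show main: "pole_coeff (n + 2) (cmult h ([:0, 1:], 0) r) = pole_coeff n r" for n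
  proof (cases rule: pole_index_cases[of n])
    case one
    thus ?thesis using pole_coeff_odd[of 0 "(pCons 0 (fst r), pCons 0 (snd r))"] by (simp add: c numeral_eq_Suc)
  next
    case (even i)
    thus ?thesis using pole_coeff_even[of "Suc i" "(pCons 0 (fst r), pCons 0 (snd r))"]
      by (simp add: c pole_coeff_even)
  next
    case (odd i)
    have "n + 2 = 2 * Suc i + 3" using odd by simp
    thus ?thesis using odd by (simp only: pole_coeff_odd) (simp add: c)
  qed
  show "pole_le (m + 2) (cmult h ([:0, 1:], 0) r)" if "pole_le m r" unfolding pole_le_def
  proof (intro allI impI)
    fix n assume n: "n > m + 2"
    thus "pole_coeff n (cmult h ([:0, 1:], 0) r) = 0" using main[of "n - 2"] that
      by (simp add: pole_le_def numeral_2_eq_2 Suc_diff_Suc)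
  qed
qed

text \<open>Every monomial except 1 and y is x times a smaller one; in terms of orders, every n
  \<noteq> 1 is 0, 3 or k + 2 with k \<noteq> 1.\<close>

lemma basis_mult:
  assumes "pole_le m r"
  shows "n \<noteq> 1 \<Longrightarrow> pole_le (n + m) (cmult h (pole_basis n) r) \<and>
    pole_coeff (n + m) (cmult h (pole_basis n) r) = pole_coeff m r"
proof (induction n rule: less_induct)
  case (less n)
  have step: ?case if n: "n = k + 2" "k \<noteq> 1" for k
  proof -
    have "pole_basis n = cmult h ([:0, 1:], 0) (pole_basis k)"
    proof (cases rule: pole_index_cases[of k])
      case (even i)
      have "n = 2 * Suc i" using even n by simp
      thus ?thesis using even by (simp only: pole_basis_even) (simp add: cmult_def monom_Suc)
    next
      case (odd i)
      have "n = 2 * Suc i + 3" using odd n by simp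
      thus ?thesis using odd by (simp only: pole_basis_odd) (simp add: cmult_def monom_Suc)
    qed (use n in simp)
    hence "cmult h (pole_basis n) r = cmult h ([:0, 1:], 0) (cmult h (pole_basis k) r)"
      by (simp add: cmult_assoc)
    moreover have "pole_le (k + m) (cmult h (pole_basis k) r) \<and>
      pole_coeff (k + m) (cmult h (pole_basis k) r) = pole_coeff m r" using less.IH[of k] n by simp
    moreover have "n + m = (k + m) + 2" using n by simp
    ultimately show ?thesis using pole_mult_x by metis
  qed
  consider "n = 0" | "n = 3" | k where "n = k + 2" "k \<noteq> 1"
    using less.prems by (metis One_nat_def Suc_1 add_2_eq_Suc' less_2_cases not0_implies_Suc numeral_3_eq_3)
  thus ?case
  proof cases
    case 1
    have "pole_basis 0 = ((1, 0) :: 'a curve_ring)" by (simp add: pole_basis_def)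
    thus ?thesis using 1 assms by simp
  next
    case 2
    have "pole_basis 3 = ((0, 1) :: 'a curve_ring)" by (simp add: pole_basis_def)
    thus ?thesis using 2 pole_mult_y[OF assms] by (simp add: add.commute)
  qed (rule step)
qed

text \<open>The leading monomial of s is split off and treated by \<open>basis_mult\<close>; the
  rest has a smaller bound.\<close>

lemma pole_mult:
  assumes "pole_le n s" "pole_le m r"
  shows "pole_le (n + m) (cmult h s r)" "pole_coeff (n + m) (cmult h s r) = pole_coeff n s * pole_coeff m r"
proof -
  have "pole_le (n + m) (cmult h s r) \<and> pole_coeff (n + m) (cmult h s r) = pole_coeff n s * pole_coeff m r"
    using assms(1)
  proof (induction n arbitrary: s)
    case 0
    then obtain c where c: "s = ([:c:], 0)" using pole_le_0 by blast
    hence "cmult h s r = cscale c r" using cscale_eq_cmult by metis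
    moreover have "pole_coeff 0 s = c" using c by (simp add: pole_coeff_def)
    ultimately show ?case using assms(2) by (simp add: pole_le_cscale pole_coeff_cscale)
  next
    case (Suc n)
    show ?case
    proof (cases "n = 0")
      \<comment> \<open>The bound 1 is improved to 0, as there are no elements of order 1.\<close>
      case True
      hence s: "pole_le 0 s" using Suc.prems pole_le_1[of s] by simp
      show ?thesis using Suc.IH[of s] s True by (auto simp: pole_le_def)
    next
      case False
      define c where "c = pole_coeff (Suc n) s"
      define s' where "s' = s - cscale c (pole_basis (Suc n))"
      have s': "pole_le n s'"
      proof (rule pole_le_Suc)
        show "pole_le (Suc n) s'" using Suc.prems unfolding s'_def
          by (intro pole_le_diff pole_le_cscale pole_le_basis)
        show "pole_coeff (Suc n) s' = 0" using False
          by (simp add: s'_def c_def pole_coeff_diff pole_coeff_cscale pole_coeff_basis)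
      qed
      have "s = s' + cscale c (pole_basis (Suc n))" by (simp add: s'_def)
      hence e: "cmult h s r = cmult h s' r + cscale c (cmult h (pole_basis (Suc n)) r)"
        by (metis cmult_add_left cscale_cmult)
      have 1: "pole_le (n + m) (cmult h s' r)" using Suc.IH[OF s'] by simp
      have 2: "pole_le (Suc n + m) (cmult h (pole_basis (Suc n)) r)"
        "pole_coeff (Suc n + m) (cmult h (pole_basis (Suc n)) r) = pole_coeff m r"
        using basis_mult[OF assms(2), of "Suc n"] False by auto
      have "pole_coeff (Suc n + m) (cmult h s' r) = 0" using 1 by (simp add: pole_le_def)
      thus ?thesis unfolding e using 1 2 c_def
        by (auto simp: pole_coeff_add pole_coeff_cscale intro!: pole_le_add pole_le_cscale intro: pole_le_mono)
    qed
  qed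
  thus "pole_le (n + m) (cmult h s r)" "pole_coeff (n + m) (cmult h s r) = pole_coeff n s * pole_coeff m r"
    by auto
qed

lemma pole_monic_mult: "pole_monic n s \<Longrightarrow> pole_monic m r \<Longrightarrow> pole_monic (n + m) (cmult h s r)"
  by (simp add: pole_monic_def pole_mult)

lemma cmult_eq_0:
  assumes "cmult h s r = 0" "r \<noteq> 0"
  shows "s = 0"
proof (rule ccontr)
  assume "s \<noteq> 0"
  then obtain n where n: "pole_le n s" "pole_coeff n s \<noteq> 0" using pole_order_exists by blast
  obtain m where m: "pole_le m r" "pole_coeff m r \<noteq> 0" using assms(2) pole_order_exists by blast
  show False using pole_mult(2)[OF n(1) m(1)] assms(1) n m by simp
qed

lemma cmult_cancel: "cmult h s r = cmult h t r \<Longrightarrow> r \<noteq> 0 \<Longrightarrow> s = t"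
  using cmult_eq_0[of "s - t" r] by (simp add: cmult_diff_left)

text \<open>The orders 0, 2, 3, ... of the ring act on the pole orders of an ideal. The least one,
  m, therefore determines all of them except for the membership of m + 1.\<close>

lemma pole_orders_add:
  assumes J: "curve_ideal h J" "m \<in> pole_orders J" "n \<noteq> 1"
  shows "m + n \<in> pole_orders J"
proof -
  obtain r where r: "r \<in> J" "pole_monic m r" using J by (auto simp: pole_orders_def)
  have "pole_monic (n + m) (cmult h (pole_basis n) r)"
    using r pole_monic_basis[OF J(3)] by (intro pole_monic_mult) auto
  thus ?thesis using curve_ideal_mult[OF J(1) r(1)] unfolding pole_orders_def add.commute[of m] by blast
qed

end

section \<open>Counting ideals\<close>

definition ceval :: "'a::field curve_ring \<Rightarrow> 'a \<Rightarrow> 'a \<Rightarrow> 'a" where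
  "ceval r x y = poly (fst r) x + poly (snd r) x * y"

definition curve_points :: "'a::field poly \<Rightarrow> ('a \<times> 'a) set" where
  "curve_points h = {(x, y). y ^ 2 = poly h x}"

lemma ceval_add: "ceval (r + s) x y = ceval r x y + ceval s x y"
  and ceval_zero [simp]: "ceval 0 x y = 0"
  by (simp_all add: ceval_def algebra_simps)

lemma ceval_cmult: "(x, y) \<in> curve_points h \<Longrightarrow> ceval (cmult h r s) x y = ceval r x y * ceval s x y"
  by (simp add: ceval_def cmult_def curve_points_def algebra_simps power2_eq_square)

section \<open>Principal ideals and ideals residual to a point\<close>

context cubic begin

definition principal_ideal :: "'a curve_ring \<Rightarrow> 'a curve_ring set" where
  "principal_ideal r = range (\<lambda>s. cmult h s r)"

lemma principal_curve_ideal: "curve_ideal h (principal_ideal r)"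
  unfolding curve_ideal_def principal_ideal_def
proof (intro conjI ballI allI)
  show "0 \<in> range (\<lambda>s. cmult h s r)" by (rule image_eqI[of _ _ 0]) auto
  fix u v assume "u \<in> range (\<lambda>s. cmult h s r)" "v \<in> range (\<lambda>s. cmult h s r)"
  then obtain s t where "u = cmult h s r" "v = cmult h t r" by blast
  thus "u + v \<in> range (\<lambda>s. cmult h s r)" by (intro image_eqI[of _ _ "s + t"]) (auto simp: cmult_add_left)
next
  fix u w assume "u \<in> range (\<lambda>s. cmult h s r)"
  then obtain s where "u = cmult h s r" by blast
  thus "cmult h w u \<in> range (\<lambda>s. cmult h s r)"
    by (intro image_eqI[of _ _ "cmult h w s"]) (auto simp: cmult_assoc)
qed

lemma pole_orders_principal:
  assumes "pole_monic m r"
  shows "pole_orders (principal_ideal r) = {m + n |n. n \<noteq> 1}"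
proof
  have r: "r \<in> principal_ideal r" unfolding principal_ideal_def by (rule image_eqI[of _ _ "(1, 0)"]) auto
  hence "m \<in> pole_orders (principal_ideal r)" using assms by (auto simp: pole_orders_def)
  thus "{m + n |n. n \<noteq> 1} \<subseteq> pole_orders (principal_ideal r)"
    using pole_orders_add[OF principal_curve_ideal] by blast
  show "pole_orders (principal_ideal r) \<subseteq> {m + n |n. n \<noteq> 1}"
  proof
    fix k assume "k \<in> pole_orders (principal_ideal r)"
    then obtain s where s: "pole_monic k (cmult h s r)" by (auto simp: pole_orders_def principal_ideal_def)
    have "s \<noteq> 0" using s by (auto simp: pole_monic_def)
    then obtain n where n: "pole_le n s" "pole_coeff n s \<noteq> 0" using pole_order_exists by blast
    have "pole_le (n + m) (cmult h s r)" "pole_coeff (n + m) (cmult h s r) \<noteq> 0"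
      using n assms pole_mult[OF n(1), of m r] by (auto simp: pole_monic_def)
    hence "k = n + m" using s pole_order_unique[of k "cmult h s r" "n + m"] by (auto simp: pole_monic_def)
    moreover have "n \<noteq> 1" using n(2) by auto
    ultimately show "k \<in> {m + n |n. n \<noteq> 1}" by (auto simp: add.commute)
  qed
qed

text \<open>The difference of two such elements has an order below the minimum, or is 0. This yields
  the canonical generators by which ideals are counted.\<close>

lemma pole_monic_least_unique:
  assumes J: "curve_ideal h J" and r: "r \<in> J" "pole_monic m r" and s: "s \<in> J" "pole_monic m s"
    and least: "\<And>k. k \<in> pole_orders J \<Longrightarrow> m \<le> k"
  shows "r = s"
proof (rule ccontr)
  assume "r \<noteq> s"
  hence "r - s \<noteq> 0" by simp
  then obtain k where k: "pole_le k (r - s)" "pole_coeff k (r - s) \<noteq> 0" using pole_order_exists by blast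
  have "k \<in> pole_orders J" using k pole_orders_eq[OF J] curve_ideal_diff[OF J] r s by blast
  hence "m \<le> k" by (rule least)
  moreover have "pole_coeff m (r - s) = 0" using r s by (simp add: pole_monic_def pole_coeff_diff)
  moreover have "pole_coeff k (r - s) = 0" if "k > m"
    using r s that by (simp add: pole_monic_def pole_le_def pole_coeff_diff)
  ultimately show False using k by (cases "k = m") auto
qed

lemma mult_linear: "cmult h ([:- x0, 1:], 0) r = ([:- x0, 1:] * fst r, [:- x0, 1:] * snd r)"
  by (simp add: cmult_def)

lemma pole_monic_linear: "pole_monic 2 ([:- x0, 1:], 0)"
proof -
  have "([:- x0, 1:], 0) = pole_basis 2 + cscale (- x0) (pole_basis 0)"
    by (auto simp: pole_basis_def cscale_def monom_Suc numeral_2_eq_2)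
  thus ?thesis by (auto simp: pole_monic_def pole_coeff_add pole_coeff_cscale pole_coeff_basis
        intro!: pole_le_add pole_le_cscale pole_le_basis pole_le_mono[OF pole_le_basis])
qed

lemma pole_monic_conj: "pole_monic 3 ([:y0:], 1)"
proof -
  have "([:y0:], 1) = pole_basis 3 + cscale y0 (pole_basis 0)"
    by (auto simp: pole_basis_def cscale_def)
  thus ?thesis by (auto simp: pole_monic_def pole_coeff_add pole_coeff_cscale pole_coeff_basis
        intro!: pole_le_add pole_le_cscale pole_le_basis pole_le_mono[OF pole_le_basis])
qed

(* The quotient of (r) by the prime ideal of the point (x0, y0), at which r vanishes: since
   (x - x0) is the product of the primes of (x0, y0) and (x0, - y0), it consists of the s r / (x - x0)
   with s vanishing at (x0, - y0). *)
definition residual_ideal :: "'a \<Rightarrow> 'a \<Rightarrow> 'a curve_ring \<Rightarrow> 'a curve_ring set" where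
  "residual_ideal x0 y0 r = {w. \<exists>s. cmult h ([:- x0, 1:], 0) w = cmult h s r \<and> ceval s x0 (- y0) = 0}"

context
  fixes x0 y0 :: 'a and r :: "'a curve_ring" and m :: nat
  assumes P: "(x0, y0) \<in> curve_points h" and r: "pole_monic m r" and rP: "ceval r x0 y0 = 0"
begin

lemma P': "(x0, - y0) \<in> curve_points h" using P by (simp add: curve_points_def)

lemma residual_curve_ideal: "curve_ideal h (residual_ideal x0 y0 r)"
  unfolding curve_ideal_def
proof (intro conjI ballI allI)
  show "0 \<in> residual_ideal x0 y0 r" unfolding residual_ideal_def
    by (intro CollectI exI[of _ 0]) simp
  fix u v assume "u \<in> residual_ideal x0 y0 r" "v \<in> residual_ideal x0 y0 r"
  then obtain s t where "cmult h ([:- x0, 1:], 0) u = cmult h s r" "ceval s x0 (- y0) = 0"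
    "cmult h ([:- x0, 1:], 0) v = cmult h t r" "ceval t x0 (- y0) = 0"
    unfolding residual_ideal_def by blast
  thus "u + v \<in> residual_ideal x0 y0 r" unfolding residual_ideal_def
    by (intro CollectI exI[of _ "s + t"]) (simp add: cmult_add_left cmult_add_right ceval_add)
next
  fix u w assume "u \<in> residual_ideal x0 y0 r"
  then obtain s where s: "cmult h ([:- x0, 1:], 0) u = cmult h s r" "ceval s x0 (- y0) = 0"
    unfolding residual_ideal_def by blast
  have "cmult h ([:- x0, 1:], 0) (cmult h w u) = cmult h w (cmult h ([:- x0, 1:], 0) u)"
    by (metis cmult_assoc cmult_commute)
  thus "cmult h w u \<in> residual_ideal x0 y0 r" unfolding residual_ideal_def
    using s P' by (intro CollectI exI[of _ "cmult h w s"]) (simp add: cmult_assoc ceval_cmult)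
qed

lemma residual_generator: "r \<in> residual_ideal x0 y0 r"
  unfolding residual_ideal_def by (intro CollectI exI[of _ "([:- x0, 1:], 0)"]) (simp add: ceval_def)

text \<open>The components of (y + y0) r take at x0 the values y0 and 1 times the value of r at (x0,
  y0), which is 0; so x - x0 divides both.\<close>

lemma residual_quotient: "\<exists>w. cmult h ([:- x0, 1:], 0) w = cmult h ([:y0:], 1) r"
proof -
  have 0: "poly (fst r) x0 + poly (snd r) x0 * y0 = 0" using rP by (simp add: ceval_def)
  have "poly (fst (cmult h ([:y0:], 1) r)) x0 = y0 * (poly (fst r) x0 + poly (snd r) x0 * y0)"
    using P by (simp add: cmult_def curve_points_def power2_eq_square algebra_simps)
  hence "[:- x0, 1:] dvd fst (cmult h ([:y0:], 1) r)" using 0 by (simp add: poly_eq_0_iff_dvd)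
  then obtain u where u: "fst (cmult h ([:y0:], 1) r) = [:- x0, 1:] * u" by (elim dvdE)
  have "poly (snd (cmult h ([:y0:], 1) r)) x0 = poly (fst r) x0 + poly (snd r) x0 * y0"
    by (simp add: cmult_def algebra_simps)
  hence "[:- x0, 1:] dvd snd (cmult h ([:y0:], 1) r)" using 0 by (simp add: poly_eq_0_iff_dvd)
  then obtain v where v: "snd (cmult h ([:y0:], 1) r) = [:- x0, 1:] * v" by (elim dvdE)
  show ?thesis by (rule exI[of _ "(u, v)"], rule prod_eqI) (simp_all only: mult_linear u v fst_conv snd_conv)
qed

text \<open>r has order m, and (y + y0) r / (x - x0) has order 3 + m - 2 = m + 1. Nothing lies below
  m: a nonzero s vanishing at a point is not constant, so it has order at least 2, and s r / (x -
  x0) has order at least m.\<close>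

lemma pole_orders_residual: "pole_orders (residual_ideal x0 y0 r) = {m..}"
proof
  show "pole_orders (residual_ideal x0 y0 r) \<subseteq> {m..}"
  proof
    fix k assume "k \<in> pole_orders (residual_ideal x0 y0 r)"
    then obtain w s where w: "pole_monic k w" "cmult h ([:- x0, 1:], 0) w = cmult h s r" "ceval s x0 (- y0) = 0"
      by (auto simp: pole_orders_def residual_ideal_def)
    have kk: "pole_monic (2 + k) (cmult h s r)" using pole_monic_mult[OF pole_monic_linear[of x0] w(1)] w(2) by simp
    hence "s \<noteq> 0" by (auto simp: pole_monic_def)
    then obtain n where n: "pole_le n s" "pole_coeff n s \<noteq> 0" using pole_order_exists by blast
    have "pole_le (n + m) (cmult h s r)" "pole_coeff (n + m) (cmult h s r) \<noteq> 0"
      using n r pole_mult[OF n(1), of m r] by (auto simp: pole_monic_def)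
    hence "2 + k = n + m" using kk pole_order_unique[of "2 + k" "cmult h s r" "n + m"] by (auto simp: pole_monic_def)
    moreover have "n \<noteq> 0"
    proof
      assume "n = 0"
      then obtain c where "s = ([:c:], 0)" using n pole_le_0 by blast
      thus False using w(3) \<open>s \<noteq> 0\<close> by (auto simp: ceval_def zero_prod_def)
    qed
    moreover have "n \<noteq> 1" using n(2) by auto
    ultimately show "k \<in> {m..}" by auto
  qed
  have 1: "m \<in> pole_orders (residual_ideal x0 y0 r)"
    using residual_generator r by (auto simp: pole_orders_def)
  obtain w where w: "cmult h ([:- x0, 1:], 0) w = cmult h ([:y0:], 1) r" using residual_quotient by blast
  have wJ: "w \<in> residual_ideal x0 y0 r" unfolding residual_ideal_def using w
    by (intro CollectI exI[of _ "([:y0:], 1)"]) (simp add: ceval_def)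
  have mon: "pole_monic (3 + m) (cmult h ([:- x0, 1:], 0) w)"
    using pole_monic_mult[OF pole_monic_conj r] w by simp
  hence "w \<noteq> 0" by (auto simp: pole_monic_def)
  then obtain n where n: "pole_le n w" "pole_coeff n w \<noteq> 0" using pole_order_exists by blast
  have l: "pole_le 2 ([:- x0, 1:], 0)" "pole_coeff 2 ([:- x0, 1:], 0) = 1"
    using pole_monic_linear by (auto simp: pole_monic_def)
  have "2 + n = 3 + m"
    using pole_mult[OF l(1) n(1)] l(2) n(2) mon
    by (intro pole_order_unique[of _ "cmult h ([:- x0, 1:], 0) w"]) (auto simp: pole_monic_def)
  hence "n = Suc m" by simp
  hence 2: "Suc m \<in> pole_orders (residual_ideal x0 y0 r)"
    using n wJ pole_orders_eq[OF residual_curve_ideal] by blast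
  show "{m..} \<subseteq> pole_orders (residual_ideal x0 y0 r)"
  proof
    fix k assume "k \<in> {m..}"
    then obtain d where d: "k = m + d" using le_Suc_ex by auto
    show "k \<in> pole_orders (residual_ideal x0 y0 r)"
    proof (cases "d = 1")
      case False
      thus ?thesis using pole_orders_add[OF residual_curve_ideal 1] d by blast
    qed (use 2 d in simp)
  qed
qed

end

text \<open>r is recovered as the monic element of least order, and the point from the element (y +
  y0) r / (x - x0).\<close>

lemma residual_ideal_inj:
  assumes P: "(x0, y0) \<in> curve_points h" and r: "pole_monic m r" and rP: "ceval r x0 y0 = 0"
    and Q: "(x1, y1) \<in> curve_points h" and r': "pole_monic m r'" and rQ: "ceval r' x1 y1 = 0"
    and eq: "residual_ideal x0 y0 r = residual_ideal x1 y1 r'"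
  shows "x0 = x1 \<and> y0 = y1 \<and> r = r'"
proof -
  let ?J = "residual_ideal x0 y0 r"
  have rr: "r = r'"
  proof (rule pole_monic_least_unique[OF residual_curve_ideal[OF P r rP]])
    show "r \<in> ?J" by (rule residual_generator[OF P r rP])
    show "r' \<in> ?J" unfolding eq by (rule residual_generator[OF Q r' rQ])
    show "m \<le> k" if "k \<in> pole_orders ?J" for k using that pole_orders_residual[OF P r rP] by simp
  qed (use r r' in auto)
  have r0: "r \<noteq> 0" using r by (auto simp: pole_monic_def)
  obtain w where w: "cmult h ([:- x0, 1:], 0) w = cmult h ([:y0:], 1) r" using residual_quotient[OF P r rP] by blast
  have "w \<in> ?J" unfolding residual_ideal_def using w
    by (intro CollectI exI[of _ "([:y0:], 1)"]) (simp add: ceval_def)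
  hence "w \<in> residual_ideal x1 y1 r" using eq rr by simp
  then obtain s where s: "cmult h ([:- x1, 1:], 0) w = cmult h s r" "ceval s x1 (- y1) = 0"
    unfolding residual_ideal_def by blast
  \<comment> \<open>As w = (y + y0) r / (x - x0) lies in the second ideal too, cancelling r leaves
    (x - x1) (y + y0) = (x - x0) s. Comparing components gives x0 = x1 and s = y + y0, and s
    vanishes at (x1, - y1).\<close>
  have "cmult h (cmult h ([:- x1, 1:], 0) ([:y0:], 1)) r = cmult h ([:- x1, 1:], 0) (cmult h ([:- x0, 1:], 0) w)"
    by (simp add: w cmult_assoc)
  also have "\<dots> = cmult h ([:- x0, 1:], 0) (cmult h ([:- x1, 1:], 0) w)" by (metis cmult_assoc cmult_commute)
  also have "\<dots> = cmult h (cmult h ([:- x0, 1:], 0) s) r" by (simp add: s cmult_assoc)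
  finally have e: "cmult h ([:- x1, 1:], 0) ([:y0:], 1) = cmult h ([:- x0, 1:], 0) s"
    using r0 by (rule cmult_cancel)
  have e2: "[:- x1, 1:] = [:- x0, 1:] * snd s" "[:- x1, 1:] * [:y0:] = [:- x0, 1:] * fst s"
    using e unfolding mult_linear prod.inject fst_conv snd_conv mult_1_right by blast+
  have "poly [:- x1, 1:] x0 = 0" unfolding e2(1) by simp
  hence x: "x0 = x1" by simp
  have nz: "[:- x0, 1:] \<noteq> 0" by simp
  have "[:- x0, 1:] * snd s = [:- x0, 1:] * 1" "[:- x0, 1:] * fst s = [:- x0, 1:] * [:y0:]"
    using e2 x by (metis mult_1_right)+
  hence "snd s = 1" "fst s = [:y0:]" using nz mult_left_cancel by blast+
  thus ?thesis using s(2) x rr by (simp add: ceval_def)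
qed

text \<open>On a one-dimensional module x and y act by scalars x0 and y0: this is the wanted point,
  found from the action on J / (r). That it lies on the curve and that r vanishes there is read off
  from (x - x0) u = s r, where s turns out to have the form y + f(x).\<close>

lemma pole_orders_tail_residual:
  assumes J: "curve_ideal h J" and O: "pole_orders J = {m..}" and m: "m \<ge> 2"
  shows "\<exists>x0 y0 r. (x0, y0) \<in> curve_points h \<and> pole_monic m r \<and> ceval r x0 y0 = 0 \<and> J = residual_ideal x0 y0 r"
proof -
  have "m \<in> pole_orders J" using O by simp
  then obtain r where r: "r \<in> J" "pole_monic m r" unfolding pole_orders_def by blast
  have "Suc m \<in> pole_orders J" using O by simp
  then obtain u where u: "u \<in> J" "pole_monic (Suc m) u" unfolding pole_orders_def by blast
  have r0: "r \<noteq> 0" using r by (auto simp: pole_monic_def)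
  define K where "K = principal_ideal r"
  have K: "curve_ideal h K" unfolding K_def by (rule principal_curve_ideal)
  have OK: "pole_orders K = {m + n |n. n \<noteq> 1}" unfolding K_def by (rule pole_orders_principal[OF r(2)])
  have KJ: "K \<subseteq> J" unfolding K_def principal_ideal_def using curve_ideal_mult[OF J r(1)] by auto
  (* J/(r) is one-dimensional, spanned by u. *)
  have span: "\<exists>c s. w = cmult h s r + cscale c u" if w: "w \<in> J" for w
  proof -
    obtain s where s: "s \<in> pole_support (gaps K)" "w - s \<in> K" using pole_reduce[OF K] by blast
    have sJ: "s \<in> J" using curve_ideal_diff[OF J w, of "w - s"] s KJ by auto
    obtain t where t: "w - s = cmult h t r" using s(2) by (auto simp: K_def principal_ideal_def)
    obtain t' where t': "t' \<in> pole_support (gaps K)" "s - cscale (pole_coeff (Suc m) s) u - t' \<in> K"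
      using pole_reduce[OF K] by blast
    have low: "pole_le (Suc m) s" unfolding pole_le_def
    proof (intro allI impI)
      fix n assume n: "n > Suc m"
      have "m + (n - m) \<in> pole_orders K" unfolding OK using n by (intro CollectI exI[of _ "n - m"]) auto
      hence "n \<notin> gaps K" using n by (simp add: gaps_def)
      thus "pole_coeff n s = 0" using s(1) by (auto simp: pole_support_def)
    qed
    have "m \<in> pole_orders K" unfolding OK by (intro CollectI exI[of _ 0]) auto
    hence sm: "pole_coeff m s = 0" using s(1) by (auto simp: pole_support_def gaps_def)
    \<comment> \<open>The orders m + 1 and m are removed from s by multiples of u and r; the second
      multiple compensates the coefficient that u has at order m.\<close>
    define z where "z = s - cscale (pole_coeff (Suc m) s) u - cscale (- pole_coeff (Suc m) s * pole_coeff m u) r"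
    have zJ: "z \<in> J" unfolding z_def using sJ u r J by (intro curve_ideal_diff[OF J] curve_ideal_cscale[OF J])
    have "z = 0"
    proof (rule ccontr)
      assume "z \<noteq> 0"
      then obtain k where k: "pole_le k z" "pole_coeff k z \<noteq> 0" using pole_order_exists by blast
      have "k \<in> pole_orders J" using pole_orders_eq[OF J] zJ k by blast
      hence "k \<ge> m" using O by simp
      moreover have "pole_coeff m z = 0" using sm r by (simp add: z_def pole_coeff_diff pole_coeff_cscale pole_monic_def)
      moreover have "pole_coeff (Suc m) z = 0" using u r
        by (simp add: z_def pole_coeff_diff pole_coeff_cscale pole_monic_def pole_le_def)
      moreover have "pole_coeff n z = 0" if "n > Suc m" for n using u r low that
        by (simp add: z_def pole_coeff_diff pole_coeff_cscale pole_monic_def pole_le_def)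
      ultimately show False using k(2) by (metis le_neq_implies_less Suc_lessI)
    qed
    hence "s = cscale (pole_coeff (Suc m) s) u + cscale (- pole_coeff (Suc m) s * pole_coeff m u) r"
      unfolding z_def by (simp add: algebra_simps)
    hence "w = cmult h t r + (cscale (pole_coeff (Suc m) s) u + cscale (- pole_coeff (Suc m) s * pole_coeff m u) r)"
      using t by (metis diff_add_cancel)
    also have "cscale (- pole_coeff (Suc m) s * pole_coeff m u) r = cmult h ([:- pole_coeff (Suc m) s * pole_coeff m u:], 0) r"
      by (rule cscale_eq_cmult)
    finally have "w = cmult h (t + ([:- pole_coeff (Suc m) s * pole_coeff m u:], 0)) r + cscale (pole_coeff (Suc m) s) u"
      by (simp only: cmult_add_left add_ac)
    thus ?thesis by blast
  qed
  obtain x0 s where x0: "cmult h ([:0, 1:], 0) u = cmult h s r + cscale x0 u"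
    using span[OF curve_ideal_mult[OF J u(1)]] by blast
  obtain y0 t where y0: "cmult h (0, 1) u = cmult h t r + cscale y0 u"
    using span[OF curve_ideal_mult[OF J u(1)]] by blast
  have s: "cmult h ([:- x0, 1:], 0) u = cmult h s r"
  proof -
    have "([:- x0, 1:], 0) = ([:0, 1:], 0) - ([:x0:], 0 :: 'a poly)" by simp
    thus ?thesis using x0 by (simp only: cmult_diff_left flip: cscale_eq_cmult) simp
  qed
  have t: "cmult h ([:- y0:], 1) u = cmult h t r"
  proof -
    have "([:- y0:], 1) = (0, 1) - ([:y0:], 0 :: 'a poly)" by simp
    thus ?thesis using y0 by (simp only: cmult_diff_left flip: cscale_eq_cmult) simp
  qed
  \<comment> \<open>Elimination of u and r from (x - x0) u = s r and (y - y0) u = t r.\<close>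
  have "cmult h (cmult h ([:- y0:], 1) s) r = cmult h ([:- y0:], 1) (cmult h ([:- x0, 1:], 0) u)"
    by (simp add: s cmult_assoc)
  also have "\<dots> = cmult h ([:- x0, 1:], 0) (cmult h ([:- y0:], 1) u)" by (metis cmult_assoc cmult_commute)
  also have "\<dots> = cmult h (cmult h ([:- x0, 1:], 0) t) r" by (simp add: t cmult_assoc)
  finally have e: "cmult h ([:- y0:], 1) s = cmult h ([:- x0, 1:], 0) t" using r0 by (rule cmult_cancel)
  have e1: "h * snd s - smult y0 (fst s) = [:- x0, 1:] * fst t" and e2: "fst s - smult y0 (snd s) = [:- x0, 1:] * snd t"
    using e by (simp_all add: mult_linear) (simp_all add: cmult_def)
  have "poly (h * snd s - smult y0 (fst s)) x0 = 0" "poly (fst s - smult y0 (snd s)) x0 = 0"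
    unfolding e1 e2 by simp_all
  hence v: "poly h x0 * poly (snd s) x0 = y0 * poly (fst s) x0" "poly (fst s) x0 = y0 * poly (snd s) x0" by simp_all
  \<comment> \<open>Orders in (x - x0) u = s r: 2 + (m + 1) = 3 + m. A monic element of order 3 has
    y-component 1.\<close>
  have s3: "pole_monic 3 s"
  proof -
    have mon: "pole_monic (2 + Suc m) (cmult h s r)" using pole_monic_mult[OF pole_monic_linear[of x0] u(2)] s by simp
    hence "s \<noteq> 0" by (auto simp: pole_monic_def)
    then obtain n where n: "pole_le n s" "pole_coeff n s \<noteq> 0" using pole_order_exists by blast
    have mm: "pole_le (n + m) (cmult h s r)" "pole_coeff (n + m) (cmult h s r) = pole_coeff n s"
      using n r pole_mult[OF n(1), of m r] by (auto simp: pole_monic_def)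
    hence "n + m = 2 + Suc m" using mon n pole_order_unique[of "2 + Suc m" "cmult h s r" "n + m"]
      by (auto simp: pole_monic_def)
    hence "n = 3" by simp
    moreover have "pole_coeff n s = 1" using mm mon \<open>n + m = 2 + Suc m\<close> by (simp add: pole_monic_def)
    ultimately show ?thesis using n by (simp add: pole_monic_def)
  qed
  have snd_s: "snd s = 1"
  proof (rule poly_eqI)
    fix i show "poly.coeff (snd s) i = poly.coeff 1 i"
      using s3 pole_coeff_odd[of i s] by (cases i) (auto simp: pole_monic_def pole_le_def)
  qed
  have P: "(x0, y0) \<in> curve_points h" using v snd_s by (simp add: curve_points_def power2_eq_square)
  have sP: "ceval s x0 (- y0) = 0" using v snd_s by (simp add: ceval_def)
  have "poly (snd (cmult h s r)) x0 = 0" unfolding s[symmetric] mult_linear by simp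
  hence rP: "ceval r x0 y0 = 0" using snd_s v by (simp add: cmult_def ceval_def algebra_simps)
  have uR: "u \<in> residual_ideal x0 y0 r" using s sP unfolding residual_ideal_def by blast
  have sub: "J \<subseteq> residual_ideal x0 y0 r"
  proof
    fix w assume "w \<in> J"
    then obtain c t where "w = cmult h t r + cscale c u" using span by blast
    thus "w \<in> residual_ideal x0 y0 r"
      using residual_curve_ideal[OF P r(2) rP] residual_generator[OF P r(2) rP] uR
        curve_ideal_add curve_ideal_mult curve_ideal_cscale by metis
  qed
  have "J = residual_ideal x0 y0 r"
    using J residual_curve_ideal[OF P r(2) rP] sub
    by (rule curve_ideal_eqI) (simp add: O pole_orders_residual[OF P r(2) rP])
  thus ?thesis using P r rP by blast
qed

lemma tail_orders_iff:
  assumes "m \<ge> 2"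
  shows "{J. curve_ideal h J \<and> pole_orders J = {m..}} =
    (\<lambda>((x0, y0), r). residual_ideal x0 y0 r) `
      (SIGMA P : curve_points h. {r. pole_monic m r \<and> ceval r (fst P) (snd P) = 0})"
proof (intro equalityI subsetI)
  fix J assume "J \<in> {J. curve_ideal h J \<and> pole_orders J = {m..}}"
  then obtain x0 y0 r where *: "(x0, y0) \<in> curve_points h" "pole_monic m r" "ceval r x0 y0 = 0"
    "J = residual_ideal x0 y0 r" using pole_orders_tail_residual[of J m] assms by blast
  show "J \<in> (\<lambda>((x0, y0), r). residual_ideal x0 y0 r) `
      (SIGMA P : curve_points h. {r. pole_monic m r \<and> ceval r (fst P) (snd P) = 0})"
    by (rule image_eqI[of _ _ "((x0, y0), r)"]) (use * in simp_all)
next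
  fix J assume "J \<in> (\<lambda>((x0, y0), r). residual_ideal x0 y0 r) `
      (SIGMA P : curve_points h. {r. pole_monic m r \<and> ceval r (fst P) (snd P) = 0})"
  then obtain x0 y0 r where *: "(x0, y0) \<in> curve_points h" "pole_monic m r" "ceval r x0 y0 = 0"
    "J = residual_ideal x0 y0 r" by (elim imageE SigmaE) auto
  show "J \<in> {J. curve_ideal h J \<and> pole_orders J = {m..}}"
    unfolding *(4) using residual_curve_ideal[OF *(1-3)] pole_orders_residual[OF *(1-3)] by simp
qed

lemma principal_orders_iff:
  assumes "m \<noteq> 1"
  shows "{J. curve_ideal h J \<and> pole_orders J = {m + n |n. n \<noteq> 1}} = principal_ideal ` {r. pole_monic m r}"
proof (intro equalityI subsetI)
  fix J assume "J \<in> {J. curve_ideal h J \<and> pole_orders J = {m + n |n. n \<noteq> 1}}"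
  hence J: "curve_ideal h J" "pole_orders J = {m + n |n. n \<noteq> 1}" by auto
  have "m \<in> pole_orders J" unfolding J(2) by (intro CollectI exI[of _ 0]) auto
  then obtain r where r: "r \<in> J" "pole_monic m r" unfolding pole_orders_def by blast
  have "principal_ideal r \<subseteq> J" unfolding principal_ideal_def using curve_ideal_mult[OF J(1) r(1)] by auto
  hence "principal_ideal r = J"
    using principal_curve_ideal J(1) by (intro curve_ideal_eqI) (auto simp: J(2) pole_orders_principal[OF r(2)])
  thus "J \<in> principal_ideal ` {r. pole_monic m r}" using r by blast
next
  fix J assume "J \<in> principal_ideal ` {r. pole_monic m r}"
  thus "J \<in> {J. curve_ideal h J \<and> pole_orders J = {m + n |n. n \<noteq> 1}}"
    using principal_curve_ideal pole_orders_principal by auto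
qed

lemma principal_ideal_inj: "inj_on principal_ideal {r. pole_monic m r}"
proof (rule inj_onI)
  fix r s assume r: "r \<in> {r. pole_monic m r}" and s: "s \<in> {r. pole_monic m r}"
    and eq: "principal_ideal r = principal_ideal s"
  have mem: "u \<in> principal_ideal u" for u
    unfolding principal_ideal_def by (rule image_eqI[of _ _ "(1, 0)"]) auto
  show "r = s"
  proof (rule pole_monic_least_unique[OF principal_curve_ideal mem])
    show "s \<in> principal_ideal r" using mem[of s] eq by simp
    show "m \<le> k" if "k \<in> pole_orders (principal_ideal r)" for k
      using that pole_orders_principal r by auto
  qed (use r s in auto)
qed

text \<open>Let m be the least pole order. If m + 1 is missing and m > 0, the gaps are m + 1 and the
  numbers below m other than 1, in total m; if m + 1 occurs, they are one fewer. For m = 0 only the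
  first case is possible, as 1 is never a pole order.\<close>

lemma ideal_orders_cases:
  assumes J: "curve_ideal h J" and fin: "finite (gaps J)"
  obtains (principal) m where "m \<noteq> 1" "pole_orders J = {m + n |n. n \<noteq> 1}" "card (gaps J) = m"
  | (tail) m where "m \<ge> 2" "pole_orders J = {m..}" "card (gaps J) = m - 1"
proof -
  have "pole_orders J \<noteq> {}"
  proof
    assume "pole_orders J = {}"
    hence "gaps J = - {1}" by (simp add: gaps_def)
    thus False using fin by (simp add: Compl_eq_Diff_UNIV)
  qed
  define m where "m = (LEAST m. m \<in> pole_orders J)"
  have m: "m \<in> pole_orders J" unfolding m_def using \<open>pole_orders J \<noteq> {}\<close> by (metis LeastI all_not_in_conv)
  have least: "m \<le> k" if "k \<in> pole_orders J" for k unfolding m_def using that by (rule Least_le)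
  have m1: "m \<noteq> 1" using m one_not_pole_order by metis
  have up: "m + n \<in> pole_orders J" if "n \<noteq> 1" for n using pole_orders_add[OF J m that] .
  have c: "card ({..<m} - {1}) = (if m = 0 then 0 else m - 1)" using m1 by auto
  show thesis
  proof (cases "Suc m \<in> pole_orders J")
    case True
    have O: "pole_orders J = {m..}"
    proof (intro equalityI subsetI)
      fix k assume "k \<in> {m..}"
      then obtain d where "k = m + d" using le_Suc_ex by auto
      thus "k \<in> pole_orders J" using up[of d] True by (cases "d = 1") auto
    qed (use least in auto)
    have "m \<noteq> 0" using True one_not_pole_order by (metis One_nat_def)
    moreover have "gaps J = {..<m} - {1}" unfolding gaps_def O by auto
    ultimately show thesis using tail[of m] m1 O c by auto
  next
    case False
    have O: "pole_orders J = {m + n |n. n \<noteq> 1}"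
    proof (intro equalityI subsetI)
      fix k assume k: "k \<in> pole_orders J"
      then obtain d where "k = m + d" using le_Suc_ex least by metis
      thus "k \<in> {m + n |n. n \<noteq> 1}" using False k by auto
    qed (use up in auto)
    show thesis
    proof (cases "m = 0")
      case True
      have "gaps J = {}" unfolding gaps_def O using True by auto
      thus thesis using principal[of m] m1 O True by auto
    next
      case m0: False
      have "gaps J = insert (Suc m) ({..<m} - {1})"
      proof (intro equalityI subsetI)
        fix k assume k: "k \<in> gaps J"
        show "k \<in> insert (Suc m) ({..<m} - {1})"
        proof (cases "k < m")
          case False
          then obtain d where "k = m + d" using le_Suc_ex by (metis not_less)
          thus ?thesis using k unfolding gaps_def O by auto
        qed (use k in \<open>auto simp: gaps_def\<close>)
      next
        fix k assume "k \<in> insert (Suc m) ({..<m} - {1})"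
        thus "k \<in> gaps J" using m0 unfolding gaps_def O by auto
      qed
      hence "card (gaps J) = Suc (card ({..<m} - {1}))" by simp
      thus thesis using principal[of m] m1 O c m0 by auto
    qed
  qed
qed

lemma gaps_principal:
  assumes "m \<noteq> 1" "pole_orders J = {m + n |n. n \<noteq> 1}"
  shows "finite (gaps J)"
proof (rule finite_subset)
  show "gaps J \<subseteq> {..Suc m}"
  proof
    fix k assume k: "k \<in> gaps J"
    show "k \<in> {..Suc m}"
    proof (rule ccontr)
      assume "k \<notin> {..Suc m}"
      hence "k = m + (k - m)" "k - m \<noteq> 1" by auto
      thus False using k assms by (auto simp: gaps_def)
    qed
  qed
qed simp

lemma gaps_tail:
  assumes "pole_orders J = {m..}"
  shows "finite (gaps J)"
  by (rule finite_subset[of _ "{..<m}"]) (auto simp: gaps_def assms)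

text \<open>The exceptions are codimension 1, with no principal ideal because no element has order
  1, and codimension 0, where the whole ring is the only ideal.\<close>

lemma ideals_eq:
  "ideals h j = (if j = 1 then {} else {J. curve_ideal h J \<and> pole_orders J = {j + n |n. n \<noteq> 1}}) \<union>
    (if j = 0 then {} else {J. curve_ideal h J \<and> pole_orders J = {j + 1..}})"
proof (intro equalityI subsetI)
  fix J assume "J \<in> ideals h j"
  hence J: "curve_ideal h J" "finite (gaps J)" "card (gaps J) = j" by (auto simp: ideals_def)
  from J(1,2) show "J \<in> (if j = 1 then {} else {J. curve_ideal h J \<and> pole_orders J = {j + n |n. n \<noteq> 1}}) \<union>
    (if j = 0 then {} else {J. curve_ideal h J \<and> pole_orders J = {j + 1..}})"
  proof (cases rule: ideal_orders_cases)
    case (principal m)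
    thus ?thesis using J by simp
  next
    case (tail m)
    thus ?thesis using J by auto
  qed
next
  fix J assume J: "J \<in> (if j = 1 then {} else {J. curve_ideal h J \<and> pole_orders J = {j + n |n. n \<noteq> 1}}) \<union>
    (if j = 0 then {} else {J. curve_ideal h J \<and> pole_orders J = {j + 1..}})"
  then consider "j \<noteq> 1" "curve_ideal h J" "pole_orders J = {j + n |n. n \<noteq> 1}"
    | "j \<noteq> 0" "curve_ideal h J" "pole_orders J = {j + 1..}" by (auto split: if_splits)
  thus "J \<in> ideals h j"
  proof cases
    case 1
    have fin: "finite (gaps J)" using gaps_principal 1 by blast
    have j: "j \<in> pole_orders J" "Suc j \<notin> pole_orders J" unfolding 1(3)
      by (auto intro: exI[of _ 0])
    have least: "j \<le> k" if "k \<in> pole_orders J" for k using that 1(3) by auto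
    from 1(2) fin show ?thesis
    proof (cases rule: ideal_orders_cases)
      case (principal m)
      have "m \<in> pole_orders J" unfolding principal(2) by (auto intro: exI[of _ 0])
      hence "j \<le> m" by (rule least)
      moreover have "m \<le> j" using j(1) unfolding principal(2) by auto
      ultimately show ?thesis using 1 fin principal by (simp add: ideals_def)
    next
      case (tail m)
      thus ?thesis using j by auto
    qed
  next
    case 2
    have fin: "finite (gaps J)" using gaps_tail 2 by blast
    from 2(2) fin show ?thesis
    proof (cases rule: ideal_orders_cases)
      case (principal m)
      have "m \<in> pole_orders J" "Suc m \<notin> pole_orders J" unfolding principal(2) by (auto intro: exI[of _ 0])
      thus ?thesis using 2 by auto
    next
      case (tail m)
      hence "m = j + 1" using 2 by (metis atLeast_eq_iff)
      thus ?thesis using 2 fin tail by (simp add: ideals_def)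
    qed
  qed
qed

end

text \<open>Adding a constant changes the value at the point and keeps an element monic of order m,
  so every value is taken equally often.\<close>

lemma card_pole_monic_ceval:
  assumes "m \<ge> 2"
  shows "card {r :: 'a::{finite,field} curve_ring. pole_monic m r \<and> ceval r x0 y0 = 0} = CARD('a) ^ (m - 2)"
proof -
  let ?A = "{r :: 'a curve_ring. pole_monic m r \<and> ceval r x0 y0 = 0}"
  have mon: "pole_monic m (r + ([:c:], 0)) \<longleftrightarrow> pole_monic m r" for r :: "'a curve_ring" and c
  proof -
    have "([:c:], 0) = cscale c (pole_basis 0)" by (simp add: cscale_def pole_basis_def)
    thus ?thesis using assms by (auto simp: pole_monic_def pole_le_def pole_coeff_add pole_coeff_cscale pole_coeff_basis)
  qed
  have ev: "ceval (r + ([:c:], 0)) x0 y0 = ceval r x0 y0 + c" for r :: "'a curve_ring" and c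
    by (simp add: ceval_def algebra_simps)
  have "bij_betw (\<lambda>(r, c). r + ([:c:], 0)) (?A \<times> UNIV) {r :: 'a curve_ring. pole_monic m r}"
  proof (rule bij_betwI[where g = "\<lambda>r. (r + ([:- ceval r x0 y0:], 0), ceval r x0 y0)"])
    show "(\<lambda>(r, c). r + ([:c:], 0)) \<in> ?A \<times> UNIV \<rightarrow> {r. pole_monic m r}" using mon by auto
    show "(\<lambda>r. (r + ([:- ceval r x0 y0:], 0), ceval r x0 y0)) \<in> {r. pole_monic m r} \<rightarrow> ?A \<times> UNIV"
      using mon ev by auto
  qed (auto simp: ceval_def algebra_simps zero_prod_def)
  from bij_betw_same_card[OF this] have "card ?A * CARD('a) = CARD('a) ^ (m - 1)"
    using card_pole_monic[OF assms, where 'a = 'a] by (simp add: card_cartesian_product)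
  also have "\<dots> = CARD('a) ^ (m - 2) * CARD('a)"
    using assms by (simp add: Suc_diff_Suc numeral_2_eq_2 flip: power_Suc2)
  finally show ?thesis by simp
qed

text \<open>In codimension j \<ge> 2 principal ideals correspond to monic elements of order j, the
  others to a point together with a monic element of order j + 1 vanishing there. By the preceding
  counts both kinds contribute the power q ^ (j - 1), the second once for each point.\<close>

lemma card_ideals:
  fixes h :: "'a::{finite,field} poly"
  assumes "cubic h"
  shows "finite (ideals h j)" and "card (ideals h 0) = 1" and "card (ideals h 1) = card (curve_points h)"
    and "j \<ge> 2 \<Longrightarrow> card (ideals h j) = CARD('a) ^ (j - 1) + card (curve_points h) * CARD('a) ^ (j - 1)"
proof -
  interpret cubic h by fact
  let ?Pr = "\<lambda>j. {J. curve_ideal h J \<and> pole_orders J = {j + n |n. n \<noteq> 1}}"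
  let ?Ta = "\<lambda>j. {J. curve_ideal h J \<and> pole_orders J = {j + 1..}}"
  have fin0: "finite {r :: 'a curve_ring. pole_monic m r}" for m
  proof (cases "m \<ge> 2")
    case True
    thus ?thesis using card_pole_monic[OF True, where 'a = 'a] by (intro card_ge_0_finite) simp
  next
    case False
    have "{r :: 'a curve_ring. pole_monic m r} \<subseteq> (\<lambda>c. ([:c:], 0)) ` UNIV"
    proof
      fix r :: "'a curve_ring" assume "r \<in> {r. pole_monic m r}"
      hence "pole_le 0 r" using False pole_le_1[of r] pole_le_mono[of m r 1] by (simp add: pole_monic_def)
      thus "r \<in> (\<lambda>c. ([:c:], 0)) ` UNIV" using pole_le_0[of r] by auto
    qed
    thus ?thesis by (rule finite_subset) simp
  qed
  have finC: "finite (curve_points h)" by (rule finite_subset[of _ UNIV]) auto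
  have pr: "finite (?Pr j)" "card (?Pr j) = card {r :: 'a curve_ring. pole_monic j r}" if "j \<noteq> 1" for j
    unfolding principal_orders_iff[OF that] using fin0 principal_ideal_inj by (auto simp: card_image)
  have ta: "finite (?Ta j)" "card (?Ta j) = card (curve_points h) * CARD('a) ^ (j - 1)" if "j \<ge> 1" for j
  proof -
    let ?S = "SIGMA P : curve_points h. {r. pole_monic (j + 1) r \<and> ceval r (fst P) (snd P) = 0}"
    have m: "j + 1 \<ge> 2" using that by simp
    have finS: "finite ?S" using finC fin0 by (intro finite_SigmaI) (auto intro: finite_subset)
    have "inj_on (\<lambda>((x0, y0), r). residual_ideal x0 y0 r) ?S"
      using residual_ideal_inj by (auto intro!: inj_onI)
    hence "card (?Ta j) = card ?S" unfolding tail_orders_iff[OF m] by (rule card_image)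
    also have "\<dots> = (\<Sum>P\<in>curve_points h. card {r. pole_monic (j + 1) r \<and> ceval r (fst P) (snd P) = 0})"
      using finC fin0 by (intro card_SigmaI) (auto intro: finite_subset)
    also have "\<dots> = card (curve_points h) * CARD('a) ^ (j - 1)" using m by (simp add: card_pole_monic_ceval)
    finally show "card (?Ta j) = card (curve_points h) * CARD('a) ^ (j - 1)" .
    show "finite (?Ta j)" unfolding tail_orders_iff[OF m] using finS by simp
  qed
  show "finite (ideals h j)" 
  proof -
    have "finite (if j = 1 then {} else ?Pr j)"
    proof (cases "j = 1")
      case False
      thus ?thesis using pr(1)[OF False] by (simp only: if_False)
    qed simp
    moreover have "finite (if j = 0 then {} else ?Ta j)"
    proof (cases "j = 0")
      case False
      thus ?thesis using ta(1)[of j] by (simp only: if_False)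
    qed simp
    ultimately show ?thesis unfolding ideals_eq by (rule finite_UnI)
  qed
  have "{r :: 'a curve_ring. pole_monic 0 r} = {(1, 0)}"
    using pole_le_0 by (auto simp: pole_monic_def pole_coeff_def one_pCons)
  thus "card (ideals h 0) = 1" unfolding ideals_eq using pr(2)[of 0] by simp
  show "card (ideals h 1) = card (curve_points h)" unfolding ideals_eq using ta(2)[of 1] by simp
  assume j: "j \<ge> 2"
  have "?Pr j \<inter> ?Ta j = {}"
  proof -
    have "j \<in> {j + n |n. n \<noteq> 1}" "j \<notin> {j + 1..}" by (auto intro: exI[of _ 0])
    hence "{j + n |n. n \<noteq> 1} \<noteq> {j + 1..}" by metis
    thus ?thesis by blast
  qed
  hence "card (?Pr j \<union> ?Ta j) = card (?Pr j) + card (?Ta j)" using pr(1) ta(1) j by (intro card_Un_disjoint) auto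
  thus "card (ideals h j) = CARD('a) ^ (j - 1) + card (curve_points h) * CARD('a) ^ (j - 1)"
    unfolding ideals_eq using j pr(2)[of j] ta(2)[of j] card_pole_monic[OF j, where 'a = 'a] by simp
qed

section \<open>Matrix pairs as modules over the coordinate ring\<close>

lemma mat_eqI_vec:
  assumes "M \<in> carrier_mat n m" "N \<in> carrier_mat n m" "\<And>u. u \<in> carrier_vec m \<Longrightarrow> M *\<^sub>v u = N *\<^sub>v u"
  shows "M = (N :: 'a::field mat)"
proof (rule eq_matI)
  fix i j assume ij: "i < dim_row N" "j < dim_col N"
  have "(M *\<^sub>v unit_vec m j) $ i = (N *\<^sub>v unit_vec m j) $ i" using assms(3) by simp
  thus "M $$ (i, j) = N $$ (i, j)" using ij assms(1,2) by simp
qed (use assms in auto)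

lemma linear_map_matrix:
  fixes F :: "'a::field vec \<Rightarrow> 'a vec"
  assumes F: "\<And>u. u \<in> carrier_vec m \<Longrightarrow> F u \<in> carrier_vec n"
    and add: "\<And>u v. u \<in> carrier_vec m \<Longrightarrow> v \<in> carrier_vec m \<Longrightarrow> F (u + v) = F u + F v"
    and smult: "\<And>c u. u \<in> carrier_vec m \<Longrightarrow> F (c \<cdot>\<^sub>v u) = c \<cdot>\<^sub>v F u"
  shows "\<exists>M\<in>carrier_mat n m. \<forall>u\<in>carrier_vec m. M *\<^sub>v u = F u"
proof (intro bexI ballI)
  define M where "M = mat n m (\<lambda>(i, l). F (unit_vec m l) $ i)"
  show "M \<in> carrier_mat n m" by (simp add: M_def)
  fix u :: "'a vec" assume u: "u \<in> carrier_vec m"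
  \<comment> \<open>The truncation of u to its first k entries. By additivity, F of it is the
    partial sum of k terms of the matrix product.\<close>
  define cut where "cut k = vec m (\<lambda>l. if l < k then u $ l else 0)" for k
  have cut: "F (cut k) $ i = (\<Sum>l<k. F (unit_vec m l) $ i * u $ l)" if i: "i < n" and "k \<le> m" for i k
    using that(2)
  proof (induction k)
    case 0
    have "cut 0 = 0 \<cdot>\<^sub>v (0\<^sub>v m)" by (intro eq_vecI) (auto simp: cut_def)
    hence "F (cut 0) = 0 \<cdot>\<^sub>v F (0\<^sub>v m)" using smult by simp
    moreover have "F (0\<^sub>v m) \<in> carrier_vec n" using F by simp
    ultimately show ?case using i by simp
  next
    case (Suc k)
    have "cut (Suc k) = cut k + u $ k \<cdot>\<^sub>v unit_vec m k"
      using Suc.prems by (intro eq_vecI) (auto simp: cut_def less_Suc_eq)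
    hence "F (cut (Suc k)) = F (cut k) + u $ k \<cdot>\<^sub>v F (unit_vec m k)"
      using add[of "cut k" "u $ k \<cdot>\<^sub>v unit_vec m k"] smult by (simp add: cut_def)
    moreover have "F (cut k) \<in> carrier_vec n" "F (unit_vec m k) \<in> carrier_vec n" using F by (simp_all add: cut_def)
    ultimately show ?case using i Suc by simp
  qed
  have "cut m = u" using u by (intro eq_vecI) (auto simp: cut_def)
  show "M *\<^sub>v u = F u"
  proof (rule eq_vecI)
    fix i assume "i < dim_vec (F u)"
    hence i: "i < n" using F[OF u] by simp
    have "(M *\<^sub>v u) $ i = (\<Sum>l<m. F (unit_vec m l) $ i * u $ l)"
      using i u by (simp add: M_def scalar_prod_def atLeast0LessThan)
    thus "(M *\<^sub>v u) $ i = F u $ i" using cut[OF i order.refl] \<open>cut m = u\<close> by simp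
  qed (use F[OF u] in \<open>simp add: M_def\<close>)
qed

text \<open>The vector f(A) v, computed by Horner's scheme.\<close>

definition poly_vec :: "'a::field mat \<Rightarrow> 'a poly \<Rightarrow> 'a vec \<Rightarrow> 'a vec" where
  "poly_vec A f v = fold_coeffs (\<lambda>c w. c \<cdot>\<^sub>v v + A *\<^sub>v w) f (0\<^sub>v (dim_vec v))"

text \<open>The module structure that a pair defines: f + g y acts as f(A) + g(A) B.\<close>

definition curve_act :: "'a::field mat \<Rightarrow> 'a mat \<Rightarrow> 'a curve_ring \<Rightarrow> 'a vec \<Rightarrow> 'a vec" where
  "curve_act A B r v = poly_vec A (fst r) v + poly_vec A (snd r) (B *\<^sub>v v)"

context
  fixes n :: nat and A :: "'a::field mat"
  assumes A: "A \<in> carrier_mat n n"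
begin

lemma poly_vec_0 [simp]: "v \<in> carrier_vec n \<Longrightarrow> poly_vec A 0 v = 0\<^sub>v n"
  by (simp add: poly_vec_def)

lemma mult_mat_zero_vec: "M \<in> carrier_mat m n \<Longrightarrow> M *\<^sub>v 0\<^sub>v n = 0\<^sub>v m"
  by (intro eq_vecI) auto

lemma poly_vec_pCons:
  assumes v: "v \<in> carrier_vec n"
  shows "poly_vec A (pCons c f) v = c \<cdot>\<^sub>v v + A *\<^sub>v poly_vec A f v"
proof (cases "c = 0 \<and> f = 0")
  case True
  have "0 \<cdot>\<^sub>v v = 0\<^sub>v n" using v by (intro eq_vecI) auto
  thus ?thesis using True v mult_mat_zero_vec[OF A] by simp
next
  case False
  thus ?thesis unfolding poly_vec_def by (cases "c = 0") simp_all
qed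

lemma poly_vec_carrier [simp]: "v \<in> carrier_vec n \<Longrightarrow> poly_vec A f v \<in> carrier_vec n"
  by (induction f rule: pCons_induct) (use A in \<open>auto simp: poly_vec_pCons\<close>)

lemma poly_vec_smult:
  assumes v: "v \<in> carrier_vec n"
  shows "poly_vec A (Polynomial.smult c f) v = c \<cdot>\<^sub>v poly_vec A f v"
proof (induction f rule: pCons_induct)
  case 0
  show ?case using v by (intro eq_vecI) auto
next
  case (pCons d f)
  have "poly_vec A (Polynomial.smult c (pCons d f)) v = (c * d) \<cdot>\<^sub>v v + A *\<^sub>v (c \<cdot>\<^sub>v poly_vec A f v)"
    using pCons v by (simp add: poly_vec_pCons)
  also have "A *\<^sub>v (c \<cdot>\<^sub>v poly_vec A f v) = c \<cdot>\<^sub>v (A *\<^sub>v poly_vec A f v)"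
    using A v by (intro mult_mat_vec) auto
  finally show ?case using A v by (simp add: poly_vec_pCons smult_add_distrib_vec[of _ n] smult_smult_assoc)
qed

lemma poly_vec_add:
  assumes v: "v \<in> carrier_vec n"
  shows "poly_vec A (f + g) v = poly_vec A f v + poly_vec A g v"
proof (induction f g rule: poly_induct2)
  case 0
  show ?case using v by simp
next
  case (pCons c f d g)
  have "poly_vec A (pCons c f + pCons d g) v = (c + d) \<cdot>\<^sub>v v + A *\<^sub>v (poly_vec A f v + poly_vec A g v)"
    using pCons v by (simp add: poly_vec_pCons)
  also have "A *\<^sub>v (poly_vec A f v + poly_vec A g v) = A *\<^sub>v poly_vec A f v + A *\<^sub>v poly_vec A g v"
    using A v by (intro mult_add_distrib_mat_vec) auto
  finally show ?case using A v by (intro eq_vecI) (auto simp: poly_vec_pCons algebra_simps)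
qed

lemma poly_vec_mult:
  assumes v: "v \<in> carrier_vec n"
  shows "poly_vec A (f * g) v = poly_vec A f (poly_vec A g v)"
proof (induction f rule: pCons_induct)
  case 0
  show ?case using v by simp
next
  case (pCons c f)
  have z: "0 \<cdot>\<^sub>v v = 0\<^sub>v n" using v by (intro eq_vecI) auto
  show ?case using v A pCons(2)
    by (simp add: mult_pCons_left poly_vec_add poly_vec_smult poly_vec_pCons z)
qed

lemma poly_vec_add_vec:
  assumes v: "v \<in> carrier_vec n" "w \<in> carrier_vec n"
  shows "poly_vec A f (v + w) = poly_vec A f v + poly_vec A f w"
proof (induction f rule: pCons_induct)
  case 0
  show ?case using v by simp
next
  case (pCons c f)
  have "A *\<^sub>v (poly_vec A f v + poly_vec A f w) = A *\<^sub>v poly_vec A f v + A *\<^sub>v poly_vec A f w"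
    using A v by (intro mult_add_distrib_mat_vec) auto
  thus ?case using A v pCons(2) by (intro eq_vecI) (auto simp: poly_vec_pCons algebra_simps)
qed

text \<open>The right-hand side is \<open>poly_vec A' f\<close> at \<open>P *\<^sub>v v\<close> in
  unfolded form, with the zero vector of the target dimension m.\<close>

lemma poly_vec_intertwine:
  assumes A': "A' \<in> carrier_mat m m" and P: "P \<in> carrier_mat m n" and c: "P * A = A' * P" and v: "v \<in> carrier_vec n"
  shows "P *\<^sub>v poly_vec A f v = fold_coeffs (\<lambda>c w. c \<cdot>\<^sub>v (P *\<^sub>v v) + A' *\<^sub>v w) f (0\<^sub>v m)"
proof (induction f rule: pCons_induct)
  case 0
  show ?case using v mult_mat_zero_vec[OF P] by simp
next
  case (pCons d f)
  have "P *\<^sub>v (A *\<^sub>v poly_vec A f v) = A' *\<^sub>v (P *\<^sub>v poly_vec A f v)"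
    using A A' P v c by (metis assoc_mult_mat_vec poly_vec_carrier)
  moreover have "P *\<^sub>v (d \<cdot>\<^sub>v v + A *\<^sub>v poly_vec A f v) = d \<cdot>\<^sub>v (P *\<^sub>v v) + P *\<^sub>v (A *\<^sub>v poly_vec A f v)"
    using A P v mult_mat_vec[OF P v] by (subst mult_add_distrib_mat_vec[OF P]) auto
  ultimately have "P *\<^sub>v poly_vec A (pCons d f) v =
      d \<cdot>\<^sub>v (P *\<^sub>v v) + A' *\<^sub>v fold_coeffs (\<lambda>c w. c \<cdot>\<^sub>v (P *\<^sub>v v) + A' *\<^sub>v w) f (0\<^sub>v m)"
    using pCons(2) v by (simp add: poly_vec_pCons)
  thus ?case using pCons(1) by (cases "d = 0") auto
qed

end

lemma poly_vec_intertwine':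
  assumes "A \<in> carrier_mat n n" "A' \<in> carrier_mat m m" "P \<in> carrier_mat m n" "P * A = A' * P" "v \<in> carrier_vec n"
  shows "P *\<^sub>v poly_vec A f v = poly_vec A' f (P *\<^sub>v v)"
  using poly_vec_intertwine[OF assms] assms(3) by (simp add: poly_vec_def)

definition legendre_poly :: "'a::field \<Rightarrow> 'a poly" where
  "legendre_poly a = [:0, 1:] * [:- 1, 1:] * [:- a, 1:]"

lemma poly_legendre_poly: "poly (legendre_poly a) x = x * (x - 1) * (x - a)"
  by (simp add: legendre_poly_def algebra_simps)

lemma cubic_legendre_poly: "cubic (legendre_poly a)"
proof
  have e: "legendre_poly a = [:0, a, - (1 + a), 1:]" by (simp add: legendre_poly_def)
  show "Polynomial.degree (legendre_poly a) = 3" "poly.coeff (legendre_poly a) 3 = 1"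
    unfolding e by (simp_all add: numeral_3_eq_3)
qed

lemma legendre_mat_poly_vec:
  assumes A: "A \<in> carrier_mat n n" and v: "v \<in> carrier_vec n"
  shows "legendre_mat a n A *\<^sub>v v = poly_vec A (legendre_poly a) v"
proof -
  have lin: "poly_vec A [:- c, 1:] w = (A - c \<cdot>\<^sub>m 1\<^sub>m n) *\<^sub>v w" if w: "w \<in> carrier_vec n" for c w
  proof -
    have "(A - c \<cdot>\<^sub>m 1\<^sub>m n) *\<^sub>v w = A *\<^sub>v w - (c \<cdot>\<^sub>m 1\<^sub>m n) *\<^sub>v w"
      using A w by (intro minus_mult_distrib_mat_vec) auto
    also have "(c \<cdot>\<^sub>m 1\<^sub>m n) *\<^sub>v w = c \<cdot>\<^sub>v w"
      using w by (intro eq_vecI) auto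
    finally show ?thesis using A w
      by (simp add: poly_vec_pCons[OF A] mult_mat_zero_vec[OF A] poly_vec_0[OF A]) (intro eq_vecI, auto)
  qed
  have 1: "1\<^sub>m n = (1::'a) \<cdot>\<^sub>m 1\<^sub>m n" by (intro eq_matI) auto
  have zero: "poly_vec A [:0, 1:] w = A *\<^sub>v w" if w: "w \<in> carrier_vec n" for w
  proof -
    have "A - 0 \<cdot>\<^sub>m 1\<^sub>m n = A" using A by (intro eq_matI) auto
    thus ?thesis using lin[OF w, of 0] by simp
  qed
  have c: "A - 1 \<cdot>\<^sub>m 1\<^sub>m n \<in> carrier_mat n n" "A - a \<cdot>\<^sub>m 1\<^sub>m n \<in> carrier_mat n n" using A by auto
  have "legendre_mat a n A *\<^sub>v v = A *\<^sub>v ((A - 1 \<cdot>\<^sub>m 1\<^sub>m n) *\<^sub>v ((A - a \<cdot>\<^sub>m 1\<^sub>m n) *\<^sub>v v))"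
    unfolding legendre_mat_def using A c v
    by (subst 1, subst assoc_mult_mat_vec[of _ n n _ n], auto simp: assoc_mult_mat_vec[of _ n n _ n] intro!: mult_carrier_mat[of _ n n])
  also have "\<dots> = poly_vec A [:0, 1:] (poly_vec A [:- 1, 1:] (poly_vec A [:- a, 1:] v))"
    using c v mult_mat_vec_carrier by (simp only: lin zero mult_mat_vec_carrier)
  also have "\<dots> = poly_vec A (legendre_poly a) v"
    unfolding legendre_poly_def using v by (simp only: poly_vec_mult[OF A] poly_vec_carrier[OF A])
  finally show ?thesis .
qed

section \<open>Annihilators of vectors and cyclic modules\<close>

definition ann_ideal :: "'a::field mat \<Rightarrow> 'a mat \<Rightarrow> nat \<Rightarrow> 'a vec \<Rightarrow> 'a curve_ring set" where
  "ann_ideal A B n v = {r. curve_act A B r v = 0\<^sub>v n}"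

lemma legendre_pairsD:
  assumes "(A, B) \<in> legendre_pairs a n"
  shows "A \<in> carrier_mat n n" "B \<in> carrier_mat n n" "A * B = B * A" "B * B = legendre_mat a n A"
  using assms by (auto simp: legendre_pairs_def)

context
  fixes a :: "'a::field" and n :: nat and A B :: "'a mat"
  assumes AB: "(A, B) \<in> legendre_pairs a n"
begin

lemmas AB' = legendre_pairsD[OF AB]

lemma curve_act_carrier [simp]: "v \<in> carrier_vec n \<Longrightarrow> curve_act A B r v \<in> carrier_vec n"
  unfolding curve_act_def using poly_vec_carrier[OF AB'(1)] mult_mat_vec_carrier[OF AB'(2)] by auto

lemma curve_act_add: "v \<in> carrier_vec n \<Longrightarrow> curve_act A B (r + s) v = curve_act A B r v + curve_act A B s v"
proof -
  assume v: "v \<in> carrier_vec n"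
  have c: "B *\<^sub>v v \<in> carrier_vec n" using AB' v by auto
  have p: "poly_vec A f w \<in> carrier_vec n" if "w \<in> carrier_vec n" for f w using poly_vec_carrier[OF AB'(1) that] .
  show ?thesis unfolding curve_act_def fst_add snd_add poly_vec_add[OF AB'(1) v] poly_vec_add[OF AB'(1) c]
    using p[OF v, of "fst r"] p[OF v, of "fst s"] p[OF c, of "snd r"] p[OF c, of "snd s"]
    by (intro eq_vecI) auto
qed

text \<open>This is where both defining relations of a pair enter: B commutes with polynomials in A,
  and B^2 = h(A) matches y^2 = h.\<close>

lemma curve_act_cmult:
  assumes v: "v \<in> carrier_vec n"
  shows "curve_act A B (cmult (legendre_poly a) s r) v = curve_act A B s (curve_act A B r v)"
proof -
  note A = AB'(1) and B = AB'(2)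
  have Bv: "B *\<^sub>v v \<in> carrier_vec n" using B v by auto
  have p: "poly_vec A f w \<in> carrier_vec n" if "w \<in> carrier_vec n" for f w using poly_vec_carrier[OF A that] .
  have com: "B *\<^sub>v poly_vec A f w = poly_vec A f (B *\<^sub>v w)" if "w \<in> carrier_vec n" for f w
    using poly_vec_intertwine'[OF A A B AB'(3)[symmetric] that] .
  have sq: "B *\<^sub>v (B *\<^sub>v w) = poly_vec A (legendre_poly a) w" if "w \<in> carrier_vec n" for w
    using legendre_mat_poly_vec[OF A that, of a] assoc_mult_mat_vec[OF B B that] AB'(4) by simp
  define f where "f = fst s" define g where "g = snd s"
  define x where "x = fst r" define y where "y = snd r"
  have "curve_act A B s (curve_act A B r v) =
      poly_vec A f (poly_vec A x v + poly_vec A y (B *\<^sub>v v)) + poly_vec A g (B *\<^sub>v (poly_vec A x v + poly_vec A y (B *\<^sub>v v)))"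
    by (simp add: curve_act_def f_def g_def x_def y_def)
  also have "poly_vec A f (poly_vec A x v + poly_vec A y (B *\<^sub>v v)) = poly_vec A (f * x) v + poly_vec A (f * y) (B *\<^sub>v v)"
    using v Bv p by (simp only: poly_vec_add_vec[OF A] poly_vec_mult[OF A])
  also have "B *\<^sub>v (poly_vec A x v + poly_vec A y (B *\<^sub>v v)) =
      poly_vec A x (B *\<^sub>v v) + poly_vec A y (poly_vec A (legendre_poly a) v)"
    using v Bv p by (simp only: mult_add_distrib_mat_vec[OF B] com sq)
  also have "poly_vec A g \<dots> = poly_vec A (g * x) (B *\<^sub>v v) + poly_vec A (g * y * legendre_poly a) v"
    using v Bv p by (simp only: poly_vec_add_vec[OF A] poly_vec_mult[OF A])
  also have "(poly_vec A (f * x) v + poly_vec A (f * y) (B *\<^sub>v v)) +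
      (poly_vec A (g * x) (B *\<^sub>v v) + poly_vec A (g * y * legendre_poly a) v) =
      (poly_vec A (f * x) v + poly_vec A (g * y * legendre_poly a) v) +
      (poly_vec A (f * y) (B *\<^sub>v v) + poly_vec A (g * x) (B *\<^sub>v v))"
    using p[OF v, of "f * x"] p[OF v, of "g * y * legendre_poly a"] p[OF Bv, of "f * y"] p[OF Bv, of "g * x"]
    by (intro eq_vecI) auto
  also have "\<dots> = poly_vec A (f * x + legendre_poly a * (g * y)) v + poly_vec A (f * y + g * x) (B *\<^sub>v v)"
    using v Bv by (simp only: poly_vec_add[OF A]) (simp add: mult_ac)
  also have "\<dots> = curve_act A B (cmult (legendre_poly a) s r) v"
    by (simp add: curve_act_def cmult_def f_def g_def x_def y_def)
  finally show ?thesis by simp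
qed

lemma curve_act_simps:
  assumes v: "v \<in> carrier_vec n"
  shows "curve_act A B 0 v = 0\<^sub>v n" "curve_act A B (1, 0) v = v"
    "curve_act A B ([:0, 1:], 0) v = A *\<^sub>v v" "curve_act A B (0, 1) v = B *\<^sub>v v"
    "curve_act A B (cscale c r) v = c \<cdot>\<^sub>v curve_act A B r v"
    "curve_act A B (r - s) v = curve_act A B r v - curve_act A B s v"
proof -
  note A = AB'(1) and B = AB'(2)
  have Bv: "B *\<^sub>v v \<in> carrier_vec n" using B v by auto
  have one: "poly_vec A 1 w = w" if "w \<in> carrier_vec n" for w
    using that A poly_vec_pCons[OF A that, of 1 0] mult_mat_zero_vec[OF A A] by (simp add: one_pCons poly_vec_0[OF A])
  have xx: "poly_vec A [:0, 1:] w = A *\<^sub>v w" if w: "w \<in> carrier_vec n" for w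
  proof -
    have "poly_vec A [:0, 1:] w = 0 \<cdot>\<^sub>v w + A *\<^sub>v poly_vec A 1 w"
      unfolding one_pCons by (rule poly_vec_pCons[OF A w])
    thus ?thesis using A w one by (intro eq_vecI) auto
  qed
  show "curve_act A B 0 v = 0\<^sub>v n" "curve_act A B (1, 0) v = v"
    "curve_act A B ([:0, 1:], 0) v = A *\<^sub>v v" "curve_act A B (0, 1) v = B *\<^sub>v v"
    using v A Bv one xx by (simp_all add: curve_act_def poly_vec_0[OF A])
  show sc: "curve_act A B (cscale c r) v = c \<cdot>\<^sub>v curve_act A B r v" for c r
    unfolding curve_act_def cscale_def using v Bv poly_vec_carrier[OF A]
    by (simp add: poly_vec_smult[OF A] smult_add_distrib_vec[of _ n])
  have "r - s = r + cscale (- 1) s" by (intro prod_eqI) (simp_all add: cscale_def)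
  hence "curve_act A B (r - s) v = curve_act A B r v + (- 1) \<cdot>\<^sub>v curve_act A B s v"
    using v by (simp only: curve_act_add sc)
  also have "\<dots> = curve_act A B r v - curve_act A B s v"
    using curve_act_carrier[OF v, of r] curve_act_carrier[OF v, of s] by (intro eq_vecI) auto
  finally show "curve_act A B (r - s) v = curve_act A B r v - curve_act A B s v" .
qed

lemma curve_act_zero_vec: "curve_act A B r (0\<^sub>v n) = 0\<^sub>v n"
proof -
  have "curve_act A B r (curve_act A B 0 (0\<^sub>v n)) = curve_act A B 0 (0\<^sub>v n)"
    using curve_act_cmult[of "0\<^sub>v n" r 0] by simp
  thus ?thesis by (simp add: curve_act_simps)
qed

lemma ann_curve_ideal: "v \<in> carrier_vec n \<Longrightarrow> curve_ideal (legendre_poly a) (ann_ideal A B n v)"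
  unfolding curve_ideal_def ann_ideal_def
  by (auto simp: curve_act_simps curve_act_add curve_act_cmult curve_act_zero_vec)

lemma curve_act_eq_iff: "v \<in> carrier_vec n \<Longrightarrow> curve_act A B r v = curve_act A B s v \<longleftrightarrow> r - s \<in> ann_ideal A B n v"
proof -
  assume v: "v \<in> carrier_vec n"
  have "curve_act A B r v = curve_act A B s v \<longleftrightarrow> curve_act A B r v - curve_act A B s v = 0\<^sub>v n"
    using curve_act_carrier[OF v, of r] curve_act_carrier[OF v, of s]
    by (auto simp: vec_eq_iff)
  thus ?thesis using v by (simp add: ann_ideal_def curve_act_simps)
qed

end

text \<open>An annihilating element supported on gaps is 0. Hence different elements supported on a
  set G of gaps send v to different vectors, and counting these in k^n gives card G \<le> n.\<close>

lemma ann_ideal_codim: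
  fixes a :: "'a::{finite,field}"
  assumes AB: "(A, B) \<in> legendre_pairs a n" and v: "v \<in> carrier_vec n"
  shows "\<exists>j\<le>n. ann_ideal A B n v \<in> ideals (legendre_poly a) j"
proof -
  let ?J = "ann_ideal A B n v"
  have J: "curve_ideal (legendre_poly a) ?J" by (rule ann_curve_ideal[OF AB v])
  \<comment> \<open>Stated for finite subsets, because the finiteness of \<open>gaps\<close> itself
    is deduced from this bound.\<close>
  have bound: "card G \<le> n" if G: "finite G" "G \<subseteq> gaps ?J" for G
  proof -
    have sub: "pole_support G \<subseteq> pole_support (gaps ?J)" using G by (auto simp: pole_support_def)
    have diff: "r - s \<in> pole_support (gaps ?J)" if "r \<in> pole_support (gaps ?J)" "s \<in> pole_support (gaps ?J)" for r s :: "'a curve_ring"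
      using that unfolding pole_support_def by (auto simp: pole_coeff_diff) (metis diff_zero)
    have inj: "inj_on (\<lambda>r. curve_act A B r v) (pole_support G)"
    proof (rule inj_onI)
      fix r s assume "r \<in> pole_support G" "s \<in> pole_support G" "curve_act A B r v = curve_act A B s v"
      hence "r - s \<in> ?J" "r - s \<in> pole_support (gaps ?J)" using curve_act_eq_iff[OF AB v] sub diff by blast+
      thus "r = s" using pole_support_gaps_Int[OF J] by fastforce
    qed
    have "1 \<notin> G" using G by (auto simp: gaps_def)
    hence "CARD('a) ^ card G = card (pole_support G :: 'a curve_ring set)" using card_pole_support G by metis
    also have "\<dots> \<le> card (carrier_vec n :: 'a vec set)"
      using inj curve_act_carrier[OF AB v] by (intro card_inj_on_le[of "\<lambda>r. curve_act A B r v"]) auto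
    also have "\<dots> = CARD('a) ^ n" by (rule card_carrier_vec)
    finally have le: "CARD('a) ^ card G \<le> CARD('a) ^ n" .
    have "card {0, 1 :: 'a} \<le> CARD('a)" by (intro card_mono) auto
    hence "1 < CARD('a)" by simp
    from power_le_imp_le_exp[OF this le] show ?thesis .
  qed
  have fin: "finite (gaps ?J)"
  proof (rule ccontr)
    assume "infinite (gaps ?J)"
    then obtain G where "G \<subseteq> gaps ?J" "finite G" "card G = Suc n" using infinite_arbitrarily_large by metis
    thus False using bound by fastforce
  qed
  thus ?thesis using bound[OF fin] J by (auto simp: ideals_def)
qed

(* The module R/J in coordinates: a basis is given by the monomials whose pole order is a gap. *)
lemma cyclic_module_exists:
  fixes a :: "'a::field"
  assumes J: "J \<in> ideals (legendre_poly a) j"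
  shows "\<exists>A B v. (A, B) \<in> legendre_pairs a j \<and> v \<in> carrier_vec j \<and> ann_ideal A B j v = J \<and>
    (\<forall>u\<in>carrier_vec j. \<exists>r. u = curve_act A B r v)"
proof -
  let ?h = "legendre_poly a"
  have id: "curve_ideal ?h J" and fin: "finite (gaps J)" and cj: "card (gaps J) = j" using J by (auto simp: ideals_def)
  have one: "1 \<notin> gaps J" by (simp add: gaps_def)
  obtain e where e: "bij_betw e {0..<j} (gaps J)" using ex_bij_betw_nat_finite[OF fin] cj by auto
  \<comment> \<open>The normal form modulo J, which is unique by
    \<open>pole_support_gaps_Int\<close>.\<close>
  define red where "red r = (SOME s. s \<in> pole_support (gaps J) \<and> r - s \<in> J)" for r
  have red: "red r \<in> pole_support (gaps J)" "r - red r \<in> J" for r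
    using someI_ex[OF pole_reduce[OF id, of r]] by (auto simp: red_def)
  have sup_diff: "r - s \<in> pole_support (gaps J)" and sup_add: "r + s \<in> pole_support (gaps J)"
    and sup_scale: "cscale c r \<in> pole_support (gaps J)"
    if "r \<in> pole_support (gaps J)" "s \<in> pole_support (gaps J)" for r s c
    using that unfolding pole_support_def by (auto simp: pole_coeff_diff pole_coeff_add pole_coeff_cscale) (metis diff_zero add_0)+
  have red_unique: "red r = s" if "s \<in> pole_support (gaps J)" "r - s \<in> J" for r s
  proof -
    have "(r - s) - (r - red r) \<in> J" by (rule curve_ideal_diff[OF id that(2) red(2)])
    moreover have "(r - s) - (r - red r) = red r - s" by simp
    ultimately have "red r - s \<in> J" by simp
    hence "red r - s = 0" using pole_support_gaps_Int[OF id] sup_diff[OF red(1) that(1)] by blast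
    thus ?thesis by simp
  qed
  have red_add: "red (r + s) = red r + red s" for r s
  proof (rule red_unique)
    have "(r + s) - (red r + red s) = (r - red r) + (s - red s)" by simp
    thus "(r + s) - (red r + red s) \<in> J" using curve_ideal_add[OF id red(2) red(2)] by metis
  qed (rule sup_add[OF red(1) red(1)])
  have cscale_diff: "cscale c (r - s) = cscale c r - cscale c s" for c and r s :: "'a curve_ring"
    by (simp add: cscale_def smult_diff_right)
  have red_scale: "red (cscale c r) = cscale c (red r)" for c r
    using curve_ideal_cscale[OF id red(2), of c r] sup_scale[OF red(1) red(1)]
    by (intro red_unique) (auto simp: cscale_diff)
  \<comment> \<open>The projection onto R/J in the coordinates of the normal form; its kernel is
    J.\<close>
  define \<psi> where "\<psi> r = vec j (\<lambda>i. pole_coeff (e i) (red r))" for r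
  have \<psi>_carrier [simp]: "\<psi> r \<in> carrier_vec j" for r by (simp add: \<psi>_def)
  have \<psi>_add: "\<psi> (r + s) = \<psi> r + \<psi> s" and \<psi>_scale: "\<psi> (cscale c r) = c \<cdot>\<^sub>v \<psi> r" for r s c
    by (auto simp: \<psi>_def red_add red_scale pole_coeff_add pole_coeff_cscale intro!: eq_vecI)
  have \<psi>_0: "\<psi> r = 0\<^sub>v j \<longleftrightarrow> r \<in> J" for r
  proof
    assume "\<psi> r = 0\<^sub>v j"
    hence "pole_coeff (e i) (red r) = 0" if "i < j" for i using that by (auto simp: \<psi>_def vec_eq_iff)
    hence "pole_coeff m (red r) = 0" if "m \<in> gaps J" for m
      using that e unfolding bij_betw_def by (metis atLeastLessThan_iff imageE)
    moreover have "pole_coeff m (red r) = 0" if "m \<notin> gaps J" for m using red(1)[of r] that by (auto simp: pole_support_def)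
    ultimately have "red r = 0" by (intro pole_coeff_eqI) (metis pole_coeff_zero)
    thus "r \<in> J" using red(2)[of r] by simp
  next
    assume "r \<in> J"
    hence "red r = 0" by (intro red_unique) (auto simp: pole_support_def)
    thus "\<psi> r = 0\<^sub>v j" by (auto simp: \<psi>_def intro!: eq_vecI)
  qed
  have \<psi>_eq: "\<psi> r = \<psi> s \<longleftrightarrow> r - s \<in> J" for r s
  proof -
    have "r = s + (r - s)" by simp
    hence *: "\<psi> r = \<psi> s + \<psi> (r - s)" using \<psi>_add by metis
    show ?thesis unfolding \<psi>_0[symmetric] unfolding * by (auto simp: vec_eq_iff \<psi>_def)
  qed
  \<comment> \<open>A section of \<open>\<psi>\<close>. It allows multiplication on R/J to be
    defined on vectors; independence of the representative is shown separately.\<close>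
  define sec where "sec u = (\<Sum>m\<in>gaps J. cscale (u $ (inv_into {0..<j} e m)) (pole_basis m))" for u :: "'a vec"
  have sec: "\<psi> (sec u) = u" if u: "u \<in> carrier_vec j" for u
  proof -
    have pc: "pole_coeff m (sec u) = (if m \<in> gaps J then u $ (inv_into {0..<j} e m) else 0)" for m
      unfolding sec_def using pole_coeff_combination[OF fin one] .
    have "sec u \<in> pole_support (gaps J)" by (auto simp: pole_support_def pc)
    hence "red (sec u) = sec u" using curve_ideal_zero[OF id] by (intro red_unique) auto
    thus ?thesis using u e by (intro eq_vecI) (auto simp: \<psi>_def pc bij_betw_def)
  qed
  have mat: "\<exists>M\<in>carrier_mat j j. \<forall>r. M *\<^sub>v \<psi> r = \<psi> (cmult ?h t r)" for t
  proof -
    have wd: "\<psi> (cmult ?h t r) = \<psi> (cmult ?h t s)" if "\<psi> r = \<psi> s" for r s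
      using that curve_ideal_mult[OF id, of "r - s" t] by (simp add: \<psi>_eq flip: cmult_diff_right)
    have "\<exists>M\<in>carrier_mat j j. \<forall>u\<in>carrier_vec j. M *\<^sub>v u = \<psi> (cmult ?h t (sec u))"
    proof (rule linear_map_matrix)
      fix u v :: "'a vec" and c assume u: "u \<in> carrier_vec j" "v \<in> carrier_vec j"
      have "\<psi> (sec (u + v)) = \<psi> (sec u + sec v)" using u sec by (simp add: \<psi>_add)
      thus "\<psi> (cmult ?h t (sec (u + v))) = \<psi> (cmult ?h t (sec u)) + \<psi> (cmult ?h t (sec v))"
        using wd by (metis cmult_add_right \<psi>_add)
    next
      fix u :: "'a vec" and c assume u: "u \<in> carrier_vec j"
      have "\<psi> (sec (c \<cdot>\<^sub>v u)) = \<psi> (cscale c (sec u))" using u sec by (simp add: \<psi>_scale)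
      thus "\<psi> (cmult ?h t (sec (c \<cdot>\<^sub>v u))) = c \<cdot>\<^sub>v \<psi> (cmult ?h t (sec u))"
        using wd by (metis cmult_commute cscale_cmult \<psi>_scale)
    qed simp
    then obtain M where M: "M \<in> carrier_mat j j" "\<forall>u\<in>carrier_vec j. M *\<^sub>v u = \<psi> (cmult ?h t (sec u))" by blast
    have "M *\<^sub>v \<psi> r = \<psi> (cmult ?h t r)" for r using M wd[of "sec (\<psi> r)" r] sec[of "\<psi> r"] by simp
    thus ?thesis using M by blast
  qed
  obtain A where A: "A \<in> carrier_mat j j" "\<And>r. A *\<^sub>v \<psi> r = \<psi> (cmult ?h ([:0, 1:], 0) r)" using mat by blast
  obtain B where B: "B \<in> carrier_mat j j" "\<And>r. B *\<^sub>v \<psi> r = \<psi> (cmult ?h (0, 1) r)" using mat by blast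
  have pv: "poly_vec A f (\<psi> r) = \<psi> (cmult ?h (f, 0) r)" for f r
  proof (induction f rule: pCons_induct)
    case 0
    have "\<psi> 0 = 0\<^sub>v j" using \<psi>_0 curve_ideal_zero[OF id] by blast
    moreover have "cmult ?h (0, 0) r = 0" using cmult_zero(1)[of ?h r] by (simp add: zero_prod_def)
    ultimately show ?case by (simp add: poly_vec_0[OF A(1)])
  next
    case (pCons c f)
    have "poly_vec A (pCons c f) (\<psi> r) = c \<cdot>\<^sub>v \<psi> r + A *\<^sub>v \<psi> (cmult ?h (f, 0) r)"
      using pCons poly_vec_pCons[OF A(1)] by simp
    also have "\<dots> = \<psi> (cscale c r + cmult ?h ([:0, 1:], 0) (cmult ?h (f, 0) r))"
      by (simp add: A \<psi>_add \<psi>_scale)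
    also have "cscale c r + cmult ?h ([:0, 1:], 0) (cmult ?h (f, 0) r) = cmult ?h (pCons c f, 0) r"
      by (simp add: cscale_def cmult_def)
    finally show ?case .
  qed
  have act: "curve_act A B r (\<psi> s) = \<psi> (cmult ?h r s)" for r s
  proof -
    have "curve_act A B r (\<psi> s) = \<psi> (cmult ?h (fst r, 0) s) + \<psi> (cmult ?h (snd r, 0) (cmult ?h (0, 1) s))"
      by (simp add: curve_act_def pv B)
    also have "\<dots> = \<psi> (cmult ?h ((fst r, 0) + cmult ?h (snd r, 0) (0, 1)) s)"
      by (simp add: \<psi>_add cmult_add_left cmult_assoc)
    also have "(fst r, 0) + cmult ?h (snd r, 0) (0, 1) = r" by (simp add: cmult_def)
    finally show ?thesis .
  qed
  have AB: "(A, B) \<in> legendre_pairs a j"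
  proof -
    have "A * B = B * A"
    proof (rule mat_eqI_vec)
      fix u :: "'a vec" assume u: "u \<in> carrier_vec j"
      have "A * B *\<^sub>v \<psi> (sec u) = B * A *\<^sub>v \<psi> (sec u)"
        using A B by (simp add: assoc_mult_mat_vec[of _ j j _ j]) (metis cmult_assoc cmult_commute)
      thus "A * B *\<^sub>v u = B * A *\<^sub>v u" using sec[OF u] by simp
    qed (use A B in auto)
    moreover have "B * B = legendre_mat a j A"
    proof (rule mat_eqI_vec)
      fix u :: "'a vec" assume u: "u \<in> carrier_vec j"
      have "cmult ?h (0, 1) (cmult ?h (0, 1) r) = cmult ?h (?h, 0) r" for r by (simp add: cmult_def)
      hence "B * B *\<^sub>v \<psi> (sec u) = poly_vec A ?h (\<psi> (sec u))"
        using B by (simp add: assoc_mult_mat_vec[of _ j j _ j] pv)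
      thus "B * B *\<^sub>v u = legendre_mat a j A *\<^sub>v u" using sec[OF u] u legendre_mat_poly_vec[OF A(1) u, of a] by simp
    qed (use A B in auto)
    ultimately show ?thesis using A B by (simp add: legendre_pairs_def)
  qed
  moreover have "ann_ideal A B j (\<psi> (1, 0)) = J" by (auto simp: ann_ideal_def act \<psi>_0)
  moreover have "\<forall>u\<in>carrier_vec j. \<exists>r. u = curve_act A B r (\<psi> (1, 0))"
  proof
    fix u :: "'a vec" assume "u \<in> carrier_vec j"
    hence "u = curve_act A B (sec u) (\<psi> (1, 0))" using sec by (simp add: act)
    thus "\<exists>r. u = curve_act A B r (\<psi> (1, 0))" by (rule exI)
  qed
  ultimately show ?thesis by (intro exI[of _ A] exI[of _ B] exI[of _ "\<psi> (1, 0)"]) simp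
qed

definition mat_inj :: "nat \<Rightarrow> nat \<Rightarrow> 'a::field mat set" where
  "mat_inj n m = {P \<in> carrier_mat n m. \<forall>u\<in>carrier_vec m. P *\<^sub>v u = 0\<^sub>v n \<longrightarrow> u = 0\<^sub>v m}"

lemma intertwiner_act:
  fixes a :: "'a::field"
  assumes AB: "(A, B) \<in> legendre_pairs a n" and AB': "(A', B') \<in> legendre_pairs a j"
    and P: "P \<in> carrier_mat n j" and c: "A * P = P * A'" "B * P = P * B'" and v': "v' \<in> carrier_vec j"
  shows "P *\<^sub>v curve_act A' B' r v' = curve_act A B r (P *\<^sub>v v')"
proof -
  note k = legendre_pairsD[OF AB] and k' = legendre_pairsD[OF AB']
  have Bv: "B' *\<^sub>v v' \<in> carrier_vec j" using k' v' by auto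
  have pc: "poly_vec A' f w \<in> carrier_vec j" if "w \<in> carrier_vec j" for f w using poly_vec_carrier[OF k'(1) that] .
  have "P *\<^sub>v curve_act A' B' r v' = P *\<^sub>v poly_vec A' (fst r) v' + P *\<^sub>v poly_vec A' (snd r) (B' *\<^sub>v v')"
    unfolding curve_act_def using P pc v' Bv by (intro mult_add_distrib_mat_vec) auto
  also have "\<dots> = poly_vec A (fst r) (P *\<^sub>v v') + poly_vec A (snd r) (P *\<^sub>v (B' *\<^sub>v v'))"
    using poly_vec_intertwine'[OF k'(1) k(1) P c(1)[symmetric]] v' Bv by simp
  also have "P *\<^sub>v (B' *\<^sub>v v') = B *\<^sub>v (P *\<^sub>v v')"
    using assoc_mult_mat_vec[OF P k'(2) v'] assoc_mult_mat_vec[OF k(2) P v'] c(2) by simp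
  finally show ?thesis by (simp add: curve_act_def)
qed

text \<open>A module map out of a cyclic module is determined by the image of the generator. The
  equality of the annihilators makes the map well defined in one direction and injective in the
  other.\<close>

lemma cyclic_intertwiner:
  fixes a :: "'a::field"
  assumes AB: "(A, B) \<in> legendre_pairs a n" and v: "v \<in> carrier_vec n"
    and AB': "(A', B') \<in> legendre_pairs a j" and v': "v' \<in> carrier_vec j"
    and gen: "\<And>u. u \<in> carrier_vec j \<Longrightarrow> \<exists>r. u = curve_act A' B' r v'"
    and ann: "ann_ideal A' B' j v' = ann_ideal A B n v"
  shows "\<exists>!P. P \<in> mat_inj n j \<and> A * P = P * A' \<and> B * P = P * B' \<and> P *\<^sub>v v' = v"
proof -
  note c = legendre_pairsD[OF AB] and c' = legendre_pairsD[OF AB']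
  define F where "F u = curve_act A B (SOME r. u = curve_act A' B' r v') v" for u
  have F: "F (curve_act A' B' r v') = curve_act A B r v" for r
  proof -
    define s where "s = (SOME s. curve_act A' B' r v' = curve_act A' B' s v')"
    have "curve_act A' B' r v' = curve_act A' B' s v'" unfolding s_def by (rule someI[of _ r]) simp
    hence "curve_act A B r v = curve_act A B s v"
      using curve_act_eq_iff[OF AB v] curve_act_eq_iff[OF AB' v'] ann by simp
    thus ?thesis by (simp add: F_def s_def)
  qed
  have "\<exists>P\<in>carrier_mat n j. \<forall>u\<in>carrier_vec j. P *\<^sub>v u = F u"
  proof (rule linear_map_matrix)
    fix u :: "'a vec" assume "u \<in> carrier_vec j"
    then obtain r where u: "u = curve_act A' B' r v'" using gen by blast
    show "F u \<in> carrier_vec n" unfolding u F using AB v by simp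
    show "F (c \<cdot>\<^sub>v u) = c \<cdot>\<^sub>v F u" for c
      unfolding u F using F[of "cscale c r"] by (simp add: curve_act_simps[OF AB v] curve_act_simps[OF AB' v'])
    fix w :: "'a vec" assume "w \<in> carrier_vec j"
    then obtain s where w: "w = curve_act A' B' s v'" using gen by blast
    show "F (u + w) = F u + F w"
      unfolding u w F using F[of "r + s"] by (simp add: curve_act_add[OF AB v] curve_act_add[OF AB' v'])
  qed
  then obtain P where P: "P \<in> carrier_mat n j" "\<And>u. u \<in> carrier_vec j \<Longrightarrow> P *\<^sub>v u = F u" by blast
  have Pact: "P *\<^sub>v curve_act A' B' r v' = curve_act A B r v" for r
    using P F curve_act_carrier[OF AB' v'] by simp
  have inter: "M * P = P * M'"
    if M: "M \<in> carrier_mat n n" "M' \<in> carrier_mat j j"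
      "\<And>r. M *\<^sub>v curve_act A B r v = curve_act A B (cmult (legendre_poly a) t r) v"
      "\<And>r. M' *\<^sub>v curve_act A' B' r v' = curve_act A' B' (cmult (legendre_poly a) t r) v'" for M M' t
  proof (rule mat_eqI_vec)
    fix u :: "'a vec" assume uc: "u \<in> carrier_vec j"
    then obtain r where u: "u = curve_act A' B' r v'" using gen by blast
    have "(M * P) *\<^sub>v u = M *\<^sub>v (P *\<^sub>v u)" using M(1) P(1) uc by (rule assoc_mult_mat_vec)
    also have "\<dots> = P *\<^sub>v (M' *\<^sub>v u)" unfolding u Pact M(3,4) ..
    also have "\<dots> = (P * M') *\<^sub>v u" using P(1) M(2) uc by (rule assoc_mult_mat_vec[symmetric])
    finally show "(M * P) *\<^sub>v u = (P * M') *\<^sub>v u" .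
  qed (use M P in auto)
  show ?thesis
  proof (rule ex1I[of _ P])
    have "P \<in> mat_inj n j" unfolding mat_inj_def
    proof (intro CollectI conjI ballI impI P(1))
      fix u :: "'a vec" assume "u \<in> carrier_vec j" and 0: "P *\<^sub>v u = 0\<^sub>v n"
      then obtain r where u: "u = curve_act A' B' r v'" using gen by blast
      hence "r \<in> ann_ideal A B n v" using 0 Pact by (simp add: ann_ideal_def)
      thus "u = 0\<^sub>v j" using ann u by (auto simp: ann_ideal_def)
    qed
    moreover have "A * P = P * A'"
      using c c' curve_act_cmult[OF AB v] curve_act_cmult[OF AB' v'] curve_act_simps(3)[OF AB] curve_act_simps(3)[OF AB']
        curve_act_carrier[OF AB v] curve_act_carrier[OF AB' v'] by (intro inter[of _ _ "([:0, 1:], 0)"]) simp_all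
    moreover have "B * P = P * B'"
      using c c' curve_act_cmult[OF AB v] curve_act_cmult[OF AB' v'] curve_act_simps(4)[OF AB] curve_act_simps(4)[OF AB']
        curve_act_carrier[OF AB v] curve_act_carrier[OF AB' v'] by (intro inter[of _ _ "(0, 1)"]) simp_all
    moreover have "P *\<^sub>v v' = v" using Pact[of "(1, 0)"] by (simp add: curve_act_simps[OF AB v] curve_act_simps[OF AB' v'])
    ultimately show "P \<in> mat_inj n j \<and> A * P = P * A' \<and> B * P = P * B' \<and> P *\<^sub>v v' = v" by blast
  next
    fix Q assume Q: "Q \<in> mat_inj n j \<and> A * Q = Q * A' \<and> B * Q = Q * B' \<and> Q *\<^sub>v v' = v"
    hence Qc: "Q \<in> carrier_mat n j" by (simp add: mat_inj_def)
    show "Q = P"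
    proof (rule mat_eqI_vec[OF Qc P(1)])
      fix u :: "'a vec" assume "u \<in> carrier_vec j"
      then obtain r where u: "u = curve_act A' B' r v'" using gen by blast
      show "Q *\<^sub>v u = P *\<^sub>v u" unfolding u Pact using intertwiner_act[OF AB AB' Qc, where r = r and v' = v'] Q v' by simp
    qed
  qed
qed

section \<open>Completion of injective matrices and the order of the general linear group\<close>

definition GL :: "nat \<Rightarrow> 'a::field mat set" where
  "GL n = {g \<in> carrier_mat n n. \<exists>g'\<in>carrier_mat n n. g * g' = 1\<^sub>m n \<and> g' * g = 1\<^sub>m n}"

text \<open>The inclusion of k^j into k^(j + l) as the first coordinates; multiplying by it on the
  right selects the first j columns.\<close>

definition first_cols :: "nat \<Rightarrow> nat \<Rightarrow> 'a::field mat" where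
  "first_cols j l = mat (j + l) j (\<lambda>(p, r). if p = r then 1 else 0)"

lemma first_cols_carrier [simp]: "first_cols j l \<in> carrier_mat (j + l) j"
  by (simp add: first_cols_def)

lemma dim_first_cols [simp]: "dim_row (first_cols j l) = j + l" "dim_col (first_cols j l) = j"
  by (simp_all add: first_cols_def)

lemma mult_first_cols:
  assumes "M \<in> carrier_mat n (j + l)" "p < n" "r < j"
  shows "(M * first_cols j l) $$ (p, r) = (M $$ (p, r) :: 'a::field)"
proof -
  have "(M * first_cols j l) $$ (p, r) = (\<Sum>i<j + l. M $$ (p, i) * (if i = r then 1 else 0))"
    using assms by (simp add: scalar_prod_def first_cols_def atLeast0LessThan)
  also have "\<dots> = M $$ (p, r)" using assms by (simp add: if_distrib cong: if_cong)
  finally show ?thesis .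
qed

lemma first_cols_mult:
  assumes "A \<in> carrier_mat j m" "p < j + l" "r < m"
  shows "(first_cols j l * A) $$ (p, r) = (if p < j then A $$ (p, r) else (0 :: 'a::field))"
proof -
  have "(first_cols j l * A) $$ (p, r) = (\<Sum>i<j. (if p = i then 1 else 0) * A $$ (i, r))"
    using assms by (simp add: scalar_prod_def first_cols_def atLeast0LessThan)
  also have "\<dots> = (if p < j then A $$ (p, r) else 0)" using assms by (simp add: if_distrib[of "\<lambda>x. x * _"] cong: if_cong)
  finally show ?thesis .
qed

text \<open>The first j unit vectors span a subspace that is stable under M, with action A, exactly
  when M is block triangular with upper left block A.\<close>

lemma first_cols_intertwine_iff:
  assumes M: "M \<in> carrier_mat (j + l) (j + l)" and A: "A \<in> carrier_mat j j"
  shows "M * first_cols j l = first_cols j l * A \<longleftrightarrow>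
    (\<exists>U\<in>carrier_mat j l. \<exists>D\<in>carrier_mat l l. M = upper_block j l A U (D :: 'a::field mat))"
proof
  assume eq: "M * first_cols j l = first_cols j l * A"
  have e: "M $$ (p, r) = (if p < j then A $$ (p, r) else 0)" if "p < j + l" "r < j" for p r
    using arg_cong[OF eq, of "\<lambda>N. N $$ (p, r)"] mult_first_cols[OF M that] first_cols_mult[OF A, of p l r] that by simp
  define U where "U = mat j l (\<lambda>(p, r). M $$ (p, j + r))"
  define D where "D = mat l l (\<lambda>(p, r). M $$ (j + p, j + r))"
  have "M = upper_block j l A U D"
    using M A e by (intro eq_matI) (auto simp: upper_block_def U_def D_def)
  moreover have "U \<in> carrier_mat j l" "D \<in> carrier_mat l l" by (simp_all add: U_def D_def)
  ultimately show "\<exists>U\<in>carrier_mat j l. \<exists>D\<in>carrier_mat l l. M = upper_block j l A U D" by blast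
next
  assume "\<exists>U\<in>carrier_mat j l. \<exists>D\<in>carrier_mat l l. M = upper_block j l A U D"
  then obtain U D where UD: "U \<in> carrier_mat j l" "D \<in> carrier_mat l l" "M = upper_block j l A U D" by blast
  show "M * first_cols j l = first_cols j l * A"
  proof (rule eq_matI)
    fix p r assume "p < dim_row (first_cols j l * A)" "r < dim_col (first_cols j l * A)"
    hence pr: "p < j + l" "r < j" using A by auto
    have "M $$ (p, r) = (if p < j then A $$ (p, r) else 0)"
      unfolding UD(3) upper_block_def using UD(1,2) A pr by auto
    thus "(M * first_cols j l) $$ (p, r) = (first_cols j l * A) $$ (p, r)"
      using mult_first_cols[OF M pr] first_cols_mult[OF A, of p l r] pr by simp
  qed (use M A in auto)
qed

lemma GL_carrier: "g \<in> GL n \<Longrightarrow> g \<in> carrier_mat n n" by (simp add: GL_def)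

definition minv :: "nat \<Rightarrow> 'a::field mat \<Rightarrow> 'a mat" where
  "minv n g = (SOME g'. g' \<in> carrier_mat n n \<and> g * g' = 1\<^sub>m n \<and> g' * g = 1\<^sub>m n)"

lemma minv:
  assumes "g \<in> GL n"
  shows "minv n g \<in> carrier_mat n n" "g * minv n g = 1\<^sub>m n" "minv n g * g = 1\<^sub>m n"
proof -
  have "\<exists>g'. g' \<in> carrier_mat n n \<and> g * g' = 1\<^sub>m n \<and> g' * g = 1\<^sub>m n" using assms by (auto simp: GL_def)
  from someI_ex[OF this] show "minv n g \<in> carrier_mat n n" "g * minv n g = 1\<^sub>m n" "minv n g * g = 1\<^sub>m n"
    by (auto simp: minv_def)
qed

lemma GL_cancel:
  assumes "g \<in> GL n" "M \<in> carrier_mat n m"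
  shows "minv n g * (g * M) = M" "g * (minv n g * M) = M"
  using assoc_mult_mat[OF minv(1)[OF assms(1)] GL_carrier[OF assms(1)] assms(2)]
    assoc_mult_mat[OF GL_carrier[OF assms(1)] minv(1)[OF assms(1)] assms(2)] minv[OF assms(1)] assms(2)
  by simp_all

lemma GL_cancel_right:
  assumes "g \<in> GL n" "M \<in> carrier_mat m n"
  shows "M * g * minv n g = M" "M * minv n g * g = M"
  using assoc_mult_mat[OF assms(2) minv(1)[OF assms(1)] GL_carrier[OF assms(1)]]
    assoc_mult_mat[OF assms(2) GL_carrier[OF assms(1)] minv(1)[OF assms(1)]] minv[OF assms(1)] assms(2)
  by (simp_all del: assoc_mult_mat)

lemma GL_mult:
  assumes "g \<in> GL n" "k \<in> GL n"
  shows "g * k \<in> GL n"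
proof -
  note c = GL_carrier[OF assms(1)] GL_carrier[OF assms(2)] minv(1)[OF assms(1)] minv(1)[OF assms(2)]
  have "g * k * (minv n k * minv n g) = g * (k * (minv n k * minv n g))" using c by (intro assoc_mult_mat) auto
  also have "\<dots> = 1\<^sub>m n" using GL_cancel(2)[OF assms(2) c(3)] minv(2)[OF assms(1)] by simp
  finally have 1: "g * k * (minv n k * minv n g) = 1\<^sub>m n" .
  have "minv n k * minv n g * (g * k) = minv n k * (minv n g * (g * k))" using c by (intro assoc_mult_mat) auto
  also have "\<dots> = 1\<^sub>m n" using GL_cancel(1)[OF assms(1) c(2)] minv(3)[OF assms(2)] by simp
  finally show ?thesis unfolding GL_def using 1 mult_carrier_mat[OF c(1,2)] mult_carrier_mat[OF c(4,3)] by blast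
qed

lemma minv_GL: "g \<in> GL n \<Longrightarrow> minv n g \<in> GL n"
  using minv[of g n] GL_carrier[of g n] unfolding GL_def by auto

lemma mat_inj_carrier: "P \<in> mat_inj n m \<Longrightarrow> P \<in> carrier_mat n m" by (simp add: mat_inj_def)

lemma mat_inj_inj_on:
  assumes "P \<in> mat_inj n m"
  shows "inj_on (\<lambda>u. P *\<^sub>v u) (carrier_vec m :: 'a::field vec set)"
proof (rule inj_onI)
  fix u v :: "'a vec" assume uv: "u \<in> carrier_vec m" "v \<in> carrier_vec m" "P *\<^sub>v u = P *\<^sub>v v"
  note P = mat_inj_carrier[OF assms]
  have "P *\<^sub>v (u - v) = 0\<^sub>v n" using P uv mult_mat_vec_carrier[OF P uv(2)]
    by (simp add: mult_minus_distrib_mat_vec) 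
  hence "u - v = 0\<^sub>v m" using assms uv by (simp add: mat_inj_def)
  thus "u = v" using uv by (auto simp: vec_eq_iff)
qed

text \<open>An injective self-map of the finite set k^n is bijective, and the inverse of a linear
  bijection is linear, so it comes from a matrix.\<close>

lemma mat_inj_square: "mat_inj n n = (GL n :: 'a::{finite,field} mat set)"
proof (intro equalityI subsetI)
  fix g :: "'a mat" assume g: "g \<in> mat_inj n n"
  note gc = mat_inj_carrier[OF g]
  let ?V = "carrier_vec n :: 'a vec set"
  have surj: "(\<lambda>u. g *\<^sub>v u) ` ?V = ?V"
    using gc mat_inj_inj_on[OF g] by (intro endo_inj_surj) auto
  define F where "F u = inv_into ?V (\<lambda>u. g *\<^sub>v u) u" for u
  have F: "F u \<in> ?V" "g *\<^sub>v F u = u" if "u \<in> ?V" for u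
    using that surj inv_into_into[of u "\<lambda>u. g *\<^sub>v u" ?V] f_inv_into_f[of u "\<lambda>u. g *\<^sub>v u" ?V] by (auto simp: F_def)
  have Feq: "F u = w" if "u \<in> ?V" "w \<in> ?V" "g *\<^sub>v w = u" for u w
    using that F[of u] mat_inj_inj_on[OF g] by (auto dest: inj_onD)
  have "\<exists>M\<in>carrier_mat n n. \<forall>u\<in>?V. M *\<^sub>v u = F u"
  proof (rule linear_map_matrix)
    fix u v :: "'a vec" assume u: "u \<in> ?V" "v \<in> ?V"
    show "F (u + v) = F u + F v"
      using u F gc by (intro Feq) (simp_all add: mult_add_distrib_mat_vec)
  next
    fix c and u :: "'a vec" assume u: "u \<in> ?V"
    show "F (c \<cdot>\<^sub>v u) = c \<cdot>\<^sub>v F u" using u F gc by (intro Feq) (simp_all add: mult_mat_vec)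
  qed (rule F)
  then obtain M where M: "M \<in> carrier_mat n n" "\<forall>u\<in>?V. M *\<^sub>v u = F u" by blast
  have "g * M = 1\<^sub>m n"
    using gc M F by (intro mat_eqI_vec[of _ n n]) (auto simp: assoc_mult_mat_vec[of _ n n _ n])
  moreover have "M * g = 1\<^sub>m n"
    using gc M F Feq by (intro mat_eqI_vec[of _ n n]) (auto simp: assoc_mult_mat_vec[of _ n n _ n])
  ultimately show "g \<in> GL n" using gc M by (auto simp: GL_def)
next
  fix g :: "'a mat" assume g: "g \<in> GL n"
  have "u = 0\<^sub>v n" if u: "u \<in> carrier_vec n" "g *\<^sub>v u = 0\<^sub>v n" for u
  proof -
    have "u = minv n g *\<^sub>v (g *\<^sub>v u)"
      using assoc_mult_mat_vec[OF minv(1)[OF g] GL_carrier[OF g] u(1)] minv(3)[OF g] u(1) by simp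
    thus ?thesis using u(2) mult_mat_zero_vec[of "minv n g" n] minv(1)[OF g] by auto
  qed
  thus "g \<in> mat_inj n n" using GL_carrier[OF g] by (auto simp: mat_inj_def)
qed

lemma GL_mult_mat_inj:
  assumes "g \<in> GL n" "P \<in> mat_inj n m"
  shows "g * P \<in> mat_inj n m"
proof -
  note gc = GL_carrier[OF assms(1)] and P = mat_inj_carrier[OF assms(2)]
  have "u = 0\<^sub>v m" if u: "u \<in> carrier_vec m" "g * P *\<^sub>v u = 0\<^sub>v n" for u
  proof -
    have w: "P *\<^sub>v u \<in> carrier_vec n" using P u by auto
    have "P *\<^sub>v u = minv n g *\<^sub>v (g *\<^sub>v (P *\<^sub>v u))"
      using assoc_mult_mat_vec[OF minv(1)[OF assms(1)] gc w] minv(3)[OF assms(1)] w by simp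
    also have "g *\<^sub>v (P *\<^sub>v u) = 0\<^sub>v n" using assoc_mult_mat_vec[OF gc P u(1)] u(2) by simp
    also have "minv n g *\<^sub>v 0\<^sub>v n = 0\<^sub>v n" using minv(1)[OF assms(1)] by (intro eq_vecI) auto
    finally show ?thesis using assms(2) u(1) by (simp add: mat_inj_def)
  qed
  thus ?thesis using gc P by (auto simp: mat_inj_def)
qed

lemma first_cols_mat_inj: "first_cols j l \<in> mat_inj (j + l) j"
proof -
  have "u = 0\<^sub>v j" if u: "u \<in> carrier_vec j" "first_cols j l *\<^sub>v u = 0\<^sub>v (j + l)" for u :: "'a vec"
  proof (rule eq_vecI)
    fix i assume i: "i < dim_vec (0\<^sub>v j :: 'a vec)"
    have "(first_cols j l *\<^sub>v u) $ i = (\<Sum>k<j. (if i = k then 1 else 0) * u $ k)"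
      using u(1) i by (simp add: scalar_prod_def first_cols_def atLeast0LessThan)
    also have "\<dots> = u $ i" using i by (simp add: if_distrib[of "\<lambda>x. x * _"] cong: if_cong)
    finally show "u $ i = 0\<^sub>v j $ i" using u i by simp
  qed (use u in auto)
  thus ?thesis by (auto simp: mat_inj_def)
qed

text \<open>The image of P has at most q ^ m < q ^ n elements. A vector outside it can serve as the
  new column, since a relation in which it had a nonzero coefficient would put it into the
  image.\<close>

lemma mat_inj_append_col:
  fixes P :: "'a::{finite,field} mat"
  assumes P: "P \<in> mat_inj n m" and mn: "m < n"
  shows "\<exists>Q\<in>mat_inj n (Suc m). \<forall>i<n. \<forall>k<m. Q $$ (i, k) = P $$ (i, k)"
proof -
  note Pc = mat_inj_carrier[OF P]
  let ?im = "(\<lambda>u. P *\<^sub>v u) ` (carrier_vec m :: 'a vec set)"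
  have "card {0, 1 :: 'a} \<le> CARD('a)" by (intro card_mono) auto
  hence q: "1 < CARD('a)" by simp
  have "card ?im \<le> CARD('a) ^ m" using card_image_le[of "carrier_vec m :: 'a vec set" "\<lambda>u. P *\<^sub>v u"] by (simp add: card_carrier_vec)
  also have "\<dots> < CARD('a) ^ n" using q mn by (rule power_strict_increasing[rotated])
  also have "\<dots> = card (carrier_vec n :: 'a vec set)" by (simp add: card_carrier_vec)
  finally have "\<not> carrier_vec n \<subseteq> ?im" using card_mono[of ?im "carrier_vec n"] by auto
  then obtain c where c: "c \<in> carrier_vec n" "c \<notin> ?im" by blast
  define Q where "Q = mat n (Suc m) (\<lambda>(i, k). if k < m then P $$ (i, k) else c $ i)"
  have Qu: "Q *\<^sub>v u = P *\<^sub>v vec m (\<lambda>k. u $ k) + u $ m \<cdot>\<^sub>v c" if u: "u \<in> carrier_vec (Suc m)" for u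
  proof (rule eq_vecI)
    fix i assume "i < dim_vec (P *\<^sub>v vec m (\<lambda>k. u $ k) + u $ m \<cdot>\<^sub>v c)"
    hence i: "i < n" using c by simp
    have "(Q *\<^sub>v u) $ i = (\<Sum>k<Suc m. (if k < m then P $$ (i, k) else c $ i) * u $ k)"
      using i u by (simp add: scalar_prod_def Q_def atLeast0LessThan)
    also have "\<dots> = (\<Sum>k<m. P $$ (i, k) * u $ k) + c $ i * u $ m" by simp
    finally show "(Q *\<^sub>v u) $ i = (P *\<^sub>v vec m (\<lambda>k. u $ k) + u $ m \<cdot>\<^sub>v c) $ i"
      using i u Pc c by (simp add: scalar_prod_def atLeast0LessThan mult.commute)
  qed (use Pc c in \<open>simp add: Q_def\<close>)
  have "u = 0\<^sub>v (Suc m)" if u: "u \<in> carrier_vec (Suc m)" "Q *\<^sub>v u = 0\<^sub>v n" for u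
  proof -
    define w where "w = vec m (\<lambda>k. u $ k)"
    have w: "w \<in> carrier_vec m" by (simp add: w_def)
    have 0: "P *\<^sub>v w + u $ m \<cdot>\<^sub>v c = 0\<^sub>v n" using Qu[OF u(1)] u(2) by (simp add: w_def)
    have um: "u $ m = 0"
    proof (rule ccontr)
      assume nz: "u $ m \<noteq> 0"
      have "c = P *\<^sub>v ((- inverse (u $ m)) \<cdot>\<^sub>v w)"
      proof (rule eq_vecI)
        fix i assume "i < dim_vec (P *\<^sub>v ((- inverse (u $ m)) \<cdot>\<^sub>v w))"
        hence i: "i < n" using Pc by simp
        have "(P *\<^sub>v w) $ i + u $ m * c $ i = 0" using arg_cong[OF 0, of "\<lambda>v. v $ i"] i c by simp
        hence "c $ i = - inverse (u $ m) * (P *\<^sub>v w) $ i" using nz by (simp add: field_simps add_eq_0_iff)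
        thus "c $ i = (P *\<^sub>v ((- inverse (u $ m)) \<cdot>\<^sub>v w)) $ i" using i Pc w by (simp add: mult_mat_vec)
      qed (use c Pc in auto)
      moreover have "(- inverse (u $ m)) \<cdot>\<^sub>v w \<in> carrier_vec m" using w by simp
      ultimately show False using c(2) by blast
    qed
    have "P *\<^sub>v w = 0\<^sub>v n" using 0 um c Pc by (auto simp: vec_eq_iff)
    hence "w = 0\<^sub>v m" using P w by (simp add: mat_inj_def)
    hence "u $ k = 0" if "k < Suc m" for k
      using that um by (cases "k = m") (auto simp: w_def vec_eq_iff)
    thus ?thesis using u(1) by (intro eq_vecI) auto
  qed
  hence "Q \<in> mat_inj n (Suc m)" by (auto simp: mat_inj_def Q_def)
  thus ?thesis by (intro bexI[of _ Q]) (auto simp: Q_def)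
qed

lemma mat_inj_complete:
  fixes P :: "'a::{finite,field} mat"
  assumes "P \<in> mat_inj (j + l) j"
  shows "\<exists>g\<in>GL (j + l). g * first_cols j l = P"
proof -
  have ex: "\<exists>g\<in>mat_inj n n. \<forall>i<n. \<forall>k<m. g $$ (i, k) = P $$ (i, k)" if "P \<in> mat_inj n m" "n = m + d"
    for n m d and P :: "'a mat"
    using that
  proof (induction d arbitrary: m P)
    case 0
    thus ?case by auto
  next
    case (Suc d)
    obtain Q where Q: "Q \<in> mat_inj n (Suc m)" "\<forall>i<n. \<forall>k<m. Q $$ (i, k) = P $$ (i, k)"
      using mat_inj_append_col[OF Suc.prems(1)] Suc.prems(2) by auto
    obtain g where "g \<in> mat_inj n n" "\<forall>i<n. \<forall>k<Suc m. g $$ (i, k) = Q $$ (i, k)"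
      using Suc.IH[OF Q(1)] Suc.prems(2) by auto
    thus ?case using Q(2) by (intro bexI[of _ g]) auto
  qed
  obtain g where g: "g \<in> mat_inj (j + l) (j + l)" "\<forall>i<j + l. \<forall>k<j. g $$ (i, k) = P $$ (i, k)"
    using ex[OF assms, of l] by auto
  have "g * first_cols j l = P"
    using mat_inj_carrier[OF g(1)] mat_inj_carrier[OF assms] first_cols_carrier[of j l] g(2)
    by (intro eq_matI) (auto simp del: index_mult_mat(1) simp add: mult_first_cols)
  thus ?thesis using g(1) mat_inj_square by blast
qed

lemma upper_block_one: "upper_block j l (1\<^sub>m j) (0\<^sub>m j l) (1\<^sub>m l) = (1\<^sub>m (j + l) :: 'a::field mat)"
  by (intro eq_matI) (auto simp: upper_block_def)

lemma upper_block_GL_iff: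
  assumes U: "U \<in> carrier_mat j l" and D: "D \<in> carrier_mat l l"
  shows "upper_block j l (1\<^sub>m j) U D \<in> GL (j + l) \<longleftrightarrow> (D :: 'a::field mat) \<in> GL l"
proof
  let ?E = "first_cols j l :: 'a mat"
  assume g: "upper_block j l (1\<^sub>m j) U D \<in> GL (j + l)"
  let ?g = "upper_block j l (1\<^sub>m j) U D"
  have E1: "?E * 1\<^sub>m j = ?E" by (rule right_mult_one_mat[OF first_cols_carrier])
  have "?g * ?E = ?E * 1\<^sub>m j" using first_cols_intertwine_iff[of ?g j l "1\<^sub>m j"] U D by auto
  hence "minv (j + l) ?g * ?E = minv (j + l) ?g * (?g * ?E)" using E1 by simp
  also have "\<dots> = ?E * 1\<^sub>m j" using GL_cancel(1)[OF g, of ?E j] E1 by simp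
  finally obtain U' D' where U': "U' \<in> carrier_mat j l" "D' \<in> carrier_mat l l"
    "minv (j + l) ?g = upper_block j l (1\<^sub>m j) U' D'"
    using first_cols_intertwine_iff[of "minv (j + l) ?g" j l "1\<^sub>m j"] minv(1)[OF g] by auto
  have "D * D' = 1\<^sub>m l"
    using minv(2)[OF g] U' U D upper_block_eq_iff[of "1\<^sub>m j" j "1\<^sub>m j * U' + U * D'" l "D * D'" "1\<^sub>m j" "0\<^sub>m j l" "1\<^sub>m l"]
    by (simp add: upper_block_mult[of _ j _ l] flip: upper_block_one)
  moreover have "D' * D = 1\<^sub>m l"
    using minv(3)[OF g] U' U D upper_block_eq_iff[of "1\<^sub>m j" j "1\<^sub>m j * U + U' * D" l "D' * D" "1\<^sub>m j" "0\<^sub>m j l" "1\<^sub>m l"]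
    by (simp add: upper_block_mult[of _ j _ l] flip: upper_block_one)
  ultimately show "D \<in> GL l" using D U' by (auto simp: GL_def)
next
  assume g: "D \<in> GL l"
  note m = minv[OF g]
  define U' where "U' = 0\<^sub>m j l - U * minv l D"
  have c: "U' \<in> carrier_mat j l" using U m unfolding U'_def by (intro minus_carrier_mat) auto
  have UmD: "U * minv l D \<in> carrier_mat j l" using U m by auto
  have 1: "1\<^sub>m j * U' + U * minv l D = 0\<^sub>m j l"
    using c UmD left_mult_one_mat[OF c] U m(1) unfolding U'_def by (intro eq_matI) auto
  have "U' * D = 0\<^sub>m j l * D - U * minv l D * D" unfolding U'_def using UmD D
    by (intro minus_mult_distrib_mat) auto
  also have "U * minv l D * D = U" using GL_cancel_right(2)[OF g U] .
  finally have 2: "1\<^sub>m j * U + U' * D = 0\<^sub>m j l" using U D by (intro eq_matI) auto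
  have "upper_block j l (1\<^sub>m j) U D * upper_block j l (1\<^sub>m j) U' (minv l D) = 1\<^sub>m (j + l)"
    using U D c m 1 by (simp add: upper_block_mult[of _ j _ l] upper_block_one)
  moreover have "upper_block j l (1\<^sub>m j) U' (minv l D) * upper_block j l (1\<^sub>m j) U D = 1\<^sub>m (j + l)"
    using U D c m 2 by (simp add: upper_block_mult[of _ j _ l] upper_block_one)
  moreover have "upper_block j l (1\<^sub>m j) U' (minv l D) \<in> carrier_mat (j + l) (j + l)" using m by simp
  moreover have "upper_block j l (1\<^sub>m j) U D \<in> carrier_mat (j + l) (j + l)" using D by simp
  ultimately show "upper_block j l (1\<^sub>m j) U D \<in> GL (j + l)" unfolding GL_def by blast
qed

lemma finite_GL [simp]: "finite (GL n :: 'a::{finite,field} mat set)"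
  by (rule finite_subset[OF _ finite_carrier_mat[of n n]]) (auto simp: GL_def)

text \<open>The completions of P form one coset g0 S of the stabiliser S of the first j unit
  vectors, which consists of the block triangular matrices with blocks 1, U, D and D
  invertible.\<close>

lemma card_completions:
  fixes P :: "'a::{finite,field} mat"
  assumes P: "P \<in> mat_inj (j + l) j"
  shows "card {g \<in> GL (j + l). g * first_cols j l = P} = CARD('a) ^ (j * l) * card (GL l :: 'a mat set)"
proof -
  let ?E = "first_cols j l :: 'a mat" and ?n = "j + l"
  obtain g0 where g0: "g0 \<in> GL ?n" "g0 * ?E = P" using mat_inj_complete[OF P] by blast
  note g0c = GL_carrier[OF g0(1)]
  let ?f = "\<lambda>(U, D). g0 * upper_block j l (1\<^sub>m j) U D"
  have E1: "?E * 1\<^sub>m j = ?E" by (rule right_mult_one_mat[OF first_cols_carrier])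
  have "bij_betw ?f (carrier_mat j l \<times> GL l) {g \<in> GL ?n. g * ?E = P}"
    unfolding bij_betw_def
  proof
    show "inj_on ?f (carrier_mat j l \<times> GL l)"
    proof (rule inj_onI, clarify)
      fix U D U' D' assume c: "U \<in> carrier_mat j l" "D \<in> GL l" "U' \<in> carrier_mat j l" "D' \<in> GL l"
        and eq: "g0 * upper_block j l (1\<^sub>m j) U D = g0 * upper_block j l (1\<^sub>m j) U' D'"
      note k = GL_carrier[OF c(2)] GL_carrier[OF c(4)]
      have "upper_block j l (1\<^sub>m j) U D = upper_block j l (1\<^sub>m j) U' D'"
        using arg_cong[OF eq, of "\<lambda>M. minv ?n g0 * M"]
          GL_cancel(1)[OF g0(1), of "upper_block j l (1\<^sub>m j) U D" ?n] GL_cancel(1)[OF g0(1), of "upper_block j l (1\<^sub>m j) U' D'" ?n] k by simp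
      thus "U = U' \<and> D = D'" using upper_block_eq_iff[of "1\<^sub>m j" j U l D "1\<^sub>m j" U' D'] c k by simp
    qed
    show "?f ` (carrier_mat j l \<times> GL l) = {g \<in> GL ?n. g * ?E = P}"
    proof (intro equalityI subsetI)
      fix g assume "g \<in> ?f ` (carrier_mat j l \<times> GL l)"
      then obtain U D where UD: "U \<in> carrier_mat j l" "D \<in> GL l" "g = g0 * upper_block j l (1\<^sub>m j) U D" by auto
      note Dc = GL_carrier[OF UD(2)]
      let ?B = "upper_block j l (1\<^sub>m j) U D"
      have B: "?B \<in> GL ?n" using upper_block_GL_iff[OF UD(1) Dc] UD(2) by simp
      have "?B * ?E = ?E * 1\<^sub>m j" using first_cols_intertwine_iff[of ?B j l "1\<^sub>m j"] UD Dc by auto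
      hence "g * ?E = P" using assoc_mult_mat[OF g0c GL_carrier[OF B] first_cols_carrier] g0(2) E1 UD(3) by simp
      thus "g \<in> {g \<in> GL ?n. g * ?E = P}" using GL_mult[OF g0(1) B] UD(3) by simp
    next
      fix g assume "g \<in> {g \<in> GL ?n. g * ?E = P}"
      hence g: "g \<in> GL ?n" "g * ?E = P" by auto
      note gc = GL_carrier[OF g(1)]
      define M where "M = minv ?n g0 * g"
      have M: "M \<in> GL ?n" unfolding M_def using minv_GL[OF g0(1)] g(1) by (rule GL_mult)
      have "M * ?E = minv ?n g0 * (g0 * ?E)" unfolding M_def g0(2) g(2)[symmetric]
        using minv(1)[OF g0(1)] gc by (intro assoc_mult_mat) auto
      also have "\<dots> = ?E * 1\<^sub>m j" using GL_cancel(1)[OF g0(1) first_cols_carrier] E1 by simp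
      finally obtain U D where UD: "U \<in> carrier_mat j l" "D \<in> carrier_mat l l" "M = upper_block j l (1\<^sub>m j) U D"
        using first_cols_intertwine_iff[of M j l "1\<^sub>m j"] GL_carrier[OF M] by auto
      have "D \<in> GL l" using upper_block_GL_iff[OF UD(1,2)] M UD(3) by simp
      moreover have "g = g0 * M" unfolding M_def using GL_cancel(2)[OF g0(1) gc] by simp
      ultimately show "g \<in> ?f ` (carrier_mat j l \<times> GL l)" using UD by (intro image_eqI[of _ _ "(U, D)"]) auto
    qed
  qed
  from bij_betw_same_card[OF this] show ?thesis by (simp add: card_cartesian_product card_carrier_mat)
qed

lemma mat_inj_col: "mat_inj n 1 = (\<lambda>v. mat n 1 (\<lambda>(i, k). v $ i)) ` (carrier_vec n - {0\<^sub>v n :: 'a::field vec})"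
proof -
  have mv: "mat n 1 (\<lambda>(i, k). v $ i) *\<^sub>v u = u $ 0 \<cdot>\<^sub>v v" if "v \<in> carrier_vec n" "u \<in> carrier_vec 1" for u v :: "'a vec"
    using that by (intro eq_vecI) (auto simp: scalar_prod_def)
  show ?thesis
  proof (intro equalityI subsetI)
    fix P :: "'a mat" assume P: "P \<in> mat_inj n 1"
    note Pc = mat_inj_carrier[OF P]
    define v where "v = col P 0"
    have v: "v \<in> carrier_vec n" using Pc by (intro carrier_vecI) (auto simp: v_def)
    have Pe: "P = mat n 1 (\<lambda>(i, k). v $ i)" using Pc by (intro eq_matI) (auto simp: v_def)
    have "v \<noteq> 0\<^sub>v n"
    proof
      assume v0: "v = 0\<^sub>v n"
      have "P *\<^sub>v unit_vec 1 0 = 0\<^sub>v n" unfolding Pe using mv[OF v, of "unit_vec 1 0"] v0 by (auto intro!: eq_vecI)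
      hence "unit_vec 1 0 = (0\<^sub>v 1 :: 'a vec)" using P by (simp add: mat_inj_def)
      thus False by (metis index_unit_vec(1) index_zero_vec(1) less_one zero_neq_one)
    qed
    thus "P \<in> (\<lambda>v. mat n 1 (\<lambda>(i, k). v $ i)) ` (carrier_vec n - {0\<^sub>v n})" using Pe v by blast
  next
    fix P :: "'a mat" assume "P \<in> (\<lambda>v. mat n 1 (\<lambda>(i, k). v $ i)) ` (carrier_vec n - {0\<^sub>v n})"
    then obtain v where v: "v \<in> carrier_vec n" "v \<noteq> 0\<^sub>v n" "P = mat n 1 (\<lambda>(i, k). v $ i)" by auto
    have "u = 0\<^sub>v 1" if u: "u \<in> carrier_vec 1" "P *\<^sub>v u = 0\<^sub>v n" for u
    proof -
      have e: "u $ 0 \<cdot>\<^sub>v v = 0\<^sub>v n" using mv[OF v(1) u(1)] u(2) v(3) by simp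
      obtain i where i: "i < n" "v $ i \<noteq> 0" using v by (auto simp: vec_eq_iff)
      have "u $ 0 * v $ i = 0" using arg_cong[OF e, of "\<lambda>w. w $ i"] i v(1) by simp
      thus ?thesis using i u(1) by (intro eq_vecI) auto
    qed
    thus "P \<in> mat_inj n 1" using v by (auto simp: mat_inj_def)
  qed
qed

lemma card_GL_0: "card (GL 0 :: 'a::field mat set) = 1"
proof -
  have "GL 0 = {1\<^sub>m 0 :: 'a mat}" by (auto simp: GL_def intro!: eq_matI)
  thus ?thesis by simp
qed

text \<open>The first column is any nonzero vector, and each choice is completed in q ^ l * card (GL
  l) ways.\<close>

lemma card_GL_Suc:
  "card (GL (Suc l) :: 'a::{finite,field} mat set) = (CARD('a) ^ Suc l - 1) * CARD('a) ^ l * card (GL l :: 'a mat set)"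
proof -
  let ?E = "first_cols 1 l :: 'a mat"
  have dec: "GL (1 + l) = (\<Union>P\<in>mat_inj (1 + l) 1. {g \<in> GL (1 + l). g * ?E = (P :: 'a mat)})"
    using GL_mult_mat_inj[OF _ first_cols_mat_inj[of 1 l]] by blast
  have "card (mat_inj (1 + l) 1 :: 'a mat set) = card (carrier_vec (1 + l) - {0\<^sub>v (1 + l) :: 'a vec})"
    unfolding mat_inj_col
  proof (rule card_image, rule inj_onI)
    fix v w :: "'a vec" assume v: "v \<in> carrier_vec (1 + l) - {0\<^sub>v (1 + l)}" "w \<in> carrier_vec (1 + l) - {0\<^sub>v (1 + l)}"
      and eq: "mat (1 + l) 1 (\<lambda>(i, k). v $ i) = mat (1 + l) 1 (\<lambda>(i, k). w $ i)"
    have "v $ i = w $ i" if "i < 1 + l" for i using arg_cong[OF eq, of "\<lambda>M. M $$ (i, 0)"] that by simp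
    thus "v = w" using v by (intro eq_vecI) auto
  qed
  also have "\<dots> = CARD('a) ^ (1 + l) - 1" by (subst card_Diff_singleton) (simp_all add: card_carrier_vec)
  finally have cI: "card (mat_inj (1 + l) 1 :: 'a mat set) = CARD('a) ^ (1 + l) - 1" .
  have finI: "finite (mat_inj (1 + l) 1 :: 'a mat set)" unfolding mat_inj_col by simp
  have "card (GL (1 + l) :: 'a mat set) = (\<Sum>P\<in>mat_inj (1 + l) 1. card {g \<in> GL (1 + l). g * ?E = P})"
    by (subst dec, rule card_UN_disjoint) (use finI in auto)
  also have "\<dots> = (\<Sum>P\<in>(mat_inj (1 + l) 1 :: 'a mat set). CARD('a) ^ (1 * l) * card (GL l :: 'a mat set))"
    by (intro sum.cong refl card_completions)
  finally show ?thesis using cI by simp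
qed

lemma legendre_pairs_conj:
  assumes g: "g \<in> GL n" and AB: "(A, B) \<in> legendre_pairs a n"
  shows "(g * A * minv n g, g * B * minv n g) \<in> legendre_pairs a n"
proof -
  note c = legendre_pairsD[OF AB] and gc = GL_carrier[OF g] and m = minv[OF g]
  have mul: "(g * M * minv n g) * (g * N * minv n g) = g * (M * N) * minv n g"
    if MN: "M \<in> carrier_mat n n" "N \<in> carrier_mat n n" for M N
  proof -
    have k: "g * M \<in> carrier_mat n n" "g * N \<in> carrier_mat n n" "N * minv n g \<in> carrier_mat n n"
      using MN gc m by auto
    have e: "g * N * minv n g = g * (N * minv n g)" using gc MN(2) m(1) by (rule assoc_mult_mat)
    have "(g * M * minv n g) * (g * N * minv n g) = g * M * (minv n g * (g * (N * minv n g)))"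
      unfolding e using k m MN gc by (intro assoc_mult_mat) auto
    also have "minv n g * (g * (N * minv n g)) = N * minv n g" using GL_cancel(1)[OF g k(3)] .
    also have "g * M * (N * minv n g) = g * M * N * minv n g" using k(1) MN(2) m(1) by (rule assoc_mult_mat[symmetric])
    also have "g * M * N = g * (M * N)" using gc MN by (rule assoc_mult_mat)
    finally show ?thesis .
  qed
  have one: "g * M * minv n g - b \<cdot>\<^sub>m 1\<^sub>m n = g * (M - b \<cdot>\<^sub>m 1\<^sub>m n) * minv n g"
    if M: "M \<in> carrier_mat n n" for M b
  proof -
    have k: "b \<cdot>\<^sub>m 1\<^sub>m n \<in> carrier_mat n n" by simp
    have "g * (M - b \<cdot>\<^sub>m 1\<^sub>m n) * minv n g = (g * M - g * (b \<cdot>\<^sub>m 1\<^sub>m n)) * minv n g"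
      using mult_minus_distrib_mat[OF gc M k] by simp
    also have "\<dots> = g * M * minv n g - g * (b \<cdot>\<^sub>m 1\<^sub>m n) * minv n g"
      using gc M k m by (intro minus_mult_distrib_mat) auto
    also have "g * (b \<cdot>\<^sub>m 1\<^sub>m n) = b \<cdot>\<^sub>m g" using mult_smult_distrib[OF gc one_carrier_mat] gc by simp
    also have "(b \<cdot>\<^sub>m g) * minv n g = b \<cdot>\<^sub>m 1\<^sub>m n" using mult_smult_assoc_mat[OF gc m(1)] m by simp
    finally show ?thesis by simp
  qed
  have 1: "1\<^sub>m n = (1::'a) \<cdot>\<^sub>m 1\<^sub>m n" by (intro eq_matI) auto
  have c1: "A - b \<cdot>\<^sub>m 1\<^sub>m n \<in> carrier_mat n n" for b using c(1) by (intro minus_carrier_mat) auto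
  have c2: "A * (A - b \<cdot>\<^sub>m 1\<^sub>m n) \<in> carrier_mat n n" for b using mult_carrier_mat[OF c(1) c1] .
  have "legendre_mat a n (g * A * minv n g) = g * legendre_mat a n A * minv n g"
    unfolding legendre_mat_def one[OF c(1), of a] one[OF c(1), of 1, folded 1]
      mul[OF c(1) c1[of 1, folded 1]] mul[OF c2[of 1, folded 1] c1[of a]] ..
  moreover have "(g * A * minv n g) * (g * B * minv n g) = (g * B * minv n g) * (g * A * minv n g)"
    using mul c by simp
  moreover have "(g * B * minv n g) * (g * B * minv n g) = g * legendre_mat a n A * minv n g" using mul c by simp
  moreover have "g * A * minv n g \<in> carrier_mat n n" "g * B * minv n g \<in> carrier_mat n n" using gc c m by auto
  ultimately show ?thesis by (simp add: legendre_pairs_def)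
qed

lemma finite_legendre_pairs [simp]: "finite (legendre_pairs (a :: 'a::{finite,field}) n)"
  by (rule finite_subset[of _ "carrier_mat n n \<times> carrier_mat n n"]) (auto simp: legendre_pairs_def)

lemma GL_conj_eq:
  assumes g: "g \<in> GL n" and A: "A \<in> carrier_mat n n" and E: "E \<in> carrier_mat n j" and A': "A' \<in> carrier_mat j j"
  shows "A * E = E * A' \<longleftrightarrow> (g * A * minv n g) * (g * E) = (g * E) * A'"
proof -
  note gc = GL_carrier[OF g] and m = minv[OF g]
  have "(g * A * minv n g) * (g * E) = g * A * (minv n g * (g * E))" using gc A m E by (intro assoc_mult_mat) auto
  also have "\<dots> = g * (A * E)" using GL_cancel(1)[OF g E] assoc_mult_mat[OF gc A E] by simp
  finally have 1: "(g * A * minv n g) * (g * E) = g * (A * E)" .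
  have 2: "(g * E) * A' = g * (E * A')" using gc E A' by (rule assoc_mult_mat)
  have "A * E = E * A'" if "g * (A * E) = g * (E * A')"
    using arg_cong[OF that, of "\<lambda>M. minv n g * M"] GL_cancel(1)[OF g, of "A * E" j] GL_cancel(1)[OF g, of "E * A'" j] A E A' by simp
  thus ?thesis unfolding 1 2 by auto
qed

(* Both sides count the pairs of a point (A, B, v) with annihilator J and a basis of the ambient space
   whose first vectors are the standard basis of the cyclic module R/J. *)
lemma card_ann_ideal:
  fixes a :: "'a::{finite,field}"
  assumes a: "a \<noteq> 0" "a \<noteq> 1" and two: "(2::'a) \<noteq> 0" and J: "J \<in> ideals (legendre_poly a) j"
  shows "card {((A, B), v). (A, B) \<in> legendre_pairs a (j + l) \<and> v \<in> carrier_vec (j + l) \<and> ann_ideal A B (j + l) v = J}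
     * card (GL l :: 'a mat set) = card (GL (j + l) :: 'a mat set) * card (legendre_pairs a l)"
proof -
  let ?n = "j + l" and ?E = "first_cols j l :: 'a mat" and ?q = "CARD('a)"
  obtain A' B' v' where AB': "(A', B') \<in> legendre_pairs a j" and v': "v' \<in> carrier_vec j"
    and ann': "ann_ideal A' B' j v' = J" and gen: "\<And>u. u \<in> carrier_vec j \<Longrightarrow> \<exists>r. u = curve_act A' B' r v'"
    using cyclic_module_exists[OF J] by blast
  note c' = legendre_pairsD[OF AB']
  define S where "S = {((A, B), v). (A, B) \<in> legendre_pairs a ?n \<and> v \<in> carrier_vec ?n \<and> ann_ideal A B ?n v = J}"
  define good where "good = (\<lambda>((A, B), v) P. A * P = P * A' \<and> B * P = P * B' \<and> P *\<^sub>v v' = v)"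
  \<comment> \<open>The bases whose first j vectors are the images of the standard basis of the
    model under a module map that sends its generator to v.\<close>
  define T where "T x = {g \<in> GL ?n. good x (g * ?E)}" for x
  have finS: "finite S"
    by (rule finite_subset[of _ "legendre_pairs a ?n \<times> carrier_vec ?n"]) (auto simp: S_def)
  \<comment> \<open>By \<open>cyclic_intertwiner\<close> there is exactly one such module map, so
    only its completions to a basis are counted.\<close>
  have cT: "card (T x) = ?q ^ (j * l) * card (GL l :: 'a mat set)" if x: "x \<in> S" for x
  proof -
    obtain A B v where xx: "x = ((A, B), v)" by (metis prod.exhaust)
    have AB: "(A, B) \<in> legendre_pairs a ?n" "v \<in> carrier_vec ?n" "ann_ideal A B ?n v = J" using x xx by (auto simp: S_def)
    have "\<exists>!P. P \<in> mat_inj ?n j \<and> good x P"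
      using cyclic_intertwiner[OF AB(1,2) AB' v' gen] ann' AB(3) by (simp add: good_def xx)
    then obtain P where P: "P \<in> mat_inj ?n j" "good x P" and un: "\<And>Q. Q \<in> mat_inj ?n j \<Longrightarrow> good x Q \<Longrightarrow> Q = P" by blast
    have "T x = {g \<in> GL ?n. g * ?E = P}"
      unfolding T_def using P un GL_mult_mat_inj[OF _ first_cols_mat_inj[of j l]] by blast
    thus ?thesis using card_completions[OF P(1)] by simp
  qed
  have "card (SIGMA x : S. T x) = (\<Sum>x\<in>S. card (T x))"
    using finS by (intro card_SigmaI) (auto simp: T_def)
  also have "\<dots> = card S * (?q ^ (j * l) * card (GL l :: 'a mat set))" using cT by simp
  finally have count1: "card (SIGMA x : S. T x) = card S * (?q ^ (j * l) * card (GL l :: 'a mat set))" .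

  \<comment> \<open>The pairs for which the first j coordinates form a submodule equal to the fixed
    model of R/J.\<close>
  define Y where "Y = {(A, B). (A, B) \<in> legendre_pairs a ?n \<and> A * ?E = ?E * A' \<and> B * ?E = ?E * B'}"
  let ?ext = "\<lambda>(D, F). {(U, V). U \<in> carrier_mat j l \<and> V \<in> carrier_mat j l \<and>
     (upper_block j l A' U D, upper_block j l B' V F) \<in> legendre_pairs a ?n}"
  have finext: "finite (?ext x)" for x
    by (rule finite_subset[of _ "carrier_mat j l \<times> carrier_mat j l"]) auto
  have "bij_betw (\<lambda>((D, F), (U, V)). (upper_block j l A' U D, upper_block j l B' V F))
     (SIGMA x : legendre_pairs a l. ?ext x) Y"
    unfolding bij_betw_def
  proof
    show "inj_on (\<lambda>((D, F), (U, V)). (upper_block j l A' U D, upper_block j l B' V F)) (SIGMA x : legendre_pairs a l. ?ext x)"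
    proof (rule inj_onI)
      fix x y
      assume x: "x \<in> (SIGMA x : legendre_pairs a l. ?ext x)" and y: "y \<in> (SIGMA x : legendre_pairs a l. ?ext x)"
        and xy: "(\<lambda>((D, F), (U, V)). (upper_block j l A' U D, upper_block j l B' V F)) x =
          (\<lambda>((D, F), (U, V)). (upper_block j l A' U D, upper_block j l B' V F)) y"
      obtain D F U V D2 F2 U2 V2 where z: "x = ((D, F), (U, V))" "y = ((D2, F2), (U2, V2))" by (metis prod.exhaust)
      have c: "(D, F) \<in> legendre_pairs a l" "(D2, F2) \<in> legendre_pairs a l" "U \<in> carrier_mat j l" "V \<in> carrier_mat j l"
        "U2 \<in> carrier_mat j l" "V2 \<in> carrier_mat j l"
        and eq: "upper_block j l A' U D = upper_block j l A' U2 D2" "upper_block j l B' V F = upper_block j l B' V2 F2"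
        using x y xy by (auto simp: z)
      note d = legendre_pairsD[OF c(1)] legendre_pairsD[OF c(2)]
      show "x = y" unfolding z
        using upper_block_eq_iff[OF c'(1) c(3) d(1) c'(1) c(5) d(5)] upper_block_eq_iff[OF c'(2) c(4) d(2) c'(2) c(6) d(6)] eq
        by simp
    qed
    show "(\<lambda>((D, F), (U, V)). (upper_block j l A' U D, upper_block j l B' V F)) ` (SIGMA x : legendre_pairs a l. ?ext x) = Y"
    proof (intro equalityI subsetI)
      fix y assume "y \<in> (\<lambda>((D, F), (U, V)). (upper_block j l A' U D, upper_block j l B' V F)) ` (SIGMA x : legendre_pairs a l. ?ext x)"
      then obtain D F U V where y: "y = (upper_block j l A' U D, upper_block j l B' V F)" "(D, F) \<in> legendre_pairs a l"
        "U \<in> carrier_mat j l" "V \<in> carrier_mat j l" "(upper_block j l A' U D, upper_block j l B' V F) \<in> legendre_pairs a ?n"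
        by auto
      note d = legendre_pairsD[OF y(2)]
      show "y \<in> Y" unfolding Y_def y(1)
        using y d c' first_cols_intertwine_iff[of "upper_block j l A' U D" j l A'] first_cols_intertwine_iff[of "upper_block j l B' V F" j l B']
        by auto
    next
      fix y assume "y \<in> Y"
      then obtain A B where y: "y = (A, B)" "(A, B) \<in> legendre_pairs a ?n" "A * ?E = ?E * A'" "B * ?E = ?E * B'"
        by (auto simp: Y_def)
      note d = legendre_pairsD[OF y(2)]
      obtain U D where U: "U \<in> carrier_mat j l" "D \<in> carrier_mat l l" "A = upper_block j l A' U D"
        using first_cols_intertwine_iff[OF d(1) c'(1)] y(3) by blast
      obtain V F where V: "V \<in> carrier_mat j l" "F \<in> carrier_mat l l" "B = upper_block j l B' V F"
        using first_cols_intertwine_iff[OF d(2) c'(2)] y(4) by blast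
      have "(D, F) \<in> legendre_pairs a l"
        using upper_block_legendre_pairs_iff[OF c'(1) U(1,2) c'(2) V(1,2), of a] y(2) U(3) V(3) by simp
      thus "y \<in> (\<lambda>((D, F), (U, V)). (upper_block j l A' U D, upper_block j l B' V F)) ` (SIGMA x : legendre_pairs a l. ?ext x)"
        using U V y by (intro image_eqI[of _ _ "((D, F), (U, V))"]) auto
    qed
  qed
  from bij_betw_same_card[OF this] have "card Y = card (SIGMA x : legendre_pairs a l. ?ext x)" by simp
  also have "\<dots> = (\<Sum>x\<in>legendre_pairs a l. card (?ext x))" using finext by (intro card_SigmaI) auto
  also have "\<dots> = (\<Sum>x\<in>legendre_pairs a l. ?q ^ (j * l))"
    using card_extensions[OF a two AB'] by (intro sum.cong refl) auto
  finally have cY: "card Y = card (legendre_pairs a l) * ?q ^ (j * l)" by simp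

  \<comment> \<open>Change of basis: in the coordinates given by the basis g, a pair with a vector
    of annihilator J becomes an element of \<open>Y\<close>.\<close>
  have "bij_betw (\<lambda>(g, (A, B)). (((g * A * minv ?n g, g * B * minv ?n g), (g * ?E) *\<^sub>v v'), g)) (GL ?n \<times> Y) (SIGMA x : S. T x)"
  proof (rule bij_betwI[where g = "\<lambda>(((A, B), v), g). (g, (minv ?n g * A * g, minv ?n g * B * g))"])
    show "(\<lambda>(g, (A, B)). (((g * A * minv ?n g, g * B * minv ?n g), (g * ?E) *\<^sub>v v'), g)) \<in> GL ?n \<times> Y \<rightarrow> (SIGMA x : S. T x)"
    proof (rule funcsetI)
      fix x assume "x \<in> (GL ?n :: 'a mat set) \<times> Y"
      then obtain g A B where x: "x = (g, (A, B))" and g: "g \<in> GL ?n" and "(A, B) \<in> Y" by auto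
      hence Y: "(A, B) \<in> legendre_pairs a ?n" "A * ?E = ?E * A'" "B * ?E = ?E * B'" by (auto simp: Y_def)
      note d = legendre_pairsD[OF Y(1)]
      let ?A = "g * A * minv ?n g" and ?B = "g * B * minv ?n g" and ?P = "g * ?E"
      have AB: "(?A, ?B) \<in> legendre_pairs a ?n" using legendre_pairs_conj[OF g Y(1)] .
      have Pi: "?P \<in> mat_inj ?n j" using GL_mult_mat_inj[OF g first_cols_mat_inj] .
      note Pc = mat_inj_carrier[OF Pi]
      have int: "?A * ?P = ?P * A'" "?B * ?P = ?P * B'"
        using GL_conj_eq[OF g d(1) first_cols_carrier c'(1)] GL_conj_eq[OF g d(2) first_cols_carrier c'(2)] Y by simp_all
      have v: "?P *\<^sub>v v' \<in> carrier_vec ?n" using Pc v' by (rule mult_mat_vec_carrier)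
      have "ann_ideal ?A ?B ?n (?P *\<^sub>v v') = ann_ideal A' B' j v'"
      proof -
        have "curve_act ?A ?B r (?P *\<^sub>v v') = 0\<^sub>v ?n \<longleftrightarrow> curve_act A' B' r v' = 0\<^sub>v j" for r
        proof -
          have e: "curve_act ?A ?B r (?P *\<^sub>v v') = ?P *\<^sub>v curve_act A' B' r v'"
            using intertwiner_act[OF AB AB' Pc int v'] by simp
          have "?P *\<^sub>v 0\<^sub>v j = 0\<^sub>v ?n" using Pc GL_carrier[OF g] by (intro eq_vecI) auto
          thus ?thesis unfolding e using Pi curve_act_carrier[OF AB' v', of r] by (auto simp: mat_inj_def)
        qed
        thus ?thesis by (simp add: ann_ideal_def)
      qed
      hence "((?A, ?B), ?P *\<^sub>v v') \<in> S" using AB v ann' by (simp add: S_def)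
      moreover have "g \<in> T ((?A, ?B), ?P *\<^sub>v v')" using g int by (simp add: T_def good_def)
      ultimately show "(\<lambda>(g, (A, B)). (((g * A * minv ?n g, g * B * minv ?n g), (g * ?E) *\<^sub>v v'), g)) x \<in> (SIGMA x : S. T x)"
        unfolding x by simp
    qed
    show "(\<lambda>(((A, B), v), g). (g, (minv ?n g * A * g, minv ?n g * B * g))) \<in> (SIGMA x : S. T x) \<rightarrow> GL ?n \<times> Y"
    proof (rule funcsetI)
      fix x assume "x \<in> (SIGMA x : S. T x)"
      then obtain A B v g where x: "x = (((A, B), v), g)" and "((A, B), v) \<in> S" and "g \<in> T ((A, B), v)" by auto
      hence AB: "(A, B) \<in> legendre_pairs a ?n" and g: "g \<in> GL ?n" and int: "A * (g * ?E) = (g * ?E) * A'" "B * (g * ?E) = (g * ?E) * B'"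
        by (auto simp: S_def T_def good_def)
      note d = legendre_pairsD[OF AB] and gc = GL_carrier[OF g] and m = minv[OF g]
      have dd: "minv ?n (minv ?n g) = g"
      proof -
        have m2: "minv ?n (minv ?n g) \<in> carrier_mat ?n ?n" "minv ?n g * minv ?n (minv ?n g) = 1\<^sub>m ?n"
          using minv[OF minv_GL[OF g]] by auto
        have "minv ?n (minv ?n g) = g * (minv ?n g * minv ?n (minv ?n g))" using GL_cancel(2)[OF g m2(1)] by simp
        thus ?thesis using m2(2) gc by simp
      qed
      let ?A = "minv ?n g * A * g" and ?B = "minv ?n g * B * g"
      have AB2: "(?A, ?B) \<in> legendre_pairs a ?n" using legendre_pairs_conj[OF minv_GL[OF g] AB] dd by simp
      note d2 = legendre_pairsD[OF AB2]
      have conj_back: "g * (minv ?n g * M * g) * minv ?n g = M" if M: "M \<in> carrier_mat ?n ?n" for M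
      proof -
        have "minv ?n g * M * g = minv ?n g * (M * g)" using m(1) M gc by (rule assoc_mult_mat)
        hence "g * (minv ?n g * M * g) = M * g" using GL_cancel(2)[OF g mult_carrier_mat[OF M gc]] by simp
        thus ?thesis using GL_cancel_right(1)[OF g M] by simp
      qed
      have "?A * ?E = ?E * A'" "?B * ?E = ?E * B'"
        using GL_conj_eq[OF g d2(1) first_cols_carrier c'(1)] GL_conj_eq[OF g d2(2) first_cols_carrier c'(2)]
          conj_back[OF d(1)] conj_back[OF d(2)] int by simp_all
      thus "(\<lambda>(((A, B), v), g). (g, (minv ?n g * A * g, minv ?n g * B * g))) x \<in> GL ?n \<times> Y"
        using g AB2 by (simp add: Y_def x)
    qed
    fix x assume "x \<in> (GL ?n :: 'a mat set) \<times> Y"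
    then obtain g A B where x: "x = (g, (A, B))" "g \<in> GL ?n" "(A, B) \<in> legendre_pairs a ?n" by (auto simp: Y_def)
    note d = legendre_pairsD[OF x(3)]
    have "minv ?n g * (g * M * minv ?n g) * g = M" if M: "M \<in> carrier_mat ?n ?n" for M
    proof -
      note gc = GL_carrier[OF x(2)] and m = minv[OF x(2)]
      have "g * M * minv ?n g = g * (M * minv ?n g)" using gc M m(1) by (rule assoc_mult_mat)
      hence "minv ?n g * (g * M * minv ?n g) = M * minv ?n g" using GL_cancel(1)[OF x(2) mult_carrier_mat[OF M m(1)]] by simp
      thus ?thesis using GL_cancel_right(2)[OF x(2) M] by simp
    qed
    thus "(\<lambda>(((A, B), v), g). (g, (minv ?n g * A * g, minv ?n g * B * g)))
      ((\<lambda>(g, (A, B)). (((g * A * minv ?n g, g * B * minv ?n g), (g * ?E) *\<^sub>v v'), g)) x) = x"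
      using d by (simp add: x(1))
  next
    fix y assume "y \<in> (SIGMA x : S. T x)"
    then obtain A B v g where y: "y = (((A, B), v), g)" "(A, B) \<in> legendre_pairs a ?n" "g \<in> GL ?n" "(g * ?E) *\<^sub>v v' = v"
      by (auto simp: S_def T_def good_def)
    note d = legendre_pairsD[OF y(2)]
    have "g * (minv ?n g * M * g) * minv ?n g = M" if M: "M \<in> carrier_mat ?n ?n" for M
    proof -
      note gc = GL_carrier[OF y(3)] and m = minv[OF y(3)]
      have "minv ?n g * M * g = minv ?n g * (M * g)" using m(1) M gc by (rule assoc_mult_mat)
      hence "g * (minv ?n g * M * g) = M * g" using GL_cancel(2)[OF y(3) mult_carrier_mat[OF M gc]] by simp
      thus ?thesis using GL_cancel_right(1)[OF y(3) M] by simp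
    qed
    thus "(\<lambda>(g, (A, B)). (((g * A * minv ?n g, g * B * minv ?n g), (g * ?E) *\<^sub>v v'), g))
      ((\<lambda>(((A, B), v), g). (g, (minv ?n g * A * g, minv ?n g * B * g))) y) = y"
      using d y(4) by (simp add: y(1))
  qed
  from bij_betw_same_card[OF this] have "card (SIGMA x : S. T x) = card (GL ?n :: 'a mat set) * card Y"
    by (simp add: card_cartesian_product)
  \<comment> \<open>The factor q ^ (j * l) from the completions on one side and from the extensions
    on the other cancels; this is the point at which smoothness pays off.\<close>
  hence "card S * card (GL l :: 'a mat set) * ?q ^ (j * l) = card (GL ?n :: 'a mat set) * card (legendre_pairs a l) * ?q ^ (j * l)"
    using count1 cY by (simp add: mult_ac)
  hence "card S * card (GL l :: 'a mat set) = card (GL ?n :: 'a mat set) * card (legendre_pairs a l)" by simp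
  thus ?thesis unfolding S_def .
qed

lemma CARD_gt_1: "CARD('a::{finite,field}) > 1"
proof -
  have "card {0, 1 :: 'a} \<le> CARD('a)" by (intro card_mono) auto
  thus ?thesis by simp
qed

lemma GL_nonempty: "card (GL n :: 'a::{finite,field} mat set) > 0"
proof -
  have "1\<^sub>m n \<in> (GL n :: 'a mat set)" by (auto simp: GL_def)
  thus ?thesis by (metis card_gt_0_iff empty_iff finite_GL)
qed

section \<open>The recurrence for the normalised number of pairs\<close>

context
  fixes a :: "'a::{finite,field}"
  assumes a: "a \<noteq> 0" "a \<noteq> 1" and two: "(2::'a) \<noteq> 0"
begin

lemma legendre_pairs_count:
  "CARD('a) ^ n * card (legendre_pairs a n) =
    (\<Sum>j\<le>n. \<Sum>J\<in>ideals (legendre_poly a) j.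
       card {((A, B), v). (A, B) \<in> legendre_pairs a n \<and> v \<in> carrier_vec n \<and> ann_ideal A B n v = J})"
proof -
  let ?h = "legendre_poly a"
  let ?S = "\<lambda>J. {((A, B), v). (A, B) \<in> legendre_pairs a n \<and> v \<in> carrier_vec n \<and> ann_ideal A B n v = J}"
  interpret cubic ?h by (rule cubic_legendre_poly)
  note finI = card_ideals(1)[OF cubic_legendre_poly[of a]]
  have finS: "finite (?S J)" for J
    by (rule finite_subset[of _ "legendre_pairs a n \<times> (carrier_vec n :: 'a vec set)"]) auto
  have dis: "ideals ?h j \<inter> ideals ?h k = {}" if "j \<noteq> k" for j k using that by (auto simp: ideals_def)
  have "legendre_pairs a n \<times> (carrier_vec n :: 'a vec set) = (\<Union>J\<in>(\<Union>j\<le>n. ideals ?h j). ?S J)"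
  proof (intro equalityI subsetI)
    fix x assume x: "x \<in> legendre_pairs a n \<times> (carrier_vec n :: 'a vec set)"
    then obtain A B v where xx: "x = ((A, B), v)" "(A, B) \<in> legendre_pairs a n" "v \<in> carrier_vec n" by auto
    obtain j where "j \<le> n" "ann_ideal A B n v \<in> ideals ?h j" using ann_ideal_codim[OF xx(2,3)] by blast
    thus "x \<in> (\<Union>J\<in>(\<Union>j\<le>n. ideals ?h j). ?S J)" using xx by auto
  qed auto
  hence "card (legendre_pairs a n \<times> (carrier_vec n :: 'a vec set)) = card (\<Union>J\<in>(\<Union>j\<le>n. ideals ?h j). ?S J)" by simp
  also have "\<dots> = (\<Sum>J\<in>(\<Union>j\<le>n. ideals ?h j). card (?S J))"
    using finI finS by (intro card_UN_disjoint) auto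
  also have "\<dots> = (\<Sum>j\<le>n. \<Sum>J\<in>ideals ?h j. card (?S J))"
    using finI dis by (intro sum.UNION_disjoint) auto
  finally show ?thesis by (simp add: card_cartesian_product card_carrier_vec mult.commute)
qed

definition pair_ratio :: "nat \<Rightarrow> complex" where
  "pair_ratio n = of_nat (card (legendre_pairs a n)) / of_nat (card (GL n :: 'a mat set))"

text \<open>After division by card (GL n), an ideal of codimension j contributes
  \<open>pair_ratio (n - j)\<close>, whichever ideal it is. This is the reason for the
  normalisation.\<close>

lemma pair_ratio_recurrence:
  "of_nat (CARD('a)) ^ n * pair_ratio n =
    (\<Sum>j\<le>n. of_nat (card (ideals (legendre_poly a) j)) * pair_ratio (n - j))"
proof -
  let ?\<gamma> = "\<lambda>n. of_nat (card (GL n :: 'a mat set)) :: complex"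
  have nz: "?\<gamma> n \<noteq> 0" for n by (simp only: of_nat_eq_0_iff neq0_conv GL_nonempty)
  let ?S = "\<lambda>J. {((A, B), v). (A, B) \<in> legendre_pairs a n \<and> v \<in> carrier_vec n \<and> ann_ideal A B n v = J}"
  have S: "of_nat (card (?S J)) = ?\<gamma> n * pair_ratio (n - j)"
    if "j \<le> n" "J \<in> ideals (legendre_poly a) j" for j J
  proof -
    have "card (?S J) * card (GL (n - j) :: 'a mat set) = card (GL n :: 'a mat set) * card (legendre_pairs a (n - j))"
      using card_ann_ideal[OF a two that(2), of "n - j"] that(1) by simp
    from arg_cong[OF this, of "of_nat :: nat \<Rightarrow> complex"]
    have "of_nat (card (?S J)) * ?\<gamma> (n - j) = ?\<gamma> n * of_nat (card (legendre_pairs a (n - j)))"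
      by (simp only: of_nat_mult)
    thus ?thesis using nz[of "n - j"] by (simp add: pair_ratio_def field_simps)
  qed
  have "of_nat (CARD('a)) ^ n * of_nat (card (legendre_pairs a n)) =
      (\<Sum>j\<le>n. \<Sum>J\<in>ideals (legendre_poly a) j. of_nat (card (?S J)) :: complex)"
    using arg_cong[OF legendre_pairs_count[of n], of "of_nat :: nat \<Rightarrow> complex"] by simp
  also have "\<dots> = (\<Sum>j\<le>n. \<Sum>J\<in>ideals (legendre_poly a) j. ?\<gamma> n * pair_ratio (n - j))"
    by (intro sum.cong refl S) auto
  also have "\<dots> = ?\<gamma> n * (\<Sum>j\<le>n. of_nat (card (ideals (legendre_poly a) j)) * pair_ratio (n - j))"
    by (simp add: sum_distrib_left mult_ac)
  finally show ?thesis using nz[of n] by (simp add: pair_ratio_def field_simps)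
qed

lemma pair_ratio_0: "pair_ratio 0 = 1"
proof -
  have "legendre_pairs a 0 = {(1\<^sub>m 0, 1\<^sub>m 0)}"
    by (auto simp: legendre_pairs_def legendre_mat_def intro!: eq_matI)
  thus ?thesis by (simp add: pair_ratio_def card_GL_0)
qed

(* The number of ideals satisfies S(j) = q S(j-1) except for small j; subtracting q times the previous
   instance of the recurrence therefore leaves three terms. *)
lemma pair_ratio_three_term:
  fixes q c :: complex
  defines "q \<equiv> of_nat (CARD('a))" and "c \<equiv> q - of_nat (card (curve_points (legendre_poly a)))"
  shows "(q - 1) * pair_ratio 1 = q - c"
    and "(q ^ (n + 2) - 1) * pair_ratio (n + 2) = (q ^ (n + 2) - c) * pair_ratio (n + 1) + q * pair_ratio n"
proof -
  define S where "S j = (of_nat (card (ideals (legendre_poly a) j)) :: complex)" for j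
  note ci = card_ideals[OF cubic_legendre_poly[of a]]
  have S0: "S 0 = 1" "S (Suc 0) = q - c" using ci by (simp_all add: S_def c_def)
  \<comment> \<open>Continued down to j = 1, the general formula would include q ^ 0 = 1 principal
    ideal, which does not exist; hence the correction q when passing from 1 to 2.\<close>
  have S2: "S 2 = q * S 1 + q" using ci(3) ci(4)[of 2] by (simp add: S_def q_def algebra_simps)
  have S3: "S (Suc (Suc (Suc j))) = q * S (Suc (Suc j))" for j
    using ci(4)[of "Suc (Suc (Suc j))"] ci(4)[of "Suc (Suc j)"] by (simp add: S_def q_def algebra_simps)
  have rec: "q ^ n * pair_ratio n = (\<Sum>j\<le>n. S j * pair_ratio (n - j))" for n
    using pair_ratio_recurrence[of n] by (simp add: S_def q_def)
  show "(q - 1) * pair_ratio 1 = q - c" using rec[of 1] by (simp add: S0 pair_ratio_0 algebra_simps)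
  have "q ^ (n + 2) * pair_ratio (n + 2) =
      S 0 * pair_ratio (n + 2) + S 1 * pair_ratio (n + 1) + (\<Sum>j\<le>n. S (j + 2) * pair_ratio (n - j))"
    unfolding rec[of "n + 2"]
    by (simp add: sum.atMost_Suc_shift del: sum.atMost_Suc)
  also have "(\<Sum>j\<le>n. S (j + 2) * pair_ratio (n - j)) =
      (\<Sum>j\<le>n. q * S (j + 1) * pair_ratio (n - j)) + q * pair_ratio n"
  proof -
    have "S (j + 2) * pair_ratio (n - j) = q * S (j + 1) * pair_ratio (n - j) + (if j = 0 then q * pair_ratio n else 0)" for j
    proof (cases j)
      case 0
      thus ?thesis using S2 by (simp add: numeral_2_eq_2 algebra_simps)
    next
      case (Suc k)
      thus ?thesis using S3[of k] by simp
    qed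
    thus ?thesis by (simp add: sum.distrib)
  qed
  also have "(\<Sum>j\<le>n. q * S (j + 1) * pair_ratio (n - j)) = q * (q ^ (n + 1) * pair_ratio (n + 1) - S 0 * pair_ratio (n + 1))"
    unfolding rec[of "n + 1"] by (simp add: sum.atMost_Suc_shift sum_distrib_left mult_ac del: sum.atMost_Suc)
  finally show "(q ^ (n + 2) - 1) * pair_ratio (n + 2) = (q ^ (n + 2) - c) * pair_ratio (n + 1) + q * pair_ratio n"
    by (simp add: S0 algebra_simps)
qed

end

section \<open>Characters and hypergeometric sums over finite fields\<close>

text \<open>Subfields are sets, since the fields \<open>ext_field k\<close> for all k live in the
  same type.\<close>

locale odd_finite_subfield =
  fixes K :: "'b::field set"
  assumes fin: "finite K" and zero: "0 \<in> K" and one: "1 \<in> K"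
    and diff: "\<And>x y. x \<in> K \<Longrightarrow> y \<in> K \<Longrightarrow> x - y \<in> K"
    and mult: "\<And>x y. x \<in> K \<Longrightarrow> y \<in> K \<Longrightarrow> x * y \<in> K"
    and inv: "\<And>x. x \<in> K \<Longrightarrow> inverse x \<in> K"
    and two: "(2::'b) \<noteq> 0"
begin

lemma uminus: "x \<in> K \<Longrightarrow> - x \<in> K" using diff[OF zero, of x] by simp
lemma add: "x \<in> K \<Longrightarrow> y \<in> K \<Longrightarrow> x + y \<in> K" using diff[of x "- y"] uminus by simp
lemma divide: "x \<in> K \<Longrightarrow> y \<in> K \<Longrightarrow> x / y \<in> K" using mult inv by (simp add: divide_inverse)
lemma pow: "x \<in> K \<Longrightarrow> x ^ n \<in> K" by (induction n) (auto simp: one mult)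

lemmas closed = zero one diff mult inv uminus add divide pow

abbreviation "U \<equiv> K - {0}"
abbreviation "Q \<equiv> card K"

lemma card_U: "card U = Q - 1" using fin zero by simp

lemma one_neq_minus_one: "(1::'b) \<noteq> - 1"
  using two by (metis add.right_inverse one_add_one)

lemma Q_gt_2: "Q > 2"
proof -
  have "card {0, 1, - 1 :: 'b} \<le> Q" using fin closed by (intro card_mono) auto
  moreover have "card {0, 1, - 1 :: 'b} = 3" using one_neq_minus_one by auto
  ultimately show ?thesis by simp
qed

lemma pow_card: "x \<in> U \<Longrightarrow> x ^ (Q - 1) = 1"
proof -
  assume x: "x \<in> U"
  have "bij_betw (\<lambda>y. x * y) U U"
    by (rule bij_betwI[where g = "\<lambda>y. inverse x * y"]) (use x closed in auto)
  hence "(\<Prod>y\<in>U. x * y) = (\<Prod>y\<in>U. y)" by (rule prod.reindex_bij_betw)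
  hence "x ^ card U * (\<Prod>y\<in>U. y) = (\<Prod>y\<in>U. y)" by (simp add: prod.distrib)
  moreover have "(\<Prod>y\<in>U. y) \<noteq> 0" using fin by simp
  ultimately show ?thesis by (simp add: card_U)
qed

lemma pow_Q: "x \<in> K \<Longrightarrow> x ^ Q = x"
proof (cases "x = 0")
  case False
  assume "x \<in> K"
  with False have "x ^ (Q - 1) = 1" using pow_card by auto
  moreover have "Q = Suc (Q - 1)" using Q_gt_2 by simp
  ultimately show ?thesis by (metis mult.right_neutral power_Suc)
qed (use Q_gt_2 in auto)

lemma generator_exists: "\<exists>g\<in>U. \<forall>x\<in>U. \<exists>i. x = g ^ i"
proof -
  \<comment> \<open>The subfield as a ring with a carrier, so that the cyclicity of the
    multiplicative group of a finite field applies.\<close>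
  define R :: "'b ring" where "R = \<lparr>carrier = K, monoid.mult = (*), one = 1, ring.zero = 0, add = (+)\<rparr>"
  have R: "carrier R = K" by (simp add: R_def)
  have "Ring.field R"
  proof (rule cring.cring_fieldI2)
    show "cring R"
    proof (rule cringI)
      show "abelian_group R"
      proof (rule abelian_groupI)
        fix x assume "x \<in> carrier R"
        thus "\<exists>y\<in>carrier R. y \<oplus>\<^bsub>R\<^esub> x = \<zero>\<^bsub>R\<^esub>" using uminus by (auto simp: R_def intro: bexI[of _ "- x"])
      qed (auto simp: R_def closed algebra_simps)
      show "comm_monoid R" by unfold_locales (auto simp: R_def closed algebra_simps)
    qed (auto simp: R_def algebra_simps)
    show "\<zero>\<^bsub>R\<^esub> \<noteq> \<one>\<^bsub>R\<^esub>" by (simp add: R_def)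
    show "\<exists>b\<in>carrier R. a \<otimes>\<^bsub>R\<^esub> b = \<one>\<^bsub>R\<^esub>" if "a \<in> carrier R" "a \<noteq> \<zero>\<^bsub>R\<^esub>" for a
      using that inv by (auto simp: R_def intro!: bexI[of _ "inverse a"])
  qed
  then interpret R: Ring.field R .
  have pw: "x [^]\<^bsub>R\<^esub> (i::nat) = x ^ i" for x i
    by (induction i) (auto simp: nat_pow_def R_def)
  have "finite (carrier R)" using fin R by simp
  from R.finite_field_mult_group_has_gen[OF this]
  obtain g where g: "g \<in> carrier (Multiplicative_Group.mult_of R)" "carrier (Multiplicative_Group.mult_of R) = {g [^]\<^bsub>R\<^esub> i |i::nat. i \<in> UNIV}"
    by (elim bexE) (rule that)
  have c: "carrier (Multiplicative_Group.mult_of R) = U" by (simp add: R_def)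
  show ?thesis
  proof (intro bexI ballI)
    show "g \<in> U" using g(1) unfolding c .
    fix x assume "x \<in> U"
    hence "x \<in> {g [^]\<^bsub>R\<^esub> i |i::nat. i \<in> UNIV}" using g(2) unfolding c by (simp only:)
    thus "\<exists>i. x = g ^ i" unfolding pw by (elim CollectE exE conjE) (rule exI)
  qed
qed

definition gen :: 'b where "gen = (SOME g. g \<in> U \<and> (\<forall>x\<in>U. \<exists>i. x = g ^ i))"

lemma gen: "gen \<in> U" "x \<in> U \<Longrightarrow> \<exists>i. x = gen ^ i"
proof -
  have "\<exists>g. g \<in> U \<and> (\<forall>x\<in>U. \<exists>i. x = g ^ i)" using generator_exists by blast
  from someI_ex[OF this] show "gen \<in> U" "x \<in> U \<Longrightarrow> \<exists>i. x = gen ^ i" unfolding gen_def by auto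
qed

lemma gen_mod: "gen ^ (i mod (Q - 1)) = gen ^ i"
proof -
  have "gen ^ i = gen ^ ((Q - 1) * (i div (Q - 1)) + i mod (Q - 1))" by simp
  also have "\<dots> = (gen ^ (Q - 1)) ^ (i div (Q - 1)) * gen ^ (i mod (Q - 1))" unfolding power_add power_mult ..
  finally show ?thesis using pow_card[OF gen(1)] by simp
qed

lemma gen_eq_iff: "gen ^ i = gen ^ j \<longleftrightarrow> i mod (Q - 1) = j mod (Q - 1)"
proof
  have sub: "U \<subseteq> (\<lambda>i. gen ^ i) ` {..<Q - 1}"
  proof
    fix x assume "x \<in> U"
    then obtain i where "x = gen ^ i" using gen by blast
    hence "x = gen ^ (i mod (Q - 1))" by (simp only: gen_mod)
    thus "x \<in> (\<lambda>i. gen ^ i) ` {..<Q - 1}" by (rule image_eqI) (use Q_gt_2 in simp)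
  qed
  have "card {..<Q - 1} \<le> card ((\<lambda>i. gen ^ i) ` {..<Q - 1})" using card_mono[OF _ sub] card_U by simp
  hence inj: "inj_on (\<lambda>i. gen ^ i) {..<Q - 1}" using card_image_le[of "{..<Q - 1}" "\<lambda>i. gen ^ i"] by (intro eq_card_imp_inj_on) auto
  assume "gen ^ i = gen ^ j"
  hence "gen ^ (i mod (Q - 1)) = gen ^ (j mod (Q - 1))" by (simp only: gen_mod)
  thus "i mod (Q - 1) = j mod (Q - 1)" using inj Q_gt_2 by (auto dest!: inj_onD)
qed (metis gen_mod)

text \<open>A discrete logarithm; only its class modulo Q - 1 is determined.\<close>

definition ind :: "'b \<Rightarrow> nat" where "ind x = (SOME i. x = gen ^ i)"

lemma ind: "x \<in> U \<Longrightarrow> gen ^ ind x = x"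
  unfolding ind_def using someI_ex[OF gen(2)] by metis

text \<open>Writing -1 as gen ^ i, the number Q - 1 divides 2 i but not i, as -1 differs from
  1.\<close>

lemma even_card: "even (Q - 1)"
proof -
  have "- 1 \<in> U" using closed one_neq_minus_one by auto
  then obtain i where i: "- 1 = gen ^ i" using gen by blast
  have "gen ^ (2 * i) = gen ^ 0" using i by (simp add: mult.commute[of 2] power_mult flip: i)
  hence "2 * i mod (Q - 1) = 0" unfolding gen_eq_iff by simp
  then obtain k where k: "2 * i = (Q - 1) * k" by auto
  show ?thesis
  proof (rule ccontr)
    assume "odd (Q - 1)"
    hence "even k" using k by (metis dvd_triv_left even_mult_iff)
    then obtain l where "k = 2 * l" by blast
    hence "i = (Q - 1) * l" using k by simp
    hence "gen ^ i = gen ^ 0" unfolding gen_eq_iff by simp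
    thus False using i one_neq_minus_one by simp
  qed
qed

abbreviation "H \<equiv> (Q - 1) div 2"

lemma H2: "2 * H = Q - 1" using even_card by simp

text \<open>Euler's criterion taken as definition: quadratic characters of fields of different size
  can then be compared through exponents.\<close>

definition phi :: "'b \<Rightarrow> complex" where
  "phi x = (if x \<in> U then if x ^ H = 1 then 1 else - 1 else 0)"

lemma euler_cases: "x \<in> U \<Longrightarrow> x ^ H = 1 \<or> x ^ H = - 1"
proof -
  assume "x \<in> U"
  hence "(x ^ H) ^ 2 = 1" using pow_card H2 by (metis mult.commute power_mult)
  thus ?thesis by (simp add: power2_eq_1_iff)
qed

lemma phi_mult:
  assumes "x \<in> K" "y \<in> K"
  shows "phi (x * y) = phi x * phi y"
proof (cases "x = 0 \<or> y = 0")
  case False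
  hence U: "x \<in> U" "y \<in> U" "x * y \<in> U" using assms mult by auto
  have n: "(1::'b) \<noteq> - 1" "(- 1::'b) \<noteq> 1" using one_neq_minus_one by metis+
  show ?thesis using euler_cases[OF U(1)] euler_cases[OF U(2)]
    by (elim disjE; simp only: phi_def U if_True power_mult_distrib n if_False mult_1 mult_1_right minus_mult_minus; simp)
qed (auto simp: phi_def)

lemma phi_0 [simp]: "phi 0 = 0" and phi_1 [simp]: "phi 1 = 1"
  using one by (auto simp: phi_def)

lemma phi_square: "x \<in> U \<Longrightarrow> phi (x ^ 2) = 1"
  using pow_card[of x] H2 closed by (auto simp: phi_def simp flip: power_mult)

lemma phi_eq_0_iff: "x \<in> K \<Longrightarrow> phi x = 0 \<longleftrightarrow> x = 0"
  by (auto simp: phi_def)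

lemma phi_cases: "x \<in> U \<Longrightarrow> phi x = 1 \<or> phi x = - 1"
  by (auto simp: phi_def)

lemma phi_gen: "phi gen = - 1"
proof -
  have "gen ^ H \<noteq> gen ^ 0" unfolding gen_eq_iff using H2 Q_gt_2 by auto
  thus ?thesis using gen by (simp add: phi_def)
qed

lemma phi_1_square: "x \<in> U \<Longrightarrow> phi x = 1 \<Longrightarrow> \<exists>y\<in>U. x = y ^ 2"
proof -
  assume x: "x \<in> U" "phi x = 1"
  hence "gen ^ (ind x * H) = gen ^ 0" using ind[OF x(1)] by (auto simp: phi_def power_mult split: if_splits)
  hence "ind x * H mod (2 * H) = 0" unfolding gen_eq_iff H2 by simp
  then obtain k where "ind x * H = 2 * H * k" by auto
  moreover have "H > 0" using H2 Q_gt_2 by simp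
  ultimately have "ind x = 2 * k" by simp
  hence "x = (gen ^ k) ^ 2" using ind[OF x(1)] by (simp add: power_mult mult.commute)
  moreover have "gen ^ k \<in> U" using gen(1) closed by auto
  ultimately show ?thesis by blast
qed

lemma mult_charsD:
  assumes "\<chi> \<in> mult_chars K"
  shows "x \<notin> U \<Longrightarrow> \<chi> x = 0" "x \<in> U \<Longrightarrow> \<chi> x \<noteq> 0" "x \<in> K \<Longrightarrow> y \<in> K \<Longrightarrow> \<chi> (x * y) = \<chi> x * \<chi> y" "\<chi> 1 = 1"
proof -
  show 1: "x \<notin> U \<Longrightarrow> \<chi> x = 0" "x \<in> U \<Longrightarrow> \<chi> x \<noteq> 0" for x using assms by (auto simp: mult_chars_def)
  show 2: "\<chi> (x * y) = \<chi> x * \<chi> y" if "x \<in> K" "y \<in> K" for x y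
  proof (cases "x = 0 \<or> y = 0")
    case True
    thus ?thesis using 1 by auto
  next
    case False
    thus ?thesis using assms that by (simp add: mult_chars_def)
  qed
  show "\<chi> 1 = 1" using 2[of 1 1] 1(2)[of 1] one by simp
qed

text \<open>Uniqueness: a nontrivial \<chi> with trivial square takes the values 1 and -1 and is 1
  on squares. It is -1 at some non-square, and then at all of them, as the product of two
  non-squares is a square.\<close>

lemma quadratic_char_eq: "quadratic_char K = phi"
  unfolding quadratic_char_def
proof (rule the_equality)
  have "phi \<noteq> trivial_char K"
  proof
    assume "phi = trivial_char K"
    hence "phi gen = trivial_char K gen" by simp
    thus False using gen(1) by (simp add: phi_gen trivial_char_def)
  qed
  moreover have "phi \<in> mult_chars K" 
    by (auto simp: mult_chars_def phi_mult phi_eq_0_iff) (auto simp: phi_def)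
  moreover have "(\<lambda>x. phi x * phi x) = trivial_char K"
    by (auto simp: fun_eq_iff trivial_char_def phi_def)
  ultimately show "phi \<in> mult_chars K \<and> phi \<noteq> trivial_char K \<and> (\<lambda>x. phi x * phi x) = trivial_char K" by blast
next
  fix \<chi> assume \<chi>: "\<chi> \<in> mult_chars K \<and> \<chi> \<noteq> trivial_char K \<and> (\<lambda>x. \<chi> x * \<chi> x) = trivial_char K"
  hence c: "\<chi> \<in> mult_chars K" and nt: "\<chi> \<noteq> trivial_char K" and sq: "\<chi> x * \<chi> x = trivial_char K x" for x
    by (auto dest: fun_cong)
  have vals: "\<chi> x = 1 \<or> \<chi> x = - 1" if "x \<in> U" for x
    using sq[of x] that by (simp add: trivial_char_def square_eq_1_iff)
  have pos: "\<chi> x = 1" if x: "x \<in> U" "phi x = 1" for x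
  proof -
    obtain y where y: "y \<in> U" "x = y ^ 2" using phi_1_square[OF x] by blast
    thus ?thesis using sq[of y] mult_charsD(3)[OF c, of y y] by (simp add: trivial_char_def power2_eq_square)
  qed
  obtain x0 where x0: "\<chi> x0 \<noteq> trivial_char K x0" using nt by auto
  have x0U: "x0 \<in> U" using x0 mult_charsD(1)[OF c] by (auto simp: trivial_char_def split: if_splits)
  hence x01: "\<chi> x0 = - 1" using vals[OF x0U] x0 by (auto simp: trivial_char_def)
  hence phix0: "phi x0 = - 1" using pos[OF x0U] phi_cases[OF x0U] by auto
  show "\<chi> = phi"
  proof
    fix x
    show "\<chi> x = phi x"
    proof (cases "x \<in> U")
      case False
      thus ?thesis using mult_charsD(1)[OF c] by (simp add: phi_def)
    next
      case True
      show ?thesis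
      proof (cases "phi x = 1")
        case False
        hence "phi x = - 1" using phi_cases[OF True] by auto
        moreover have "phi (x * x0) = 1" using phi_mult[of x x0] True x0U calculation phix0 by auto
        moreover have "x * x0 \<in> U" using True x0U mult by auto
        ultimately show ?thesis using pos[of "x * x0"] mult_charsD(3)[OF c, of x x0] True x0U x01
          by (simp add: minus_equation_iff)
      qed (use pos True in simp)
    qed
  qed
qed

lemma sum_phi: "(\<Sum>x\<in>K. phi x) = 0"
proof -
  have "bij_betw (\<lambda>x. gen * x) K K"
    by (rule bij_betwI[where g = "\<lambda>y. inverse gen * y"]) (use gen(1) closed in auto)
  hence "(\<Sum>x\<in>K. phi (gen * x)) = (\<Sum>x\<in>K. phi x)" by (rule sum.reindex_bij_betw)
  moreover have "(\<Sum>x\<in>K. phi (gen * x)) = - (\<Sum>x\<in>K. phi x)"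
    using gen(1) by (simp add: phi_mult phi_gen sum_negf)
  ultimately show ?thesis by simp
qed

lemma sum_phi_shift: "c \<in> K \<Longrightarrow> (\<Sum>x\<in>K. phi (x + c)) = 0"
proof -
  assume c: "c \<in> K"
  have "bij_betw (\<lambda>x. x + c) K K"
    by (rule bij_betwI[where g = "\<lambda>y. y - c"]) (use c closed in auto)
  hence "(\<Sum>x\<in>K. phi (x + c)) = (\<Sum>x\<in>K. phi x)" by (rule sum.reindex_bij_betw)
  thus ?thesis by (simp add: sum_phi)
qed

text \<open>A translation and division by the square x^2 lead to the sum of phi (1 + w / x) over x
  \<noteq> 0. For w \<noteq> 0 the argument runs through everything except 1, which leaves - phi
  1.\<close>

lemma sum_phi_quadratic:
  assumes u: "u \<in> K" and v: "v \<in> K"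
  shows "(\<Sum>x\<in>K. phi ((x + u) * (x + v))) = (if u = v then of_nat Q - 1 else - 1)"
proof -
  define w where "w = v - u"
  have w: "w \<in> K" using u v closed by (simp add: w_def)
  have "bij_betw (\<lambda>x. x - u) K K"
    by (rule bij_betwI[where g = "\<lambda>y. y + u"]) (use u closed in auto)
  hence "(\<Sum>x\<in>K. phi ((x - u + u) * (x - u + v))) = (\<Sum>x\<in>K. phi ((x + u) * (x + v)))"
    by (rule sum.reindex_bij_betw)
  hence "(\<Sum>x\<in>K. phi ((x + u) * (x + v))) = (\<Sum>x\<in>K. phi (x * (x + w)))"
    by (simp add: w_def algebra_simps)
  also have "\<dots> = (\<Sum>x\<in>U. phi (x * (x + w)))"
    using fin by (intro sum.mono_neutral_right) auto
  also have "\<dots> = (\<Sum>x\<in>U. phi (1 + w / x))"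
  proof (rule sum.cong, simp)
    fix x assume x: "x \<in> U"
    have "x * (x + w) = x ^ 2 * (1 + w / x)" using x by (simp add: field_simps power2_eq_square)
    thus "phi (x * (x + w)) = phi (1 + w / x)" using x w phi_square[OF x] by (simp add: phi_mult closed)
  qed
  also have "\<dots> = (if u = v then of_nat Q - 1 else - 1)"
  proof (cases "u = v")
    case True
    have "(\<Sum>x\<in>U. phi (1 + w / x)) = of_nat (card U)" using True by (simp add: w_def)
    thus ?thesis using True Q_gt_2 card_U by (simp add: of_nat_diff)
  next
    case False
    have "bij_betw (\<lambda>x. 1 + w / x) U (K - {1})"
      by (rule bij_betwI[where g = "\<lambda>y. w / (y - 1)"]) (use w closed False in \<open>auto simp: w_def\<close>)
    hence "(\<Sum>x\<in>U. phi (1 + w / x)) = (\<Sum>x\<in>K - {1}. phi x)" by (rule sum.reindex_bij_betw)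
    also have "\<dots> = - 1" using fin one sum_phi by (simp add: sum_diff1)
    finally show ?thesis using False by simp
  qed
  finally show ?thesis .
qed

section \<open>Orthogonality of multiplicative characters\<close>

lemma mult_char_abs:
  assumes c: "\<chi> \<in> mult_chars K" and x: "x \<in> U"
  shows "cnj (\<chi> x) = inverse (\<chi> x)"
proof -
  have "\<chi> (x ^ n) = \<chi> x ^ n" for n
    by (induction n) (use x in \<open>auto simp: mult_charsD[OF c] closed\<close>)
  hence "\<chi> x ^ (Q - 1) = 1" using pow_card[OF x] mult_charsD(4)[OF c] by metis
  hence "norm (\<chi> x) ^ (Q - 1) = 1" by (metis norm_one norm_power)
  hence "norm (\<chi> x) = 1" using Q_gt_2 by (intro power_eq_imp_eq_base[of "norm (\<chi> x)" "Q - 1" 1]) auto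
  hence "\<chi> x * cnj (\<chi> x) = 1" using complex_norm_square[of "\<chi> x"] by simp
  thus ?thesis by (metis inverse_unique)
qed

text \<open>A character is determined by its value at the generator, and this is a root of unity of
  order dividing Q - 1.\<close>

lemma finite_mult_chars: "finite (mult_chars K)"
proof -
  have inj: "inj_on (\<lambda>\<chi>. \<chi> gen) (mult_chars K)"
  proof (rule inj_onI)
    fix \<chi> \<psi> assume c: "\<chi> \<in> mult_chars K" "\<psi> \<in> mult_chars K" "\<chi> gen = \<psi> gen"
    have p: "\<theta> (gen ^ n) = \<theta> gen ^ n" if "\<theta> \<in> mult_chars K" for n \<theta>
      by (induction n) (use gen(1) in \<open>auto simp: mult_charsD[OF that] closed\<close>)
    show "\<chi> = \<psi>"
    proof
      fix x show "\<chi> x = \<psi> x"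
        using p[OF c(1), of "ind x"] p[OF c(2), of "ind x"] c(3) ind[of x] mult_charsD(1)[OF c(1), of x] mult_charsD(1)[OF c(2), of x]
        by (cases "x \<in> U") auto
    qed
  qed
  have "(\<lambda>\<chi>. \<chi> gen) ` mult_chars K \<subseteq> {z. z ^ (Q - 1) = 1}"
  proof clarify
    fix \<chi> assume c: "\<chi> \<in> mult_chars K"
    have "\<chi> (gen ^ n) = \<chi> gen ^ n" for n
      by (induction n) (use gen(1) in \<open>auto simp: mult_charsD[OF c] closed\<close>)
    thus "\<chi> gen ^ (Q - 1) = 1" using pow_card[OF gen(1)] mult_charsD(4)[OF c] by metis
  qed
  moreover have "finite {z :: complex. z ^ (Q - 1) = 1}" using Q_gt_2 by (intro finite_roots_unity) simp
  ultimately show ?thesis using inj finite_imageD finite_subset by blast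
qed

lemma mult_chars_times: "\<chi> \<in> mult_chars K \<Longrightarrow> \<psi> \<in> mult_chars K \<Longrightarrow> (\<lambda>x. \<chi> x * \<psi> x) \<in> mult_chars K"
  by (auto simp: mult_chars_def)

lemma mult_chars_cnj: "\<chi> \<in> mult_chars K \<Longrightarrow> (\<lambda>x. cnj (\<chi> x)) \<in> mult_chars K"
  by (auto simp: mult_chars_def)

text \<open>The character that sends gen ^ i to \<omega> ^ i, with \<omega> a root of unity of exact
  order Q - 1, is injective on the nonzero elements.\<close>

lemma separating_char:
  assumes "x \<in> U" "x \<noteq> 1"
  shows "\<exists>\<chi>\<in>mult_chars K. \<chi> x \<noteq> 1"
proof -
  define \<omega> where "\<omega> = cis (2 * pi / of_nat (Q - 1))"
  define \<chi> where "\<chi> y = (if y \<in> U then \<omega> ^ ind y else 0)" for y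
  have pQ: "\<omega> ^ n = 1 \<longleftrightarrow> (Q - 1) dvd n" for n
  proof -
    have "\<omega> ^ n = cis (2 * pi * of_nat n / of_nat (Q - 1))" by (simp add: \<omega>_def DeMoivre field_simps)
    thus ?thesis
    proof (subst \<open>\<omega> ^ n = _\<close>)
      let ?t = "2 * pi * of_nat n / of_nat (Q - 1)"
      have q0: "real (Q - 1) > 0" using Q_gt_2 by simp
      have "cis ?t = 1 \<longleftrightarrow> cos ?t = 1"
      proof
        assume c: "cos ?t = 1"
        hence "sin ?t = 0" using sin_cos_squared_add[of ?t] by simp
        with c show "cis ?t = 1" by (simp add: complex_eq_iff)
      qed (metis cis.simps(1) one_complex.simps(1))
      also have "\<dots> \<longleftrightarrow> (\<exists>k::int. ?t = of_int k * 2 * pi)" by (simp add: cos_one_2pi_int)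
      also have "\<dots> \<longleftrightarrow> (Q - 1) dvd n"
      proof
        assume "\<exists>k::int. ?t = of_int k * 2 * pi"
        then obtain k :: int where "?t = of_int k * 2 * pi" ..
        hence "2 * pi * real n = of_int k * 2 * pi * real (Q - 1)" using q0 by (simp only: divide_eq_eq; simp)
        hence "2 * pi * real n = 2 * pi * (of_int k * real (Q - 1))" by (simp only: mult_ac)
        hence "real n = of_int k * real (Q - 1)" by (metis mult_left_cancel pi_neq_zero mult_eq_0_iff zero_neq_numeral)
        hence "of_int (int n) = (of_int (k * int (Q - 1)) :: real)" by simp
        hence "int n = k * int (Q - 1)" by (simp only: of_int_eq_iff)
        hence "int (Q - 1) dvd int n" by simp
        thus "(Q - 1) dvd n" by (simp only: of_nat_dvd_iff)
      next
        assume "(Q - 1) dvd n"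
        then obtain m where "n = (Q - 1) * m" by blast
        hence "?t = of_int (int m) * 2 * pi" using q0 by (simp only: of_nat_mult divide_eq_eq; simp)
        thus "\<exists>k::int. ?t = of_int k * 2 * pi" by blast
      qed
      finally show "cis ?t = 1 \<longleftrightarrow> (Q - 1) dvd n" .
    qed
  qed
  \<comment> \<open>\<open>ind\<close> turns products into sums only modulo Q - 1, which suffices
    for powers of \<omega>.\<close>
  have per: "\<omega> ^ i = \<omega> ^ j" if "i mod (Q - 1) = j mod (Q - 1)" for i j
  proof -
    have "\<omega> ^ i = \<omega> ^ (i mod (Q - 1))" for i
    proof -
      have "\<omega> ^ i = \<omega> ^ ((Q - 1) * (i div (Q - 1)) + i mod (Q - 1))" by simp
      also have "\<dots> = \<omega> ^ ((Q - 1) * (i div (Q - 1))) * \<omega> ^ (i mod (Q - 1))" by (rule power_add)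
      also have "\<omega> ^ ((Q - 1) * (i div (Q - 1))) = 1" unfolding pQ by simp
      finally show ?thesis by simp
    qed
    thus ?thesis using that by metis
  qed
  have "\<omega> \<noteq> 0" by (simp add: \<omega>_def)
  moreover have "\<chi> (y * z) = \<chi> y * \<chi> z" if "y \<in> U" "z \<in> U" for y z
  proof -
    have yz: "y * z \<in> U" using that mult by auto
    have "gen ^ ind (y * z) = gen ^ (ind y + ind z)" using ind[OF yz] ind[OF that(1)] ind[OF that(2)] by (simp add: power_add)
    hence "\<omega> ^ ind (y * z) = \<omega> ^ (ind y + ind z)" unfolding gen_eq_iff by (rule per)
    thus ?thesis using that yz by (simp add: \<chi>_def power_add)
  qed
  ultimately have "\<chi> \<in> mult_chars K" by (auto simp: mult_chars_def \<chi>_def)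
  moreover have "\<chi> x \<noteq> 1"
  proof
    assume "\<chi> x = 1"
    hence "(Q - 1) dvd ind x" using assms(1) by (simp add: \<chi>_def pQ)
    hence "gen ^ ind x = gen ^ 0" unfolding gen_eq_iff by simp
    thus False using ind[OF assms(1)] assms(2) by simp
  qed
  ultimately show ?thesis by blast
qed

text \<open>Multiplication by a character \<psi> with \<psi>(x) \<noteq> 1 permutes the characters
  and multiplies the sum by \<psi>(x).\<close>

lemma sum_chars_nontrivial:
  assumes "x \<in> U" "x \<noteq> 1"
  shows "(\<Sum>\<chi>\<in>mult_chars K. \<chi> x) = 0"
proof -
  obtain \<psi> where \<psi>: "\<psi> \<in> mult_chars K" "\<psi> x \<noteq> 1" using separating_char[OF assms] by blast
  have one': "cnj (\<psi> y) * \<psi> y = 1" if "y \<in> U" for y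
    using mult_char_abs[OF \<psi>(1) that] mult_charsD(2)[OF \<psi>(1) that] by simp
  have canc: "(\<lambda>y. cnj (\<psi> y) * (\<psi> y * \<chi> y)) = \<chi>" "(\<lambda>y. \<psi> y * (cnj (\<psi> y) * \<chi> y)) = \<chi>" if "\<chi> \<in> mult_chars K" for \<chi>
  proof -
    have "cnj (\<psi> y) * (\<psi> y * \<chi> y) = \<chi> y \<and> \<psi> y * (cnj (\<psi> y) * \<chi> y) = \<chi> y" for y
    proof (cases "y \<in> U")
      case True
      thus ?thesis using one'[OF True] by (metis mult.assoc mult.commute mult_1)
    qed (use mult_charsD(1)[OF that] in simp)
    thus "(\<lambda>y. cnj (\<psi> y) * (\<psi> y * \<chi> y)) = \<chi>" "(\<lambda>y. \<psi> y * (cnj (\<psi> y) * \<chi> y)) = \<chi>" by auto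
  qed
  have "bij_betw (\<lambda>\<chi> y. \<psi> y * \<chi> y) (mult_chars K) (mult_chars K)"
    by (rule bij_betwI[where g = "\<lambda>\<chi> y. cnj (\<psi> y) * \<chi> y"])
      (use \<psi>(1) mult_chars_times mult_chars_cnj canc in auto)
  hence "(\<Sum>\<chi>\<in>mult_chars K. \<psi> x * \<chi> x) = (\<Sum>\<chi>\<in>mult_chars K. \<chi> x)"
    using sum.reindex_bij_betw[of "\<lambda>\<chi> y. \<psi> y * \<chi> y" "mult_chars K" "mult_chars K" "\<lambda>\<chi>. \<chi> x"] by simp
  hence "\<psi> x * (\<Sum>\<chi>\<in>mult_chars K. \<chi> x) = (\<Sum>\<chi>\<in>mult_chars K. \<chi> x)" by (simp only: sum_distrib_left)
  hence "(\<psi> x - 1) * (\<Sum>\<chi>\<in>mult_chars K. \<chi> x) = 0" by (simp add: left_diff_distrib)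
  thus ?thesis using \<psi>(2) by simp
qed

text \<open>The double sum of \<chi>(x) is evaluated in both orders: only x = 1 contributes in the
  one, only the trivial character in the other.\<close>

lemma card_mult_chars: "card (mult_chars K) = Q - 1"
proof -
  have triv: "trivial_char K \<in> mult_chars K" using mult by (auto simp: mult_chars_def trivial_char_def)
  have 0: "(\<Sum>x\<in>U. \<chi> x) = (if \<chi> = trivial_char K then of_nat (Q - 1) else 0)" if c: "\<chi> \<in> mult_chars K" for \<chi>
  proof (cases "\<chi> = trivial_char K")
    case True
    thus ?thesis using card_U by (simp add: trivial_char_def)
  next
    case False
    then obtain y where y: "\<chi> y \<noteq> trivial_char K y" by auto
    hence yU: "y \<in> U" using mult_charsD(1)[OF c] by (auto simp: trivial_char_def split: if_splits)
    have "bij_betw (\<lambda>x. y * x) U U"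
      by (rule bij_betwI[where g = "\<lambda>z. inverse y * z"]) (use yU closed in auto)
    hence "(\<Sum>x\<in>U. \<chi> (y * x)) = (\<Sum>x\<in>U. \<chi> x)" by (rule sum.reindex_bij_betw)
    moreover have "(\<Sum>x\<in>U. \<chi> (y * x)) = \<chi> y * (\<Sum>x\<in>U. \<chi> x)"
      using yU by (simp add: sum_distrib_left mult_charsD(3)[OF c])
    ultimately have "(\<chi> y - 1) * (\<Sum>x\<in>U. \<chi> x) = 0" by (simp add: algebra_simps)
    moreover have "\<chi> y \<noteq> 1" using y yU by (simp add: trivial_char_def)
    ultimately show ?thesis using False by simp
  qed
  have "of_nat (card (mult_chars K)) = (\<Sum>\<chi>\<in>mult_chars K. \<chi> 1)" by (simp add: mult_charsD(4))
  also have "\<dots> = (\<Sum>x\<in>U. if x = 1 then (\<Sum>\<chi>\<in>mult_chars K. \<chi> 1) else 0)" using fin one by simp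
  also have "\<dots> = (\<Sum>x\<in>U. \<Sum>\<chi>\<in>mult_chars K. \<chi> x)"
    by (intro sum.cong refl) (use sum_chars_nontrivial in auto)
  also have "\<dots> = (\<Sum>\<chi>\<in>mult_chars K. \<Sum>x\<in>U. \<chi> x)" by (rule sum.swap)
  also have "\<dots> = of_nat (Q - 1)" using triv finite_mult_chars by (simp add: 0)
  finally show ?thesis by (simp only: of_nat_eq_iff)
qed

lemma orthogonality:
  assumes "u \<in> K" "w \<in> K"
  shows "(\<Sum>\<chi>\<in>mult_chars K. \<chi> u * cnj (\<chi> w)) = (if u = w \<and> u \<noteq> 0 then of_nat Q - 1 else 0)"
proof (cases "u = 0 \<or> w = 0")
  case True
  thus ?thesis by (auto simp: mult_charsD(1))
next
  case False
  hence U: "u \<in> U" "w \<in> U" "u / w \<in> U" using assms closed by auto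
  have e: "\<chi> u * cnj (\<chi> w) = \<chi> (u / w)" if c: "\<chi> \<in> mult_chars K" for \<chi>
  proof -
    have "\<chi> u = \<chi> (u / w) * \<chi> w" using mult_charsD(3)[OF c, of "u / w" w] U by simp
    thus ?thesis using mult_char_abs[OF c U(2)] mult_charsD(2)[OF c U(2)] by simp
  qed
  have E: "(\<Sum>\<chi>\<in>mult_chars K. \<chi> u * cnj (\<chi> w)) = (\<Sum>\<chi>\<in>mult_chars K. \<chi> (u / w))"
    by (intro sum.cong refl e)
  show ?thesis
  proof (cases "u = w")
    case True
    have "of_nat (card (mult_chars K)) = (of_nat Q - 1 :: complex)" using card_mult_chars Q_gt_2 by (simp add: of_nat_diff)
    thus ?thesis unfolding E using True False by (simp add: mult_charsD(4))
  next
    case uw: False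
    hence "u / w \<noteq> 1" using False by simp
    thus ?thesis unfolding E using sum_chars_nontrivial[OF U(3)] uw by simp
  qed
qed

definition cubic_sum :: "'b \<Rightarrow> complex" where
  "cubic_sum a = (\<Sum>x\<in>K. phi (x * (x - 1) * (x - a)))"

(* Orthogonality leaves the terms with y z a = (1 - y)(1 - z); z is a function of y, and the
   substitution y = 1/(1 - x) turns the remaining sum into the Legendre form. *)
lemma hypergeom_2F1_ff_eq:
  assumes a: "a \<in> K" "a \<noteq> 0"
  shows "hypergeom_2F1_ff K a = phi (- 1) / of_nat Q * cubic_sum a"
proof -
  let ?Q = "of_nat Q :: complex"
  have Q0: "?Q \<noteq> 0" "?Q - 1 \<noteq> 0"
  proof -
    have "?Q - 1 = of_nat (Q - 1)" using Q_gt_2 by (simp add: of_nat_diff)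
    also have "\<dots> \<noteq> 0" using Q_gt_2 by (simp only: of_nat_eq_0_iff)
    finally show "?Q - 1 \<noteq> 0" .
    show "?Q \<noteq> 0" using Q_gt_2 by (simp only: of_nat_eq_0_iff)
  qed
  let ?b = "\<lambda>\<chi>. char_binomial K (\<lambda>y. phi y * \<chi> y) \<chi>"
  have summand: "?b \<chi> * char_binomial K (\<lambda>y. phi y * \<chi> y) (\<lambda>y. trivial_char K y * \<chi> y) * \<chi> a =
      1 / ?Q ^ 2 * (\<Sum>y\<in>K. \<Sum>z\<in>K. phi y * phi z * (\<chi> (y * z * a) * cnj (\<chi> ((1 - y) * (1 - z)))))"
    if c: "\<chi> \<in> mult_chars K" for \<chi>
  proof -
    have t: "(\<lambda>y. trivial_char K y * \<chi> y) = \<chi>"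
      using mult_charsD(1)[OF c] by (auto simp: trivial_char_def fun_eq_iff)
    have sq: "\<chi> (- 1) * \<chi> (- 1) = 1"
      using mult_charsD(3)[OF c, of "- 1" "- 1"] mult_charsD(4)[OF c] closed by simp
    have "?b \<chi> * ?b \<chi> * \<chi> a = (\<chi> (- 1) * \<chi> (- 1)) / ?Q ^ 2 *
        ((\<Sum>y\<in>K. phi y * \<chi> y * cnj (\<chi> (1 - y))) * (\<Sum>z\<in>K. phi z * \<chi> z * cnj (\<chi> (1 - z))) * \<chi> a)"
      by (simp add: char_binomial_def power2_eq_square)
    also have "(\<Sum>y\<in>K. phi y * \<chi> y * cnj (\<chi> (1 - y))) * (\<Sum>z\<in>K. phi z * \<chi> z * cnj (\<chi> (1 - z))) * \<chi> a =
        (\<Sum>y\<in>K. \<Sum>z\<in>K. phi y * phi z * (\<chi> (y * z * a) * cnj (\<chi> ((1 - y) * (1 - z)))))"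
      unfolding sum_product unfolding sum_distrib_right
      by (intro sum.cong refl) (simp add: mult_charsD(3)[OF c] closed a)
    finally show ?thesis using sq t by simp
  qed
  \<comment> \<open>The condition of \<open>orthogonality\<close>: equal arguments that are not
    0.\<close>
  let ?R = "\<lambda>y z. y * z * a = (1 - y) * (1 - z) \<and> y * z * a \<noteq> 0"
  have "hypergeom_2F1_ff K a = ?Q / (?Q - 1) * (\<Sum>\<chi>\<in>mult_chars K.
      1 / ?Q ^ 2 * (\<Sum>y\<in>K. \<Sum>z\<in>K. phi y * phi z * (\<chi> (y * z * a) * cnj (\<chi> ((1 - y) * (1 - z))))))"
    unfolding hypergeom_2F1_ff_def quadratic_char_eq
    by (intro arg_cong2[of _ _ _ _ "(*)"] refl sum.cong summand)
  also have "\<dots> = ?Q / (?Q - 1) * (1 / ?Q ^ 2) * (\<Sum>\<chi>\<in>mult_chars K.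
      \<Sum>y\<in>K. \<Sum>z\<in>K. phi y * phi z * (\<chi> (y * z * a) * cnj (\<chi> ((1 - y) * (1 - z)))))"
    by (simp add: sum_distrib_left mult_ac)
  also have "(\<Sum>\<chi>\<in>mult_chars K. \<Sum>y\<in>K. \<Sum>z\<in>K. phi y * phi z * (\<chi> (y * z * a) * cnj (\<chi> ((1 - y) * (1 - z))))) =
      (\<Sum>y\<in>K. \<Sum>z\<in>K. phi y * phi z * (\<Sum>\<chi>\<in>mult_chars K. \<chi> (y * z * a) * cnj (\<chi> ((1 - y) * (1 - z)))))"
    unfolding sum_distrib_left by (subst sum.swap, intro sum.cong refl, rule sum.swap)
  also have "\<dots> = (\<Sum>y\<in>K. \<Sum>z\<in>K. phi y * phi z * (if ?R y z then ?Q - 1 else 0))"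
    by (intro sum.cong refl) (simp add: orthogonality closed a)
  also have "\<dots> = (\<Sum>y\<in>K. (?Q - 1) * phi (y * (1 - y) * (1 - y + y * a)))"
  proof (rule sum.cong, simp)
    fix y assume y: "y \<in> K"
    \<comment> \<open>For fixed y the relation is linear in z, namely z d = 1 - y.\<close>
    define d where "d = 1 - y + y * a"
    have d: "d \<in> K" using y a by (simp add: d_def closed)
    show "(\<Sum>z\<in>K. phi y * phi z * (if ?R y z then ?Q - 1 else 0)) = (?Q - 1) * phi (y * (1 - y) * (1 - y + y * a))"
    proof (cases "y = 0 \<or> y = 1 \<or> d = 0")
      case True
      have no: "\<not> ?R y z" for z
      proof
        assume R: "?R y z"
        hence "y \<noteq> 0" "y \<noteq> 1" by auto
        hence "d = 0" using True by simp
        moreover have "z * d = 1 - y" using R by (simp add: d_def algebra_simps)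
        ultimately show False using \<open>y \<noteq> 1\<close> by simp
      qed
      have "y * (1 - y) * (1 - y + y * a) = 0" using True by (auto simp: d_def)
      thus ?thesis by (simp only: no if_False phi_0) simp
    next
      case False
      define z0 where "z0 = (1 - y) / d"
      have z0: "z0 \<in> K" using y d by (simp add: z0_def closed)
      have iff: "?R y z \<longleftrightarrow> z = z0" for z
      proof -
        have "y * z * a = (1 - y) * (1 - z) \<longleftrightarrow> z * d = 1 - y" by (auto simp: d_def algebra_simps)
        also have "\<dots> \<longleftrightarrow> z = z0" using False by (simp add: z0_def eq_divide_eq)
        finally have "y * z * a = (1 - y) * (1 - z) \<longleftrightarrow> z = z0" .
        moreover have "z0 \<noteq> 0" using False by (simp add: z0_def)
        ultimately show ?thesis using False a by auto
      qed
      have "(\<Sum>z\<in>K. phi y * phi z * (if ?R y z then ?Q - 1 else 0)) = (\<Sum>z\<in>K. if z = z0 then phi y * phi z * (?Q - 1) else 0)"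
        unfolding iff by (intro sum.cong) auto
      also have "\<dots> = phi (y * z0) * (?Q - 1)" using fin z0 y by (simp add: phi_mult)
      \<comment> \<open>The square d^2 clears the denominator of \<open>z0\<close> without changing
        the character value.\<close>
      also have "phi (y * z0) = phi (y * z0) * phi (d ^ 2)" using phi_square[of d] d False by simp
      also have "\<dots> = phi (y * z0 * d ^ 2)" using y z0 d by (simp add: phi_mult closed)
      also have "y * z0 * d ^ 2 = y * (1 - y) * d" using False by (simp add: z0_def power2_eq_square)
      finally show ?thesis by (simp add: d_def)
    qed
  qed
  also have "\<dots> = (?Q - 1) * (\<Sum>y\<in>K. phi (y * (1 - y) * (1 - y + y * a)))" by (simp add: sum_distrib_left)
  also have "(\<Sum>y\<in>K. phi (y * (1 - y) * (1 - y + y * a))) = (\<Sum>y\<in>U. phi (y * (1 - y) * (1 - y + y * a)))"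
    using fin by (intro sum.mono_neutral_right) auto
  also have "\<dots> = (\<Sum>x\<in>K - {1}. phi (1 / (1 - x) * (1 - 1 / (1 - x)) * (1 - 1 / (1 - x) + 1 / (1 - x) * a)))"
  proof -
    have "bij_betw (\<lambda>x. 1 / (1 - x)) (K - {1}) U"
      by (rule bij_betwI[where g = "\<lambda>y. 1 - 1 / y"]) (auto simp: closed)
    thus ?thesis by (rule sum.reindex_bij_betw[symmetric])
  qed
  also have "\<dots> = (\<Sum>x\<in>K - {1}. phi (- 1) * phi (x * (x - 1) * (x - a)))"
  proof (rule sum.cong, simp)
    fix x assume x: "x \<in> K - {1}"
    define t where "t = 1 - x"
    have t: "t \<in> U" using x by (auto simp: t_def closed)
    have "x = 1 - t" by (simp add: t_def)
    \<comment> \<open>The factor t^4 is a square and clears all denominators: what remains is t (t -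
      1) (t - 1 + a) with t = 1 - x.\<close>
    have "phi (1 / t * (1 - 1 / t) * (1 - 1 / t + 1 / t * a)) =
        phi (1 / t * (1 - 1 / t) * (1 - 1 / t + 1 / t * a)) * phi ((t ^ 2) ^ 2)"
      using phi_square[of "t ^ 2"] t by (auto simp: closed)
    also have "\<dots> = phi (1 / t * (1 - 1 / t) * (1 - 1 / t + 1 / t * a) * (t ^ 2) ^ 2)"
      using t a by (intro phi_mult[symmetric]) (auto simp: closed)
    also have "1 / t * (1 - 1 / t) * (1 - 1 / t + 1 / t * a) * (t ^ 2) ^ 2 = - 1 * (x * (x - 1) * (x - a))"
      using t by (simp add: \<open>x = 1 - t\<close> field_simps power2_eq_square)
    also have "phi \<dots> = phi (- 1) * phi (x * (x - 1) * (x - a))"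
      using x a by (intro phi_mult) (auto simp: closed)
    finally show "phi (1 / (1 - x) * (1 - 1 / (1 - x)) * (1 - 1 / (1 - x) + 1 / (1 - x) * a)) =
        phi (- 1) * phi (x * (x - 1) * (x - a))" by (simp add: t_def)
  qed
  also have "\<dots> = phi (- 1) * cubic_sum a"
    unfolding cubic_sum_def sum_distrib_left using fin by (intro sum.mono_neutral_left) auto
  finally show ?thesis using Q0 by (simp add: power2_eq_square)
qed

end

section \<open>The L-function of the Legendre curve\<close>

text \<open>If f vanished everywhere, f + 1 would have no root and would thus be constant.\<close>

lemma alg_closed_poly_nonzero_value:
  assumes "(f :: 'b::alg_closed_field poly) \<noteq> 0"
  shows "\<exists>x. poly f x \<noteq> 0"
proof (rule ccontr)
  assume "\<not> ?thesis"
  hence 0: "poly f x = 0" for x by blast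
  have "Polynomial.degree (f + 1) = 0"
  proof (rule ccontr)
    assume "Polynomial.degree (f + 1) \<noteq> 0"
    then obtain x where "poly (f + 1) x = 0" using alg_closed_imp_poly_has_root by blast
    thus False using 0 by simp
  qed
  then obtain c where "f + 1 = [:c:]" by (elim degree_eq_zeroE)
  hence "f = [:c - 1:]" by (metis add_diff_cancel_right' diff_pCons diff_0_right one_pCons)
  thus False using 0[of 0] assms by simp
qed

lemma alg_closed_poly_eqI:
  assumes "\<And>x. poly f x = poly g (x :: 'b::alg_closed_field)"
  shows "f = g"
  using alg_closed_poly_nonzero_value[of "f - g"] assms by auto

lemma alg_closed_sum_order:
  assumes "(f :: 'b::alg_closed_field poly) \<noteq> 0"
  shows "(\<Sum>x | poly f x = 0. Polynomial.order x f) = Polynomial.degree f"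
proof -
  obtain A where A: "size A = Polynomial.degree f"
    "f = Polynomial.smult (lead_coeff f) (\<Prod>x\<in>#A. [:- x, 1:])"
    using alg_closed_imp_factorization[OF assms] by blast
  have "proots (\<Prod>x\<in>#A. [:- x, 1:]) = A"
  proof (induction A)
    case (add x A)
    have "proots ([:- x, 1:] * (\<Prod>x\<in>#A. [:- x, 1:])) = proots [:- x, 1:] + proots (\<Prod>x\<in>#A. [:- x, 1:])"
      by (rule proots_mult) (auto simp: prod_mset_zero_iff)
    also have "\<dots> = {#x#} + A" by (simp only: add.IH proots_linear_factor minus_minus)
    finally show ?case by (simp only: image_mset_add_mset prod_mset.add_mset) simp
  qed simp
  hence "proots f = A" using A(2) assms by (metis leading_coeff_0_iff proots_smult)
  moreover have "size (proots f) = (\<Sum>x\<in>set_mset (proots f). count (proots f) x)"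
    by (simp add: size_multiset_overloaded_eq)
  hence "size (proots f) = (\<Sum>x | poly f x = 0. Polynomial.order x f)" using assms by simp
  ultimately show ?thesis using A(1) by (simp only:)
qed

lemma distinct_roots_dvd:
  assumes "finite S" "\<And>z. z \<in> S \<Longrightarrow> poly f z = (0 :: 'b::field)"
  shows "(\<Prod>z\<in>S. [:- z, 1:]) dvd f"
  using assms
proof (induction S rule: finite_induct)
  case (insert z S)
  then obtain g where g: "f = (\<Prod>z\<in>S. [:- z, 1:]) * g" by (metis dvdE insertCI)
  have "poly (\<Prod>z\<in>S. [:- z, 1:]) z \<noteq> 0" using insert.hyps by (simp add: poly_prod)
  moreover have "poly f z = 0" using insert.prems by simp
  ultimately have "poly g z = 0" unfolding g by simp
  then obtain k where "g = [:- z, 1:] * k" by (metis dvdE poly_eq_0_iff_dvd)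
  hence "f = ([:- z, 1:] * (\<Prod>z\<in>S. [:- z, 1:])) * k" using g by (simp only: mult_ac)
  thus ?case unfolding prod.insert[OF insert.hyps(1,2)] by (rule dvdI)
qed auto

text \<open>For monic f with roots x1, ..., xd the argument is the product of the h(xi): the values
  at 0, 1, b carry the sign (-1)^(3 d) with respect to it, which the factor (-1)^d corrects. So the
  character of X - x is phi (h(x)).\<close>

definition legendre_poly_char :: "'b::field set \<Rightarrow> 'b \<Rightarrow> 'b poly \<Rightarrow> complex" where
  "legendre_poly_char K b f =
     odd_finite_subfield.phi K ((- 1) ^ Polynomial.degree f * poly f 0 * poly f 1 * poly f b)"

definition monics :: "'b::field set \<Rightarrow> nat \<Rightarrow> 'b poly set" where
  "monics K d = {f. Polynomial.degree f = d \<and> lead_coeff f = 1 \<and> (\<forall>i. poly.coeff f i \<in> K)}"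

context odd_finite_subfield
begin

lemma sum_closed: "(\<And>i. i \<in> A \<Longrightarrow> f i \<in> K) \<Longrightarrow> sum f A \<in> K"
  by (induction A rule: infinite_finite_induct) (auto simp: closed)

lemma poly_closed: "(\<And>i. poly.coeff f i \<in> K) \<Longrightarrow> x \<in> K \<Longrightarrow> poly f x \<in> K"
  unfolding poly_altdef by (intro sum_closed closed)

lemma monics_eq_image:
  "monics K d = (\<lambda>c. (\<Sum>i<d. Polynomial.monom (c i) i) + Polynomial.monom 1 d) ` ({..<d} \<rightarrow>\<^sub>E K)"
proof -
  have co: "poly.coeff (\<Sum>i<n. Polynomial.monom (c i) i) k = (if k < n then c k else 0)" for c :: "nat \<Rightarrow> 'b" and k n
    by (auto simp: coeff_sum)
  show ?thesis
  proof (intro equalityI subsetI)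
    fix f assume f: "f \<in> monics K d"
    have "f = (\<Sum>i<d. Polynomial.monom (restrict (poly.coeff f) {..<d} i) i) + Polynomial.monom 1 d"
      using f by (intro poly_eqI) (auto simp: co monics_def coeff_eq_0)
    thus "f \<in> (\<lambda>c. (\<Sum>i<d. Polynomial.monom (c i) i) + Polynomial.monom 1 d) ` ({..<d} \<rightarrow>\<^sub>E K)"
      by (rule image_eqI[where x = "restrict (poly.coeff f) {..<d}"]) (use f in \<open>auto simp: monics_def\<close>)
  next
    fix f assume "f \<in> (\<lambda>c. (\<Sum>i<d. Polynomial.monom (c i) i) + Polynomial.monom 1 d) ` ({..<d} \<rightarrow>\<^sub>E K)"
    then obtain c where c: "c \<in> {..<d} \<rightarrow>\<^sub>E K" "f = (\<Sum>i<d. Polynomial.monom (c i) i) + Polynomial.monom 1 d" by blast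
    have "Polynomial.degree f = d"
      by (rule antisym; (rule degree_le | rule le_degree)) (auto simp: c(2) co)
    thus "f \<in> monics K d" using c closed by (auto simp: monics_def co)
  qed
qed

lemma finite_monics [simp]: "finite (monics K d)"
  unfolding monics_eq_image using fin by (intro finite_imageI finite_PiE) auto

lemma monics_0: "monics K 0 = {1}"
  using closed by (auto simp: monics_def elim!: degree_eq_zeroE)

lemma sum_monics_1: "(\<Sum>f\<in>monics K 1. F f) = (\<Sum>x\<in>K. F [:- x, 1:])"
proof -
  have "bij_betw (\<lambda>x. [:- x, 1:]) K (monics K 1)"
  proof (rule bij_betwI[where g = "\<lambda>f. - poly.coeff f 0"])
    show "(\<lambda>x. [:- x, 1:]) \<in> K \<rightarrow> monics K 1"
      using closed by (auto simp: monics_def coeff_pCons split: nat.splits)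
    show "(\<lambda>f. - poly.coeff f 0) \<in> monics K 1 \<rightarrow> K" using closed by (auto simp: monics_def)
    fix f assume f: "f \<in> monics K 1"
    show "[:- (- poly.coeff f 0), 1:] = f"
    proof (rule poly_eqI)
      fix i show "poly.coeff [:- (- poly.coeff f 0), 1:] i = poly.coeff f i"
        using f by (cases i; cases "i - 1") (auto simp: monics_def coeff_eq_0)
    qed
  qed simp
  thus ?thesis by (rule sum.reindex_bij_betw[symmetric])
qed

lemma sum_monics_2: "(\<Sum>f\<in>monics K 2. F f) = (\<Sum>c\<in>K. \<Sum>b\<in>K. F [:c, b, 1:])"
proof -
  have "bij_betw (\<lambda>(c, b). [:c, b, 1:]) (K \<times> K) (monics K 2)"
  proof (rule bij_betwI[where g = "\<lambda>f. (poly.coeff f 0, poly.coeff f 1)"])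
    show "(\<lambda>(c, b). [:c, b, 1:]) \<in> K \<times> K \<rightarrow> monics K 2"
      using closed by (auto simp: monics_def coeff_pCons split: nat.splits)
    show "(\<lambda>f. (poly.coeff f 0, poly.coeff f 1)) \<in> monics K 2 \<rightarrow> K \<times> K" by (auto simp: monics_def)
    fix f assume f: "f \<in> monics K 2"
    have "[:poly.coeff f 0, poly.coeff f 1, 1:] = f"
    proof (rule poly_eqI)
      fix i :: nat
      consider "i = 0" | "i = 1" | "i = 2" | "i > 2" by linarith
      thus "poly.coeff [:poly.coeff f 0, poly.coeff f 1, 1:] i = poly.coeff f i"
        using f by cases (auto simp: monics_def coeff_eq_0 numeral_2_eq_2 coeff_pCons split: nat.splits)
    qed
    thus "(case (poly.coeff f 0, poly.coeff f 1) of (c, b) \<Rightarrow> [:c, b, 1:]) = f" by simp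
  qed auto
  hence "(\<Sum>f\<in>monics K 2. F f) = (\<Sum>(c, b)\<in>K \<times> K. F [:c, b, 1:])"
    by (subst sum.reindex_bij_betw[symmetric]) (auto simp: case_prod_unfold)
  thus ?thesis using fin by (simp add: sum.cartesian_product)
qed

lemma monics_mult: "f \<in> monics K d \<Longrightarrow> g \<in> monics K e \<Longrightarrow> f * g \<in> monics K (d + e)"
proof -
  assume f: "f \<in> monics K d" and g: "g \<in> monics K e"
  have nz: "f \<noteq> 0" "g \<noteq> 0" using f g by (auto simp: monics_def)
  have "poly.coeff (f * g) i \<in> K" for i
    unfolding coeff_mult using f g by (intro sum_closed) (auto simp: monics_def closed)
  moreover have "lead_coeff (f * g) = 1" using f g unfolding lead_coeff_mult by (auto simp: monics_def)
  moreover have "Polynomial.degree (f * g) = d + e" using f g nz by (simp add: monics_def degree_mult_eq)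
  ultimately show "f * g \<in> monics K (d + e)" by (simp add: monics_def)
qed

abbreviation "\<chi> \<equiv> legendre_poly_char K"

lemma char_mult:
  assumes "f \<in> monics K d" "g \<in> monics K e" "b \<in> K"
  shows "\<chi> b (f * g) = \<chi> b f * \<chi> b g"
proof -
  have nz: "f \<noteq> 0" "g \<noteq> 0" using assms by (auto simp: monics_def)
  have c: "poly f x \<in> K" "poly g x \<in> K" if "x \<in> K" for x
    using assms that by (auto simp: monics_def intro!: poly_closed)
  let ?v = "\<lambda>f. (- 1) ^ Polynomial.degree f * poly f 0 * poly f 1 * poly f b"
  have "?v (f * g) = ?v f * ?v g" using nz by (simp add: degree_mult_eq power_add mult_ac)
  moreover have "?v f \<in> K" "?v g \<in> K" using c assms(3) by (auto intro!: closed)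
  ultimately show ?thesis by (simp only: legendre_poly_char_def phi_mult)
qed

text \<open>The coefficient of T^d in the L-function of the character.\<close>

definition lsum :: "'b \<Rightarrow> nat \<Rightarrow> complex" where
  "lsum b d = (\<Sum>f\<in>monics K d. \<chi> b f)"

lemma lsum_0: "lsum b 0 = 1"
  by (simp add: lsum_def monics_0 legendre_poly_char_def)

lemma lsum_1: "lsum b 1 = cubic_sum b"
proof -
  have "\<chi> b [:- x, 1:] = phi (x * (x - 1) * (x - b))" for x
    unfolding legendre_poly_char_def by (rule arg_cong[where f = phi]) (simp add: algebra_simps)
  thus ?thesis by (simp add: lsum_def sum_monics_1[simplified] cubic_sum_def)
qed

text \<open>For X^2 + u X + c with c \<noteq> 0 the values at 1 and b are u + (1 + c) and b (u + (b
  + c / b)), and \<open>sum_phi_quadratic\<close> evaluates the sum over u. The two factors have the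
  same zero only for c = b; that term yields Q, and the rest adds up to a multiple of the sum of
  phi, which is 0.\<close>

lemma lsum_2:
  assumes b: "b \<in> K" "b \<noteq> 0" "b \<noteq> 1"
  shows "lsum b 2 = of_nat Q"
proof -
  have inner: "(\<Sum>u\<in>K. \<chi> b [:c, u, 1:]) = phi b * (if c = b then of_nat Q * phi b else 0) - phi b * phi c" if c: "c \<in> K" for c
  proof (cases "c = 0")
    case True
    thus ?thesis using b by (simp add: legendre_poly_char_def)
  next
    case False
    have "\<chi> b [:c, u, 1:] = phi c * phi b * phi ((u + (1 + c)) * (u + (b + c / b)))" if u: "u \<in> K" for u
    proof -
      have "(- 1) ^ Polynomial.degree [:c, u, 1:] * poly [:c, u, 1:] 0 * poly [:c, u, 1:] 1 * poly [:c, u, 1:] b =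
        (c * b) * ((u + (1 + c)) * (u + (b + c / b)))"
        using b by (simp add: field_simps)
      thus ?thesis unfolding legendre_poly_char_def using u c b by (simp only: phi_mult closed)
    qed
    hence "(\<Sum>u\<in>K. \<chi> b [:c, u, 1:]) = phi c * phi b * (\<Sum>u\<in>K. phi ((u + (1 + c)) * (u + (b + c / b))))"
      by (simp add: sum_distrib_left)
    also have "(\<Sum>u\<in>K. phi ((u + (1 + c)) * (u + (b + c / b)))) = (if c = b then of_nat Q - 1 else - 1)"
    proof -
      have "1 + c = b + c / b \<longleftrightarrow> (c - b) * (b - 1) = 0" using b by (auto simp: field_simps)
      hence "1 + c = b + c / b \<longleftrightarrow> c = b" using b by simp
      thus ?thesis using b c by (simp add: sum_phi_quadratic closed)
    qed
    finally show ?thesis by (simp add: algebra_simps)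
  qed
  have "lsum b 2 = (\<Sum>c\<in>K. phi b * (if c = b then of_nat Q * phi b else 0) - phi b * phi c)"
    unfolding lsum_def sum_monics_2 by (intro sum.cong refl inner)
  also have "\<dots> = phi b * phi b * of_nat Q"
    using fin b sum_phi by (simp add: sum_subtractf flip: sum_distrib_left)
  also have "phi b * phi b = phi (b ^ 2)" using b by (simp add: phi_mult power2_eq_square)
  also have "\<dots> = 1" using b phi_square by auto
  finally show ?thesis by simp
qed

(* Adding a multiple of (T - 1)(T - b) moves only the value at 0, over which the character sums to 0. *)
lemma lsum_ge_3:
  assumes b: "b \<in> K" "b \<noteq> 0" "b \<noteq> 1" and d: "d \<ge> 3"
  shows "lsum b d = 0"
proof -
  define w where "w = [:b, - (1 + b), 1:]"
  have w: "poly w x = (x - 1) * (x - b)" for x by (simp add: w_def algebra_simps)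
  have wc: "poly.coeff w i \<in> K" for i
    using b closed by (auto simp: w_def coeff_pCons split: nat.splits)
  \<comment> \<open>Here d \<ge> 3 enters: w has degree 2, so adding a multiple of it keeps f monic
    of degree d.\<close>
  have dw: "Polynomial.degree (Polynomial.smult t w) < d" for t using d by (simp add: w_def degree_smult_eq)
  have mem: "f + Polynomial.smult t w \<in> monics K d" if f: "f \<in> monics K d" and t: "t \<in> K" for f t
  proof -
    have "Polynomial.degree (f + Polynomial.smult t w) = d"
      using f dw[of t] by (subst degree_add_eq_left) (auto simp: monics_def)
    moreover have "poly.coeff (Polynomial.smult t w) d = 0" using dw by (intro coeff_eq_0)
    moreover have "poly.coeff f i + t * poly.coeff w i \<in> K" for i
      using f wc[of i] t by (intro closed) (simp_all add: monics_def)
    ultimately show ?thesis using f unfolding monics_def mem_Collect_eq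
      by (elim conjE) (simp only: coeff_add coeff_smult add_0_right simp_thms)
  qed
  have val: "\<chi> b (f + Polynomial.smult t w) = phi ((- 1) ^ d * poly f 1 * poly f b * b) * phi (t + poly f 0 / b)"
    if f: "f \<in> monics K d" and t: "t \<in> K" for f t
  proof -
    have pc: "poly f x \<in> K" if "x \<in> K" for x using f that by (auto simp: monics_def intro!: poly_closed)
    have "Polynomial.degree (f + Polynomial.smult t w) = d" using mem[OF f t] by (simp add: monics_def)
    hence "\<chi> b (f + Polynomial.smult t w) = phi ((- 1) ^ d * (poly f 0 + t * b) * poly f 1 * poly f b)"
      by (simp add: legendre_poly_char_def w)
    also have "(- 1) ^ d * (poly f 0 + t * b) * poly f 1 * poly f b = ((- 1) ^ d * poly f 1 * poly f b * b) * (t + poly f 0 / b)"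
      using b by (simp add: field_simps)
    finally show ?thesis using pc b t by (simp add: phi_mult closed)
  qed
  have shift: "(\<Sum>f\<in>monics K d. \<chi> b (f + Polynomial.smult t w)) = lsum b d" if t: "t \<in> K" for t
  proof -
    have "bij_betw (\<lambda>f. f + Polynomial.smult t w) (monics K d) (monics K d)"
    proof (rule bij_betwI[where g = "\<lambda>f. f + Polynomial.smult (- t) w"])
      have "- t \<in> K" using t by (rule closed)
      thus "(\<lambda>f. f + Polynomial.smult (- t) w) \<in> monics K d \<rightarrow> monics K d" using mem by blast
      show "(\<lambda>f. f + Polynomial.smult t w) \<in> monics K d \<rightarrow> monics K d" using mem t by blast
    qed simp_all
    thus ?thesis unfolding lsum_def by (rule sum.reindex_bij_betw)
  qed
  have "of_nat Q * lsum b d = (\<Sum>t\<in>K. \<Sum>f\<in>monics K d. \<chi> b (f + Polynomial.smult t w))"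
    using shift by simp
  also have "\<dots> = (\<Sum>f\<in>monics K d. \<Sum>t\<in>K. \<chi> b (f + Polynomial.smult t w))" by (rule sum.swap)
  also have "\<dots> = (\<Sum>f\<in>monics K d. phi ((- 1) ^ d * poly f 1 * poly f b * b) * (\<Sum>t\<in>K. phi (t + poly f 0 / b)))"
    by (intro sum.cong refl) (simp add: val sum_distrib_left)
  also have "\<dots> = 0"
  proof (intro sum.neutral ballI)
    fix f assume f: "f \<in> monics K d"
    hence "poly f 0 \<in> K" using zero by (auto simp: monics_def intro!: poly_closed)
    hence "poly f 0 / b \<in> K" using b(1) by (rule closed)
    thus "phi ((- 1) ^ d * poly f 1 * poly f b * b) * (\<Sum>t\<in>K. phi (t + poly f 0 / b)) = 0" by (simp add: sum_phi_shift)
  qed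
  finally show ?thesis using Q_gt_2 by simp
qed

end

section \<open>Point counts over field extensions\<close>

locale odd_finite_field =
  fixes a :: "'a::{field,finite}" and p r q :: nat
  assumes prime_p: "prime p" and p_ge_3: "p \<ge> 3" and r_ge_1: "r \<ge> 1" and q_eq: "q = p ^ r" and CARD_q: "CARD('a) = q"
    and a_ne: "a \<noteq> 0" "a \<noteq> 1"
begin

text \<open>Keeps \<open>E 1\<close> from being rewritten to \<open>E (Suc 0)\<close>.\<close>

declare One_nat_def [simp del]

lemma char_field: "CHAR('a) = p"
proof -
  have "CHAR('a) > 0" by (rule finite_imp_CHAR_pos) simp
  hence "prime CHAR('a)" by (rule prime_CHAR_semidom)
  moreover have "CHAR('a) dvd p ^ r"
  proof -
    \<comment> \<open>Translation by 1 permutes the field; comparing the sums shows that the number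
      of elements is 0 in the field.\<close>
    have "(\<Sum>x\<in>UNIV. x + 1) = (\<Sum>x\<in>UNIV. x :: 'a)"
    proof (rule sum.reindex_bij_betw[where g = "\<lambda>x. x"])
      show "bij (\<lambda>x :: 'a. x + 1)" by (rule bij_betwI[where g = "\<lambda>x. x - 1"]) auto
    qed
    hence "of_nat CARD('a) = (0 :: 'a)" by (simp add: sum.distrib)
    thus ?thesis unfolding of_nat_eq_0_iff_char_dvd q_eq CARD_q .
  qed
  ultimately show ?thesis using prime_p by (metis prime_dvd_power primes_dvd_imp_eq)
qed

lemma q_gt_2: "q > 2" 
proof -
  have "p ^ 1 \<le> p ^ r" using r_ge_1 p_ge_3 by (intro power_increasing) auto
  thus ?thesis using q_eq p_ge_3 by simp
qed

lemma frob_add: "(x + y) ^ (q ^ k) = x ^ (q ^ k) + (y :: 'a alg_closure) ^ (q ^ k)"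
proof (rule freshmans_dream')
  show "prime CHAR('a alg_closure)" using char_field prime_p by simp
  show "q ^ k = CHAR('a alg_closure) ^ (r * k)" using char_field q_eq by (simp add: power_mult)
qed

lemma of_nat_q: "of_nat q = (0 :: 'a alg_closure)"
proof -
  have "CHAR('a alg_closure) dvd q" using char_field q_eq r_ge_1 by simp
  thus ?thesis by (simp add: of_nat_eq_0_iff_char_dvd)
qed

lemma two_ne: "(2 :: 'a alg_closure) \<noteq> 0" "(2 :: 'a) \<noteq> 0"
proof -
  have n: "\<not> p dvd 2" using p_ge_3 by (auto dest: dvd_imp_le)
  have "of_nat 2 \<noteq> (0 :: 'a alg_closure)" using n char_field by (subst of_nat_eq_0_iff_char_dvd) simp
  thus "(2 :: 'a alg_closure) \<noteq> 0" by simp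
  have "of_nat 2 \<noteq> (0 :: 'a)" using n char_field by (subst of_nat_eq_0_iff_char_dvd) simp
  thus "(2 :: 'a) \<noteq> 0" by simp
qed

lemma frob_uminus: "(- x) ^ (q ^ k) = - ((x :: 'a alg_closure) ^ (q ^ k))"
proof -
  have "(x + - x) ^ (q ^ k) = x ^ (q ^ k) + (- x) ^ (q ^ k)" by (rule frob_add)
  moreover have "(x + - x) ^ (q ^ k) = 0" using q_gt_2 by simp
  ultimately show ?thesis by (simp add: eq_neg_iff_add_eq_0 add.commute)
qed

lemma frob_diff: "(x - y) ^ (q ^ k) = x ^ (q ^ k) - (y :: 'a alg_closure) ^ (q ^ k)"
  using frob_add[of x "- y" k] by (simp add: frob_uminus)

lemma frob_inj: "x ^ (q ^ k) = (y :: 'a alg_closure) ^ (q ^ k) \<Longrightarrow> x = y"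
proof -
  assume "x ^ (q ^ k) = y ^ (q ^ k)"
  hence "(x - y) ^ (q ^ k) = 0" by (simp add: frob_diff)
  thus ?thesis by simp
qed

abbreviation "E \<equiv> (ext_field :: nat \<Rightarrow> 'a alg_closure set)"

lemma E_eq: "E k = {x. x ^ (q ^ k) = x}"
  by (simp add: ext_field_def CARD_q)

text \<open>The derivative of X ^ (q ^ k) - X is -1, so all roots are simple and their number is the
  degree.\<close>

lemma card_ext_field:
  assumes "k \<ge> 1"
  shows "finite (E k)" "card (E k) = q ^ k"
proof -
  let ?Q = "q ^ k"
  have Q: "?Q > 1" using q_gt_2 assms by (intro one_less_power) auto
  define f where "f = Polynomial.monom 1 ?Q - Polynomial.monom (1 :: 'a alg_closure) 1"
  have degf: "Polynomial.degree f = ?Q"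
    unfolding f_def diff_conv_add_uminus using Q by (subst degree_add_eq_left) (auto simp: degree_monom_eq)
  have f0: "f \<noteq> 0"
  proof
    assume "f = 0"
    hence "Polynomial.degree f = 0" by simp
    thus False using degf Q by linarith
  qed
  have roots: "{x. poly f x = 0} = E k" by (auto simp: f_def poly_monom E_eq)
  show "finite (E k)" using poly_roots_finite[OF f0] roots by simp
  have Q0: "of_nat ?Q = (0 :: 'a alg_closure)" using of_nat_q assms by simp
  have der: "pderiv f = - 1"
    unfolding f_def pderiv_diff pderiv_monom Q0 by (simp add: monom_0 one_pCons)
  have ord: "Polynomial.order x f = 1" if x: "poly f x = 0" for x
  proof (rule antisym)
    show "Polynomial.order x f \<le> 1"
    proof (rule ccontr)
      assume "\<not> Polynomial.order x f \<le> 1"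
      hence "[:- x, 1:] ^ 2 dvd f" using order_divides[of x 2 f] by auto
      then obtain g where g: "f = [:- x, 1:] ^ 2 * g" by (elim dvdE)
      have "f = [:- x, 1:] * ([:- x, 1:] * g)" using g by (simp only: power2_eq_square mult.assoc)
      hence "poly (pderiv f) x = 0" by (simp only: pderiv_mult poly_add poly_mult) simp
      thus False using der by simp
    qed
    have "Polynomial.order x f \<noteq> 0" using x order_root[of f x] f0 by simp
    thus "1 \<le> Polynomial.order x f" by simp
  qed
  have "(\<Sum>x\<in>E k. Polynomial.order x f) = ?Q" using alg_closed_sum_order[OF f0] roots degf by simp
  moreover have "(\<Sum>x\<in>E k. Polynomial.order x f) = (\<Sum>x\<in>E k. 1)"
    by (intro sum.cong refl ord) (simp flip: roots)
  ultimately show "card (E k) = ?Q" by simp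
qed

lemma ext_field_locale: "k \<ge> 1 \<Longrightarrow> odd_finite_subfield (E k)"
proof
  assume k: "k \<ge> 1"
  have Q: "q ^ k > 0" using q_gt_2 by simp
  show "finite (E k)" using card_ext_field[OF k] by simp
  show "0 \<in> E k" "1 \<in> E k" using Q by (auto simp: E_eq)
  show "x - y \<in> E k" "x * y \<in> E k" if "x \<in> E k" "y \<in> E k" for x y
    using that by (auto simp: E_eq frob_diff power_mult_distrib)
  show "inverse x \<in> E k" if "x \<in> E k" for x using that by (auto simp: E_eq power_inverse)
  show "(2 :: 'a alg_closure) \<noteq> 0" by (rule two_ne)
qed

lemma ext_field_1: "E 1 = range to_ac"
proof -
  have fc: "x ^ q = x" for x :: 'a
  proof -
    have "odd_finite_subfield (UNIV :: 'a set)" by unfold_locales (use two_ne in auto)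
    from odd_finite_subfield.pow_Q[OF this] show ?thesis by (simp add: CARD_q)
  qed
  have "to_ac x \<in> E 1" for x :: 'a using fc[of x] by (simp add: E_eq flip: to_ac_power)
  hence "range to_ac \<subseteq> E 1" by auto
  moreover have "card (range (to_ac :: 'a \<Rightarrow> _)) = card (E 1)" 
    using card_ext_field[of 1] card_image[OF inj_to_ac[where 'a = 'a]] by (simp add: CARD_q)
  ultimately show ?thesis using card_ext_field[of 1] by (metis card_subset_eq order.refl)
qed

sublocale K1: odd_finite_subfield "E 1" by (rule ext_field_locale) simp

abbreviation "b \<equiv> (to_ac a :: 'a alg_closure)"

lemma b: "b \<in> E 1" "b \<noteq> 0" "b \<noteq> 1"
  using a_ne ext_field_1 to_ac_eq_iff[of a 1] by auto

lemma E1_frob: "x \<in> E 1 \<Longrightarrow> x ^ (q ^ i) = x"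
proof (induction i)
  case (Suc i)
  have "x ^ (q ^ Suc i) = (x ^ (q ^ i)) ^ q" by (simp add: mult.commute flip: power_mult)
  thus ?case using Suc by (simp add: E_eq)
qed simp

lemma E1_sub: "x \<in> E 1 \<Longrightarrow> x \<in> E k"
  using E1_frob by (auto simp: E_eq)

text \<open>For x in \<open>E k\<close> this is the characteristic polynomial of x over the field
  with q elements: a power of the minimal polynomial of x.\<close>

definition orbit_poly :: "nat \<Rightarrow> 'a alg_closure \<Rightarrow> 'a alg_closure poly" where
  "orbit_poly k x = (\<Prod>i<k. [:- (x ^ (q ^ i)), 1:])"

lemma frob_sum: "(\<Sum>i\<in>A. f i) ^ q = (\<Sum>i\<in>A. f i ^ q :: 'a alg_closure)"
proof (induction A rule: infinite_finite_induct)
  case (insert x A)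
  thus ?case using frob_add[of "f x" "sum f A" 1] by simp
qed (use q_gt_2 in auto)

lemma frob_root: "\<exists>y. y ^ q = (x :: 'a alg_closure)"
  using nth_root_exists[of q x] q_gt_2 by simp

text \<open>Frobenius on coefficients. Its fixed points are the polynomials over the base field, and
  because every element is a q-th power, an identity for \<open>frob_poly\<close> can be checked on
  values at q-th powers.\<close>

definition frob_poly :: "'a alg_closure poly \<Rightarrow> 'a alg_closure poly" where
  "frob_poly f = map_poly (\<lambda>c. c ^ q) f"

lemma poly_frob_poly: "poly (frob_poly f) (x ^ q) = poly f x ^ q"
proof -
  have co: "poly.coeff (frob_poly f) i = poly.coeff f i ^ q" for i
    unfolding frob_poly_def using q_gt_2 by (subst coeff_map_poly) auto
  have "Polynomial.degree (frob_poly f) = Polynomial.degree f"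
    unfolding frob_poly_def by (rule degree_map_poly) (use q_gt_2 in auto)
  thus ?thesis unfolding poly_altdef frob_sum by (simp add: co power_mult_distrib mult.commute flip: power_mult)
qed

lemma frob_poly_fixed: "frob_poly f = f \<longleftrightarrow> (\<forall>i. poly.coeff f i \<in> E 1)"
proof -
  have co: "poly.coeff (frob_poly f) i = poly.coeff f i ^ q" for i
    unfolding frob_poly_def using q_gt_2 by (subst coeff_map_poly) auto
  show ?thesis by (auto simp: poly_eq_iff co E_eq)
qed

lemma frob_poly_eqI:
  assumes "\<And>x. poly g (x ^ q) = poly f x ^ q"
  shows "frob_poly f = g"
proof (rule alg_closed_poly_eqI)
  fix x :: "'a alg_closure"
  obtain y where "x = y ^ q" using frob_root by metis
  thus "poly (frob_poly f) x = poly g x" using assms poly_frob_poly by simp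
qed

lemma poly_orbit: "poly (orbit_poly k x) y = (\<Prod>i<k. y - x ^ (q ^ i))"
  by (simp add: orbit_poly_def poly_prod)

lemma orbit_poly_monic: "Polynomial.degree (orbit_poly k x) = k" "lead_coeff (orbit_poly k x) = 1"
proof -
  show "lead_coeff (orbit_poly k x) = 1" unfolding orbit_poly_def lead_coeff_prod by simp
  show "Polynomial.degree (orbit_poly k x) = k" unfolding orbit_poly_def
    by (subst degree_prod_eq_sum_degree) auto
qed

text \<open>Frobenius permutes the linear factors cyclically, since x ^ (q ^ k) = x closes the
  cycle.\<close>

lemma orbit_poly_in_monics:
  assumes "x \<in> E k"
  shows "orbit_poly k x \<in> monics (E 1) k"
proof -
  have "frob_poly (orbit_poly k x) = orbit_poly k x"
  proof (rule frob_poly_eqI)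
    fix y
    have "poly (orbit_poly k x) y ^ q = (\<Prod>i<k. y ^ q - x ^ (q ^ Suc i))"
      unfolding poly_orbit prod_power_distrib
      using frob_diff[of y _ 1] by (intro prod.cong) (auto simp: mult.commute simp flip: power_mult)
    also have "\<dots> = (\<Prod>i<k. y ^ q - x ^ (q ^ i))"
    proof (cases k)
      case (Suc m)
      have "x ^ (q ^ Suc m) = x ^ (q ^ 0)" using assms Suc by (simp add: E_eq)
      thus ?thesis unfolding Suc
        by (subst prod.lessThan_Suc, subst prod.lessThan_Suc_shift) (simp add: mult.commute)
    qed simp
    finally show "poly (orbit_poly k x) (y ^ q) = poly (orbit_poly k x) y ^ q" by (simp add: poly_orbit)
  qed
  thus ?thesis using orbit_poly_monic unfolding frob_poly_fixed monics_def by blast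
qed

text \<open>Frobenius fixes f and F, so F times the difference of \<open>frob_poly g\<close> and g
  is 0, and F can be cancelled.\<close>

lemma monics_quotient:
  assumes f: "f \<in> monics (E 1) d" and F: "F \<in> monics (E 1) k" and fg: "f = F * g"
  shows "g \<in> monics (E 1) (d - k)" "k \<le> d"
proof -
  have F0: "F \<noteq> 0" and f0: "f \<noteq> 0" using F f by (auto simp: monics_def)
  hence g0: "g \<noteq> 0" using fg by auto
  have ff: "frob_poly f = f" "frob_poly F = F" using f F by (simp_all add: frob_poly_fixed monics_def)
  have "F * (frob_poly g - g) = 0"
  proof (rule alg_closed_poly_eqI)
    fix x :: "'a alg_closure"
    obtain y where x: "x = y ^ q" using frob_root by metis
    have "poly F (y ^ q) * poly (frob_poly g) (y ^ q) = (poly F y * poly g y) ^ q"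
      using poly_frob_poly[of F y] poly_frob_poly[of g y] ff by (simp add: power_mult_distrib)
    also have "\<dots> = poly f (y ^ q)" using poly_frob_poly[of f y] ff fg by simp
    finally show "poly (F * (frob_poly g - g)) x = poly 0 x" using fg x by (simp add: algebra_simps)
  qed
  hence "frob_poly g = g" using F0 by simp
  moreover have "Polynomial.degree f = Polynomial.degree F + Polynomial.degree g" unfolding fg using F0 g0 by (rule degree_mult_eq)
  moreover have "lead_coeff f = lead_coeff F * lead_coeff g" unfolding fg by (rule lead_coeff_mult)
  ultimately show "g \<in> monics (E 1) (d - k)" "k \<le> d"
    using f F by (auto simp: frob_poly_fixed monics_def)
qed

lemma frob_root_orbit: "f \<in> monics (E 1) d \<Longrightarrow> poly f y = 0 \<Longrightarrow> poly f (y ^ (q ^ i)) = 0"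
proof (induction i)
  case (Suc i)
  have ff: "frob_poly f = f" using Suc.prems by (simp add: frob_poly_fixed monics_def)
  have "poly f (y ^ (q ^ Suc i)) = poly (frob_poly f) ((y ^ (q ^ i)) ^ q)"
    unfolding ff by (simp add: mult.commute flip: power_mult)
  also have "\<dots> = poly f (y ^ (q ^ i)) ^ q" by (rule poly_frob_poly)
  finally show ?case using Suc q_gt_2 by simp
qed simp

text \<open>The degree of y over the base field, provided that y lies in some \<open>E k\<close>;
  for roots of monic polynomials over the base field this is shown below.\<close>

definition frob_period :: "'a alg_closure \<Rightarrow> nat" where
  "frob_period y = (LEAST k. k \<ge> 1 \<and> y \<in> E k)"

lemma frob_power_add: "(y :: 'a alg_closure) ^ (q ^ (i + j)) = (y ^ (q ^ i)) ^ (q ^ j)"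
  by (simp add: power_add flip: power_mult)

context
  fixes f d y
  assumes f: "f \<in> monics (E 1) d" and y: "poly f y = 0"
begin

lemma frob_period: "frob_period y \<ge> 1" "y \<in> E (frob_period y)"
proof -
  have f0: "f \<noteq> 0" using f by (auto simp: monics_def)
  have "range (\<lambda>i. y ^ (q ^ i)) \<subseteq> {x. poly f x = 0}" using frob_root_orbit[OF f y] by auto
  hence "finite (range (\<lambda>i. y ^ (q ^ i)))" using poly_roots_finite[OF f0] finite_subset by blast
  hence "\<not> inj (\<lambda>i. y ^ (q ^ i))" using finite_imageD by blast
  then obtain i j where ij: "i < j" "y ^ (q ^ i) = y ^ (q ^ j)" unfolding inj_def by (metis linorder_neqE_nat)
  \<comment> \<open>Frobenius is injective, so a repetition in the orbit can be pulled back to its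
    start.\<close>
  have "(y ^ (q ^ (j - i))) ^ (q ^ i) = y ^ (q ^ i)" using ij frob_power_add[of y "j - i" i] by simp
  hence "y ^ (q ^ (j - i)) = y" by (rule frob_inj)
  hence "j - i \<ge> 1 \<and> y \<in> E (j - i)" using ij by (simp add: E_eq)
  from LeastI[of "\<lambda>k. k \<ge> 1 \<and> y \<in> E k", OF this] show "frob_period y \<ge> 1" "y \<in> E (frob_period y)"
    by (auto simp: frob_period_def)
qed

lemma frob_mod: "y ^ (q ^ i) = y ^ (q ^ (i mod frob_period y))"
proof -
  have m: "y ^ (q ^ (frob_period y * t)) = y" for t
  proof (induction t)
    case (Suc t)
    have "y ^ (q ^ (frob_period y * Suc t)) = (y ^ (q ^ frob_period y)) ^ (q ^ (frob_period y * t))"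
      using frob_power_add[of y "frob_period y" "frob_period y * t"] by simp
    thus ?case using Suc frob_period(2) by (simp add: E_eq)
  qed simp
  have "y ^ (q ^ i) = y ^ (q ^ (frob_period y * (i div frob_period y) + i mod frob_period y))" by simp
  also have "\<dots> = y ^ (q ^ (i mod frob_period y))" unfolding frob_power_add m ..
  finally show ?thesis .
qed

lemma in_ext_field_iff: "k \<ge> 1 \<Longrightarrow> y \<in> E k \<longleftrightarrow> frob_period y dvd k"
proof
  assume k: "k \<ge> 1" "y \<in> E k"
  let ?m = "k mod frob_period y"
  have "y \<in> E ?m" using k(2) frob_mod[of k] by (simp add: E_eq)
  moreover have "?m < frob_period y" using frob_period(1) by simp
  ultimately have "?m = 0" using not_less_Least[of ?m "\<lambda>k. k \<ge> 1 \<and> y \<in> E k"] by (auto simp: frob_period_def)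
  thus "frob_period y dvd k" by auto
next
  assume "frob_period y dvd k"
  thus "y \<in> E k" using frob_mod[of k] by (simp add: E_eq dvd_imp_mod_0)
qed

lemma orbit_inj: "inj_on (\<lambda>i. y ^ (q ^ i)) {..<frob_period y}"
proof -
  have lt: False if ij: "i < j" "j < frob_period y" "y ^ (q ^ i) = y ^ (q ^ j)" for i j
  proof -
    have "(y ^ (q ^ (j - i))) ^ (q ^ i) = y ^ (q ^ i)" using ij frob_power_add[of y "j - i" i] by simp
    hence "y ^ (q ^ (j - i)) = y" by (rule frob_inj)
    hence "y \<in> E (j - i)" by (simp add: E_eq)
    hence "frob_period y dvd j - i" using in_ext_field_iff[of "j - i"] ij by simp
    thus False using ij by (auto dest: dvd_imp_le)
  qed
  show ?thesis by (rule inj_onI) (metis lessThan_iff linorder_neqE_nat lt)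
qed

lemma orbit_poly_power: "orbit_poly (frob_period y * t) y = orbit_poly (frob_period y) y ^ t"
proof (induction t)
  case (Suc t)
  have split: "orbit_poly (m + n) y = orbit_poly m y * (\<Prod>i<n. [:- (y ^ (q ^ (m + i))), 1:])" for m n
    by (induction n) (simp_all add: orbit_poly_def mult.assoc del: mult_pCons_left mult_pCons_right)
  have "orbit_poly (frob_period y * Suc t) y = orbit_poly (frob_period y + frob_period y * t) y" by simp
  also have "\<dots> = orbit_poly (frob_period y) y * (\<Prod>i<frob_period y * t. [:- (y ^ (q ^ (frob_period y + i))), 1:])" by (rule split)
  also have "(\<Prod>i<frob_period y * t. [:- (y ^ (q ^ (frob_period y + i))), 1:]) = orbit_poly (frob_period y * t) y"
    unfolding orbit_poly_def
  proof (rule prod.cong[OF refl])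
    fix i
    show "[:- (y ^ (q ^ (frob_period y + i))), 1:] = [:- (y ^ (q ^ i)), 1:]"
      using frob_mod[of "frob_period y + i"] frob_mod[of i] by simp
  qed
  finally show ?case using Suc by simp
qed (simp add: orbit_poly_def)

lemma orbit_poly_dvd: "orbit_poly (frob_period y) y dvd f"
proof -
  have "orbit_poly (frob_period y) y = (\<Prod>z\<in>(\<lambda>i. y ^ (q ^ i)) ` {..<frob_period y}. [:- z, 1:])"
    unfolding orbit_poly_def using orbit_inj by (simp add: prod.reindex)
  also have "\<dots> dvd f" using frob_root_orbit[OF f y] by (intro distinct_roots_dvd) auto
  finally show ?thesis .
qed

lemma order_orbit_poly: "Polynomial.order y (orbit_poly (frob_period y) y) = 1"
proof -
  obtain m where m: "frob_period y = Suc m" using frob_period(1) by (cases "frob_period y") auto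
  have e: "orbit_poly (frob_period y) y = [:- y, 1:] * (\<Prod>i<frob_period y - 1. [:- (y ^ (q ^ Suc i)), 1:])"
    unfolding orbit_poly_def m prod.lessThan_Suc_shift by (simp del: power_Suc mult_pCons_left mult_pCons_right)
  have "poly (\<Prod>i<frob_period y - 1. [:- (y ^ (q ^ Suc i)), 1:]) y \<noteq> 0"
  proof -
    have "y \<noteq> y ^ (q ^ Suc i)" if "i < frob_period y - 1" for i
      using inj_onD[OF orbit_inj, of 0 "Suc i"] that m by (auto simp del: power_Suc)
    thus ?thesis by (simp add: poly_prod)
  qed
  moreover have "Polynomial.order y [:- y, 1:] = 1" using order_power_n_n[of y 1] by simp
  moreover have "orbit_poly (frob_period y) y \<noteq> 0" using orbit_poly_monic(2)[of "frob_period y" y] by auto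
  ultimately show ?thesis unfolding e by (subst order_mult) (auto simp: order_0I)
qed

end

text \<open>One period gives the minimal polynomial P of y, and t periods give P ^ t. As y is a
  simple root of P, splitting P off from f lowers the multiplicity of y by exactly one.\<close>

lemma orbit_poly_power_dvd_iff:
  "f \<in> monics (E 1) d \<Longrightarrow> poly f y = 0 \<Longrightarrow>
    orbit_poly (frob_period y * t) y dvd f \<longleftrightarrow> t \<le> Polynomial.order y f"
proof
  assume f: "f \<in> monics (E 1) d" and y: "poly f y = 0" and dvd: "orbit_poly (frob_period y * t) y dvd f"
  let ?P = "orbit_poly (frob_period y) y"
  have f0: "f \<noteq> 0" using f by (auto simp: monics_def)
  obtain g where g: "f = ?P ^ t * g" using dvd orbit_poly_power[OF f y, of t] by (auto elim: dvdE)
  have "[:- y, 1:] dvd ?P" using order_orbit_poly[OF f y] order_root[of ?P y] by (simp add: poly_eq_0_iff_dvd)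
  hence "[:- y, 1:] ^ t dvd f" unfolding g by (meson dvd_mult2 dvd_power_same)
  thus "t \<le> Polynomial.order y f" using order_divides[of y t f] f0 by simp
next
  assume "f \<in> monics (E 1) d" "poly f y = 0" "t \<le> Polynomial.order y f"
  thus "orbit_poly (frob_period y * t) y dvd f"
  proof (induction t arbitrary: f d)
    case 0
    thus ?case by (simp add: orbit_poly_def)
  next
    case (Suc t)
    let ?P = "orbit_poly (frob_period y) y"
    note f = Suc.prems(1,2)
    have f0: "f \<noteq> 0" using f by (auto simp: monics_def)
    obtain g where g: "f = ?P * g" using orbit_poly_dvd[OF f] by (elim dvdE)
    have gm: "g \<in> monics (E 1) (d - frob_period y)"
      using monics_quotient(1)[OF f(1) orbit_poly_in_monics[OF frob_period(2)[OF f]] g] .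
    have og: "t \<le> Polynomial.order y g"
      using order_mult[of ?P g y] f0 g order_orbit_poly[OF f] Suc.prems(3) by simp
    have "?P ^ t dvd g"
    proof (cases "t = 0")
      case False
      hence "poly g y = 0" using og order_0I[of g y] by fastforce
      thus ?thesis using Suc.IH[OF gm _ og] orbit_poly_power[OF f, of t] by simp
    qed simp
    hence "?P ^ Suc t dvd f" unfolding g by simp
    thus ?case using orbit_poly_power[OF f, of "Suc t"] by simp
  qed
qed

text \<open>A pair \<open>(k, y)\<close> amounts to a power P ^ t of an irreducible polynomial
  dividing f, with k = t deg P, together with a root y of P. Each such power is thus counted deg P
  times: this is the weight of the von Mangoldt function, whose sum over the divisors of f is deg
  f.\<close>

definition orbit_divisors :: "'a alg_closure poly \<Rightarrow> (nat \<times> 'a alg_closure) set" where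
  "orbit_divisors f = {(k, y). k \<ge> 1 \<and> y \<in> E k \<and> orbit_poly k y dvd f}"

lemma card_orbit_divisors:
  assumes f: "f \<in> monics (E 1) d"
  shows "finite (orbit_divisors f)" "card (orbit_divisors f) = d"
proof -
  have f0: "f \<noteq> 0" using f by (auto simp: monics_def)
  let ?R = "{y. poly f y = 0}"
  have finR: "finite ?R" by (rule poly_roots_finite[OF f0])
  have root: "poly f y = 0" if "k \<ge> 1" "orbit_poly k y dvd f" for k y
  proof -
    have "poly (orbit_poly k y) y = 0" using that(1) by (auto simp: poly_orbit intro!: prod_zero bexI[of _ 0])
    thus ?thesis using that(2) by (auto elim!: dvdE)
  qed
  have eq: "orbit_divisors f = (\<lambda>(y, t). (frob_period y * t, y)) ` (SIGMA y : ?R. {1..Polynomial.order y f})"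
  proof (intro equalityI subsetI)
    fix x assume "x \<in> orbit_divisors f"
    then obtain k y where x: "x = (k, y)" "k \<ge> 1" "y \<in> E k" "orbit_poly k y dvd f" by (auto simp: orbit_divisors_def)
    have y: "poly f y = 0" by (rule root[OF x(2,4)])
    obtain t where t: "k = frob_period y * t" using in_ext_field_iff[OF f y x(2)] x(3) by (auto elim: dvdE)
    hence "t \<ge> 1" using x(2) by (cases t) auto
    moreover have "t \<le> Polynomial.order y f" using orbit_poly_power_dvd_iff[OF f y, of t] x(4) t by simp
    ultimately show "x \<in> (\<lambda>(y, t). (frob_period y * t, y)) ` (SIGMA y : ?R. {1..Polynomial.order y f})"
      using x(1) t y by (intro image_eqI[of _ _ "(y, t)"]) auto
  next
    fix x assume "x \<in> (\<lambda>(y, t). (frob_period y * t, y)) ` (SIGMA y : ?R. {1..Polynomial.order y f})"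
    then obtain z where z: "z \<in> (SIGMA y : ?R. {1..Polynomial.order y f})" "x = (\<lambda>(y, t). (frob_period y * t, y)) z"
      by (elim imageE)
    obtain y t where "z = (y, t)" by (cases z)
    hence x: "x = (frob_period y * t, y)" "poly f y = 0" "1 \<le> t" "t \<le> Polynomial.order y f" using z by simp_all
    have k: "frob_period y * t \<ge> 1" using mult_le_mono[OF frob_period(1)[OF f x(2)] x(3)] by simp
    show "x \<in> orbit_divisors f"
      using k in_ext_field_iff[OF f x(2) k] orbit_poly_power_dvd_iff[OF f x(2), of t] x(1,4) by (simp add: orbit_divisors_def)
  qed
  show "finite (orbit_divisors f)" unfolding eq using finR by (intro finite_imageI finite_SigmaI) auto
  have "inj_on (\<lambda>(y, t). (frob_period y * t, y)) (SIGMA y : ?R. {1..Polynomial.order y f})"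
  proof (rule inj_onI)
    fix u v
    assume u: "u \<in> (SIGMA y : ?R. {1..Polynomial.order y f})"
      and e: "(\<lambda>(y, t). (frob_period y * t, y)) u = (\<lambda>(y, t). (frob_period y * t, y)) v"
    obtain y t y' t' where uv: "u = (y, t)" "v = (y', t')" by (cases u, cases v)
    have "frob_period y \<ge> 1" using frob_period(1)[OF f, of y] u by (simp add: uv)
    thus "u = v" using e by (auto simp: uv)
  qed
  hence "card (orbit_divisors f) = (\<Sum>y\<in>?R. Polynomial.order y f)"
    unfolding eq using finR by (subst card_image) (auto simp: card_SigmaI)
  also have "\<dots> = d" using alg_closed_sum_order[OF f0] f by (simp add: monics_def)
  finally show "card (orbit_divisors f) = d" .
qed

text \<open>Compatibility of quadratic characters with the norm: the left side is the character of N
  = h(x) ^ (1 + q + ... + q ^ (k - 1)), and N ^ ((q - 1) / 2) = h(x) ^ ((q ^ k - 1) / 2).\<close>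

lemma char_orbit_poly:
  assumes k: "k \<ge> 1" and x: "x \<in> E k"
  shows "K1.\<chi> b (orbit_poly k x) = odd_finite_subfield.phi (E k) (x * (x - 1) * (x - b))"
proof -
  interpret Kk: odd_finite_subfield "E k" by (rule ext_field_locale[OF k])
  define h where "h = x * (x - 1) * (x - b)"
  \<comment> \<open>Elements of \<open>E 1\<close> are fixed by Frobenius, so the conjugates of x -
    c are the differences of those of x and c.\<close>
  have val: "poly (orbit_poly k x) c = (- 1) ^ k * (\<Prod>i<k. (x - c) ^ (q ^ i))" if c: "c \<in> E 1" for c
  proof -
    have "poly (orbit_poly k x) c = (\<Prod>i<k. - 1 * (x - c) ^ (q ^ i))"
      unfolding poly_orbit using E1_frob[OF c] by (intro prod.cong refl) (simp add: frob_diff)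
    thus ?thesis by (simp only: prod.distrib prod_constant card_lessThan)
  qed
  define N where "N = (\<Prod>i<k. h ^ (q ^ i))"
  have "(- 1) ^ k * poly (orbit_poly k x) 0 * poly (orbit_poly k x) 1 * poly (orbit_poly k x) b =
      ((- 1) ^ k * (- 1) ^ k) * ((- 1) ^ k * (- 1) ^ k) * N"
    unfolding val[OF K1.zero] val[OF K1.one] val[OF b(1)] N_def h_def power_mult_distrib prod.distrib by (simp add: mult_ac)
  also have "\<dots> = N" by (simp flip: power_add)
  finally have e: "K1.\<chi> b (orbit_poly k x) = K1.phi N"
    by (simp add: legendre_poly_char_def orbit_poly_monic)
  have hE: "h \<in> E k" unfolding h_def using x E1_sub[OF b(1)] by (intro Kk.closed) auto
  have N: "N = h ^ (\<Sum>i<k. q ^ i)" unfolding N_def by (simp add: power_sum)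
  have "N \<in> E 1"
  proof -
    have "poly (orbit_poly k x) c \<in> E 1" if "c \<in> E 1" for c
      using orbit_poly_in_monics[OF x] that by (auto simp: monics_def intro!: K1.poly_closed)
    hence "(- 1) ^ k * poly (orbit_poly k x) 0 * poly (orbit_poly k x) 1 * poly (orbit_poly k x) b \<in> E 1"
      using b K1.zero K1.one by (intro K1.closed) auto
    thus ?thesis using \<open>_ = N\<close> \<open>_ = _ * N\<close> by simp
  qed
  have geo: "(q - 1) * (\<Sum>i<k. q ^ i) = q ^ k - 1"
  proof -
    obtain m where "q = Suc m" using q_gt_2 by (cases q) auto
    moreover have "m * (\<Sum>i<k. Suc m ^ i) + 1 = Suc m ^ k" for m k
      by (induction k) (simp_all add: algebra_simps)
    from this[of m k] have "m * (\<Sum>i<k. Suc m ^ i) = Suc m ^ k - 1" by simp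
    ultimately show ?thesis by simp
  qed
  have hh: "N ^ K1.H = h ^ Kk.H"
  proof -
    have c1: "K1.Q = q" "Kk.Q = q ^ k" using card_ext_field[of 1] card_ext_field[OF k] by simp_all
    have "2 * ((\<Sum>i<k. q ^ i) * K1.H) = (\<Sum>i<k. q ^ i) * (2 * K1.H)" by simp
    also have "\<dots> = (q - 1) * (\<Sum>i<k. q ^ i)" unfolding K1.H2 using c1 by (simp add: mult.commute)
    also have "\<dots> = Kk.Q - 1" unfolding geo c1 ..
    also have "\<dots> = 2 * Kk.H" by (rule Kk.H2[symmetric])
    finally have "(\<Sum>i<k. q ^ i) * K1.H = Kk.H" by simp
    thus ?thesis unfolding N by (metis power_mult)
  qed
  have z: "N = 0 \<longleftrightarrow> h = 0"
  proof -
    have "(\<Sum>i<k. q ^ i) > 0" using k q_gt_2 by (intro sum_pos) (auto simp: lessThan_empty_iff)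
    thus ?thesis by (simp add: N)
  qed
  show ?thesis unfolding e h_def[symmetric] K1.phi_def Kk.phi_def using \<open>N \<in> E 1\<close> hE z hh by auto
qed

definition power_sum_E :: "nat \<Rightarrow> complex" where
  "power_sum_E k = odd_finite_subfield.cubic_sum (E k) b"

lemma power_sum_E_eq: "k \<ge> 1 \<Longrightarrow> power_sum_E k = (\<Sum>x\<in>E k. K1.\<chi> b (orbit_poly k x))"
  by (simp add: power_sum_E_def odd_finite_subfield.cubic_sum_def[OF ext_field_locale] char_orbit_poly)

(* Every monic f of degree d is divisible by exactly d orbit polynomials, so each product in the
   double sum on the right is met d times. *)
lemma newton_identity:
  "of_nat d * K1.lsum b d = (\<Sum>k=1..d. power_sum_E k * K1.lsum b (d - k))"
proof -
  let ?M = "monics (E 1)" and ?X = "K1.\<chi> b"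
  have "of_nat d * K1.lsum b d = (\<Sum>f\<in>?M d. \<Sum>z\<in>orbit_divisors f. ?X f)"
    using card_orbit_divisors(2) by (simp add: K1.lsum_def sum_distrib_left)
  also have "\<dots> = (\<Sum>(f, z)\<in>(SIGMA f : ?M d. orbit_divisors f). ?X f)"
    using card_orbit_divisors(1) by (intro sum.Sigma) auto
  also have "\<dots> = (\<Sum>((k, y), g)\<in>(SIGMA z : (SIGMA k : {1..d}. E k). ?M (d - fst z)). ?X (orbit_poly k y * g))"
  proof (rule sum.reindex_bij_witness[where
      i = "\<lambda>((k, y), g). (orbit_poly k y * g, (k, y))" and
      j = "\<lambda>(f, (k, y)). ((k, y), f div orbit_poly k y)"])
    fix x assume "x \<in> (SIGMA f : ?M d. orbit_divisors f)"
    then obtain f k y where x: "x = (f, (k, y))" "f \<in> ?M d" "k \<ge> 1" "y \<in> E k" "orbit_poly k y dvd f"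
      by (auto simp: orbit_divisors_def)
    have fe: "f = orbit_poly k y * (f div orbit_poly k y)" using x(5) by simp
    note q = monics_quotient[OF x(2) orbit_poly_in_monics[OF x(4)] fe]
    show "(\<lambda>((k, y), g). (orbit_poly k y * g, (k, y))) ((\<lambda>(f, (k, y)). ((k, y), f div orbit_poly k y)) x) = x"
      using fe by (simp add: x(1))
    show "(\<lambda>(f, (k, y)). ((k, y), f div orbit_poly k y)) x \<in> (SIGMA z : (SIGMA k : {1..d}. E k). ?M (d - fst z))"
      using q x by simp
    show "(\<lambda>((k, y), g). ?X (orbit_poly k y * g)) ((\<lambda>(f, (k, y)). ((k, y), f div orbit_poly k y)) x) = (\<lambda>(f, z). ?X f) x"
      using fe by (simp add: x(1))
  next
    fix x assume "x \<in> (SIGMA z : (SIGMA k : {1..d}. E k). ?M (d - fst z))"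
    then obtain k y g where x: "x = ((k, y), g)" "1 \<le> k" "k \<le> d" "y \<in> E k" "g \<in> ?M (d - k)" by auto
    have nz: "orbit_poly k y \<noteq> 0" using orbit_poly_monic(2)[of k y] by auto
    show "(\<lambda>(f, (k, y)). ((k, y), f div orbit_poly k y)) ((\<lambda>((k, y), g). (orbit_poly k y * g, (k, y))) x) = x"
      using nz by (simp add: x(1))
    show "(\<lambda>((k, y), g). (orbit_poly k y * g, (k, y))) x \<in> (SIGMA f : ?M d. orbit_divisors f)"
      using K1.monics_mult[OF orbit_poly_in_monics[OF x(4)] x(5)] x by (simp add: orbit_divisors_def)
  qed
  also have "\<dots> = (\<Sum>((k, y), g)\<in>(SIGMA z : (SIGMA k : {1..d}. E k). ?M (d - fst z)). ?X (orbit_poly k y) * ?X g)"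
  proof (intro sum.cong refl)
    fix x assume "x \<in> (SIGMA z : (SIGMA k : {1..d}. E k). ?M (d - fst z))"
    then obtain k y g where x: "x = ((k, y), g)" "y \<in> E k" "g \<in> ?M (d - k)" by auto
    show "(\<lambda>((k, y), g). ?X (orbit_poly k y * g)) x = (\<lambda>((k, y), g). ?X (orbit_poly k y) * ?X g) x"
      using K1.char_mult[OF orbit_poly_in_monics[OF x(2)] x(3) b(1)] by (simp add: x(1))
  qed
  also have "\<dots> = (\<Sum>z\<in>(SIGMA k : {1..d}. E k). \<Sum>g\<in>?M (d - fst z). ?X (orbit_poly (fst z) (snd z)) * ?X g)"
    using card_ext_field(1) by (subst sum.Sigma) (auto simp: case_prod_unfold)
  also have "\<dots> = (\<Sum>k=1..d. \<Sum>y\<in>E k. \<Sum>g\<in>?M (d - k). ?X (orbit_poly k y) * ?X g)"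
    using card_ext_field(1) by (subst sum.Sigma) (auto simp: case_prod_unfold)
  also have "\<dots> = (\<Sum>k=1..d. power_sum_E k * K1.lsum b (d - k))"
    by (intro sum.cong refl) (simp add: power_sum_E_eq K1.lsum_def sum_product)
  finally show ?thesis .
qed

text \<open>The numbers \<open>lsum b d\<close> are the coefficients of (1 - \<alpha> T) (1 -
  \<beta> T). Newton's identities therefore become, from k = 3 on, the linear recurrence with
  characteristic roots \<alpha> and \<beta>.\<close>

lemma power_sum_E_formula:
  assumes s: "\<alpha> + \<beta> = - power_sum_E 1" and pr: "\<alpha> * \<beta> = of_nat q"
  shows "k \<ge> 1 \<Longrightarrow> power_sum_E k = - (\<alpha> ^ k + \<beta> ^ k)"
proof (induction k rule: less_induct)
  case (less k)
  have L: "K1.lsum b 0 = 1" "K1.lsum b 1 = - (\<alpha> + \<beta>)" "K1.lsum b 2 = \<alpha> * \<beta>" "\<And>d. d \<ge> 3 \<Longrightarrow> K1.lsum b d = 0"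
  proof -
    show "K1.lsum b 0 = 1" by (rule K1.lsum_0)
    show "K1.lsum b 1 = - (\<alpha> + \<beta>)" unfolding s K1.lsum_1 power_sum_E_def by simp
    show "K1.lsum b 2 = \<alpha> * \<beta>" unfolding pr using K1.lsum_2[OF b] card_ext_field[of 1] by simp
    show "K1.lsum b d = 0" if "d \<ge> 3" for d using that by (rule K1.lsum_ge_3[OF b])
  qed
  consider "k = 1" | "k = 2" | "k \<ge> 3" using less.prems by linarith
  thus ?case
  proof cases
    case 1
    thus ?thesis using s by simp
  next
    \<comment> \<open>Here the left side of Newton's identity is 2 * \<open>lsum b 2\<close> = 2
      \<alpha> \<beta>, not yet 0.\<close>
    case 2
    have i: "{1..2} = {1, 2 :: nat}" by auto
    have "2 * (\<alpha> * \<beta>) = power_sum_E 1 * power_sum_E 1 + power_sum_E 2"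
      using newton_identity[of 2] L s unfolding i by (simp add: eq_neg_iff_add_eq_0 flip: One_nat_def)
    moreover have "power_sum_E 1 = - (\<alpha> + \<beta>)" using s by simp
    ultimately have "2 * (\<alpha> * \<beta>) = - (\<alpha> + \<beta>) * - (\<alpha> + \<beta>) + power_sum_E 2" by (simp only:)
    hence "power_sum_E 2 = 2 * (\<alpha> * \<beta>) - - (\<alpha> + \<beta>) * - (\<alpha> + \<beta>)" by (simp only: add_diff_cancel_left')
    also have "\<dots> = - (\<alpha> ^ 2 + \<beta> ^ 2)" by (simp add: power2_eq_square algebra_simps)
    finally show ?thesis using 2 by simp
  next
    case 3
    then obtain m where m: "k = m + 3" using le_Suc_ex by (metis add.commute)
    have "0 = (\<Sum>i=1..k. power_sum_E i * K1.lsum b (k - i))" using newton_identity[of k] L(4)[OF 3] by simp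
    also have "\<dots> = (\<Sum>i\<in>{k - 2, k - 1, k}. power_sum_E i * K1.lsum b (k - i))"
      using 3 L(4) by (intro sum.mono_neutral_right) auto
    also have "\<dots> = power_sum_E (m + 1) * (\<alpha> * \<beta>) + power_sum_E (m + 2) * - (\<alpha> + \<beta>) + power_sum_E k"
      using L by (simp add: m flip: One_nat_def) (simp add: add.commute)
    also have "power_sum_E (m + 1) = - (\<alpha> ^ (m + 1) + \<beta> ^ (m + 1))" using less.IH[of "m + 1"] m by simp
    also have "power_sum_E (m + 2) = - (\<alpha> ^ (m + 2) + \<beta> ^ (m + 2))" using less.IH[of "m + 2"] m by simp
    finally have "power_sum_E k = (\<alpha> ^ (m + 1) + \<beta> ^ (m + 1)) * (\<alpha> * \<beta>) - (\<alpha> ^ (m + 2) + \<beta> ^ (m + 2)) * (\<alpha> + \<beta>)"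
      by (simp add: algebra_simps add_eq_0_iff)
    also have "\<dots> = - (\<alpha> ^ k + \<beta> ^ k)" by (simp add: m algebra_simps power3_eq_cube power_add)
    finally show ?thesis .
  qed
qed

end

section \<open>The polynomials P(n,k)\<close>

text \<open>The symbol \<open>q_pochhammer q q\<close> over commutative rings: over polynomials,
  divisibility can express that q-multinomials are polynomials.\<close>

definition q_fact :: "'b::comm_ring_1 \<Rightarrow> nat \<Rightarrow> 'b" where
  "q_fact x n = (\<Prod>i<n. 1 - x ^ Suc i)"

lemma q_fact_0 [simp]: "q_fact x 0 = 1"
  by (simp add: q_fact_def)

lemma q_fact_Suc: "q_fact x (Suc n) = q_fact x n * (1 - x ^ Suc n)"
  by (simp add: q_fact_def)

lemma q_pochhammer_eq_q_fact: "q_pochhammer q q n = q_fact q n"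
  by (simp add: q_pochhammer_def q_fact_def)

(* The two summands correspond to the q-Pascal rule. *)
lemma q_fact_mult_dvd: "q_fact x a * q_fact x b dvd q_fact x (a + b)"
proof (induction "a + b" arbitrary: a b)
  case (Suc n)
  show ?case
  proof (cases "a = 0 \<or> b = 0")
    case False
    then obtain c d where ab: "a = Suc c" "b = Suc d" by (metis not0_implies_Suc)
    have n: "n = c + Suc d" "n = Suc c + d" using Suc(2) ab by auto
    have e: "q_fact x (a + b) = q_fact x n * (1 - x ^ Suc c) + q_fact x n * (1 - x ^ Suc d) * x ^ Suc c"
      unfolding Suc(2)[symmetric] q_fact_Suc using n(1) by (simp add: power_add algebra_simps)
    have "q_fact x a * q_fact x b dvd q_fact x n * (1 - x ^ Suc c)"
      using mult_dvd_mono[OF Suc(1)[OF n(1)] dvd_refl[of "1 - x ^ Suc c"]] n(1)[symmetric]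
      by (simp only: ab q_fact_Suc mult_ac)
    moreover have "q_fact x a * q_fact x b dvd q_fact x n * (1 - x ^ Suc d)"
      using mult_dvd_mono[OF Suc(1)[OF n(2)] dvd_refl[of "1 - x ^ Suc d"]] n(2)[symmetric]
      by (simp only: ab q_fact_Suc mult_ac)
    ultimately show ?thesis unfolding e by (rule dvd_add[OF _ dvd_mult2])
  qed auto
qed simp

text \<open>The degree is doubled to keep the halving in n (n + 1) / 2 out of the
  arithmetic.\<close>

lemma degree_q_fact:
  defines "x \<equiv> [:0, 1 :: rat:]"
  shows "2 * Polynomial.degree (q_fact x n) = n * (n + 1)" "lead_coeff (q_fact x n) = (- 1) ^ n" "q_fact x n \<noteq> 0"
proof -
  have d: "Polynomial.degree (1 - x ^ Suc i) = Suc i" "lead_coeff (1 - x ^ Suc i) = - 1" for i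
  proof -
    have m: "1 - x ^ Suc i = 1 + - (x ^ Suc i)" by simp
    have "x ^ Suc i = Polynomial.monom 1 (Suc i)" by (simp add: x_def monom_altdef)
    hence x: "Polynomial.degree (- (x ^ Suc i)) = Suc i" "lead_coeff (- (x ^ Suc i)) = - 1"
      by (simp_all add: degree_monom_eq del: power_Suc)
    show "Polynomial.degree (1 - x ^ Suc i) = Suc i" unfolding m using x by (subst degree_add_eq_right) simp_all
    show "lead_coeff (1 - x ^ Suc i) = - 1" unfolding m using x lead_coeff_add_le[of 1 "- (x ^ Suc i)"] by simp
  qed
  show nz: "q_fact x n \<noteq> 0" for n
  proof -
    have "1 - x ^ Suc i \<noteq> 0" for i using d(1)[of i] by (metis degree_0 nat.distinct(1))
    thus ?thesis by (simp add: q_fact_def del: power_Suc)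
  qed
  show "2 * Polynomial.degree (q_fact x n) = n * (n + 1)"
  proof (induction n)
    case (Suc n)
    have "1 - x ^ Suc n \<noteq> 0" using d(1)[of n] by (metis degree_0 nat.distinct(1))
    from degree_mult_eq[OF nz[of n] this] show ?case unfolding q_fact_Suc d(1) using Suc by simp
  qed simp
  show "lead_coeff (q_fact x n) = (- 1) ^ n"
  proof (induction n)
    case (Suc n)
    have "lead_coeff (q_fact x (Suc n)) = lead_coeff (q_fact x n) * lead_coeff (1 - x ^ Suc n)"
      unfolding q_fact_Suc by (rule lead_coeff_mult)
    thus ?case unfolding d(2) Suc by simp
  qed simp
qed

lemma to_fract_power: "to_fract (x ^ n) = to_fract x ^ n"
  by (induction n) simp_all

lemma to_fract_q_fact: "to_fract (q_fact x n) = q_fact (to_fract x) n"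
  by (induction n) (simp_all add: q_fact_Suc to_fract_power del: power_Suc)

text \<open>With u = n - k - 2 s the negative exponent is - 2 s (s + u). It is absorbed by n (n - k)
  = (2 s + u + k) (2 s + u), so that an ordinary power remains.\<close>

lemma P_coeff_exponent:
  assumes n: "n = 2 * s + u + k" and y: "y \<noteq> (0 :: 'b::field)"
  shows "y ^ (n * (n - k) + k * (k + 1) div 2) * (y powi (2 * int s * (int s - int n + int k))) =
    y ^ (2 * s * s + 2 * s * u + u * u + k * u + 2 * k * s + k * (k + 1) div 2)" (is "_ = y ^ ?e")
proof -
  have nk: "n - k = 2 * s + u" using n by simp
  have e0: "n * (n - k) + k * (k + 1) div 2 = ?e + 2 * s * (s + u)"
    unfolding nk unfolding n by (simp add: algebra_simps)
  have i: "2 * int s * (int s - int n + int k) = - int (2 * s * (s + u))"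
    unfolding n by (simp add: algebra_simps)
  show ?thesis unfolding e0 i power_add power_int_minus power_int_of_nat using y by simp
qed

text \<open>Using \<open>q_fact_mult_dvd\<close> twice, the q-multinomial is a polynomial, whose
  degree and leading coefficient follow from those of the q-factorials. The summand falls short of
  the claimed degree by s (s + k).\<close>

lemma P_coeff_summand_poly:
  fixes n k s u :: nat
  assumes n: "n = 2 * s + u + k"
  defines "x \<equiv> [:0, 1 :: rat:]"
  defines "y \<equiv> to_fract x"
  obtains g where
    "y ^ (n * (n - k) + k * (k + 1) div 2) * (y powi (2 * int s * (int s - int n + int k)) *
        q_multinomial n [s, n - k - 2 * s, k + s] y) = to_fract g"
    "Polynomial.degree g + (s * s + s * k) = n ^ 2 - k * (k - 1) div 2" "lead_coeff g = 1"
proof -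
  have "q_fact x s * (q_fact x u * q_fact x (k + s)) dvd q_fact x s * q_fact x (u + (k + s))"
    by (intro mult_dvd_mono q_fact_mult_dvd dvd_refl)
  also have "\<dots> dvd q_fact x (s + (u + (k + s)))" by (rule q_fact_mult_dvd)
  also have "s + (u + (k + s)) = n" using n by simp
  finally obtain M where M: "q_fact x n = q_fact x s * (q_fact x u * q_fact x (k + s)) * M" by (elim dvdE)
  note dq = degree_q_fact[folded x_def]
  have M0: "M \<noteq> 0" using M dq(3)[of n] by auto
  have "(- 1) ^ n = ((- 1) ^ s * ((- 1) ^ u * (- 1) ^ (k + s))) * lead_coeff M"
    using arg_cong[OF M, of lead_coeff] by (simp only: lead_coeff_mult dq)
  also have "(- 1) ^ s * ((- 1) ^ u * (- 1) ^ (k + s)) = ((- 1) ^ n :: rat)"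
  proof -
    have "s + (u + (k + s)) = n" using n by simp
    thus ?thesis by (simp only: power_add[symmetric])
  qed
  finally have lM: "lead_coeff M = 1" by simp
  have "Polynomial.degree (q_fact x n) = Polynomial.degree (q_fact x s) + (Polynomial.degree (q_fact x u)
      + Polynomial.degree (q_fact x (k + s))) + Polynomial.degree M"
    unfolding M using dq(3) M0 by (simp add: degree_mult_eq)
  hence dM: "n * (n + 1) = s * (s + 1) + u * (u + 1) + (k + s) * (k + s + 1) + 2 * Polynomial.degree M"
    unfolding dq(1)[symmetric] by simp
  have y0: "y \<noteq> 0" by (simp add: y_def x_def)
  have tnz: "q_fact y j \<noteq> 0" for j
    using dq(3)[of j] unfolding y_def to_fract_q_fact[symmetric] by simp
  have mult: "q_multinomial n [s, n - k - 2 * s, k + s] y = to_fract M"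
  proof -
    have "q_fact y n = q_fact y s * (q_fact y u * q_fact y (k + s)) * to_fract M"
      using arg_cong[OF M, of to_fract] by (simp add: to_fract_q_fact flip: y_def)
    moreover have "n - k - 2 * s = u" using n by simp
    ultimately show ?thesis using tnz by (simp add: q_multinomial_def q_pochhammer_eq_q_fact)
  qed
  define e where "e = 2 * s * s + 2 * s * u + u * u + k * u + 2 * k * s + k * (k + 1) div 2"
  have "y ^ (n * (n - k) + k * (k + 1) div 2) * (y powi (2 * int s * (int s - int n + int k))) = y ^ e"
    unfolding e_def by (rule P_coeff_exponent[OF n y0])
  hence 1: "y ^ (n * (n - k) + k * (k + 1) div 2) * (y powi (2 * int s * (int s - int n + int k)) *
        q_multinomial n [s, n - k - 2 * s, k + s] y) = to_fract (x ^ e * M)"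
    unfolding mult by (simp add: to_fract_power mult.assoc[symmetric] flip: y_def)
  have xe: "x ^ e = Polynomial.monom 1 e" by (simp add: x_def monom_altdef)
  have x: "Polynomial.degree (x ^ e) = e" "lead_coeff (x ^ e) = 1" "x ^ e \<noteq> 0"
    unfolding xe by (simp_all add: degree_monom_eq)
  have 3: "lead_coeff (x ^ e * M) = 1" unfolding lead_coeff_mult x(2) lM by simp
  have dg: "Polynomial.degree (x ^ e * M) = e + Polynomial.degree M" using x M0 by (simp add: degree_mult_eq)
  have ev: "2 * (k * (k + 1) div 2) = k * (k + 1)" "2 * (k * (k - 1) div 2) = k * (k - 1)"
    by (rule dvd_mult_div_cancel, cases k, simp_all)+
  obtain K where K: "k * (k - 1) = K" by blast
  have kk: "K + k = k * k" unfolding K[symmetric] by (cases k) simp_all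
  have "2 * (Polynomial.degree (x ^ e * M) + (s * s + s * k)) + k * (k - 1) = 2 * n ^ 2"
  proof -
    have "2 * (Polynomial.degree (x ^ e * M) + (s * s + s * k)) =
      4 * s * s + 4 * s * u + 2 * u * u + 2 * k * u + 4 * k * s + k * (k + 1) + 2 * Polynomial.degree M + 2 * s * s + 2 * s * k"
      unfolding dg unfolding e_def distrib_left ev by (simp add: algebra_simps)
    thus ?thesis using dM kk unfolding K unfolding n power2_eq_square by (simp add: algebra_simps)
  qed
  hence "2 * (Polynomial.degree (x ^ e * M) + (s * s + s * k)) + 2 * (k * (k - 1) div 2) = 2 * n ^ 2"
    unfolding ev .
  moreover have "i = l - j" if "2 * i + 2 * j = 2 * l" for i j l :: nat using that by simp
  ultimately have 2: "Polynomial.degree (x ^ e * M) + (s * s + s * k) = n ^ 2 - k * (k - 1) div 2" by blast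
  show ?thesis using that[OF 1 2 3] .
qed

text \<open>Only the summand for s = 0 reaches the full degree, so nothing can cancel its leading
  term.\<close>

lemma P_coeff_poly:
  assumes k: "k \<le> n"
  shows "\<exists>f :: rat poly. P_coeff n k (to_fract [:0, 1:]) = to_fract f \<and>
    Polynomial.degree f = n ^ 2 - k * (k - 1) div 2 \<and> lead_coeff f = (- 1) ^ k"
proof -
  define y where "y = to_fract [:0, 1 :: rat:]"
  define D where "D = n ^ 2 - k * (k - 1) div 2"
  let ?S = "{0..(n - k) div 2}"
  have "\<exists>g. y ^ (n * (n - k) + k * (k + 1) div 2) * (y powi (2 * int s * (int s - int n + int k)) *
        q_multinomial n [s, n - k - 2 * s, k + s] y) = to_fract g \<and>
    Polynomial.degree g + (s * s + s * k) = D \<and> lead_coeff g = 1" if "s \<in> ?S" for s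
  proof -
    have "n = 2 * s + (n - k - 2 * s) + k" using that k by auto
    from P_coeff_summand_poly[OF this] show ?thesis unfolding y_def D_def by metis
  qed
  hence "\<forall>s\<in>?S. \<exists>g. y ^ (n * (n - k) + k * (k + 1) div 2) * (y powi (2 * int s * (int s - int n + int k)) *
        q_multinomial n [s, n - k - 2 * s, k + s] y) = to_fract g \<and>
    Polynomial.degree g + (s * s + s * k) = D \<and> lead_coeff g = 1" by blast
  from bchoice[OF this] obtain g where g:
    "\<And>s. s \<in> ?S \<Longrightarrow> y ^ (n * (n - k) + k * (k + 1) div 2) * (y powi (2 * int s * (int s - int n + int k)) *
        q_multinomial n [s, n - k - 2 * s, k + s] y) = to_fract (g s)"
    "\<And>s. s \<in> ?S \<Longrightarrow> Polynomial.degree (g s) + (s * s + s * k) = D"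
    "\<And>s. s \<in> ?S \<Longrightarrow> lead_coeff (g s) = 1" by blast
  define F where "F = (\<Sum>s\<in>?S. g s)"
  have "P_coeff n k y = (- 1) ^ k * (\<Sum>s\<in>?S. to_fract (g s))"
  proof -
    have "y ^ (n * (n - k) + k * (k + 1) div 2) * (\<Sum>s\<in>?S. y powi (2 * int s * (int s - int n + int k)) *
        q_multinomial n [s, n - k - 2 * s, k + s] y) = (\<Sum>s\<in>?S. to_fract (g s))"
      unfolding sum_distrib_left by (rule sum.cong[OF refl g(1)])
    thus ?thesis unfolding P_coeff_def mult.assoc by simp
  qed
  also have "\<dots> = to_fract ((- 1) ^ k * F)" by (simp add: F_def to_fract_sum to_fract_power)
  finally have 1: "P_coeff n k y = to_fract ((- 1) ^ k * F)" .
  have "poly.coeff F D = (\<Sum>s\<in>?S. if s = 0 then 1 else 0)"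
    unfolding F_def coeff_sum
  proof (rule sum.cong[OF refl])
    fix s assume s: "s \<in> ?S"
    show "poly.coeff (g s) D = (if s = 0 then 1 else 0)"
    proof (cases "s = 0")
      case True
      thus ?thesis using g(2,3)[OF s] by simp
    next
      case False
      hence "s * s + s * k > 0" by simp
      hence "Polynomial.degree (g s) < D" using g(2)[OF s] by linarith
      thus ?thesis using False by (simp add: coeff_eq_0)
    qed
  qed
  hence cD: "poly.coeff F D = 1" by simp
  have "Polynomial.degree F \<le> D" unfolding F_def
  proof (rule degree_sum_le)
    fix s assume "s \<in> ?S"
    thus "Polynomial.degree (g s) \<le> D" using g(2)[of s] by linarith
  qed simp
  moreover have "D \<le> Polynomial.degree F" using cD by (intro le_degree) simp
  ultimately have dF: "Polynomial.degree F = D" by simp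
  have s: "(- 1) ^ k * F = Polynomial.smult ((- 1) ^ k) F" by (cases "even k") simp_all
  have "Polynomial.degree ((- 1) ^ k * F) = D" "lead_coeff ((- 1) ^ k * F) = (- 1) ^ k"
    unfolding s using dF cD by simp_all
  thus ?thesis using 1 unfolding y_def D_def by blast
qed

text \<open>The product of the q-integers 1 + x + ... + x ^ i: the q-factorial without its zero of
  order n at x = 1.\<close>

definition q_fact_quot :: "nat \<Rightarrow> real \<Rightarrow> real" where
  "q_fact_quot n x = (\<Prod>i<n. \<Sum>j<Suc i. x ^ j)"

lemma q_fact_eq_quot: "q_fact x n = (1 - x) ^ n * q_fact_quot n x"
  by (induction n) (simp_all only: q_fact_0 q_fact_Suc one_diff_power_eq, simp_all add: q_fact_quot_def)

lemma q_fact_quot_1: "q_fact_quot n 1 = fact n"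
  by (induction n) (simp_all add: q_fact_quot_def algebra_simps)

lemma isCont_q_fact_quot: "isCont (q_fact_quot n) x"
  unfolding q_fact_quot_def[abs_def] by (intro continuous_intros)

text \<open>The zeros at x = 1 of numerator and denominator have the same order, because s + t + w =
  n.\<close>

lemma tendsto_q_multinomial:
  assumes n: "n = s + t + w"
  shows "(q_multinomial n [s, t, w] \<longlongrightarrow> fact n / (fact s * fact t * fact w)) (at (1::real))"
proof -
  have c: "(q_fact_quot m \<longlongrightarrow> fact m) (at 1)" for m
    using isCont_q_fact_quot[where n = m and x = 1] by (simp add: isCont_def q_fact_quot_1)
  have "((\<lambda>x. q_fact_quot n x / (q_fact_quot s x * q_fact_quot t x * q_fact_quot w x)) \<longlongrightarrow>
      fact n / (fact s * fact t * fact w)) (at 1)"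
    by (intro tendsto_intros c) simp
  moreover have "\<forall>\<^sub>F x in at 1. q_fact_quot n x / (q_fact_quot s x * q_fact_quot t x * q_fact_quot w x) =
      q_multinomial n [s, t, w] x"
    unfolding eventually_at_filter
    by (intro always_eventually allI impI)
       (simp add: q_multinomial_def q_pochhammer_eq_q_fact q_fact_eq_quot n power_add mult.assoc)
  ultimately show ?thesis by (rule Lim_transform_eventually)
qed

lemma tendsto_P_coeff:
  assumes "k \<le> n"
  shows "((\<lambda>x::real. P_coeff n k x) \<longlongrightarrow>
    (- 1) ^ k * (\<Sum>s = 0..(n - k) div 2. fact n / (fact s * fact (n - k - 2 * s) * fact (k + s)))) (at 1)"
proof -
  have "((\<lambda>x::real. (- 1) ^ k * x ^ (n * (n - k) + k * (k + 1) div 2) *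
     (\<Sum>s = 0..(n - k) div 2. x powi (2 * int s * (int s - int n + int k)) * q_multinomial n [s, n - k - 2 * s, k + s] x))
    \<longlongrightarrow> (- 1) ^ k * 1 ^ (n * (n - k) + k * (k + 1) div 2) *
     (\<Sum>s = 0..(n - k) div 2. 1 powi (2 * int s * (int s - int n + int k)) *
        (fact n / (fact s * fact (n - k - 2 * s) * fact (k + s))))) (at 1)"
    using assms by (intro tendsto_intros tendsto_q_multinomial tendsto_power_int) auto
  thus ?thesis by (simp add: P_coeff_def)
qed

text \<open>The factors of the two symbols with half-integer arguments interlace: doubled, they are
  up to sign m, m - 1, m - 2, and so on. This is the origin of the argument 4 of the hypergeometric
  function.\<close>

lemma pochhammer_half_product:
  fixes m s :: nat
  defines "A \<equiv> pochhammer (- real m / 2) s * pochhammer ((1 - real m) / 2) s * 4 ^ s"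
  shows "2 * s \<le> m \<Longrightarrow> fact (m - 2 * s) * A = fact m" "m < 2 * s \<Longrightarrow> A = 0"
proof -
  define B where "B = (\<lambda>s. pochhammer (- real m / 2) s * pochhammer ((1 - real m) / 2) s * 4 ^ s)"
  have st: "B (Suc s) = B s * ((real m - 2 * real s) * (real m - 2 * real s - 1))" for s
    unfolding B_def pochhammer_Suc by (simp add: field_simps)
  have "(2 * s \<le> m \<longrightarrow> fact (m - 2 * s) * B s = fact m) \<and> (m < 2 * s \<longrightarrow> B s = 0)"
  proof (induction s)
    case (Suc s)
    show ?case
    proof (cases "2 * Suc s \<le> m")
      case True
      then obtain j where j: "m = j + 2 + 2 * s" by (metis add.commute le_Suc_ex mult_Suc_right add.assoc)
      have "fact (m - 2 * s) * B s = fact m" using Suc True by simp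
      moreover have "fact (m - 2 * s) = (real m - 2 * real s) * (real m - 2 * real s - 1) * fact (m - 2 * Suc s)"
        by (simp add: j algebra_simps)
      ultimately have "fact (m - 2 * Suc s) * B (Suc s) = fact m" unfolding st by (simp only: mult_ac)
      thus ?thesis using True by simp
    next
      case False
      have "B (Suc s) = 0"
      proof (cases "2 * s \<le> m")
        case True
        hence "m = 2 * s \<or> m = 2 * s + 1" using False by presburger
        thus ?thesis unfolding st by auto
      next
        case False
        thus ?thesis using Suc unfolding st by simp
      qed
      thus ?thesis using False by simp
    qed
  qed (simp add: B_def)
  thus "2 * s \<le> m \<Longrightarrow> fact (m - 2 * s) * A = fact m" "m < 2 * s \<Longrightarrow> A = 0" by (simp_all add: A_def B_def)
qed

lemma hypergeom_2F1_cl_finite: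
  assumes k: "k \<le> n"
  shows "of_nat (n choose k) * hypergeom_2F1_cl ((of_nat k - of_nat n) / 2) ((of_nat k + 1 - of_nat n) / 2) (of_nat k + 1) 4
    = (\<Sum>s = 0..(n - k) div 2. fact n / (fact s * fact (n - k - 2 * s) * fact (k + s)))"
proof -
  define m where "m = n - k"
  have arg: "(real k - real n) / 2 = - real m / 2" "(real k + 1 - real n) / 2 = (1 - real m) / 2"
    using k by (simp_all add: m_def of_nat_diff)
  have p: "pochhammer (real k + 1) s * fact k = fact (k + s)" for s
  proof (induction s)
    case (Suc s)
    have "pochhammer (real k + 1) (Suc s) * fact k = (pochhammer (real k + 1) s * fact k) * (real k + 1 + real s)"
      by (simp only: pochhammer_Suc mult_ac)
    also have "\<dots> = fact (k + Suc s)" unfolding Suc by (simp add: algebra_simps)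
    finally show ?case .
  qed simp
  have p0: "pochhammer (real k + 1) s \<noteq> 0" for s
    using p[of s] by (metis fact_nonzero mult_zero_left)
  define t where "t = (\<lambda>s. pochhammer (- real m / 2) s * pochhammer ((1 - real m) / 2) s / pochhammer (real k + 1) s * (4 ^ s / fact s))"
  have t: "t s = pochhammer (- real m / 2) s * pochhammer ((1 - real m) / 2) s * 4 ^ s / (pochhammer (real k + 1) s * fact s)" for s
    by (simp add: t_def)
  \<comment> \<open>The series breaks off because one of its upper parameters is a nonpositive
    integer, whatever the parity of m.\<close>
  have "(\<Sum>s. t s) = (\<Sum>s\<in>{0..m div 2}. t s)"
  proof (rule suminf_finite)
    fix s assume "s \<notin> {0..m div 2}"
    hence "m < 2 * s" by auto
    thus "t s = 0" unfolding t by (simp only: pochhammer_half_product(2) div_0)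
  qed simp
  hence "of_nat (n choose k) * hypergeom_2F1_cl ((of_nat k - of_nat n) / 2) ((of_nat k + 1 - of_nat n) / 2) (of_nat k + 1) 4
    = (\<Sum>s\<in>{0..m div 2}. real (n choose k) * t s)"
    by (simp add: hypergeom_2F1_cl_def arg t_def sum_distrib_left)
  also have "\<dots> = (\<Sum>s = 0..m div 2. fact n / (fact s * fact (m - 2 * s) * fact (k + s)))"
  proof (rule sum.cong[OF refl])
    fix s assume "s \<in> {0..m div 2}"
    hence "2 * s \<le> m" by auto
    note A = pochhammer_half_product(1)[OF this]
    have c: "fact k * fact m * real (n choose k) = fact n"
      using binomial_fact_lemma[OF k, folded m_def] by (metis of_nat_fact of_nat_mult)
    define A' where "A' = pochhammer (- real m / 2) s * pochhammer ((1 - real m) / 2) s * 4 ^ s"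
    have A: "fact (m - 2 * s) * A' = fact m" using A unfolding A'_def .
    have "real (n choose k) * t s = real (n choose k) * A' / (pochhammer (real k + 1) s * fact s)"
      unfolding t A'_def by simp
    also have "\<dots> = (fact k * (fact (m - 2 * s) * A') * real (n choose k)) / (fact s * fact (m - 2 * s) * (pochhammer (real k + 1) s * fact k))"
      using p0 by (simp add: field_simps)
    finally show "real (n choose k) * t s = fact n / (fact s * fact (m - 2 * s) * fact (k + s))"
      unfolding A p c .
  qed
  finally show ?thesis unfolding m_def .
qed

section \<open>The counting formula\<close>

lemma num_legendre_pairs_eq: "num_legendre_pairs n a = card (legendre_pairs a n)"
proof -
  have "B ^\<^sub>m 2 = B * B" if "B \<in> carrier_mat n n" for B :: "'a mat"
    using that by (simp add: numeral_2_eq_2)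
  hence "{(A, B). [A, B] \<in> commuting_tuples n 2 \<and> B ^\<^sub>m 2 = A * (A - 1\<^sub>m n) * (A - a \<cdot>\<^sub>m 1\<^sub>m n)} = legendre_pairs a n"
    by (auto simp: commuting_tuples_def legendre_pairs_def legendre_mat_def)
  thus ?thesis by (simp add: num_legendre_pairs_def)
qed

text \<open>The sign collects the n factors q ^ i - 1 = - (1 - q ^ i).\<close>

lemma card_GL_eq:
  "(of_nat (card (GL n :: 'a::{finite,field} mat set)) :: complex) =
     (- 1) ^ n * of_nat CARD('a) ^ (n * (n - 1) div 2) * q_pochhammer (of_nat CARD('a)) (of_nat CARD('a)) n"
proof (induction n)
  case 0
  thus ?case by (simp add: card_GL_0)
next
  case (Suc n)
  let ?q = "of_nat CARD('a) :: complex"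
  have "Suc n * (Suc n - 1) = n * (n - 1) + n * 2" by (cases n) simp_all
  hence e: "Suc n * (Suc n - 1) div 2 = n * (n - 1) div 2 + n" by simp
  have "CARD('a) ^ Suc n \<ge> 1" using CARD_gt_1[where 'a = 'a] by simp
  hence "of_nat (CARD('a) ^ Suc n - 1) = ?q ^ Suc n - 1" by (simp add: of_nat_diff)
  thus ?case unfolding card_GL_Suc e power_add q_pochhammer_Suc of_nat_mult of_nat_power Suc.IH
    by (simp add: algebra_simps)
qed

text \<open>Pairs (i, j) are sorted by the distance k of their entries and the smaller entry s. In
  the application they are exponents of \<alpha> and \<beta>, so the common part becomes (\<alpha>
  \<beta>) ^ s.\<close>

lemma sum_triangle_by_difference:
  fixes F :: "nat \<Rightarrow> nat \<Rightarrow> 'b::comm_monoid_add"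
  shows "(\<Sum>l=0..n. \<Sum>i=0..l. F i (l - i)) =
    (\<Sum>s=0..n div 2. F s s) + (\<Sum>k=1..n. \<Sum>s=0..(n - k) div 2. F s (k + s) + F (k + s) s)"
proof -
  let ?T = "{(i, j). i + j \<le> n}"
  let ?S = "SIGMA k : {1..n}. {0..(n - k) div 2}"
  have fin: "finite ?T" by (rule finite_subset[of _ "{..n} \<times> {..n}"]) auto
  have "(\<Sum>l=0..n. \<Sum>i=0..l. F i (l - i)) = (\<Sum>(l, i)\<in>(SIGMA l : {0..n}. {0..l}). F i (l - i))"
    by (intro sum.Sigma) auto
  also have "\<dots> = (\<Sum>(i, j)\<in>?T. F i j)"
    by (rule sum.reindex_bij_witness[where i = "\<lambda>(i, j). (i + j, i)" and j = "\<lambda>(l, i). (i, l - i)"]) auto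
  also have "?T = {(i, j). i + j \<le> n \<and> i = j} \<union> ({(i, j). i + j \<le> n \<and> i < j} \<union> {(i, j). i + j \<le> n \<and> j < i})"
    by auto
  also have "(\<Sum>(i, j)\<in>\<dots>. F i j) = (\<Sum>(i, j)\<in>{(i, j). i + j \<le> n \<and> i = j}. F i j) +
      ((\<Sum>(i, j)\<in>{(i, j). i + j \<le> n \<and> i < j}. F i j) + (\<Sum>(i, j)\<in>{(i, j). i + j \<le> n \<and> j < i}. F i j))"
    by (subst sum.union_disjoint, (rule finite_subset[OF _ fin], force)+, force)+ simp
  also have "(\<Sum>(i, j)\<in>{(i, j). i + j \<le> n \<and> i = j}. F i j) = (\<Sum>s=0..n div 2. F s s)"
    by (rule sum.reindex_bij_witness[where i = "\<lambda>s. (s, s)" and j = fst]) auto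
  also have "(\<Sum>(i, j)\<in>{(i, j). i + j \<le> n \<and> i < j}. F i j) = (\<Sum>(k, s)\<in>?S. F s (k + s))"
    by (rule sum.reindex_bij_witness[where i = "\<lambda>(k, s). (s, k + s)" and j = "\<lambda>(i, j). (j - i, i)"]) auto
  also have "(\<Sum>(i, j)\<in>{(i, j). i + j \<le> n \<and> j < i}. F i j) = (\<Sum>(k, s)\<in>?S. F (k + s) s)"
    by (rule sum.reindex_bij_witness[where i = "\<lambda>(k, s). (k + s, s)" and j = "\<lambda>(i, j). (i - j, j)"]) auto
  also have "(\<Sum>(k, s)\<in>?S. F s (k + s)) + (\<Sum>(k, s)\<in>?S. F (k + s) s) = (\<Sum>(k, s)\<in>?S. F s (k + s) + F (k + s) s)"
    unfolding sum.distrib[symmetric] by (intro sum.cong) auto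
  also have "\<dots> = (\<Sum>k=1..n. \<Sum>s=0..(n - k) div 2. F s (k + s) + F (k + s) s)"
    by (intro sum.Sigma[symmetric]) auto
  finally show ?thesis .
qed

text \<open>P(n, k) in the shape in which the product of series produces it: the factor of
  \<open>card_GL_eq\<close> times the coefficients of two \<open>q_exp\<close> at s and k + s and of
  \<open>q_euler\<close> at n - 2 s - k, with an additional factor y ^ k.\<close>

lemma P_coeff_eq:
  fixes y :: "'b::field"
  assumes y: "y \<noteq> 0" and k: "k \<le> n"
  shows "P_coeff n k y = (\<Sum>s=0..(n - k) div 2. (- 1) ^ n * y ^ (n * (n - 1) div 2) * q_pochhammer y y n *
    ((- 1) ^ (n - 2 * s - k) * y ^ ((n - 2 * s - k) * (n - 2 * s - k + 1) div 2) * y ^ s * y ^ k /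
    (q_pochhammer y y s * q_pochhammer y y (k + s) * q_pochhammer y y (n - 2 * s - k))))"
  unfolding P_coeff_def sum_distrib_left
proof (rule sum.cong[OF refl])
  fix s assume s: "s \<in> {0..(n - k) div 2}"
  define u where "u = n - 2 * s - k"
  have n: "n = 2 * s + u + k" using s k unfolding u_def by auto
  have nk: "n - k - 2 * s = u" using n by simp
  define e where "e = 2 * s * s + 2 * s * u + u * u + k * u + 2 * k * s + k * (k + 1) div 2"
  have ev: "2 * (k * (k + 1) div 2) = k * (k + 1)" "2 * (u * (u + 1) div 2) = u * (u + 1)"
    by (rule dvd_mult_div_cancel, simp)+
  obtain m where m: "n * (n - 1) = m" by blast
  have mn: "m + n = n * n" unfolding m[symmetric] by (cases n) simp_all
  have "even (n * (n - 1))" by (cases n) simp_all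
  hence m2: "2 * (n * (n - 1) div 2) = m" unfolding m by simp
  have "2 * (n * (n - 1) div 2 + u * (u + 1) div 2 + s + k) = 2 * e"
    unfolding e_def distrib_left ev m2 using mn n by (simp add: algebra_simps)
  moreover have "i = j" if "2 * i = 2 * j" for i j :: nat using that by simp
  ultimately have "n * (n - 1) div 2 + u * (u + 1) div 2 + s + k = e" by blast
  hence e: "y ^ (n * (n - 1) div 2) * y ^ (u * (u + 1) div 2) * y ^ s * y ^ k = y ^ e"
    by (simp only: power_add[symmetric])
  have "n + u = 2 * (s + u) + k" using n by simp
  hence sg: "(- 1) ^ n * (- 1) ^ u = ((- 1) ^ k :: 'b)"
    unfolding power_add[symmetric] by (simp add: power_add)
  have "(- 1) ^ k * y ^ (n * (n - k) + k * (k + 1) div 2) *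
      (y powi (2 * int s * (int s - int n + int k)) * q_multinomial n [s, n - k - 2 * s, k + s] y) =
      (- 1) ^ k * (y ^ (n * (n - k) + k * (k + 1) div 2) * y powi (2 * int s * (int s - int n + int k))) *
      q_multinomial n [s, u, k + s] y"
    unfolding nk by (simp only: mult_ac)
  also have "\<dots> = (- 1) ^ k * y ^ e * q_multinomial n [s, u, k + s] y"
    unfolding P_coeff_exponent[OF n y] e_def ..
  also have "\<dots> = (- 1) ^ n * y ^ (n * (n - 1) div 2) * q_pochhammer y y n *
    ((- 1) ^ u * y ^ (u * (u + 1) div 2) * y ^ s * y ^ k /
    (q_pochhammer y y s * q_pochhammer y y (k + s) * q_pochhammer y y u))"
    unfolding e[symmetric] sg[symmetric] q_multinomial_def by (simp add: mult_ac)
  finally show "(- 1) ^ k * y ^ (n * (n - k) + k * (k + 1) div 2) *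
      (y powi (2 * int s * (int s - int n + int k)) * q_multinomial n [s, n - k - 2 * s, k + s] y) =
      (- 1) ^ n * y ^ (n * (n - 1) div 2) * q_pochhammer y y n *
    ((- 1) ^ (n - 2 * s - k) * y ^ ((n - 2 * s - k) * (n - 2 * s - k + 1) div 2) * y ^ s * y ^ k /
    (q_pochhammer y y s * q_pochhammer y y (k + s) * q_pochhammer y y (n - 2 * s - k)))"
    unfolding u_def .
qed

text \<open>The weight \<open>W\<close> is symmetric in the two exponents, so (s, k + s) and (k + s,
  s) combine to \<alpha> ^ k + \<beta> ^ k. Division by y ^ k removes the additional factor in
  \<open>P_coeff_eq\<close>.\<close>

lemma coeff_product_eq_P_coeff:
  fixes y :: "'b::field"
  assumes y: "y \<noteq> 0" and ab: "\<alpha> * \<beta> = y"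
  shows "(- 1) ^ n * y ^ (n * (n - 1) div 2) * q_pochhammer y y n *
      fps_nth (q_exp y \<alpha> * q_exp y \<beta> * q_euler y) n =
    P_coeff n 0 y + (\<Sum>k=1..n. P_coeff n k y * (\<alpha> ^ k + \<beta> ^ k) / y ^ k)"
proof -
  let ?g = "(- 1) ^ n * y ^ (n * (n - 1) div 2) * q_pochhammer y y n"
  define W where "W = (\<lambda>i j. ?g * ((- 1) ^ (n - i - j) * y ^ ((n - i - j) * (n - i - j + 1) div 2) /
    (q_pochhammer y y i * q_pochhammer y y j * q_pochhammer y y (n - i - j))))"
  have W: "W i j = W j i" for i j
  proof -
    have u: "n - i - j = n - j - i" by simp
    show ?thesis unfolding W_def u by (simp only: mult_ac)
  qed
  have P: "P_coeff n k y = y ^ k * (\<Sum>s=0..(n - k) div 2. W s (k + s) * y ^ s)" if "k \<le> n" for k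
    unfolding P_coeff_eq[OF y that] sum_distrib_left
  proof (rule sum.cong[OF refl])
    fix s
    have u: "n - s - (k + s) = n - 2 * s - k" by simp
    show "?g * ((- 1) ^ (n - 2 * s - k) * y ^ ((n - 2 * s - k) * (n - 2 * s - k + 1) div 2) * y ^ s * y ^ k /
    (q_pochhammer y y s * q_pochhammer y y (k + s) * q_pochhammer y y (n - 2 * s - k))) = y ^ k * (W s (k + s) * y ^ s)"
      unfolding W_def u by (simp add: mult_ac)
  qed
  have "?g * fps_nth (q_exp y \<alpha> * q_exp y \<beta> * q_euler y) n =
      (\<Sum>l=0..n. \<Sum>i=0..l. W i (l - i) * \<alpha> ^ i * \<beta> ^ (l - i))"
    unfolding fps_mult_nth sum_distrib_left sum_distrib_right
  proof (intro sum.cong refl)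
    fix l i assume "l \<in> {0..n}" "i \<in> {0..l}"
    hence u: "n - i - (l - i) = n - l" by auto
    show "?g * (fps_nth (q_exp y \<alpha>) i * fps_nth (q_exp y \<beta>) (l - i) * fps_nth (q_euler y) (n - l)) =
        W i (l - i) * \<alpha> ^ i * \<beta> ^ (l - i)"
      unfolding W_def u by (simp add: q_exp_def q_euler_def mult_ac)
  qed
  also have "\<dots> = (\<Sum>s=0..n div 2. W s s * \<alpha> ^ s * \<beta> ^ s) + (\<Sum>k=1..n. \<Sum>s=0..(n - k) div 2.
      W s (k + s) * \<alpha> ^ s * \<beta> ^ (k + s) + W (k + s) s * \<alpha> ^ (k + s) * \<beta> ^ s)"
    by (rule sum_triangle_by_difference)
  also have "(\<Sum>s=0..n div 2. W s s * \<alpha> ^ s * \<beta> ^ s) = P_coeff n 0 y"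
  proof -
    have "(\<Sum>s=0..n div 2. W s s * \<alpha> ^ s * \<beta> ^ s) = (\<Sum>s=0..n div 2. W s s * y ^ s)"
      unfolding ab[symmetric] by (simp add: power_mult_distrib mult_ac)
    thus ?thesis unfolding P[OF le0] by simp
  qed
  also have "(\<Sum>k=1..n. \<Sum>s=0..(n - k) div 2.
      W s (k + s) * \<alpha> ^ s * \<beta> ^ (k + s) + W (k + s) s * \<alpha> ^ (k + s) * \<beta> ^ s) =
      (\<Sum>k=1..n. P_coeff n k y * (\<alpha> ^ k + \<beta> ^ k) / y ^ k)"
  proof (rule sum.cong[OF refl])
    fix k assume "k \<in> {1..n}"
    hence k: "k \<le> n" by simp
    have "(\<Sum>s=0..(n - k) div 2. W s (k + s) * \<alpha> ^ s * \<beta> ^ (k + s) + W (k + s) s * \<alpha> ^ (k + s) * \<beta> ^ s) =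
        (\<Sum>s=0..(n - k) div 2. W s (k + s) * y ^ s) * (\<alpha> ^ k + \<beta> ^ k)"
      unfolding sum_distrib_right W[of "k + _"] ab[symmetric]
      by (intro sum.cong refl) (simp add: power_add power_mult_distrib algebra_simps)
    also have "\<dots> = P_coeff n k y * (\<alpha> ^ k + \<beta> ^ k) / y ^ k" unfolding P[OF k] using y by simp
    finally show "(\<Sum>s=0..(n - k) div 2. W s (k + s) * \<alpha> ^ s * \<beta> ^ (k + s) + W (k + s) s * \<alpha> ^ (k + s) * \<beta> ^ s) =
        P_coeff n k y * (\<alpha> ^ k + \<beta> ^ k) / y ^ k" .
  qed
  finally show ?thesis .
qed

lemma (in odd_finite_subfield) card_square_roots:
  assumes c: "c \<in> K"
  shows "(of_nat (card {y \<in> K. y ^ 2 = c}) :: complex) = 1 + phi c"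
proof (cases "c = 0")
  case True
  hence "{y \<in> K. y ^ 2 = c} = {0}" using zero by auto
  thus ?thesis using True by (simp add: phi_def)
next
  case False
  hence cU: "c \<in> U" using c by simp
  show ?thesis
  proof (cases "\<exists>d\<in>K. d ^ 2 = c")
    case True
    then obtain d where d: "d \<in> K" "d ^ 2 = c" by blast
    have d0: "d \<noteq> 0" using d False by auto
    have "- d \<in> K" using d(1) by (rule closed)
    hence "{y \<in> K. y ^ 2 = c} = {d, - d}" using d by (auto simp: power2_eq_iff)
    moreover have "d \<noteq> - d"
    proof
      assume "d = - d"
      hence "2 * d = 0" by (simp only: mult_2 eq_neg_iff_add_eq_0)
      thus False using d0 two by simp
    qed
    ultimately have "card {y \<in> K. y ^ 2 = c} = 2" by simp
    thus ?thesis using phi_square[of d] d d0 by simp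
  next
    case n: False
    obtain i where i: "c = gen ^ i" using gen(2)[OF cU] by blast
    have gK: "gen \<in> K" using gen(1) by simp
    have gpow: "gen ^ j \<in> K" for j using gK by (rule closed)
    have "odd i"
    proof
      assume "even i"
      then obtain j where "i = j * 2" by (elim evenE) simp
      hence "(gen ^ j) ^ 2 = c" using i by (simp add: power_mult)
      thus False using n gpow[of j] by blast
    qed
    moreover have "phi (gen ^ i) = (- 1) ^ i"
    proof (induction i)
      case (Suc i)
      thus ?case using phi_mult[OF gK gpow[of i]] phi_gen by simp
    qed (simp add: phi_def one)
    ultimately have "phi c = - 1" unfolding i by simp
    moreover have "{y \<in> K. y ^ 2 = c} = {}" using n by blast
    ultimately show ?thesis by (simp only: card.empty) simp
  qed
qed

context odd_finite_field
begin

text \<open>The points live in the base field, the character sum in its copy \<open>E 1\<close>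
  inside the closure. The two quadratic characters correspond under \<open>to_ac\<close> because
  both are given by the same exponent.\<close>

lemma card_curve_points:
  "of_nat (card (curve_points (legendre_poly a))) = of_nat q + power_sum_E 1"
proof -
  interpret A: odd_finite_subfield "UNIV :: 'a set" by unfold_locales (use two_ne in auto)
  have H: "A.H = K1.H" using card_ext_field[of 1] CARD_q by simp
  have phi: "A.phi x = K1.phi (to_ac x)" for x
  proof -
    have "to_ac x \<in> E 1" using ext_field_1 by simp
    moreover have "to_ac x ^ K1.H = 1 \<longleftrightarrow> x ^ A.H = 1"
      unfolding H to_ac_power[symmetric] by (metis to_ac_1 to_ac_eq_iff)
    ultimately show ?thesis by (simp add: A.phi_def K1.phi_def)
  qed
  have "curve_points (legendre_poly a) = (SIGMA x : UNIV. {y. y ^ 2 = x * (x - 1) * (x - a)})"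
    by (auto simp: curve_points_def poly_legendre_poly)
  hence "card (curve_points (legendre_poly a)) = (\<Sum>x\<in>UNIV. card {y \<in> UNIV. y ^ 2 = x * (x - 1) * (x - a)})"
    by (simp add: card_SigmaI)
  hence "of_nat (card (curve_points (legendre_poly a))) = (\<Sum>x\<in>UNIV. 1 + A.phi (x * (x - 1) * (x - a)))"
    using A.card_square_roots by simp
  also have "\<dots> = of_nat q + (\<Sum>x\<in>UNIV. K1.phi (to_ac x * (to_ac x - 1) * (to_ac x - b)))"
    by (simp add: sum.distrib phi CARD_q)
  also have "(\<Sum>x\<in>UNIV. K1.phi (to_ac x * (to_ac x - 1) * (to_ac x - b))) = power_sum_E 1"
    unfolding power_sum_E_def K1.cubic_sum_def unfolding ext_field_1
    by (subst sum.reindex[OF inj_to_ac]) (simp add: o_def)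
  finally show ?thesis .
qed

lemma num_legendre_pairs_formula:
  "of_nat (num_legendre_pairs n a) = P_coeff n 0 (of_nat q) -
    (\<Sum>k=1..n. quadratic_char (E k) (- 1) * P_coeff n k (of_nat q) * hypergeom_2F1_ff (E k) b)"
proof -
  let ?q = "of_nat q :: complex"
  \<comment> \<open>The trace of Frobenius, that is, q minus the number of affine points; \<alpha>
    and \<beta> are the complex roots of X^2 - c X + q.\<close>
  define c where "c = - power_sum_E 1"
  define \<alpha> where "\<alpha> = (c + csqrt (c ^ 2 - 4 * ?q)) / 2"
  define \<beta> where "\<beta> = (c - csqrt (c ^ 2 - 4 * ?q)) / 2"
  have s: "\<alpha> + \<beta> = c" by (simp add: \<alpha>_def \<beta>_def field_simps)
  have "4 * (\<alpha> * \<beta>) = c ^ 2 - csqrt (c ^ 2 - 4 * ?q) ^ 2"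
    by (simp add: \<alpha>_def \<beta>_def power2_eq_square algebra_simps)
  hence pr: "\<alpha> * \<beta> = ?q" by simp
  have q0: "?q \<noteq> 0" using q_gt_2 by simp
  have qi: "?q ^ i \<noteq> 1" if "0 < i" for i
  proof -
    have "1 < q ^ i" using q_gt_2 that by (intro one_less_power) auto
    hence "of_nat (q ^ i) \<noteq> (of_nat 1 :: complex)" unfolding of_nat_eq_iff by simp
    thus ?thesis by simp
  qed
  have cc: "of_nat CARD('a) - of_nat (card (curve_points (legendre_poly a))) = \<alpha> + \<beta>"
    unfolding card_curve_points CARD_q s by (simp add: c_def)
  note tt = pair_ratio_three_term[OF a_ne two_ne(2), unfolded cc, unfolded CARD_q]
  have "pair_ratio a n = fps_nth (q_exp ?q \<alpha> * q_exp ?q \<beta> * q_euler ?q) n"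
    by (rule recurrence_solution[where c = "pair_ratio a", OF qi pair_ratio_0[OF a_ne two_ne(2)]]) (use tt pr in simp_all)
  moreover have "of_nat (num_legendre_pairs n a) = of_nat (card (GL n :: 'a mat set)) * pair_ratio a n"
  proof -
    have "card (GL n :: 'a mat set) \<noteq> 0" using GL_nonempty[where 'a = 'a and n = n] by linarith
    thus ?thesis by (simp add: num_legendre_pairs_eq pair_ratio_def[OF a_ne two_ne(2)])
  qed
  ultimately have "of_nat (num_legendre_pairs n a) =
      P_coeff n 0 ?q + (\<Sum>k=1..n. P_coeff n k ?q * (\<alpha> ^ k + \<beta> ^ k) / ?q ^ k)"
    using coeff_product_eq_P_coeff[OF q0 pr, of n] by (simp only: card_GL_eq CARD_q)
  also have "(\<Sum>k=1..n. P_coeff n k ?q * (\<alpha> ^ k + \<beta> ^ k) / ?q ^ k) =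
      (\<Sum>k=1..n. - (quadratic_char (E k) (- 1) * P_coeff n k ?q * hypergeom_2F1_ff (E k) b))"
  proof (rule sum.cong[OF refl])
    fix k assume "k \<in> {1..n}"
    hence k: "k \<ge> 1" by simp
    interpret Kk: odd_finite_subfield "E k" by (rule ext_field_locale[OF k])
    have u: "- 1 \<in> E k - {0}" using Kk.one Kk.closed by simp
    have f: "Kk.phi (- 1) * Kk.phi (- 1) = 1" using Kk.phi_cases[OF u] by auto
    have h: "hypergeom_2F1_ff (E k) b = Kk.phi (- 1) / ?q ^ k * power_sum_E k"
      unfolding power_sum_E_def Kk.hypergeom_2F1_ff_eq[OF E1_sub[OF b(1)] b(2)] card_ext_field(2)[OF k] by simp
    have p: "power_sum_E k = - (\<alpha> ^ k + \<beta> ^ k)"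
      by (rule power_sum_E_formula[OF _ pr k]) (simp add: s c_def)
    \<comment> \<open>The factor phi (-1) ^ 2 = 1 is inserted: one phi (-1) appears in the formula,
      the other is part of the hypergeometric value.\<close>
    have "P_coeff n k ?q * (\<alpha> ^ k + \<beta> ^ k) / ?q ^ k =
        (Kk.phi (- 1) * Kk.phi (- 1)) * (P_coeff n k ?q * (\<alpha> ^ k + \<beta> ^ k) / ?q ^ k)"
      unfolding f by simp
    also have "\<dots> = - (Kk.phi (- 1) * P_coeff n k ?q * (Kk.phi (- 1) / ?q ^ k * - (\<alpha> ^ k + \<beta> ^ k)))"
      by (simp only: divide_inverse mult_minus_right minus_minus mult_ac)
    finally show "P_coeff n k ?q * (\<alpha> ^ k + \<beta> ^ k) / ?q ^ k =
        - (quadratic_char (E k) (- 1) * P_coeff n k ?q * hypergeom_2F1_ff (E k) b)"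
      unfolding Kk.quadratic_char_eq h p .
  qed
  finally show ?thesis by (simp add: sum_negf)
qed

end

theorem theorem1p1:
  fixes n p r q :: nat and a :: "'a::{field, finite}"
  assumes "n \<ge> 1"
    and "prime p" and "p \<ge> 3" and "r \<ge> 1" and "q = p ^ r"
    and "CARD('a) = q"
    and "a \<notin> {0, 1}"
  shows "(of_nat (num_legendre_pairs n a) :: complex) =
           P_coeff n 0 (of_nat q) -
           (\<Sum>k = 1..n.
              quadratic_char (ext_field k :: 'a alg_closure set) (-1) *
              P_coeff n k (of_nat q) *
              hypergeom_2F1_ff (ext_field k) (to_ac a))
       \<and> (\<forall>k\<le>n. \<exists>f :: rat poly.
              P_coeff n k (to_fract [:0, 1:]) = to_fract f \<and>
              degree f = n ^ 2 - k * (k - 1) div 2 \<and>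
              lead_coeff f = (-1) ^ k)
       \<and> (\<forall>k\<le>n.
              ((\<lambda>x::real. P_coeff n k x) \<longlongrightarrow>
                 (-1) ^ k * of_nat (n choose k) *
                 hypergeom_2F1_cl ((of_nat k - of_nat n) / 2)
                   ((of_nat k + 1 - of_nat n) / 2) (of_nat k + 1) 4) (at 1))"
proof (intro conjI allI impI)
  interpret odd_finite_field a p r q by unfold_locales (use assms in auto)
  show "(of_nat (num_legendre_pairs n a) :: complex) = P_coeff n 0 (of_nat q) -
      (\<Sum>k = 1..n. quadratic_char (ext_field k :: 'a alg_closure set) (-1) * P_coeff n k (of_nat q) *
        hypergeom_2F1_ff (ext_field k) (to_ac a))"
    by (rule num_legendre_pairs_formula)
next
  fix k assume k: "k \<le> n"
  show "\<exists>f :: rat poly. P_coeff n k (to_fract [:0, 1:]) = to_fract f \<and>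
      degree f = n ^ 2 - k * (k - 1) div 2 \<and> lead_coeff f = (-1) ^ k"
    by (rule P_coeff_poly[OF k])
  show "((\<lambda>x::real. P_coeff n k x) \<longlongrightarrow> (-1) ^ k * of_nat (n choose k) *
      hypergeom_2F1_cl ((of_nat k - of_nat n) / 2) ((of_nat k + 1 - of_nat n) / 2) (of_nat k + 1) 4) (at 1)"
    using tendsto_P_coeff[OF k] unfolding hypergeom_2F1_cl_finite[OF k, symmetric] by (simp only: mult.assoc)
qed

end
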